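(* Let $\mathcal R$ be a finite left-linear LCTRS over $\Sigma$ such that $\Sigma_{\mathrm{terms}}$ is finite and no constructor $c\in\mathcal C_{\mathcal R}\setminus\mathrm{Val}$ has a result sort in $\mathcal S_{\mathrm{theory}}$. Let $Q=\{\tilde\ell\,[\tilde\varphi]\mid \ell\to r\,[\varphi]\in\mathcal R,\ \ell\text{ is a pattern}\}$. Then $\mathcal R$ is quasi-reducible if and only if $\mathrm{Co}_f(Q)=\emptyset$ for every $f\in\mathcal D_{\mathcal R}\setminus(\Sigma_{\mathrm{theory}}\setminus\mathrm{Val})$. Consequently, if satisfiability of constraints is decidable, quasi-reducibility is decidable for such LCTRSs.
   Context: Signature and theories: $\mathcal S=\mathcal S_{\mathrm{theory}}\uplus\mathcal S_{\mathrm{term}}$ sorts, $\Sigma=\Sigma_{\mathrm{theory}}\cup\Sigma_{\mathrm{terms}}$ an $\mathcal S$-sorted first-order signature, $\mathcal V$ countably infinite sorted variables. Symbols of $\Sigma_{\mathrm{theory}}$ have only theory sorts; each theory sort $\iota$ has a nonempty universe $\mathcal I(\iota)$, each $f\in\Sigma_{\mathrm{theory}}$ an interpretation $\mathcal J(f)$, and $\mathrm{Val}_\iota\subseteq\Sigma_{\mathrm{theory}}$ is a set of value constants of sort $\iota$ mapped bijectively onto $\mathcal I(\iota)$; $\mathrm{Val}=\bigcup_\iota\mathrm{Val}_\iota$, $\Sigma_{\mathrm{terms}}\cap\Sigma_{\mathrm{theory}}\subseteq\mathrm{Val}$. There is a sort $\mathsf{bool}$ with values $\mathsf{true},\mathsf{false}$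 and the usual connectives and $=,\neq$, interpreted as usual; ground theory terms are evaluated by $[\![\cdot]\!]$ via $\mathcal J$. Symbols in $\Sigma_{\mathrm{theory}}\setminus\mathrm{Val}$ are calculation symbols. A constraint is a term of $T(\Sigma_{\mathrm{theory}},\mathcal V)$ of sort $\mathsf{bool}$; $\gamma$ respects $\varphi$ if $x\gamma\in\mathrm{Val}$ for $x\in\mathrm{Var}(\varphi)$ and $[\![\varphi\gamma]\!]=\top$; $\varphi$ is satisfiable if some substitution respects it. LCTRS: a set $\mathcal R$ of rules $\ell\to r\,[\varphi]$ with $\ell,r$ terms of the same sort, $\varphi$ a constraint, $\ell$ neither a variable nor a theory term. $\mathcal R_{\mathrm{calc}}=\{f(x_1,\dots,x_n)\to y\,[y=f(x_1,\dots,x_n)]\mid f$ a calculation symbol, $x_1,\dots,x_n,y$ distinct variables$\}$. A substitution $\gamma$ respects $\ell\to r\,[\varphi]$ if $x\gamma\in\mathrm{Val}$ for all $x\in\mathrm{Var}(\varphi)\cup(\mathrm{Var}(r)\setminus\mathrm{Var}(\ell))$ and $[\![\varphi\gamma]\!]=\top$. A term of the form $\ell\gamma$ with $\ell\to r\,[\varphi]\in\mathcal R\cup\mathcal R_{\mathrm{calc}}$ and $\gamma$ respecting the rule is a redex. $\mathcal R$ is left-linear if all left-hand sides of $\mathcal R$ are linear. $\mathcal D_{\mathcal R}$ is the set of root symbols of left-hand sides of $\mathcal R\cup\mathcal R_{\mathrm{calc}}$ and $\mathcal C_{\mathcal R}=\Sigma\setminus\mathcal D_{\mathcal R}$ (so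 $\mathrm{Val}\subseteq\mathcal C_{\mathcal R}$). A pattern is $f(t_1,\dots,t_n)$ with $f\in\mathcal D_{\mathcal R}$ and $t_i\in T(\mathcal C_{\mathcal R},\mathcal V)$. $\mathcal R$ is quasi-reducible if every ground pattern is a redex. Value-free variant: for a term $\ell$ and constraint $\varphi$, $\tilde\ell$ is obtained by replacing the occurrences of value constants at positions $p_1,\dots,p_k$ of $\ell$ by pairwise distinct fresh variables $y_1,\dots,y_k$, and $\tilde\varphi=\varphi\wedge\bigwedge_{i}(y_i=\ell|_{p_i})$. Constrained terms $t\,[\psi]$; value-free if $t$ has no symbol of $\mathrm{Val}$. With $\mathcal C=\mathcal C_{\mathcal R}$: $\mathcal C$-substitutions are sort-preserving substitutions with range in $T(\mathcal C,\mathcal V)$; constrained terms are identified up to variable renaming and logical equivalence of existentially closed constraints, sets taken modulo this. $\mathrm{Co}(x)=\emptyset$ for variables; $\mathrm{Co}(c(u_1,\dots,u_n))=\{c'(x_1,\dots,x_m)\mid c'\ne c$ in $\mathcal C$ with same result sort$\}\cup\bigcup_i\{c(u_1,\dots,u_{i-1},u'_i,y_{i+1},\dots,y_n)\mid u'_i\in\mathrm{Co}(u_i)\}$ (fresh distinct variables); $\mathrm{CoSub}(\sigma)=\{\rho\mid\mathrm{Dom}(\rho)=\mathrm{Dom}(\sigma),\rho\ne\sigma,\forall x\in\mathrm{Dom}(\sigma).\ x\rho\in\mathrm{Co}(x\sigma)\cup\{x\sigma\}\}$. $s\,[\varphi]$, $t\,[\psi]$ unifiable: $s,t$ have an mgu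 $\theta$ with $\mathrm{Dom}(\theta)\subseteq\mathrm{Var}(s,t)$, $x\theta\in\mathrm{Val}\cup\mathcal V$ for $x\in\mathrm{Var}(\varphi,\psi)$, $\varphi\theta\wedge\psi\theta$ satisfiable. $s\,[\varphi]\ominus t\,[\psi]$: with a variable-disjoint variant $t'\,[\psi']$ of $t\,[\psi]$ and mgu $\sigma$ of $s,t'$ when unifiable, $\{s\rho\,[\varphi\sigma]\mid\rho\in\mathrm{CoSub}(\sigma),s\rho\ne s\sigma\}\cup\{s\sigma\,[\varphi\sigma\wedge\neg\psi'\sigma]\mid$ satisfiable$\}$, else $\{s\,[\varphi]\}$. For finite sets (nondeterministic): if $P=P'\uplus\{s\,[\varphi]\}$, $Q=Q'\uplus\{t\,[\psi]\}$ and $s\,[\varphi]\ominus t\,[\psi]\ne\{s\,[\varphi]\}$, then $P\ominus Q=(P'\cup(s\,[\varphi]\ominus t\,[\psi]))\ominus(Q'\cup(t\,[\psi]\ominus s\,[\varphi]))$, else $P\ominus Q=P$. $\mathrm{Co}_f(Q)=\{f(x_1,\dots,x_n)\,[\mathsf{true}]\}\ominus Q$ for $n$-ary $f$ with distinct variables $x_i$.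
   Formalization: Added for rules with pattern ℓ: Var(φ) ⊆ Var(ℓ), and (equivalence only) Var(r)∖Var(ℓ) has theory sorts; also (equivalence only) argument sorts of Σ_terms have ground constructor terms. Without these the claim is false. Decidability assumes effectively coded syntax. *)

theory Defs
  imports "HOL-Library.Nat_Bijection"
begin

section \<open>Sorted terms\<close>

datatype (funs: 'f, vars: 'v) tm = Var 'v | Fun 'f "('f, 'v) tm list"

text \<open>
  The type \<open>'s\<close> is the set of all sorts. A variable is a pair of an index and its sort, so there are
  countably infinitely many variables of every sort.
\<close>

type_synonym 's vr = "nat \<times> 's"
type_synonym ('f, 's) trm = "('f, 's vr) tm"
type_synonym ('f, 's) sig = "'f \<Rightarrow> ('s list \<times> 's) option"
type_synonym ('f, 's) subst = "'s vr \<Rightarrow> ('f, 's) trm"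
type_synonym ('f, 's) rule = "('f, 's) trm \<times> ('f, 's) trm \<times> ('f, 's) trm"
type_synonym ('f, 's) cterm = "('f, 's) trm \<times> ('f, 's) trm"

inductive wt :: "('f, 's) sig \<Rightarrow> ('f, 's) trm \<Rightarrow> 's \<Rightarrow> bool" for \<Sigma> where
  wt_Var: "wt \<Sigma> (Var x) (snd x)"
| wt_Fun: "\<Sigma> f = Some (\<sigma>s, \<tau>) \<Longrightarrow> length ts = length \<sigma>s \<Longrightarrow>
    (\<forall>i < length ts. wt \<Sigma> (ts ! i) (\<sigma>s ! i)) \<Longrightarrow> wt \<Sigma> (Fun f ts) \<tau>"

fun app :: "('f, 'v) tm \<Rightarrow> ('v \<Rightarrow> ('f, 'v) tm) \<Rightarrow> ('f, 'v) tm" (infixl "\<cdot>" 70) where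
  "Var x \<cdot> \<sigma> = \<sigma> x"
| "Fun f ts \<cdot> \<sigma> = Fun f (map (\<lambda>t. t \<cdot> \<sigma>) ts)"

fun var_list :: "('f, 'v) tm \<Rightarrow> 'v list" where
  "var_list (Var x) = [x]"
| "var_list (Fun f ts) = concat (map var_list ts)"

definition linear :: "('f, 'v) tm \<Rightarrow> bool" where
  "linear t \<longleftrightarrow> distinct (var_list t)"

definition is_subst :: "('f, 's) sig \<Rightarrow> ('f, 's) subst \<Rightarrow> bool" where
  "is_subst \<Sigma> \<sigma> \<longleftrightarrow> (\<forall>x. wt \<Sigma> (\<sigma> x) (snd x))"

definition sdom :: "('f, 's) subst \<Rightarrow> 's vr set" where
  "sdom \<sigma> = {x. \<sigma> x \<noteq> Var x}"

definition is_renaming :: "('s vr \<Rightarrow> 's vr) \<Rightarrow> bool" where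
  "is_renaming \<pi> \<longleftrightarrow> bij \<pi> \<and> (\<forall>x. snd (\<pi> x) = snd x)"

abbreviation rename :: "('f, 's) trm \<Rightarrow> ('s vr \<Rightarrow> 's vr) \<Rightarrow> ('f, 's) trm" where
  "rename t \<pi> \<equiv> t \<cdot> (\<lambda>x. Var (\<pi> x))"

definition is_mgu :: "('f, 's) sig \<Rightarrow> ('f, 's) trm \<Rightarrow> ('f, 's) trm \<Rightarrow> ('f, 's) subst \<Rightarrow> bool" where
  "is_mgu \<Sigma> s t \<theta> \<longleftrightarrow> is_subst \<Sigma> \<theta> \<and> s \<cdot> \<theta> = t \<cdot> \<theta> \<and>
     (\<forall>\<tau>. is_subst \<Sigma> \<tau> \<and> s \<cdot> \<tau> = t \<cdot> \<tau> \<longrightarrow> (\<exists>\<delta>. is_subst \<Sigma> \<delta> \<and> (\<forall>x. \<tau> x = \<theta> x \<cdot> \<delta>)))"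


section \<open>Theory signatures and their models\<close>

text \<open>The sorts outside \<open>theory_sorts\<close> are the term sorts.\<close>

record ('s, 'f, 'a) background =
  theory_sorts :: "'s set"
  theory_sig :: "('f, 's) sig"
  universe :: "'s \<Rightarrow> 'a set"
  interp :: "'f \<Rightarrow> 'a list \<Rightarrow> 'a"
  vals :: "'f set"
  bool_sort :: 's
  truth :: "bool \<Rightarrow> 'a"
  true_sym :: 'f
  false_sym :: 'f
  not_sym :: 'f
  and_sym :: 'f
  or_sym :: 'f
  imp_sym :: 'f
  iff_sym :: 'f
  eq_sym :: "'s \<Rightarrow> 'f"
  neq_sym :: "'s \<Rightarrow> 'f"

definition interprets_connective ::
  "('s, 'f, 'a) background \<Rightarrow> 'f \<Rightarrow> (bool \<Rightarrow> bool \<Rightarrow> bool) \<Rightarrow> bool" where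
  "interprets_connective T f c \<longleftrightarrow>
     theory_sig T f = Some ([bool_sort T, bool_sort T], bool_sort T) \<and>
     (\<forall>p q. interp T f [truth T p, truth T q] = truth T (c p q))"

definition interprets_relation ::
  "('s, 'f, 'a) background \<Rightarrow> 's \<Rightarrow> 'f \<Rightarrow> ('a \<Rightarrow> 'a \<Rightarrow> bool) \<Rightarrow> bool" where
  "interprets_relation T \<iota> f R \<longleftrightarrow>
     theory_sig T f = Some ([\<iota>, \<iota>], bool_sort T) \<and>
     (\<forall>a \<in> universe T \<iota>. \<forall>b \<in> universe T \<iota>. interp T f [a, b] = truth T (R a b))"

definition is_background :: "('s, 'f, 'a) background \<Rightarrow> bool" where
  "is_background T \<longleftrightarrow>
     (\<forall>\<iota> \<in> theory_sorts T. universe T \<iota> \<noteq> {}) \<and>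
     (\<forall>f \<sigma>s \<tau>. theory_sig T f = Some (\<sigma>s, \<tau>) \<longrightarrow>
        set \<sigma>s \<subseteq> theory_sorts T \<and> \<tau> \<in> theory_sorts T \<and>
        (\<forall>as. list_all2 (\<lambda>a \<sigma>. a \<in> universe T \<sigma>) as \<sigma>s \<longrightarrow> interp T f as \<in> universe T \<tau>)) \<and>
     (\<forall>v \<in> vals T. \<exists>\<iota>. theory_sig T v = Some ([], \<iota>)) \<and>
     (\<forall>\<iota> \<in> theory_sorts T.
        bij_betw (\<lambda>v. interp T v []) {v \<in> vals T. theory_sig T v = Some ([], \<iota>)} (universe T \<iota>)) \<and>
     bool_sort T \<in> theory_sorts T \<and>
     inj (truth T) \<and> universe T (bool_sort T) = range (truth T) \<and>
     true_sym T \<in> vals T \<and> theory_sig T (true_sym T) = Some ([], bool_sort T) \<and>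
     interp T (true_sym T) [] = truth T True \<and>
     false_sym T \<in> vals T \<and> theory_sig T (false_sym T) = Some ([], bool_sort T) \<and>
     interp T (false_sym T) [] = truth T False \<and>
     theory_sig T (not_sym T) = Some ([bool_sort T], bool_sort T) \<and>
     (\<forall>p. interp T (not_sym T) [truth T p] = truth T (\<not> p)) \<and>
     interprets_connective T (and_sym T) (\<and>) \<and>
     interprets_connective T (or_sym T) (\<or>) \<and>
     interprets_connective T (imp_sym T) (\<longrightarrow>) \<and>
     interprets_connective T (iff_sym T) (\<longleftrightarrow>) \<and>
     (\<forall>\<iota> \<in> theory_sorts T. interprets_relation T \<iota> (eq_sym T \<iota>) (=)) \<and>
     (\<forall>\<iota> \<in> theory_sorts T. interprets_relation T \<iota> (neq_sym T \<iota>) (\<noteq>))"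

definition calc_syms :: "('s, 'f, 'a) background \<Rightarrow> 'f set" where
  "calc_syms T = dom (theory_sig T) - vals T"

fun den :: "('s, 'f, 'a) background \<Rightarrow> ('f, 's) trm \<Rightarrow> 'a" where
  "den T (Fun f ts) = interp T f (map (den T) ts)"
| "den T (Var x) = undefined"

definition is_val :: "('s, 'f, 'a) background \<Rightarrow> ('f, 's) trm \<Rightarrow> bool" where
  "is_val T t \<longleftrightarrow> (\<exists>v \<in> vals T. t = Fun v [])"

definition is_constraint :: "('s, 'f, 'a) background \<Rightarrow> ('f, 's) trm \<Rightarrow> bool" where
  "is_constraint T \<phi> \<longleftrightarrow> wt (theory_sig T) \<phi> (bool_sort T)"

definition resp :: "('s, 'f, 'a) background \<Rightarrow> ('f, 's) subst \<Rightarrow> ('f, 's) trm \<Rightarrow> bool" where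
  "resp T \<gamma> \<phi> \<longleftrightarrow> (\<forall>x \<in> vars \<phi>. is_val T (\<gamma> x)) \<and> den T (\<phi> \<cdot> \<gamma>) = truth T True"

text \<open>
  Only the values of \<open>\<gamma>\<close> on the variables of \<open>\<phi>\<close> matter below, so well-sortedness over the theory
  signature is no restriction compared to well-sortedness over a larger signature.
\<close>

definition satisfiable :: "('s, 'f, 'a) background \<Rightarrow> ('f, 's) trm \<Rightarrow> bool" where
  "satisfiable T \<phi> \<longleftrightarrow> (\<exists>\<gamma>. is_subst (theory_sig T) \<gamma> \<and> resp T \<gamma> \<phi>)"

abbreviation c_true :: "('s, 'f, 'a) background \<Rightarrow> ('f, 's) trm" where
  "c_true T \<equiv> Fun (true_sym T) []"

abbreviation c_not :: "('s, 'f, 'a) background \<Rightarrow> ('f, 's) trm \<Rightarrow> ('f, 's) trm" where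
  "c_not T \<phi> \<equiv> Fun (not_sym T) [\<phi>]"

abbreviation c_and :: "('s, 'f, 'a) background \<Rightarrow> ('f, 's) trm \<Rightarrow> ('f, 's) trm \<Rightarrow> ('f, 's) trm" where
  "c_and T \<phi> \<psi> \<equiv> Fun (and_sym T) [\<phi>, \<psi>]"

abbreviation c_eq :: "('s, 'f, 'a) background \<Rightarrow> 's vr \<Rightarrow> ('f, 's) trm \<Rightarrow> ('f, 's) trm" where
  "c_eq T y t \<equiv> Fun (eq_sym T (snd y)) [Var y, t]"


section \<open>Logically constrained term rewrite systems\<close>

text \<open>\<open>F\<close> is the term signature throughout.\<close>

definition is_term_sig :: "('s, 'f, 'a) background \<Rightarrow> ('f, 's) sig \<Rightarrow> bool" where
  "is_term_sig T F \<longleftrightarrow>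
     (\<forall>f \<in> dom F \<inter> dom (theory_sig T). f \<in> vals T \<and> F f = theory_sig T f)"

definition full_sig :: "('s, 'f, 'a) background \<Rightarrow> ('f, 's) sig \<Rightarrow> ('f, 's) sig" where
  "full_sig T F = theory_sig T ++ F"

definition is_lctrs :: "('s, 'f, 'a) background \<Rightarrow> ('f, 's) sig \<Rightarrow> ('f, 's) rule set \<Rightarrow> bool" where
  "is_lctrs T F R \<longleftrightarrow> (\<forall>(l, r, \<phi>) \<in> R.
     (\<exists>\<tau>. wt (full_sig T F) l \<tau> \<and> wt (full_sig T F) r \<tau>) \<and> is_constraint T \<phi> \<and>
     (\<nexists>x. l = Var x) \<and> (\<nexists>\<tau>. wt (theory_sig T) l \<tau>))"

definition calc_rules :: "('s, 'f, 'a) background \<Rightarrow> ('f, 's) rule set" where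
  "calc_rules T = {(Fun f (map Var xs), Var y, c_eq T y (Fun f (map Var xs))) | f xs y \<sigma>s.
     f \<in> calc_syms T \<and> distinct (y # xs) \<and> theory_sig T f = Some (\<sigma>s, snd y) \<and> map snd xs = \<sigma>s}"

definition respects_rule ::
  "('s, 'f, 'a) background \<Rightarrow> ('f, 's) sig \<Rightarrow> ('f, 's) subst \<Rightarrow> ('f, 's) rule \<Rightarrow> bool" where
  "respects_rule T F \<gamma> = (\<lambda>(l, r, \<phi>). is_subst (full_sig T F) \<gamma> \<and>
     (\<forall>x \<in> vars \<phi> \<union> (vars r - vars l). is_val T (\<gamma> x)) \<and> den T (\<phi> \<cdot> \<gamma>) = truth T True)"

definition is_redex ::
  "('s, 'f, 'a) background \<Rightarrow> ('f, 's) sig \<Rightarrow> ('f, 's) rule set \<Rightarrow> ('f, 's) trm \<Rightarrow> bool" where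
  "is_redex T F R t \<longleftrightarrow> (\<exists>(l, r, \<phi>) \<in> R \<union> calc_rules T. \<exists>\<gamma>.
     respects_rule T F \<gamma> (l, r, \<phi>) \<and> t = l \<cdot> \<gamma>)"

definition left_linear :: "('f, 's) rule set \<Rightarrow> bool" where
  "left_linear R \<longleftrightarrow> (\<forall>(l, r, \<phi>) \<in> R. linear l)"

definition defined_syms :: "('s, 'f, 'a) background \<Rightarrow> ('f, 's) rule set \<Rightarrow> 'f set" where
  "defined_syms T R = {f. \<exists>ts r \<phi>. (Fun f ts, r, \<phi>) \<in> R \<union> calc_rules T}"

definition constructors ::
  "('s, 'f, 'a) background \<Rightarrow> ('f, 's) sig \<Rightarrow> ('f, 's) rule set \<Rightarrow> 'f set" where
  "constructors T F R = dom (full_sig T F) - defined_syms T R"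

definition is_pattern ::
  "('s, 'f, 'a) background \<Rightarrow> ('f, 's) sig \<Rightarrow> ('f, 's) rule set \<Rightarrow> ('f, 's) trm \<Rightarrow> bool" where
  "is_pattern T F R t \<longleftrightarrow> (\<exists>\<tau>. wt (full_sig T F) t \<tau>) \<and>
     (\<exists>f ts. t = Fun f ts \<and> f \<in> defined_syms T R \<and> (\<forall>u \<in> set ts. funs u \<subseteq> constructors T F R))"

definition quasi_reducible ::
  "('s, 'f, 'a) background \<Rightarrow> ('f, 's) sig \<Rightarrow> ('f, 's) rule set \<Rightarrow> bool" where
  "quasi_reducible T F R \<longleftrightarrow>
     (\<forall>t. is_pattern T F R t \<and> vars t = {} \<longrightarrow> is_redex T F R t)"

definition no_theory_sorted_constructors ::
  "('s, 'f, 'a) background \<Rightarrow> ('f, 's) sig \<Rightarrow> ('f, 's) rule set \<Rightarrow> bool" where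
  "no_theory_sorted_constructors T F R \<longleftrightarrow>
     (\<forall>c \<sigma>s \<tau>. c \<in> constructors T F R - vals T \<and> full_sig T F c = Some (\<sigma>s, \<tau>) \<longrightarrow>
        \<tau> \<notin> theory_sorts T)"

text \<open>
  Side conditions under which the complement procedure and quasi-reducibility agree. They exclude the
  following situations, where \<open>f\<close> is the only defined symbol that is not a calculation symbol.

  \<^item> \<open>f(x) \<rightarrow> r [x = y]\<close>: every ground pattern is a redex, but the difference of \<open>f(x) [true]\<close> and
    \<open>f(x) [x = y]\<close> is \<open>f(x) [true \<and> \<not> x = y]\<close>, which is satisfiable in \<open>y\<close>. The constraint \<open>\<not> \<psi>\<close>
    describes the complement of \<open>t [\<psi>]\<close> only if all variables of \<open>\<psi>\<close> occur in \<open>t\<close>.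
  \<^item> \<open>f(x) \<rightarrow> g(y) [true]\<close> with \<open>y\<close> of a term sort: no substitution respects the rule, as \<open>y\<close> would have
    to be mapped to a value.
  \<^item> \<open>f(x, a) \<rightarrow> r [true]\<close> where \<open>x\<close> has a sort without ground constructor terms: there are no ground
    patterns with root \<open>f\<close>, but \<open>f(x, b) [true]\<close> remains if \<open>b\<close> is another constructor.
\<close>

definition constraint_vars_in_lhs ::
  "('s, 'f, 'a) background \<Rightarrow> ('f, 's) sig \<Rightarrow> ('f, 's) rule set \<Rightarrow> bool" where
  "constraint_vars_in_lhs T F R \<longleftrightarrow>
     (\<forall>(l, r, \<phi>) \<in> R. is_pattern T F R l \<longrightarrow> vars \<phi> \<subseteq> vars l)"

definition extra_vars_theory_sorted ::
  "('s, 'f, 'a) background \<Rightarrow> ('f, 's) sig \<Rightarrow> ('f, 's) rule set \<Rightarrow> bool" where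
  "extra_vars_theory_sorted T F R \<longleftrightarrow>
     (\<forall>(l, r, \<phi>) \<in> R. is_pattern T F R l \<longrightarrow> snd ` (vars r - vars l) \<subseteq> theory_sorts T)"

definition argument_sorts_inhabited ::
  "('s, 'f, 'a) background \<Rightarrow> ('f, 's) sig \<Rightarrow> ('f, 's) rule set \<Rightarrow> bool" where
  "argument_sorts_inhabited T F R \<longleftrightarrow>
     (\<forall>f \<sigma>s \<tau>. F f = Some (\<sigma>s, \<tau>) \<longrightarrow> (\<forall>\<sigma> \<in> set \<sigma>s.
        \<exists>t. vars t = {} \<and> funs t \<subseteq> constructors T F R \<and> wt (full_sig T F) t \<sigma>))"


section \<open>Value-free variants\<close>

text \<open>
  \<open>abs_vals T t t' E\<close>: \<open>t'\<close> is \<open>t\<close> with every value occurrence replaced by some variable, and \<open>E\<close> lists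
  the replacing variables with the values they replace, from left to right.
\<close>

inductive abs_vals ::
  "('s, 'f, 'a) background \<Rightarrow> ('f, 's) trm \<Rightarrow> ('f, 's) trm \<Rightarrow> ('s vr \<times> 'f) list \<Rightarrow> bool" for T where
  abs_Var: "abs_vals T (Var x) (Var x) []"
| abs_Val: "v \<in> vals T \<Longrightarrow> theory_sig T v = Some ([], snd y) \<Longrightarrow>
    abs_vals T (Fun v []) (Var y) [(y, v)]"
| abs_Fun: "f \<notin> vals T \<Longrightarrow> length us = length ts \<Longrightarrow> length Es = length ts \<Longrightarrow>
    (\<forall>i < length ts. abs_vals T (ts ! i) (us ! i) (Es ! i)) \<Longrightarrow>
    abs_vals T (Fun f ts) (Fun f us) (concat Es)"

definition value_free_variant ::
  "('s, 'f, 'a) background \<Rightarrow> ('f, 's) cterm \<Rightarrow> ('f, 's) cterm \<Rightarrow> bool" where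
  "value_free_variant T = (\<lambda>(l, \<phi>) (l', \<phi>'). \<exists>E. abs_vals T l l' E \<and>
     distinct (map fst E) \<and> fst ` set E \<inter> (vars l \<union> vars \<phi>) = {} \<and>
     \<phi>' = foldl (\<lambda>\<chi> (y, v). c_and T \<chi> (c_eq T y (Fun v []))) \<phi> E)"

definition pattern_cterms ::
  "('s, 'f, 'a) background \<Rightarrow> ('f, 's) sig \<Rightarrow> ('f, 's) rule set \<Rightarrow> ('f, 's) cterm set" where
  "pattern_cterms T F R = {q. \<exists>(l, r, \<phi>) \<in> R. is_pattern T F R l \<and> value_free_variant T (l, \<phi>) q}"


section \<open>Constrained terms modulo equivalence\<close>

text \<open>
  The existential closure is over the variables that occur in the constraint only; the variables of the
  term stay free.
\<close>

definition ceq :: "('s, 'f, 'a) background \<Rightarrow> ('f, 's) cterm \<Rightarrow> ('f, 's) cterm \<Rightarrow> bool" where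
  "ceq T = (\<lambda>(s, \<phi>) (t, \<psi>). \<exists>\<pi>. is_renaming \<pi> \<and> rename s \<pi> = t \<and>
     (\<forall>\<gamma>. is_subst (theory_sig T) \<gamma> \<and> (\<forall>x. snd x \<in> theory_sorts T \<longrightarrow> is_val T (\<gamma> x)) \<longrightarrow>
        (\<exists>\<gamma>'. is_subst (theory_sig T) \<gamma>' \<and> (\<forall>x \<in> vars t. \<gamma>' x = \<gamma> x) \<and> resp T \<gamma>' (rename \<phi> \<pi>)) \<longleftrightarrow>
        (\<exists>\<gamma>'. is_subst (theory_sig T) \<gamma>' \<and> (\<forall>x \<in> vars t. \<gamma>' x = \<gamma> x) \<and> resp T \<gamma>' \<psi>)))"

definition set_ceq ::
  "('s, 'f, 'a) background \<Rightarrow> ('f, 's) cterm set \<Rightarrow> ('f, 's) cterm set \<Rightarrow> bool" where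
  "set_ceq T A B \<longleftrightarrow> (\<forall>a \<in> A. \<exists>b \<in> B. ceq T a b) \<and> (\<forall>b \<in> B. \<exists>a \<in> A. ceq T a b)"

text \<open>
  Finite sets modulo equivalence are handled through finite sets of representatives, taken from the
  sets (closed under the choice of fresh variables, hence infinite) that the definitions describe.
\<close>

definition represents ::
  "('s, 'f, 'a) background \<Rightarrow> ('f, 's) cterm set \<Rightarrow> ('f, 's) cterm set \<Rightarrow> bool" where
  "represents T A B \<longleftrightarrow> finite A \<and> A \<subseteq> B \<and> set_ceq T A B"


section \<open>Complements\<close>

text \<open>
  \<open>co \<Sigma> C X u u'\<close>: \<open>u'\<close> is in the complement of \<open>u\<close> with respect to the constructors \<open>C\<close>, where the
  fresh variables of \<open>u'\<close> are chosen outside \<open>X\<close>.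
\<close>

inductive co ::
  "('f, 's) sig \<Rightarrow> 'f set \<Rightarrow> 's vr set \<Rightarrow> ('f, 's) trm \<Rightarrow> ('f, 's) trm \<Rightarrow> bool" for \<Sigma> C X where
  co_root: "\<Sigma> c = Some (\<sigma>s, \<tau>) \<Longrightarrow> c' \<in> C \<Longrightarrow> c' \<noteq> c \<Longrightarrow> \<Sigma> c' = Some (\<sigma>s', \<tau>) \<Longrightarrow>
    distinct xs \<Longrightarrow> map snd xs = \<sigma>s' \<Longrightarrow> set xs \<inter> X = {} \<Longrightarrow>
    co \<Sigma> C X (Fun c us) (Fun c' (map Var xs))"
| co_arg: "\<Sigma> c = Some (\<sigma>s, \<tau>) \<Longrightarrow> i < length us \<Longrightarrow> co \<Sigma> C X (us ! i) u' \<Longrightarrow>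
    distinct ys \<Longrightarrow> map snd ys = drop (Suc i) \<sigma>s \<Longrightarrow> set ys \<inter> (X \<union> vars u') = {} \<Longrightarrow>
    co \<Sigma> C X (Fun c us) (Fun c (take i us @ u' # map Var ys))"

definition cosub ::
  "('f, 's) sig \<Rightarrow> 'f set \<Rightarrow> 's vr set \<Rightarrow> ('f, 's) subst \<Rightarrow> ('f, 's) subst \<Rightarrow> bool" where
  "cosub \<Sigma> C X \<sigma> \<rho> \<longleftrightarrow> sdom \<rho> = sdom \<sigma> \<and> \<rho> \<noteq> \<sigma> \<and>
     (\<forall>x \<in> sdom \<sigma>. co \<Sigma> C X (\<sigma> x) (\<rho> x) \<or> \<rho> x = \<sigma> x) \<and>
     (\<forall>x \<in> sdom \<sigma>. \<forall>y \<in> sdom \<sigma>. x \<noteq> y \<longrightarrow> vars (\<rho> x) \<inter> vars (\<rho> y) \<subseteq> X)"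

definition cunifier ::
  "('s, 'f, 'a) background \<Rightarrow> ('f, 's) sig \<Rightarrow> ('f, 's) cterm \<Rightarrow> ('f, 's) cterm \<Rightarrow> ('f, 's) subst \<Rightarrow> bool"
where
  "cunifier T \<Sigma> = (\<lambda>(s, \<phi>) (t, \<psi>) \<theta>. is_mgu \<Sigma> s t \<theta> \<and> sdom \<theta> \<subseteq> vars s \<union> vars t \<and>
     (\<forall>x \<in> vars \<phi> \<union> vars \<psi>. is_val T (\<theta> x) \<or> (\<exists>y. \<theta> x = Var y)) \<and>
     satisfiable T (c_and T (\<phi> \<cdot> \<theta>) (\<psi> \<cdot> \<theta>)))"

definition disjoint_variant :: "('f, 's) cterm \<Rightarrow> ('f, 's) cterm \<Rightarrow> ('f, 's) cterm \<Rightarrow> bool" where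
  "disjoint_variant = (\<lambda>(s, \<phi>) (t, \<psi>) (t', \<psi>'). \<exists>\<pi>. is_renaming \<pi> \<and>
     t' = rename t \<pi> \<and> \<psi>' = rename \<psi> \<pi> \<and> (vars s \<union> vars \<phi>) \<inter> (vars t' \<union> vars \<psi>') = {})"

definition diff_set ::
  "('s, 'f, 'a) background \<Rightarrow> ('f, 's) sig \<Rightarrow> 'f set \<Rightarrow>
   ('f, 's) cterm \<Rightarrow> ('f, 's) cterm \<Rightarrow> ('f, 's) subst \<Rightarrow> ('f, 's) cterm set" where
  "diff_set T \<Sigma> C = (\<lambda>(s, \<phi>) (t', \<psi>') \<sigma>.
     {(s \<cdot> \<rho>, \<phi> \<cdot> \<sigma>) | \<rho>.
        cosub \<Sigma> C (vars s \<union> vars \<phi> \<union> vars t' \<union> vars \<psi>' \<union> (\<Union>x \<in> sdom \<sigma>. vars (\<sigma> x))) \<sigma> \<rho> \<and>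
        s \<cdot> \<rho> \<noteq> s \<cdot> \<sigma>} \<union>
     {(s \<cdot> \<sigma>, \<chi>) | \<chi>. \<chi> = c_and T (\<phi> \<cdot> \<sigma>) (c_not T (\<psi>' \<cdot> \<sigma>)) \<and> satisfiable T \<chi>})"

text \<open>
  \<open>cdiff T \<Sigma> C c d A\<close>: for some choice of the variant of \<open>d\<close>, of the most general unifier and of the
  fresh variables, \<open>A\<close> is the difference of \<open>c\<close> and \<open>d\<close> modulo equivalence.
\<close>

definition cdiff ::
  "('s, 'f, 'a) background \<Rightarrow> ('f, 's) sig \<Rightarrow> 'f set \<Rightarrow>
   ('f, 's) cterm \<Rightarrow> ('f, 's) cterm \<Rightarrow> ('f, 's) cterm set \<Rightarrow> bool" where
  "cdiff T \<Sigma> C c d A \<longleftrightarrow>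
     (\<exists>d' \<sigma>. disjoint_variant c d d' \<and> cunifier T \<Sigma> c d' \<sigma> \<and> represents T A (diff_set T \<Sigma> C c d' \<sigma>)) \<or>
     ((\<nexists>d' \<sigma>. disjoint_variant c d d' \<and> cunifier T \<Sigma> c d' \<sigma>) \<and> A = {c})"

text \<open>
  One unfolding of the recursive equation for the difference of two finite sets. Removing an element
  from a set modulo equivalence means removing all its representatives.
\<close>

inductive diff_step ::
  "('s, 'f, 'a) background \<Rightarrow> ('f, 's) sig \<Rightarrow> 'f set \<Rightarrow>
   ('f, 's) cterm set \<times> ('f, 's) cterm set \<Rightarrow> ('f, 's) cterm set \<times> ('f, 's) cterm set \<Rightarrow> bool"
  for T \<Sigma> C where
  "c \<in> P \<Longrightarrow> d \<in> Q \<Longrightarrow> cdiff T \<Sigma> C c d A \<Longrightarrow> \<not> set_ceq T A {c} \<Longrightarrow> cdiff T \<Sigma> C d c B \<Longrightarrow>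
    diff_step T \<Sigma> C (P, Q) ({p \<in> P. \<not> ceq T p c} \<union> A, {q \<in> Q. \<not> ceq T q d} \<union> B)"

definition diff_final ::
  "('s, 'f, 'a) background \<Rightarrow> ('f, 's) sig \<Rightarrow> 'f set \<Rightarrow>
   ('f, 's) cterm set \<Rightarrow> ('f, 's) cterm set \<Rightarrow> bool" where
  "diff_final T \<Sigma> C P Q \<longleftrightarrow>
     \<not> (\<exists>c \<in> P. \<exists>d \<in> Q. \<exists>A. cdiff T \<Sigma> C c d A \<and> \<not> set_ceq T A {c})"

definition diff_results ::
  "('s, 'f, 'a) background \<Rightarrow> ('f, 's) sig \<Rightarrow> 'f set \<Rightarrow>
   ('f, 's) cterm set \<Rightarrow> ('f, 's) cterm set \<Rightarrow> ('f, 's) cterm set set" where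
  "diff_results T \<Sigma> C P Q =
     {P'. \<exists>Q'. (diff_step T \<Sigma> C)\<^sup>*\<^sup>* (P, Q) (P', Q') \<and> diff_final T \<Sigma> C P' Q'}"

text \<open>
  The possible outcomes of the (nondeterministic) computation of the complement of \<open>Q\<close> at the root
  symbol \<open>f\<close>.
\<close>

definition co_results ::
  "('s, 'f, 'a) background \<Rightarrow> ('f, 's) sig \<Rightarrow> ('f, 's) rule set \<Rightarrow>
   'f \<Rightarrow> ('f, 's) cterm set \<Rightarrow> ('f, 's) cterm set set" where
  "co_results T F R f Q =
     (\<Union>xs \<in> {xs. distinct xs \<and> (\<exists>\<tau>. full_sig T F f = Some (map snd xs, \<tau>))}.
        diff_results T (full_sig T F) (constructors T F R) {(Fun f (map Var xs), c_true T)} Q)"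


section \<open>Decidability\<close>

text \<open>
  \<open>recfn k f\<close>: the restriction of \<open>f\<close> to lists of length \<open>k\<close> is a total recursive function of \<open>k\<close>
  arguments. Minimisation is restricted to regular functions, which by the normal form theorem
  yields all total recursive functions.
\<close>

inductive recfn :: "nat \<Rightarrow> (nat list \<Rightarrow> nat) \<Rightarrow> bool" where
  rec_zero: "recfn k (\<lambda>xs. 0)"
| rec_succ: "recfn 1 (\<lambda>xs. Suc (xs ! 0))"
| rec_proj: "i < k \<Longrightarrow> recfn k (\<lambda>xs. xs ! i)"
| rec_comp: "recfn m f \<Longrightarrow> length gs = m \<Longrightarrow> (\<forall>g \<in> set gs. recfn k g) \<Longrightarrow>
    recfn k (\<lambda>xs. f (map (\<lambda>g. g xs) gs))"
| rec_prim: "recfn k f \<Longrightarrow> recfn (Suc (Suc k)) g \<Longrightarrow>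
    recfn (Suc k) (\<lambda>xs. rec_nat (f (tl xs)) (\<lambda>n r. g (n # r # tl xs)) (hd xs))"
| rec_mu: "recfn (Suc k) f \<Longrightarrow> (\<forall>xs. length xs = k \<longrightarrow> (\<exists>n. f (n # xs) = 0)) \<Longrightarrow>
    recfn k (\<lambda>xs. LEAST n. f (n # xs) = 0)"

text \<open>Inputs outside \<open>A\<close> need not be recognised.\<close>

definition decidable_on :: "'i set \<Rightarrow> ('i \<Rightarrow> nat) \<Rightarrow> ('i \<Rightarrow> bool) \<Rightarrow> bool" where
  "decidable_on A code P \<longleftrightarrow> (\<exists>f. recfn 1 f \<and> (\<forall>i \<in> A. f [code i] = (if P i then 1 else 0)))"

fun code_tm :: "('s \<Rightarrow> nat) \<Rightarrow> ('f \<Rightarrow> nat) \<Rightarrow> ('f, 's) trm \<Rightarrow> nat" where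
  "code_tm cs cf (Var x) = sum_encode (Inl (prod_encode (fst x, cs (snd x))))"
| "code_tm cs cf (Fun f ts) = sum_encode (Inr (prod_encode (cf f, list_encode (map (code_tm cs cf) ts))))"

fun code_rule :: "('s \<Rightarrow> nat) \<Rightarrow> ('f \<Rightarrow> nat) \<Rightarrow> ('f, 's) rule \<Rightarrow> nat" where
  "code_rule cs cf (l, r, \<phi>) = list_encode [code_tm cs cf l, code_tm cs cf r, code_tm cs cf \<phi>]"

fun code_decl :: "('s \<Rightarrow> nat) \<Rightarrow> ('f \<Rightarrow> nat) \<Rightarrow> 'f \<times> 's list \<times> 's \<Rightarrow> nat" where
  "code_decl cs cf (f, \<sigma>s, \<tau>) = list_encode [cf f, list_encode (map cs \<sigma>s), cs \<tau>]"

text \<open>An LCTRS is presented by the declarations of its term signature and its rules.\<close>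

type_synonym ('f, 's) lctrs_input = "('f \<times> 's list \<times> 's) list \<times> ('f, 's) rule list"

fun code_lctrs :: "('s \<Rightarrow> nat) \<Rightarrow> ('f \<Rightarrow> nat) \<Rightarrow> ('f, 's) lctrs_input \<Rightarrow> nat" where
  "code_lctrs cs cf (ds, rs) =
     prod_encode (list_encode (map (code_decl cs cf) ds), list_encode (map (code_rule cs cf) rs))"

text \<open>
  The syntax of the background theory is given effectively: theory sorts and values can be recognised,
  and the equality symbol of a sort can be computed.
\<close>

definition effective_syntax ::
  "('s, 'f, 'a) background \<Rightarrow> ('s \<Rightarrow> nat) \<Rightarrow> ('f \<Rightarrow> nat) \<Rightarrow> bool" where
  "effective_syntax T cs cf \<longleftrightarrow> inj cs \<and> inj cf \<and>
     decidable_on UNIV cs (\<lambda>\<iota>. \<iota> \<in> theory_sorts T) \<and>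
     decidable_on (dom (theory_sig T)) cf (\<lambda>f. f \<in> vals T) \<and>
     (\<exists>e. recfn 1 e \<and> (\<forall>\<iota> \<in> theory_sorts T. e [cs \<iota>] = cf (eq_sym T \<iota>)))"

definition satisfiability_decidable ::
  "('s, 'f, 'a) background \<Rightarrow> ('s \<Rightarrow> nat) \<Rightarrow> ('f \<Rightarrow> nat) \<Rightarrow> bool" where
  "satisfiability_decidable T cs cf \<longleftrightarrow>
     decidable_on {\<phi>. is_constraint T \<phi>} (code_tm cs cf) (satisfiable T)"

definition admissible ::
  "('s, 'f, 'a) background \<Rightarrow> ('f, 's) sig \<Rightarrow> ('f, 's) rule set \<Rightarrow> bool" where
  "admissible T F R \<longleftrightarrow> is_term_sig T F \<and> is_lctrs T F R \<and> finite R \<and> left_linear R \<and> finite (dom F) \<and>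
     no_theory_sorted_constructors T F R"

end

theory Submission
  imports Defs
begin

text \<open>
  A constrained pattern denotes the set of its ground constructor instances that respect the constraint. For
  linear patterns, the difference of two constrained patterns denotes the difference of these sets, and its
  members are either renamings of each other or have disjoint denotations. Hence a complement is empty if and
  only if the patterns cover all ground patterns with the given root. Every step of the procedure splits a
  pattern or strengthens its constraint; the depth of all terms stays bounded, so a finite set of ground
  terms meets every pattern that can occur, and counting instances in it shows termination.

  For decidability, a ground pattern only has to be inspected down to the depth of the left-hand sides: a
  deeper constructor subterm can be exchanged for one of least depth, which is at most the number of declared
  symbols. With variables in place of values there are finitely many patterns up to that depth, and such a
  pattern is covered if and only if the conjunction of the negated matching conditions of all rules is
  unsatisfiable. The depth bound may be read off the code of the input.
\<close>

subsection \<open>Terms, matching and depth\<close>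

text \<open>Left-linearity allows all positions to be treated independently: linear terms without
  common variables unify as soon as no symbols clash, and each binding can be read off at its own
  position. Since no constructor other than a value has a theory sort, every theory-sorted subterm
  of a value-free constructor term is a variable. Unifiers therefore merely rename constraint
  variables, and complements, which are empty at variables, leave them alone.

  The measure for termination must be finite although denotations may be infinite, and it must
  notice a step that keeps a term and only strengthens its constraint. A pair of elements from the
  two sets is weighted by the number of test terms that are instances of both terms, with
  constraints ignored, but by 0 if the denotations are disjoint. A step replaces an overlapping pair
  by parts with disjoint denotations and so loses its weight.

  Exchanging a deep subterm for a shallow one is harmless for constraints, because only term-sorted
  subterms are exchanged whereas constraints speak about values.\<close>

lemma set_var_list: "set (var_list t) = vars t"
  by (induction t) auto

lemma finite_vars [simp]: "finite (vars t)"
  by (simp flip: set_var_list)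

lemma app_cong: "(\<And>x. x \<in> vars t \<Longrightarrow> \<sigma> x = \<tau> x) \<Longrightarrow> t \<cdot> \<sigma> = t \<cdot> \<tau>"
  by (induction t) auto

lemma app_eqD: "t \<cdot> \<sigma> = t \<cdot> \<tau> \<Longrightarrow> x \<in> vars t \<Longrightarrow> \<sigma> x = \<tau> x"
  by (induction t) auto

lemma app_app: "t \<cdot> \<sigma> \<cdot> \<tau> = t \<cdot> (\<lambda>x. \<sigma> x \<cdot> \<tau>)"
  by (induction t) auto

lemma app_Var [simp]: "t \<cdot> Var = t"
  by (induction t) (auto intro: map_idI)

lemma app_ident: "(\<And>x. x \<in> vars t \<Longrightarrow> \<sigma> x = Var x) \<Longrightarrow> t \<cdot> \<sigma> = t"
  using app_cong[of t \<sigma> Var] by simp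

lemma vars_app: "vars (t \<cdot> \<sigma>) = (\<Union>x\<in>vars t. vars (\<sigma> x))"
  by (induction t) auto

lemma funs_app: "funs (t \<cdot> \<sigma>) = funs t \<union> (\<Union>x\<in>vars t. funs (\<sigma> x))"
  by (induction t) auto

lemma var_list_app: "var_list (t \<cdot> \<sigma>) = concat (map (\<lambda>x. var_list (\<sigma> x)) (var_list t))"
proof (induction t)
  case (Fun f ts)
  then show ?case by (induction ts) auto
qed simp

inductive_simps wt_Var_iff [simp]: "wt \<Sigma> (Var x) \<tau>"
inductive_simps wt_Fun_iff: "wt \<Sigma> (Fun f ts) \<tau>"

lemma wt_app: "wt \<Sigma> t \<tau> \<Longrightarrow> (\<And>x. x \<in> vars t \<Longrightarrow> wt \<Sigma> (\<sigma> x) (snd x)) \<Longrightarrow> wt \<Sigma> (t \<cdot> \<sigma>) \<tau>"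
proof (induction rule: wt.induct)
  case (wt_Fun f \<sigma>s \<tau> ts)
  then have "wt \<Sigma> (ts ! i \<cdot> \<sigma>) (\<sigma>s ! i)" if "i < length ts" for i
    using that nth_mem[OF that] by (metis UN_I tm.set(4))
  with wt_Fun show ?case by (auto simp: wt_Fun_iff)
qed simp

text \<open>Positional form of distinctness. In \<open>linear_Fun\<close> it turns linearity of
  \<open>Fun f ts\<close> into linearity of the arguments and pairwise disjointness of their
  variables.\<close>

lemma distinct_concat_nth:
  "distinct (concat xss) \<longleftrightarrow> (\<forall>i < length xss. distinct (xss ! i)) \<and>
     (\<forall>i < length xss. \<forall>j < length xss. i \<noteq> j \<longrightarrow> set (xss ! i) \<inter> set (xss ! j) = {})"
proof (induction xss)
  case (Cons xs xss)
  have "set xs \<inter> set (concat xss) = {} \<longleftrightarrow> (\<forall>j < length xss. set xs \<inter> set (xss ! j) = {})"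
    using all_set_conv_all_nth[of xss "\<lambda>ys. set xs \<inter> set ys = {}"] by auto
  moreover have "(\<forall>i < length (xs # xss). \<forall>j < length (xs # xss). i \<noteq> j \<longrightarrow>
      set ((xs # xss) ! i) \<inter> set ((xs # xss) ! j) = {}) \<longleftrightarrow>
    (\<forall>j < length xss. set xs \<inter> set (xss ! j) = {}) \<and>
    (\<forall>i < length xss. \<forall>j < length xss. i \<noteq> j \<longrightarrow> set (xss ! i) \<inter> set (xss ! j) = {})"
    unfolding length_Cons All_less_Suc2 nth_Cons_0 nth_Cons_Suc by blast
  moreover have "(\<forall>i < length (xs # xss). distinct ((xs # xss) ! i)) \<longleftrightarrow>
    distinct xs \<and> (\<forall>i < length xss. distinct (xss ! i))"
    unfolding length_Cons All_less_Suc2 nth_Cons_0 nth_Cons_Suc by blast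
  moreover have "distinct (concat (xs # xss)) \<longleftrightarrow>
    distinct xs \<and> distinct (concat xss) \<and> set xs \<inter> set (concat xss) = {}"
    by simp
  ultimately show ?case unfolding Cons.IH by argo
qed simp

lemma linear_Var [simp]: "linear (Var x)"
  by (simp add: linear_def)

lemma linear_Fun:
  "linear (Fun f ts) \<longleftrightarrow> (\<forall>i < length ts. linear (ts ! i)) \<and>
     (\<forall>i < length ts. \<forall>j < length ts. i \<noteq> j \<longrightarrow> vars (ts ! i) \<inter> vars (ts ! j) = {})"
  by (simp add: linear_def distinct_concat_nth set_var_list del: distinct_concat)

lemma linear_app:
  "linear t \<Longrightarrow> (\<And>x. x \<in> vars t \<Longrightarrow> linear (\<sigma> x)) \<Longrightarrow>
   (\<And>x y. x \<in> vars t \<Longrightarrow> y \<in> vars t \<Longrightarrow> x \<noteq> y \<Longrightarrow> vars (\<sigma> x) \<inter> vars (\<sigma> y) = {}) \<Longrightarrow> linear (t \<cdot> \<sigma>)"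
  unfolding linear_def var_list_app distinct_concat_nth set_var_list[symmetric]
  by (simp add: nth_eq_iff_index_eq)

lemma linear_app_disjoint:
  assumes "linear (t \<cdot> \<sigma>)" "x \<in> vars t" "y \<in> vars t" "x \<noteq> y"
  shows "vars (\<sigma> x) \<inter> vars (\<sigma> y) = {}"
proof -
  obtain i j where "i < length (var_list t)" "j < length (var_list t)" "var_list t ! i = x" "var_list t ! j = y"
    using assms(2,3) by (metis in_set_conv_nth set_var_list)
  then show ?thesis
    using assms(1,4) unfolding linear_def var_list_app distinct_concat_nth
    by (auto simp: set_var_list dest: spec[of _ i])
qed

lemma linear_app_linear: "linear (t \<cdot> \<sigma>) \<Longrightarrow> x \<in> vars t \<Longrightarrow> linear (\<sigma> x)"
  unfolding linear_def var_list_app distinct_concat_nth set_var_list[symmetric]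
  by (auto simp: in_set_conv_nth)

lemma linear_rename:
  assumes "linear t" "inj_on \<pi> (vars t)" shows "linear (rename t \<pi>)"
  using assms by (intro linear_app) (auto dest: inj_onD)

text \<open>Arguments of a linear term have disjoint variables, so matchers found for the arguments
  one by one can be glued together.\<close>

lemma merge_disjoint:
  assumes "\<forall>i < n. \<forall>j < n. i \<noteq> j \<longrightarrow> A i \<inter> A j = {}"
  shows "\<exists>\<gamma>. \<forall>i < n. \<forall>x \<in> A i. \<gamma> x = \<Gamma> i x"
proof (intro exI allI impI ballI)
  fix i x assume i: "i < n" "x \<in> A i"
  \<comment> \<open>Disjointness makes the index of \<open>x\<close> unique, so the choice returns
    it.\<close>
  then have "(SOME i. i < n \<and> x \<in> A i) = i"
    using assms by (intro some_equality) auto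
  then show "(\<lambda>x. \<Gamma> (SOME i. i < n \<and> x \<in> A i) x) x = \<Gamma> i x" by simp
qed

text \<open>
  Matching of \<open>t\<close> against \<open>u\<close> where every variable occurrence of \<open>u\<close> is treated separately. It does
  not depend on variable names, and for linear \<open>u\<close> it is matching by a substitution.
\<close>

inductive has_instance :: "('s \<Rightarrow> ('f, 's) trm set) \<Rightarrow> ('f, 's) trm \<Rightarrow> ('f, 's) trm \<Rightarrow> bool" for G where
  has_instance_Var: "t \<in> G (snd x) \<Longrightarrow> has_instance G (Var x) t"
| has_instance_Fun: "length us = length ts \<Longrightarrow> (\<forall>i < length us. has_instance G (us ! i) (ts ! i)) \<Longrightarrow> has_instance G (Fun f us) (Fun f ts)"

inductive_simps has_instance_Var_iff [simp]: "has_instance G (Var x) t"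
inductive_simps has_instance_Fun_iff: "has_instance G (Fun f us) t"

lemma has_instance_app: "has_instance G (s \<cdot> \<sigma>) (s \<cdot> \<gamma>) \<longleftrightarrow> (\<forall>x \<in> vars s. has_instance G (\<sigma> x) (\<gamma> x))"
  by (induction s) (auto simp: has_instance_Fun_iff all_set_conv_all_nth)

lemma has_instance_inst: "(\<And>x. x \<in> vars s \<Longrightarrow> \<gamma> x \<in> G (snd x)) \<Longrightarrow> has_instance G s (s \<cdot> \<gamma>)"
  using has_instance_app[of G s Var \<gamma>] by simp

lemma has_instance_linear:
  "has_instance G s g \<Longrightarrow> linear s \<Longrightarrow> \<exists>\<gamma>. (\<forall>x \<in> vars s. \<gamma> x \<in> G (snd x)) \<and> s \<cdot> \<gamma> = g"
proof (induction rule: has_instance.induct)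
  case (has_instance_Var t x)
  then show ?case by (intro exI[of _ "\<lambda>_. t"]) simp
next
  case (has_instance_Fun us ts f)
  then have "\<forall>i. \<exists>\<gamma>. i < length us \<longrightarrow> (\<forall>x \<in> vars (us ! i). \<gamma> x \<in> G (snd x)) \<and> us ! i \<cdot> \<gamma> = ts ! i"
    by (auto simp: linear_Fun)
  then obtain \<Gamma> where \<Gamma>: "\<And>i. i < length us \<Longrightarrow> (\<forall>x \<in> vars (us ! i). \<Gamma> i x \<in> G (snd x)) \<and> us ! i \<cdot> \<Gamma> i = ts ! i"
    by metis
  obtain \<gamma> where \<gamma>: "\<forall>i < length us. \<forall>x \<in> vars (us ! i). \<gamma> x = \<Gamma> i x"
    using merge_disjoint[of "length us" "\<lambda>i. vars (us ! i)" \<Gamma>] has_instance_Fun(3) by (auto simp: linear_Fun)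
  have "us ! i \<cdot> \<gamma> = ts ! i" if "i < length us" for i
    using \<Gamma>[OF that] \<gamma> that app_cong[of "us ! i" \<gamma> "\<Gamma> i"] by simp
  then have "Fun f us \<cdot> \<gamma> = Fun f ts"
    using has_instance_Fun(1) by (simp add: list_eq_iff_nth_eq)
  moreover have "\<gamma> x \<in> G (snd x)" if x: "x \<in> vars (Fun f us)" for x
  proof -
    obtain i where "i < length us" "x \<in> vars (us ! i)"
      using x by (auto simp: in_set_conv_nth)
    then show ?thesis using \<Gamma>[of i] \<gamma> by auto
  qed
  ultimately show ?case by blast
qed

section \<open>Sort-preserving renamings and shapes of terms\<close>

lemma list_renaming:
  fixes xs ys :: "'s vr list"
  assumes "distinct xs" "distinct ys" "map snd xs = map snd ys"
  shows "\<exists>\<pi>. is_renaming \<pi> \<and> map \<pi> xs = ys"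
  using assms
proof (induction xs arbitrary: ys)
  case Nil
  then show ?case using bij_id by (intro exI[of _ id]) (auto simp: is_renaming_def id_def)
next
  case (Cons x xs)
  then obtain y ys' where ys: "ys = y # ys'" by (cases ys) auto
  then obtain \<pi> where \<pi>: "is_renaming \<pi>" "map \<pi> xs = ys'" using Cons by auto
  have inj: "inj \<pi>" using \<pi> by (auto simp: is_renaming_def bij_def)
  \<comment> \<open>This transposition corrects the image of \<open>x\<close> and moves no element
    of \<open>ys'\<close>: \<open>\<pi> x\<close> is not among them because \<open>\<pi>\<close> is
    injective, and \<open>y\<close> is not because \<open>ys\<close> is distinct.\<close>
  let ?t = "\<lambda>z. if z = \<pi> x then y else if z = y then \<pi> x else z"
  have "snd x = snd y" using Cons(4) ys by simp
  then have snd: "snd (\<pi> x) = snd y" using \<pi>(1) unfolding is_renaming_def by metis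
  have "bij ?t" by (rule o_bij[of ?t]) (auto simp: fun_eq_iff)
  moreover have "snd (?t z) = snd z" for z using snd by simp
  ultimately have "is_renaming (?t \<circ> \<pi>)"
    using \<pi>(1) bij_comp[of \<pi> ?t] unfolding is_renaming_def comp_def by metis
  moreover have "map (?t \<circ> \<pi>) (x # xs) = ys"
    using \<pi> Cons(2,3) by (auto simp: ys inj_eq[OF inj])
  ultimately show ?case by blast
qed

lemma var_list_map_tm: "var_list (map_tm f g t) = map g (var_list t)"
proof (induction t)
  case (Fun f ts)
  then show ?case by (induction ts) auto
qed simp

text \<open>Serves to show that two members of a difference with a common instance are equivalent.
  The shape \<open>map_tm (\<lambda>f. f) snd\<close> keeps of each variable only its sort.\<close>

lemma shape_renaming:
  fixes s t :: "('f, 's) trm"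
  assumes "linear s" "linear t" "map_tm (\<lambda>f. f) snd s = map_tm (\<lambda>f. f) snd t"
  shows "\<exists>\<pi>. is_renaming \<pi> \<and> rename s \<pi> = t"
proof -
  have "map snd (var_list s) = map snd (var_list t)"
    using arg_cong[OF assms(3), of var_list] by (simp add: var_list_map_tm)
  then obtain \<pi> where \<pi>: "is_renaming \<pi>" "map \<pi> (var_list s) = var_list t"
    using list_renaming assms(1,2) unfolding linear_def by metis
  \<comment> \<open>Linearity does not enter the induction: once \<open>\<pi>\<close> is fixed, it
    suffices that the two variable lists correspond.\<close>
  have "map_tm (\<lambda>f. f) snd s = map_tm (\<lambda>f. f) snd t \<Longrightarrow> map \<pi> (var_list s) = var_list t \<Longrightarrow> rename s \<pi> = t"
    for s t :: "('f, 's) trm"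
  proof (induction s arbitrary: t)
    case (Var x)
    then show ?case by (cases t) auto
  next
    case (Fun f ss)
    then obtain ts where t: "t = Fun f ts" "map (map_tm (\<lambda>f. f) snd) ss = map (map_tm (\<lambda>f. f) snd) ts"
      by (cases t) auto
    have "map (\<lambda>s. rename s \<pi>) ss = ts"
      using t(2) Fun.prems(2) Fun.IH unfolding t(1)
    proof (induction ss arbitrary: ts)
      case (Cons s ss)
      then obtain t' ts' where ts: "ts = t' # ts'" by (cases ts) auto
      \<comment> \<open>Equal shapes have variable lists of equal length, which tells where the part
        of the first argument ends.\<close>
      have "length (map \<pi> (var_list s)) = length (var_list t')"
        using Cons.prems(1) unfolding ts by simp (metis length_map var_list_map_tm)
      then have "map \<pi> (var_list s) = var_list t'" "map \<pi> (concat (map var_list ss)) = concat (map var_list ts')"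
        using Cons.prems(2) by (simp_all add: ts)
      then show ?case using Cons by (auto simp: ts)
    qed simp
    then show ?case by (simp add: t)
  qed
  then show ?thesis using assms(3) \<pi> by blast
qed

text \<open>A bound instead of a maximum, so that each argument is treated separately. Variables
  have depth 0 and constants depth 1; fresh variables thus never increase the depth.\<close>

fun depth_le :: "nat \<Rightarrow> ('f, 'v) tm \<Rightarrow> bool" where
  "depth_le n (Var x) \<longleftrightarrow> True"
| "depth_le 0 (Fun f ts) \<longleftrightarrow> False"
| "depth_le (Suc n) (Fun f ts) \<longleftrightarrow> (\<forall>t \<in> set ts. depth_le n t)"

lemma depth_le_Fun: "depth_le n (Fun f ts) \<longleftrightarrow> (\<exists>m. n = Suc m \<and> (\<forall>t \<in> set ts. depth_le m t))"
  by (cases n) auto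

lemma depth_le_mono: "depth_le m t \<Longrightarrow> m \<le> n \<Longrightarrow> depth_le n t"
proof (induction m t arbitrary: n rule: depth_le.induct)
  case (3 m f ts)
  then show ?case by (cases n) auto
qed auto

lemma depth_le_exists: "\<exists>n. depth_le n t"
proof (induction t)
  case (Fun f ts)
  then obtain n where "\<forall>t \<in> set ts. depth_le (n t) t" by metis
  moreover have "n t \<le> sum_list (map n ts)" if "t \<in> set ts" for t
    using that by (intro member_le_sum_list) auto
  ultimately have "depth_le (sum_list (map n ts)) t" if "t \<in> set ts" for t
    using that depth_le_mono by blast
  then have "depth_le (Suc (sum_list (map n ts))) (Fun f ts)" by simp
  then show ?case by blast
qed (simp add: exI[of _ 0])

lemma depth_le_app_mono: "(\<And>x n. x \<in> vars s \<Longrightarrow> depth_le n (\<sigma> x) \<Longrightarrow> depth_le n (\<rho> x)) \<Longrightarrow> depth_le n (s \<cdot> \<sigma>) \<Longrightarrow> depth_le n (s \<cdot> \<rho>)"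
proof (induction s arbitrary: n)
  case (Fun f ts)
  from Fun.prems(2) obtain m where m: "n = Suc m" "\<forall>t \<in> set ts. depth_le m (t \<cdot> \<sigma>)"
    by (auto simp: depth_le_Fun)
  have "depth_le m (t \<cdot> \<rho>)" if "t \<in> set ts" for t
    using that m(2) Fun.prems(1) by (intro Fun.IH) auto
  then show ?case by (simp add: m(1))
qed simp

lemma depth_le_rename [simp]: "depth_le n (rename t \<pi>) = depth_le n t"
  by (induction n t rule: depth_le.induct) auto

lemma avoid_renaming:
  fixes A B :: "'s vr set"
  assumes "finite A" "finite B"
  shows "\<exists>\<pi>. is_renaming \<pi> \<and> \<pi> ` A \<inter> B = {}"
proof -
  obtain xs where xs: "set xs = A" "distinct xs" using finite_distinct_list[OF assms(1)] by auto
  obtain m where m: "\<forall>x \<in> A \<union> B. fst x < m"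
    using finite_nat_set_iff_bounded[of "fst ` (A \<union> B)"] assms by auto
  let ?ys = "map (\<lambda>x. (m + fst x, snd x)) xs"
  have "distinct ?ys" using xs by (auto simp: distinct_map inj_on_def prod_eq_iff)
  then obtain \<pi> where "is_renaming \<pi>" "map \<pi> xs = ?ys"
    using list_renaming[of xs ?ys] xs by auto
  moreover have "fst y \<ge> m" if "y \<in> set ?ys" for y using that by auto
  then have "set ?ys \<inter> B = {}" using m by (meson UnI2 disjoint_iff leD)
  ultimately show ?thesis using xs by (metis list.set_map)
qed

lemma fresh_vars:
  fixes \<sigma>s :: "'s list" and X :: "'s vr set"
  assumes "finite X"
  shows "\<exists>xs. distinct xs \<and> map snd xs = \<sigma>s \<and> set xs \<inter> X = {}"
proof -
  obtain m where m: "\<forall>x \<in> X. fst x < m"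
    using finite_nat_set_iff_bounded[of "fst ` X"] assms by auto
  let ?xs = "zip [m..<m + length \<sigma>s] \<sigma>s"
  have "distinct ?xs" by (simp add: distinct_zipI1)
  moreover have "map snd ?xs = \<sigma>s" by simp
  moreover have "set ?xs \<inter> X = {}" using m by (force dest: set_zip_leftD)
  ultimately show ?thesis by blast
qed

subsection \<open>Unification of linear terms\<close>

text \<open>For linear, well-sorted terms of equal sort without common variables this amounts to
  unifiability. No occurs check appears, since no variable occurs twice.\<close>

inductive clash_free :: "('f, 'v) tm \<Rightarrow> ('f, 'v) tm \<Rightarrow> bool" where
  clash_free_Var: "clash_free (Var x) t"
| clash_free_Fun_Var: "clash_free (Fun f ss) (Var y)"
| clash_free_Fun: "length ss = length ts \<Longrightarrow> (\<forall>i < length ss. clash_free (ss ! i) (ts ! i)) \<Longrightarrow> clash_free (Fun f ss) (Fun f ts)"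

text \<open>Two substitutions are allowed, because a common ground instance of variable-disjoint
  patterns comes with one matcher for each of them.\<close>

lemma clash_free_unifiable: "s \<cdot> \<tau> = t \<cdot> \<tau>' \<Longrightarrow> clash_free s t"
proof (induction s arbitrary: t)
  case (Fun f ss)
  show ?case
  proof (cases t)
    case (Fun g ts)
    then have g: "g = f" "map (\<lambda>s. s \<cdot> \<tau>) ss = map (\<lambda>t. t \<cdot> \<tau>') ts" using Fun.prems by auto
    have len: "length ss = length ts" using g(2) by (metis length_map)
    moreover have "clash_free (ss ! i) (ts ! i)" if "i < length ss" for i
    proof (rule Fun.IH)
      show "ss ! i \<in> set ss" using that by simp
      show "ss ! i \<cdot> \<tau> = ts ! i \<cdot> \<tau>'" using that arg_cong[OF g(2), of "\<lambda>l. l ! i"] len by simp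
    qed
    ultimately show ?thesis unfolding Fun g(1) by (intro clash_free_Fun) auto
  qed (auto intro: clash_free_Fun_Var)
qed (rule clash_free_Var)

function (sequential) bindings :: "('f, 'v) tm \<Rightarrow> ('f, 'v) tm \<Rightarrow> ('v \<times> ('f, 'v) tm) list" where
  "bindings (Var x) t = [(x, t)]"
| "bindings (Fun f ss) (Var y) = [(y, Fun f ss)]"
| "bindings (Fun f ss) (Fun g ts) = concat (map (\<lambda>(s, t). bindings s t) (zip ss ts))"
  by pat_completeness auto
termination
  by (relation "measure (\<lambda>(s, t). size s)")
    (auto dest!: set_zip_leftD simp: less_Suc_eq_le size_list_estimation')

text \<open>The common instance, described without a substitution. Linearity and the depth bound of
  a unified term are read off from this form.\<close>

function (sequential) overlay :: "('f, 'v) tm \<Rightarrow> ('f, 'v) tm \<Rightarrow> ('f, 'v) tm" where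
  "overlay (Var x) t = t"
| "overlay (Fun f ss) (Var y) = Fun f ss"
| "overlay (Fun f ss) (Fun g ts) = Fun f (map (\<lambda>(s, t). overlay s t) (zip ss ts))"
  by pat_completeness auto
termination
  by (relation "measure (\<lambda>(s, t). size s)")
    (auto dest!: set_zip_leftD simp: less_Suc_eq_le size_list_estimation')

lemma set_bindings_Fun:
  "length ss = length ts \<Longrightarrow>
   set (bindings (Fun f ss) (Fun g ts)) = (\<Union>i < length ss. set (bindings (ss ! i) (ts ! i)))"
  by (auto simp: set_zip)

lemma bindings_vars:
  "(x, u) \<in> set (bindings s t) \<Longrightarrow> (x \<in> vars s \<and> vars u \<subseteq> vars t) \<or> (x \<in> vars t \<and> vars u \<subseteq> vars s)"
proof (induction s t rule: bindings.induct)
  case (3 f ss g ts)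
  then obtain s t where st: "(s, t) \<in> set (zip ss ts)" "(x, u) \<in> set (bindings s t)" by auto
  then have "s \<in> set ss" "t \<in> set ts" by (auto dest: set_zip_leftD set_zip_rightD)
  with 3(1)[of "(s, t)" s t] st show ?case by auto
qed auto

lemma bindings_unifier:
  "clash_free s t \<Longrightarrow> s \<cdot> \<tau> = t \<cdot> \<tau> \<Longrightarrow> (x, u) \<in> set (bindings s t) \<Longrightarrow> \<tau> x = u \<cdot> \<tau>"
proof (induction rule: clash_free.induct)
  case (clash_free_Fun ss ts f)
  then obtain i where i: "i < length ss" "(x, u) \<in> set (bindings (ss ! i) (ts ! i))"
    by (auto simp: set_bindings_Fun simp del: bindings.simps)
  moreover have "ss ! i \<cdot> \<tau> = ts ! i \<cdot> \<tau>"
    using arg_cong[of _ _ "\<lambda>l. l ! i", OF tm.inject(2)[THEN iffD1, THEN conjunct2, OF clash_free_Fun(3)[unfolded app.simps]]]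
      i clash_free_Fun(1) by simp
  ultimately show ?case using clash_free_Fun(2) by blast
qed auto

lemma bindings_wt:
  "clash_free s t \<Longrightarrow> wt \<Sigma> s \<tau> \<Longrightarrow> wt \<Sigma> t \<tau> \<Longrightarrow> (x, u) \<in> set (bindings s t) \<Longrightarrow> wt \<Sigma> u (snd x)"
proof (induction arbitrary: \<tau> rule: clash_free.induct)
  case (clash_free_Fun ss ts f)
  then obtain i where i: "i < length ss" "(x, u) \<in> set (bindings (ss ! i) (ts ! i))"
    by (auto simp: set_bindings_Fun simp del: bindings.simps)
  with clash_free_Fun show ?case by (auto simp: wt_Fun_iff)
qed auto

lemma bindings_funs: "(x, u) \<in> set (bindings s t) \<Longrightarrow> funs u \<subseteq> funs s \<union> funs t"
proof (induction s t rule: bindings.induct)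
  case (3 f ss g ts)
  then obtain s t where st: "(s, t) \<in> set (zip ss ts)" "(x, u) \<in> set (bindings s t)" by auto
  then have "s \<in> set ss" "t \<in> set ts" by (auto dest: set_zip_leftD set_zip_rightD)
  with 3(1)[of "(s, t)" s t] st show ?case by auto
qed auto

lemma vars_nth: "i < length ss \<Longrightarrow> vars (ss ! i) \<subseteq> vars (Fun f ss)"
  by (auto dest: nth_mem)

lemma linear_pair_disjoint:
  assumes "linear (Fun f ss)" "linear (Fun g ts)" "vars (Fun f ss) \<inter> vars (Fun g ts) = {}"
    "length ss = length ts" "i < length ss" "j < length ss" "i \<noteq> j"
  shows "(vars (ss ! i) \<union> vars (ts ! i)) \<inter> (vars (ss ! j) \<union> vars (ts ! j)) = {}"
proof -
  have "vars (ss ! k) \<subseteq> vars (Fun f ss)" "vars (ts ! k) \<subseteq> vars (Fun g ts)" if "k < length ss" for k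
    using that assms(4) by (simp_all only: vars_nth)
  then have "vars (ss ! i) \<inter> vars (ts ! j) = {}" "vars (ts ! i) \<inter> vars (ss ! j) = {}"
    using assms(3,5,6) by (meson disjoint_iff subsetD)+
  moreover have "vars (ss ! i) \<inter> vars (ss ! j) = {}" "vars (ts ! i) \<inter> vars (ts ! j) = {}"
    using assms(1,2,4-7) unfolding linear_Fun by auto
  ultimately show ?thesis by auto
qed

lemma linear_pair_nth:
  assumes "linear (Fun f ss)" "linear (Fun g ts)" "vars (Fun f ss) \<inter> vars (Fun g ts) = {}"
    "length ss = length ts" "i < length ss"
  shows "linear (ss ! i)" "linear (ts ! i)" "vars (ss ! i) \<inter> vars (ts ! i) = {}"
proof -
  have "vars (ss ! i) \<subseteq> vars (Fun f ss)" "vars (ts ! i) \<subseteq> vars (Fun g ts)"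
    using assms(4,5) by (simp_all only: vars_nth)
  then show "linear (ss ! i)" "linear (ts ! i)" "vars (ss ! i) \<inter> vars (ts ! i) = {}"
    using assms by (auto simp: linear_Fun)
qed

lemma bindings_distinct:
  "clash_free s t \<Longrightarrow> linear s \<Longrightarrow> linear t \<Longrightarrow> vars s \<inter> vars t = {} \<Longrightarrow> distinct (map fst (bindings s t))"
proof (induction rule: clash_free.induct)
  case (clash_free_Fun ss ts f)
  have eq: "map fst (bindings (Fun f ss) (Fun f ts)) = concat (map (\<lambda>(s, t). map fst (bindings s t)) (zip ss ts))"
    by (simp add: map_concat comp_def case_prod_unfold)
  have keys: "fst ` set (bindings s t) \<subseteq> vars s \<union> vars t" for s t :: "('a, 'b) tm"
    using bindings_vars by fastforce
  have d: "fst ` set (bindings (ss ! i) (ts ! i)) \<inter> fst ` set (bindings (ss ! j) (ts ! j)) = {}"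
    if "i < length ss" "j < length ss" "i \<noteq> j" for i j
    using linear_pair_disjoint[OF clash_free_Fun(3,4,5,1) that] keys by blast
  have l: "distinct (map fst (bindings (ss ! i) (ts ! i)))" if "i < length ss" for i
    using clash_free_Fun(2) linear_pair_nth[OF clash_free_Fun(3,4,5,1)] that by blast
  show ?case
    unfolding eq distinct_concat_nth using d l clash_free_Fun(1) by simp
qed auto

text \<open>One application of the bindings suffices: by linearity and disjointness, the variables
  of a bound term occur nowhere else in the two terms and so are not bound themselves.\<close>

lemma bindings_overlay:
  "clash_free s t \<Longrightarrow> linear s \<Longrightarrow> linear t \<Longrightarrow> vars s \<inter> vars t = {} \<Longrightarrow>
   (\<And>x u. (x, u) \<in> set (bindings s t) \<Longrightarrow> \<sigma> x = u) \<Longrightarrow>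
   (\<And>x. x \<in> vars s \<union> vars t \<Longrightarrow> x \<notin> fst ` set (bindings s t) \<Longrightarrow> \<sigma> x = Var x) \<Longrightarrow>
   s \<cdot> \<sigma> = overlay s t \<and> t \<cdot> \<sigma> = overlay s t"
proof (induction rule: clash_free.induct)
  case (clash_free_Var x t)
  then have "t \<cdot> \<sigma> = t" by (intro app_ident) auto
  with clash_free_Var show ?case by simp
next
  case (clash_free_Fun_Var f ss y)
  then have "Fun f ss \<cdot> \<sigma> = Fun f ss" by (intro app_ident) auto
  moreover have "\<sigma> y = Fun f ss" using clash_free_Fun_Var by simp
  ultimately show ?case by simp
next
  case (clash_free_Fun ss ts f)
  have "ss ! i \<cdot> \<sigma> = overlay (ss ! i) (ts ! i) \<and> ts ! i \<cdot> \<sigma> = overlay (ss ! i) (ts ! i)" if i: "i < length ss" for i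
  proof -
    have 1: "\<sigma> x = u" if "(x, u) \<in> set (bindings (ss ! i) (ts ! i))" for x u
      using that i clash_free_Fun(1) by (intro clash_free_Fun(6)) (auto simp: set_bindings_Fun simp del: bindings.simps)
    have 2: "\<sigma> x = Var x"
      if x: "x \<in> vars (ss ! i) \<union> vars (ts ! i)" "x \<notin> fst ` set (bindings (ss ! i) (ts ! i))" for x
    proof (rule clash_free_Fun(7))
      show "x \<in> vars (Fun f ss) \<union> vars (Fun f ts)"
        using x(1) i clash_free_Fun(1) by (auto intro: nth_mem)
      show "x \<notin> fst ` set (bindings (Fun f ss) (Fun f ts))"
      proof
        assume "x \<in> fst ` set (bindings (Fun f ss) (Fun f ts))"
        then obtain j u where j: "j < length ss" "(x, u) \<in> set (bindings (ss ! j) (ts ! j))"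
          using clash_free_Fun(1) by (auto simp: set_bindings_Fun simp del: bindings.simps)
        then have "i \<noteq> j" using x(2) by force
        then show False
          using linear_pair_disjoint[OF clash_free_Fun(3,4,5,1) i j(1)] bindings_vars[OF j(2)] x(1) by blast
      qed
    qed
    show ?thesis
      using clash_free_Fun(2) i linear_pair_nth[OF clash_free_Fun(3,4,5,1) i] 1 2 by blast
  qed
  then show ?case using clash_free_Fun(1) by (auto intro!: nth_equalityI)
qed

lemma overlay_vars: "clash_free s t \<Longrightarrow> vars (overlay s t) \<subseteq> vars s \<union> vars t"
proof (induction rule: clash_free.induct)
  case (clash_free_Fun ss ts f)
  then show ?case by (fastforce simp: set_zip in_set_conv_nth)
qed auto

lemma overlay_linear:
  "clash_free s t \<Longrightarrow> linear s \<Longrightarrow> linear t \<Longrightarrow> vars s \<inter> vars t = {} \<Longrightarrow> linear (overlay s t)"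
proof (induction rule: clash_free.induct)
  case (clash_free_Fun ss ts f)
  have "linear (overlay (ss ! i) (ts ! i))" if "i < length ss" for i
    using clash_free_Fun(2) linear_pair_nth[OF clash_free_Fun(3,4,5,1)] that by blast
  moreover have "vars (overlay (ss ! i) (ts ! i)) \<inter> vars (overlay (ss ! j) (ts ! j)) = {}"
    if "i < length ss" "j < length ss" "i \<noteq> j" for i j
    using linear_pair_disjoint[OF clash_free_Fun(3,4,5,1) that] overlay_vars[of "ss ! i" "ts ! i"]
      overlay_vars[of "ss ! j" "ts ! j"] clash_free_Fun(2) that by blast
  ultimately show ?case using clash_free_Fun(1) by (auto simp: linear_Fun)
qed auto

text \<open>Every position of the overlay stems from one of the two terms. Together with
  \<open>co_depth_le\<close> this keeps the depth bounded throughout the procedure.\<close>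

lemma overlay_depth_le: "clash_free s t \<Longrightarrow> depth_le n s \<Longrightarrow> depth_le n t \<Longrightarrow> depth_le n (overlay s t)"
proof (induction arbitrary: n rule: clash_free.induct)
  case (clash_free_Fun ss ts f)
  then show ?case by (fastforce simp: depth_le_Fun set_zip all_set_conv_all_nth)
qed auto

definition bindings_subst :: "('f, 's) trm \<Rightarrow> ('f, 's) trm \<Rightarrow> ('f, 's) subst" where
  "bindings_subst s t x = (case map_of (bindings s t) x of Some u \<Rightarrow> u | None \<Rightarrow> Var x)"

lemma bindings_subst_mgu:
  assumes c: "clash_free s t" and lin: "linear s" "linear t" "vars s \<inter> vars t = {}"
    and wt: "wt \<Sigma> s \<tau>" "wt \<Sigma> t \<tau>"
  shows "is_mgu \<Sigma> s t (bindings_subst s t)" (is ?A) "sdom (bindings_subst s t) \<subseteq> vars s \<union> vars t" (is ?B)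
    "s \<cdot> bindings_subst s t = overlay s t" (is ?C)
    "\<And>x. (x, bindings_subst s t x) \<in> set (bindings s t) \<or> bindings_subst s t x = Var x"
proof -
  let ?\<sigma> = "bindings_subst s t"
  have key: "?\<sigma> x = u" if "(x, u) \<in> set (bindings s t)" for x u
    using that bindings_distinct[OF c lin] by (simp add: bindings_subst_def)
  have nokey: "?\<sigma> x = Var x" if "x \<notin> fst ` set (bindings s t)" for x
    using that by (simp add: bindings_subst_def map_of_eq_None_iff[THEN iffD2])
  have m: "s \<cdot> ?\<sigma> = overlay s t \<and> t \<cdot> ?\<sigma> = overlay s t"
    using bindings_overlay[OF c lin, of ?\<sigma>] key nokey by blast
  have "wt \<Sigma> (?\<sigma> x) (snd x)" for x
    using key nokey[of x] bindings_wt[OF c wt] by (cases "x \<in> fst ` set (bindings s t)") auto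
  then have s: "is_subst \<Sigma> ?\<sigma>" by (simp add: is_subst_def)
  \<comment> \<open>Every unifier solves the bindings read as equations, so it factors through
    \<open>?\<sigma>\<close> with itself as the second factor.\<close>
  have "\<tau> x = ?\<sigma> x \<cdot> \<tau>" if "s \<cdot> \<tau> = t \<cdot> \<tau>" for \<tau> x
    using key nokey[of x] bindings_unifier[OF c that] by (cases "x \<in> fst ` set (bindings s t)") auto
  then show ?A using s m unfolding is_mgu_def by auto
  show ?B using nokey bindings_vars unfolding sdom_def by fastforce
  show ?C using m by simp
  show "(x, ?\<sigma> x) \<in> set (bindings s t) \<or> ?\<sigma> x = Var x" for x
    using key[of x] nokey[of x] by (cases "x \<in> fst ` set (bindings s t)") force+
qed

text \<open>The difference may be taken with any most general unifier, whereas
  \<open>bindings_subst\<close> is a particular one. The two factor through each other, so they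
  differ by a renaming of the variables in the image.\<close>

lemma mgu_variant:
  assumes "is_mgu \<Sigma> s t \<sigma>" "is_mgu \<Sigma> s t \<sigma>'"
  shows "\<exists>d. inj_on d (\<Union>x. vars (\<sigma>' x)) \<and> (\<forall>z \<in> (\<Union>x. vars (\<sigma>' x)). snd (d z) = snd z) \<and>
    (\<forall>x. \<sigma> x = rename (\<sigma>' x) d)"
proof -
  obtain \<delta> where \<delta>: "is_subst \<Sigma> \<delta>" "\<And>x. \<sigma> x = \<sigma>' x \<cdot> \<delta>"
    using assms unfolding is_mgu_def by metis
  obtain \<delta>' where \<delta>': "is_subst \<Sigma> \<delta>'" "\<And>x. \<sigma>' x = \<sigma> x \<cdot> \<delta>'"
    using assms unfolding is_mgu_def by metis
  let ?V = "\<Union>x. vars (\<sigma>' x)"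
  \<comment> \<open>The factors are inverse to each other on these variables, which forces
    \<open>\<delta>\<close> to map them injectively to variables.\<close>
  have inv: "\<delta> z \<cdot> \<delta>' = Var z" if z: "z \<in> ?V" for z
  proof -
    obtain x where x: "z \<in> vars (\<sigma>' x)" using z by blast
    have "\<sigma>' x \<cdot> (\<lambda>z. \<delta> z \<cdot> \<delta>') = \<sigma>' x \<cdot> Var"
      using \<delta>(2)[of x] \<delta>'(2)[of x] by (simp flip: app_app)
    then show ?thesis using x by (rule app_eqD)
  qed
  then have "\<forall>z. \<exists>y. z \<in> ?V \<longrightarrow> \<delta> z = Var y"
    by (metis app.simps(2) tm.distinct(1) tm.exhaust)
  then obtain d where d: "\<And>z. z \<in> ?V \<Longrightarrow> \<delta> z = Var (d z)" by metis
  have "inj_on d ?V"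
    by (rule inj_onI) (metis inv d tm.inject(1))
  moreover have "snd (d z) = snd z" if "z \<in> ?V" for z
    using \<delta>(1) d[OF that] unfolding is_subst_def by (metis wt_Var_iff)
  moreover have "\<sigma> x = rename (\<sigma>' x) d" for x
    unfolding \<delta>(2)[of x] using d by (intro app_cong) blast
  ultimately show ?thesis by blast
qed

section \<open>Complements of constructor terms\<close>

lemma co_Fun: "co \<Sigma> C X u u' \<Longrightarrow> (\<exists>f us. u' = Fun f us) \<and> (\<exists>f us. u = Fun f us)"
  by (auto elim: co.cases)

lemma co_mono: "co \<Sigma> C X' u u' \<Longrightarrow> X \<subseteq> X' \<Longrightarrow> co \<Sigma> C X u u'"
proof (induction rule: co.induct)
  case (co_root c \<sigma>s \<tau> c' \<sigma>s' xs us)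
  then show ?case by (intro co.co_root) auto
next
  case (co_arg c \<sigma>s \<tau> i us u' ys)
  then show ?case by (intro co.co_arg) auto
qed

text \<open>A member of the complement carries another symbol than \<open>u\<close> at some position
  of \<open>u\<close>, and no term is an instance of both.\<close>

lemma co_has_instance_disjoint: "co \<Sigma> C X u u' \<Longrightarrow> has_instance G u t \<Longrightarrow> \<not> has_instance G u' t"
proof (induction arbitrary: t rule: co.induct)
  case (co_arg c \<sigma>s \<tau> i us u' ys)
  show ?case
  proof
    assume "has_instance G (Fun c (take i us @ u' # map Var ys)) t"
    then obtain ts where ts: "t = Fun c ts" "length (take i us @ u' # map Var ys) = length ts"
      "\<forall>k < length ts. has_instance G ((take i us @ u' # map Var ys) ! k) (ts ! k)"
      unfolding has_instance_Fun_iff by metis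
    moreover have "(take i us @ u' # map Var ys) ! i = u'" using co_arg.hyps(2) by (simp add: nth_append)
    moreover have "i < length ts" using ts(2) co_arg.hyps(2) by simp
    ultimately have "has_instance G u' (ts ! i)" by metis
    moreover have "has_instance G (us ! i) (ts ! i)" using co_arg.hyps(2) co_arg.prems ts by (auto simp: has_instance_Fun_iff)
    ultimately show False using co_arg.IH by blast
  qed
qed (auto simp: has_instance_Fun_iff)

text \<open>A common instance determines the first position, from left to right, at which it
  deviates from \<open>u\<close>, and the symbol found there. Up to the names of fresh variables
  this determines the member of the complement.\<close>

lemma co_has_instance_shape:
  "co \<Sigma> C X u u1 \<Longrightarrow> co \<Sigma> C X u u2 \<Longrightarrow> has_instance G u1 t \<Longrightarrow> has_instance G u2 t \<Longrightarrow>
   map_tm (\<lambda>f. f) snd u1 = map_tm (\<lambda>f. f) snd u2"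
proof (induction arbitrary: u2 t rule: co.induct)
  case (co_root c \<sigma>s \<tau> c' \<sigma>s' xs us)
  obtain ts where t: "t = Fun c' ts" using co_root.prems by (auto simp: has_instance_Fun_iff)
  from co_root.prems(1) show ?case
  proof cases
    case (co_root \<sigma>s1 \<tau>1 c1 \<sigma>s1' xs1)
    with co_root.prems t have "c1 = c'" by (auto simp: has_instance_Fun_iff)
    then have "map snd xs1 = map snd xs" using co_root co_root.hyps by simp
    then show ?thesis using \<open>c1 = c'\<close> co_root by (simp add: comp_def) (metis (no_types, lifting) list.map_comp comp_apply map_eq_conv)
  next
    case (co_arg \<sigma>s1 \<tau>1 i u'1 ys1)
    with co_root.prems t co_root.hyps show ?thesis by (auto simp: has_instance_Fun_iff)
  qed
next
  case (co_arg c \<sigma>s \<tau> i us u' ys)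
  let ?l = "take i us @ u' # map Var ys"
  obtain ts where t: "t = Fun c ts" "length ?l = length ts" "\<And>k. k < length ts \<Longrightarrow> has_instance G (?l ! k) (ts ! k)"
    using co_arg.prems(2) unfolding has_instance_Fun_iff by metis
  have i: "i < length ts" "i < length us" "has_instance G u' (ts ! i)" "\<And>k. k < i \<Longrightarrow> has_instance G (us ! k) (ts ! k)"
  proof -
    show il: "i < length ts" "i < length us" using t(2) co_arg.hyps(2) by simp_all
    have "?l ! i = u'" using il(2) by (simp add: nth_append)
    then show "has_instance G u' (ts ! i)" using t(3)[OF il(1)] by simp
    show "has_instance G (us ! k) (ts ! k)" if "k < i" for k
      using t(3)[of k] that il by (simp add: nth_append)
  qed
  from co_arg.prems(1) show ?case
  proof cases
    case (co_root \<sigma>s1 \<tau>1 c1 \<sigma>s1' xs1)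
    with co_arg.prems t co_arg.hyps show ?thesis by (auto simp: has_instance_Fun_iff)
  next
    case (co_arg \<sigma>s1 \<tau>1 j v ws)
    let ?m = "take j us @ v # map Var ws"
    have t': "length ?m = length ts" "\<And>k. k < length ts \<Longrightarrow> has_instance G (?m ! k) (ts ! k)"
      using co_arg.prems(3) unfolding t(1) co_arg(1) has_instance_Fun_iff by auto
    have j: "j < length ts" "j < length us" "has_instance G v (ts ! j)" "\<And>k. k < j \<Longrightarrow> has_instance G (us ! k) (ts ! k)"
    proof -
      show jl: "j < length ts" "j < length us" using t'(1) co_arg(3) by simp_all
      have "?m ! j = v" using jl(2) by (simp add: nth_append)
      then show "has_instance G v (ts ! j)" using t'(2)[OF jl(1)] by simp
      show "has_instance G (us ! k) (ts ! k)" if "k < j" for k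
        using t'(2)[of k] that jl by (simp add: nth_append)
    qed
    \<comment> \<open>To the left of its deviating argument a complement agrees with
      \<open>u\<close>, so different indices contradict
      \<open>co_has_instance_disjoint\<close>.\<close>
    consider "i < j" | "j < i" | "i = j" by linarith
    then show ?thesis
    proof cases
      case 1
      then show ?thesis using co_has_instance_disjoint[OF co_arg.hyps(3)] i(3) j(4) by blast
    next
      case 2
      then show ?thesis using co_has_instance_disjoint[OF co_arg(4)] j(3) i(4) by blast
    next
      case 3
      then have "map_tm (\<lambda>f. f) snd u' = map_tm (\<lambda>f. f) snd v"
        using co_arg.IH[of v] co_arg(4) i(3) j(3) by blast
      moreover have "map snd ys = map snd ws" using 3 co_arg co_arg.hyps by simp
      ultimately show ?thesis using 3 co_arg(1) by (simp add: comp_def) (metis (no_types, lifting) list.map_comp comp_apply map_eq_conv)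
    qed
  qed
qed

lemma co_vars: "co \<Sigma> C X u u' \<Longrightarrow> vars u' \<subseteq> vars u \<union> - X"
proof (induction rule: co.induct)
  case (co_arg c \<sigma>s \<tau> i us u' ys)
  have "vars (us ! i) \<subseteq> vars (Fun c us)" using co_arg.hyps(2) by (rule vars_nth)
  moreover have "vars (Fun c (take i us)) \<subseteq> vars (Fun c us)" by (auto dest: in_set_takeD)
  ultimately show ?case using co_arg by auto
qed auto

lemma co_linear: "co \<Sigma> C X u u' \<Longrightarrow> linear u \<Longrightarrow> vars u \<subseteq> X \<Longrightarrow> linear u'"
proof (induction rule: co.induct)
  case (co_root c \<sigma>s \<tau> c' \<sigma>s' xs us)
  then show ?case by (simp add: linear_def comp_def)
next
  case (co_arg c \<sigma>s \<tau> i us u' ys)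
  have eq: "concat (map var_list us) =
      concat (map var_list (take i us)) @ var_list (us ! i) @ concat (map var_list (drop (Suc i) us))"
    using id_take_nth_drop[OF co_arg.hyps(2)] by (metis concat.simps(2) concat_append list.simps(9) map_append)
  have v: "vars (us ! i) \<subseteq> X" "(\<Union>t \<in> set (take i us). vars t) \<subseteq> X"
    using co_arg.hyps(2) co_arg.prems(2) by (auto dest: in_set_takeD nth_mem)
  have "linear u'" using co_arg.IH co_arg.hyps(2) co_arg.prems(1) v by (simp add: linear_Fun)
  moreover have "vars u' \<inter> (\<Union>t \<in> set (take i us). vars t) = {}"
    using co_vars[OF co_arg.hyps(3)] v(2) co_arg.prems(1) unfolding linear_def var_list.simps eq
    by (auto simp: set_var_list) blast
  ultimately show ?case
    using co_arg.hyps(4,6) co_arg.prems(1) v(2) unfolding linear_def var_list.simps eq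
    by (auto simp: set_var_list comp_def)
qed

lemma co_wt: "co \<Sigma> C X u u' \<Longrightarrow> wt \<Sigma> u \<tau> \<Longrightarrow> wt \<Sigma> u' \<tau>"
proof (induction arbitrary: \<tau> rule: co.induct)
  case (co_root c \<sigma>s \<tau>' c' \<sigma>s' xs us)
  then show ?case by (auto simp: wt_Fun_iff)
next
  case (co_arg c \<sigma>s \<tau>' i us u' ys)
  have len: "length us = length \<sigma>s" "length ys = length \<sigma>s - Suc i"
    using co_arg.hyps(1) co_arg.prems arg_cong[OF co_arg.hyps(5), of length]
    by (auto simp: wt_Fun_iff simp del: length_map) (metis length_map)
  have "wt \<Sigma> ((take i us @ u' # map Var ys) ! k) (\<sigma>s ! k)" if k: "k < length \<sigma>s" for k
  proof -
    consider "k < i" | "k = i" | "k > i" by linarith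
    then show ?thesis
    proof cases
      case 3
      then have "snd (ys ! (k - Suc i)) = \<sigma>s ! k"
        using k len arg_cong[OF co_arg.hyps(5), of "\<lambda>l. l ! (k - Suc i)"] by simp
      then show ?thesis using 3 k len co_arg.hyps(2) by (auto simp: nth_append nth_Cons')
    qed (use co_arg.hyps co_arg.prems co_arg.IH len in \<open>auto simp: nth_append wt_Fun_iff\<close>)
  qed
  moreover have "length (take i us @ u' # map Var ys) = length \<sigma>s" using len co_arg.hyps(2) by simp
  moreover have "\<tau>' = \<tau>" using co_arg.hyps(1) co_arg.prems by (simp add: wt_Fun_iff)
  ultimately show ?case unfolding wt_Fun_iff using co_arg.hyps(1) by auto
qed

text \<open>The assumption closes \<open>D\<close> under constructors of the same result sort. It
  will be applied to the constructors other than values.\<close>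

lemma co_funs:
  assumes "\<And>c c' \<sigma>s \<sigma>s' \<tau>. c \<in> D \<Longrightarrow> c' \<in> C \<Longrightarrow> \<Sigma> c = Some (\<sigma>s, \<tau>) \<Longrightarrow> \<Sigma> c' = Some (\<sigma>s', \<tau>) \<Longrightarrow> c' \<in> D"
  shows "co \<Sigma> C X u u' \<Longrightarrow> funs u \<subseteq> D \<Longrightarrow> funs u' \<subseteq> D"
proof (induction rule: co.induct)
  case (co_root c \<sigma>s \<tau>' c' \<sigma>s' xs us)
  then show ?case using assms[of c c'] by auto
next
  case (co_arg c \<sigma>s \<tau>' i us u' ys)
  then have "us ! i \<in> set us" by simp
  then have "funs u' \<subseteq> D" using co_arg.prems by (intro co_arg.IH) auto
  then show ?case using co_arg.prems by (auto dest: in_set_takeD)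
qed

text \<open>The deviation lies at a position of \<open>u\<close> that carries a symbol, and below
  the new symbol there are only variables.\<close>

lemma co_depth_le: "co \<Sigma> C X u u' \<Longrightarrow> depth_le n u \<Longrightarrow> depth_le n u'"
proof (induction arbitrary: n rule: co.induct)
  case (co_root c \<sigma>s \<tau>' c' \<sigma>s' xs us)
  then show ?case by (auto simp: depth_le_Fun)
next
  case (co_arg c \<sigma>s \<tau>' i us u' ys)
  then obtain m where m: "n = Suc m" "\<forall>t \<in> set us. depth_le m t" by (auto simp: depth_le_Fun)
  then have "depth_le m u'" using co_arg by auto
  then show ?case using m by (auto dest: in_set_takeD)
qed

text \<open>The counterpart of disjointness: a ground term that is no instance of \<open>u\<close>
  is caught by following it to the first symbol that differs. \<open>G\<close> stands for the sorted
  sets of ground constructor terms.\<close>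

lemma co_cover:
  assumes G: "\<And>\<tau> t. t \<in> G \<tau> \<Longrightarrow> \<exists>c ts \<sigma>s. t = Fun c ts \<and> c \<in> C \<and> \<Sigma> c = Some (\<sigma>s, \<tau>) \<and>
      length ts = length \<sigma>s \<and> (\<forall>i < length ts. ts ! i \<in> G (\<sigma>s ! i))"
    and X: "finite X"
  shows "wt \<Sigma> u \<tau> \<Longrightarrow> t \<in> G \<tau> \<Longrightarrow> \<not> has_instance G u t \<Longrightarrow> \<exists>u'. co \<Sigma> C X u u' \<and> has_instance G u' t"
proof (induction u arbitrary: \<tau> t)
  case (Fun c us)
  obtain \<sigma>s where c: "\<Sigma> c = Some (\<sigma>s, \<tau>)" "length us = length \<sigma>s"
    "\<And>i. i < length us \<Longrightarrow> wt \<Sigma> (us ! i) (\<sigma>s ! i)"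
    using Fun.prems(1) by (auto simp: wt_Fun_iff)
  obtain c' ts \<sigma>s' where c': "t = Fun c' ts" "c' \<in> C" "\<Sigma> c' = Some (\<sigma>s', \<tau>)" "length ts = length \<sigma>s'"
    "\<And>i. i < length ts \<Longrightarrow> ts ! i \<in> G (\<sigma>s' ! i)"
    using G[OF Fun.prems(2)] by blast
  show ?case
  proof (cases "c' = c")
    case False
    obtain xs where xs: "distinct xs" "map snd xs = \<sigma>s'" "set xs \<inter> X = {}"
      using fresh_vars[OF X] by metis
    then have "co \<Sigma> C X (Fun c us) (Fun c' (map Var xs))"
      using False c c' by (intro co_root) auto
    moreover have "has_instance G (Fun c' (map Var xs)) t"
      unfolding c'(1) using xs(2) c'(4,5) by (intro has_instance_Fun) auto
    ultimately show ?thesis by blast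
  next
    case True
    then have s: "\<sigma>s' = \<sigma>s" using c c' by simp
    define P where "P i \<longleftrightarrow> i < length us \<and> \<not> has_instance G (us ! i) (ts ! i)" for i
    have "\<exists>i. P i"
    proof (rule ccontr)
      assume "\<nexists>i. P i"
      then have "has_instance G (Fun c us) (Fun c ts)" using c c' s by (intro has_instance_Fun) (auto simp: P_def)
      then show False using Fun.prems(3) c'(1) True by simp
    qed
    then have least: "P (LEAST i. P i)" by (rule LeastI_ex)
    \<comment> \<open>The leftmost failing argument: the earlier ones match, as
      \<open>co_arg\<close> requires, and the later ones are covered by fresh variables.\<close>
    define i where "i = (LEAST i. P i)"
    have i: "i < length us" "\<not> has_instance G (us ! i) (ts ! i)"
      using least unfolding i_def[symmetric] by (simp_all add: P_def)
    moreover have "\<not> P k" if "k < i" for k using not_less_Least that unfolding i_def by blast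
    ultimately have i': "has_instance G (us ! k) (ts ! k)" if "k < i" for k
      using that by (simp add: P_def)
    obtain u' where u': "co \<Sigma> C X (us ! i) u'" "has_instance G u' (ts ! i)"
      using Fun.IH[of "us ! i" "\<sigma>s ! i" "ts ! i"] i c c' s by auto
    obtain ys where ys: "distinct ys" "map snd ys = drop (Suc i) \<sigma>s" "set ys \<inter> (X \<union> vars u') = {}"
      using fresh_vars[of "X \<union> vars u'"] X by (metis finite_Un finite_vars)
    have len: "length ys = length \<sigma>s - Suc i" using arg_cong[OF ys(2), of length] by simp
    have "has_instance G ((take i us @ u' # map Var ys) ! k) (ts ! k)" if k: "k < length \<sigma>s" for k
    proof -
      consider "k < i" | "k = i" | "k > i" by linarith
      then show ?thesis
      proof cases
        case 3
        then have "snd (ys ! (k - Suc i)) = \<sigma>s ! k"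
          using k len arg_cong[OF ys(2), of "\<lambda>l. l ! (k - Suc i)"] by simp
        moreover have "(take i us @ u' # map Var ys) ! k = Var (ys ! (k - Suc i))"
          using 3 k len i(1) c(2) by (simp add: nth_append nth_Cons')
        ultimately show ?thesis using 3 k c' s by simp
      qed (use i(1) i' u'(2) in \<open>simp_all add: nth_append\<close>)
    qed
    then have "has_instance G (Fun c (take i us @ u' # map Var ys)) t"
      unfolding c'(1) True using i(1) c c' s len by (intro has_instance_Fun) auto
    moreover have "co \<Sigma> C X (Fun c us) (Fun c (take i us @ u' # map Var ys))"
      using c(1) i(1) u'(1) ys by (intro co_arg)
    ultimately show ?thesis by blast
  qed
qed simp

subsection \<open>Background theories and admissible systems\<close>

locale background =
  fixes T :: "('s, 'f, 'a) background"
  assumes bg: "is_background T"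
begin

abbreviation "th \<equiv> theory_sorts T"

lemma universe_nonempty: "\<iota> \<in> th \<Longrightarrow> universe T \<iota> \<noteq> {}"
  using bg unfolding is_background_def by blast

lemma theory_sig_sorts:
  assumes "theory_sig T f = Some (\<sigma>s, \<tau>)"
  shows "set \<sigma>s \<subseteq> th" "\<tau> \<in> th"
    "list_all2 (\<lambda>a \<sigma>. a \<in> universe T \<sigma>) as \<sigma>s \<Longrightarrow> interp T f as \<in> universe T \<tau>"
proof -
  have "\<forall>f \<sigma>s \<tau>. theory_sig T f = Some (\<sigma>s, \<tau>) \<longrightarrow>
        set \<sigma>s \<subseteq> theory_sorts T \<and> \<tau> \<in> theory_sorts T \<and>
        (\<forall>as. list_all2 (\<lambda>a \<sigma>. a \<in> universe T \<sigma>) as \<sigma>s \<longrightarrow> interp T f as \<in> universe T \<tau>)"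
    using bg unfolding is_background_def by (elim conjE)
  with assms show "set \<sigma>s \<subseteq> th" "\<tau> \<in> th"
    "list_all2 (\<lambda>a \<sigma>. a \<in> universe T \<sigma>) as \<sigma>s \<Longrightarrow> interp T f as \<in> universe T \<tau>" by blast+
qed

lemma vals_sort: "v \<in> vals T \<Longrightarrow> \<exists>\<iota>. theory_sig T v = Some ([], \<iota>)"
  using bg unfolding is_background_def by (elim conjE) blast

lemma vals_bij: "\<iota> \<in> th \<Longrightarrow>
  bij_betw (\<lambda>v. interp T v []) {v \<in> vals T. theory_sig T v = Some ([], \<iota>)} (universe T \<iota>)"
  using bg unfolding is_background_def by (elim conjE) blast

lemma bool_facts:
  "bool_sort T \<in> th" "inj (truth T)" "universe T (bool_sort T) = range (truth T)"
  "true_sym T \<in> vals T" "theory_sig T (true_sym T) = Some ([], bool_sort T)"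
  "interp T (true_sym T) [] = truth T True"
  "theory_sig T (not_sym T) = Some ([bool_sort T], bool_sort T)"
  "interp T (not_sym T) [truth T p] = truth T (\<not> p)"
  "theory_sig T (and_sym T) = Some ([bool_sort T, bool_sort T], bool_sort T)"
  "interp T (and_sym T) [truth T p, truth T q] = truth T (p \<and> q)"
  "\<iota> \<in> th \<Longrightarrow> theory_sig T (eq_sym T \<iota>) = Some ([\<iota>, \<iota>], bool_sort T)"
  "\<iota> \<in> th \<Longrightarrow> a \<in> universe T \<iota> \<Longrightarrow> b \<in> universe T \<iota> \<Longrightarrow> interp T (eq_sym T \<iota>) [a, b] = truth T (a = b)"
  using bg unfolding is_background_def interprets_connective_def interprets_relation_def
  by (elim conjE; (simp; fail | blast))+

lemma truth_eq [simp]: "truth T p = truth T q \<longleftrightarrow> p = q"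
  using bool_facts(2) by (simp add: inj_eq)

lemma val_exists: "\<iota> \<in> th \<Longrightarrow> \<exists>v \<in> vals T. theory_sig T v = Some ([], \<iota>)"
  using vals_bij[of \<iota>] universe_nonempty[of \<iota>] by (auto simp: bij_betw_def)

lemma val_of: "a \<in> universe T \<iota> \<Longrightarrow> \<iota> \<in> th \<Longrightarrow> \<exists>v \<in> vals T. theory_sig T v = Some ([], \<iota>) \<and> interp T v [] = a"
proof -
  assume "a \<in> universe T \<iota>" "\<iota> \<in> th"
  then have "a \<in> (\<lambda>v. interp T v []) ` {v \<in> vals T. theory_sig T v = Some ([], \<iota>)}"
    unfolding bij_betw_imp_surj_on[OF vals_bij[OF \<open>\<iota> \<in> th\<close>]] by simp
  then show ?thesis by (elim imageE) blast
qed

lemma val_inj: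
  "v \<in> vals T \<Longrightarrow> w \<in> vals T \<Longrightarrow> theory_sig T v = Some ([], \<iota>) \<Longrightarrow> theory_sig T w = Some ([], \<iota>) \<Longrightarrow>
   interp T v [] = interp T w [] \<Longrightarrow> v = w"
  using vals_bij[of \<iota>] theory_sig_sorts(2)[of v "[]" \<iota>] by (auto simp: bij_betw_def inj_on_def)

lemma val_universe: "theory_sig T v = Some ([], \<iota>) \<Longrightarrow> interp T v [] \<in> universe T \<iota>"
  using theory_sig_sorts(3)[of v "[]" \<iota> "[]"] by simp

lemma constraint_var_sort: "is_constraint T \<phi> \<Longrightarrow> x \<in> vars \<phi> \<Longrightarrow> snd x \<in> th"
proof -
  have "wt (theory_sig T) t \<tau> \<Longrightarrow> \<tau> \<in> th \<Longrightarrow> x \<in> vars t \<Longrightarrow> snd x \<in> th" for t \<tau>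
  proof (induction rule: wt.induct)
    case (wt_Fun f \<sigma>s \<tau> ts)
    then obtain i where i: "i < length ts" "x \<in> vars (ts ! i)" by (auto simp: in_set_conv_nth)
    then have "\<sigma>s ! i \<in> th" using theory_sig_sorts(1)[OF wt_Fun(1)] wt_Fun(2) by auto
    then show ?case using wt_Fun i by blast
  qed auto
  then show "is_constraint T \<phi> \<Longrightarrow> x \<in> vars \<phi> \<Longrightarrow> snd x \<in> th"
    unfolding is_constraint_def using bool_facts(1) by blast
qed

definition value_terms :: "'s \<Rightarrow> ('f, 's) trm set" where
  "value_terms \<iota> = {Fun v [] | v. v \<in> vals T \<and> theory_sig T v = Some ([], \<iota>)}"

lemma value_terms_wt: "t \<in> value_terms \<iota> \<Longrightarrow> wt (theory_sig T) t \<iota>"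
  by (auto simp: value_terms_def wt_Fun_iff)

lemma value_terms_is_val: "t \<in> value_terms \<iota> \<Longrightarrow> is_val T t"
  by (auto simp: value_terms_def is_val_def)

lemma is_val_value_terms: "is_val T t \<Longrightarrow> wt (theory_sig T) t \<iota> \<Longrightarrow> t \<in> value_terms \<iota>"
  using vals_sort by (auto simp: value_terms_def is_val_def wt_Fun_iff)

lemma den_universe:
  "wt (theory_sig T) t \<tau> \<Longrightarrow> (\<And>x. x \<in> vars t \<Longrightarrow> \<gamma> x \<in> value_terms (snd x)) \<Longrightarrow> den T (t \<cdot> \<gamma>) \<in> universe T \<tau>"
proof (induction rule: wt.induct)
  case (wt_Var x)
  then show ?case by (auto simp: value_terms_def val_universe dest!: meta_spec[of _ x])
next
  case (wt_Fun f \<sigma>s \<tau> ts)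
  have "den T (ts ! i \<cdot> \<gamma>) \<in> universe T (\<sigma>s ! i)" if "i < length ts" for i
    using wt_Fun that vars_nth[OF that, of f] by blast
  then show ?case
    using theory_sig_sorts(3)[OF wt_Fun(1), of "map (den T \<circ> (\<lambda>t. t \<cdot> \<gamma>)) ts"] wt_Fun(2)
    by (auto simp: list_all2_conv_all_nth)
qed

text \<open>Unlike \<open>resp\<close>, this does not include that variables are mapped to values.
  That part is stated separately about \<open>\<gamma>\<close>, which at the same time serves as a
  matcher for the pattern.\<close>

definition holds :: "('f, 's) subst \<Rightarrow> ('f, 's) trm \<Rightarrow> bool" where
  "holds \<gamma> \<phi> \<longleftrightarrow> den T (\<phi> \<cdot> \<gamma>) = truth T True"

lemma den_constraint:
  "is_constraint T \<phi> \<Longrightarrow> (\<And>x. x \<in> vars \<phi> \<Longrightarrow> \<gamma> x \<in> value_terms (snd x)) \<Longrightarrow> den T (\<phi> \<cdot> \<gamma>) = truth T (holds \<gamma> \<phi>)"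
  unfolding is_constraint_def holds_def using den_universe[of \<phi> "bool_sort T" \<gamma>] bool_facts(3) by auto

lemma holds_and:
  "is_constraint T \<phi> \<Longrightarrow> is_constraint T \<psi> \<Longrightarrow> (\<And>x. x \<in> vars \<phi> \<union> vars \<psi> \<Longrightarrow> \<gamma> x \<in> value_terms (snd x)) \<Longrightarrow>
   holds \<gamma> (c_and T \<phi> \<psi>) \<longleftrightarrow> holds \<gamma> \<phi> \<and> holds \<gamma> \<psi>"
  using den_constraint[of \<phi> \<gamma>] den_constraint[of \<psi> \<gamma>] bool_facts(10)
  unfolding holds_def[of _ "c_and T \<phi> \<psi>"] by auto

lemma holds_not:
  "is_constraint T \<phi> \<Longrightarrow> (\<And>x. x \<in> vars \<phi> \<Longrightarrow> \<gamma> x \<in> value_terms (snd x)) \<Longrightarrow>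
   holds \<gamma> (c_not T \<phi>) \<longleftrightarrow> \<not> holds \<gamma> \<phi>"
  using den_constraint[of \<phi> \<gamma>] bool_facts(8) unfolding holds_def[of _ "c_not T \<phi>"] by auto

lemma holds_true: "holds \<gamma> (c_true T)"
  using bool_facts by (simp add: holds_def)

lemma holds_app: "(\<And>x. x \<in> vars \<phi> \<Longrightarrow> \<gamma> x = \<sigma> x \<cdot> \<delta>) \<Longrightarrow> holds \<delta> (\<phi> \<cdot> \<sigma>) \<longleftrightarrow> holds \<gamma> \<phi>"
  unfolding holds_def app_app using app_cong[of \<phi> \<gamma> "\<lambda>x. \<sigma> x \<cdot> \<delta>"] by simp

lemma holds_cong: "(\<And>x. x \<in> vars \<phi> \<Longrightarrow> \<gamma> x = \<delta> x) \<Longrightarrow> holds \<delta> \<phi> \<longleftrightarrow> holds \<gamma> \<phi>"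
  unfolding holds_def using app_cong[of \<phi> \<gamma> \<delta>] by simp

lemma constraint_and: "is_constraint T \<phi> \<Longrightarrow> is_constraint T \<psi> \<Longrightarrow> is_constraint T (c_and T \<phi> \<psi>)"
  using bool_facts(9) unfolding is_constraint_def by (auto simp: wt_Fun_iff less_Suc_eq)

lemma constraint_not: "is_constraint T \<phi> \<Longrightarrow> is_constraint T (c_not T \<phi>)"
  using bool_facts(7) unfolding is_constraint_def by (auto simp: wt_Fun_iff)

lemma constraint_true: "is_constraint T (c_true T)"
  using bool_facts(5) unfolding is_constraint_def by (auto simp: wt_Fun_iff)

lemma satisfiable_iff:
  assumes "is_constraint T \<phi>"
  shows "satisfiable T \<phi> \<longleftrightarrow> (\<exists>\<gamma>. (\<forall>x \<in> vars \<phi>. \<gamma> x \<in> value_terms (snd x)) \<and> holds \<gamma> \<phi>)"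
proof
  assume "satisfiable T \<phi>"
  then obtain \<gamma> where "is_subst (theory_sig T) \<gamma>" "resp T \<gamma> \<phi>" unfolding satisfiable_def by blast
  then show "\<exists>\<gamma>. (\<forall>x \<in> vars \<phi>. \<gamma> x \<in> value_terms (snd x)) \<and> holds \<gamma> \<phi>"
    unfolding resp_def is_subst_def holds_def using is_val_value_terms by blast
next
  assume "\<exists>\<gamma>. (\<forall>x \<in> vars \<phi>. \<gamma> x \<in> value_terms (snd x)) \<and> holds \<gamma> \<phi>"
  then obtain \<gamma> where \<gamma>: "\<And>x. x \<in> vars \<phi> \<Longrightarrow> \<gamma> x \<in> value_terms (snd x)" "holds \<gamma> \<phi>" by blast
  \<comment> \<open>Outside \<open>\<phi>\<close> the substitution has to be well sorted over the
    theory signature; variables are so at every sort.\<close>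
  define \<gamma>' where "\<gamma>' x = (if x \<in> vars \<phi> then \<gamma> x else Var x)" for x
  have "is_subst (theory_sig T) \<gamma>'" using \<gamma>(1) value_terms_wt by (auto simp: is_subst_def \<gamma>'_def)
  moreover have "holds \<gamma>' \<phi>" using holds_cong[of \<phi> \<gamma> \<gamma>'] \<gamma>(2) by (simp add: \<gamma>'_def)
  then have "resp T \<gamma>' \<phi>" using \<gamma>(1) value_terms_is_val unfolding resp_def holds_def by (auto simp: \<gamma>'_def)
  ultimately show "satisfiable T \<phi>" unfolding satisfiable_def by blast
qed

end

locale admissible_lctrs = background T for T :: "('s, 'f, 'a) background" +
  fixes F :: "('f, 's) sig" and R :: "('f, 's) rule set"
  assumes adm: "admissible T F R"
begin

abbreviation "\<Sigma> \<equiv> full_sig T F"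
abbreviation "C \<equiv> constructors T F R"

text \<open>The symbols allowed below the root of a value-free pattern. This set is finite, while
  \<open>C\<close> contains all values.\<close>

definition C0 :: "'f set" where "C0 = C \<inter> dom F - vals T"

definition ground_terms :: "'s \<Rightarrow> ('f, 's) trm set" where
  "ground_terms \<sigma> = {t. wt \<Sigma> t \<sigma> \<and> vars t = {} \<and> funs t \<subseteq> C}"

lemma sig_F: "F f = Some d \<Longrightarrow> \<Sigma> f = Some d"
  by (simp add: full_sig_def map_add_def)

lemma sig_theory: "theory_sig T f = Some d \<Longrightarrow> \<Sigma> f = Some d"
proof (cases "F f")
  case (Some e)
  assume f: "theory_sig T f = Some d"
  then have "f \<in> dom F \<inter> dom (theory_sig T)" using Some by auto
  then show ?thesis
    using adm f Some unfolding admissible_def is_term_sig_def full_sig_def by (auto simp: map_add_def)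
qed (simp add: full_sig_def map_add_def)

lemma sig_cases: "\<Sigma> f = Some d \<Longrightarrow> F f = Some d \<or> theory_sig T f = Some d"
  by (auto simp: full_sig_def map_add_def split: option.splits)

lemma dom_F_calc: "f \<in> dom F \<Longrightarrow> f \<notin> calc_syms T"
  using adm unfolding admissible_def is_term_sig_def calc_syms_def by blast

lemma wt_theory: "wt (theory_sig T) t \<tau> \<Longrightarrow> wt \<Sigma> t \<tau>"
proof (induction rule: wt.induct)
  case (wt_Fun f \<sigma>s \<tau> ts)
  then show ?case by (intro wt.wt_Fun) (auto dest: sig_theory)
qed simp

lemma rule_facts:
  assumes "(l, r, \<phi>) \<in> R"
  shows "\<exists>\<tau>. wt \<Sigma> l \<tau> \<and> wt \<Sigma> r \<tau>" "is_constraint T \<phi>" "\<And>x. l \<noteq> Var x"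
    "\<And>\<tau>. \<not> wt (theory_sig T) l \<tau>" "linear l"
  using adm assms unfolding admissible_def is_lctrs_def left_linear_def by fast+

text \<open>A rule of \<open>R\<close> with a value at the root would have a theory term as its
  left-hand side.\<close>

lemma val_not_defined: "v \<in> vals T \<Longrightarrow> v \<notin> defined_syms T R"
proof
  assume v: "v \<in> vals T" "v \<in> defined_syms T R"
  then obtain ts r \<phi> where "(Fun v ts, r, \<phi>) \<in> R \<union> calc_rules T" unfolding defined_syms_def by blast
  then show False
  proof
    assume R: "(Fun v ts, r, \<phi>) \<in> R"
    obtain \<iota> where \<iota>: "theory_sig T v = Some ([], \<iota>)" using vals_sort v(1) by blast
    obtain \<tau> where "wt \<Sigma> (Fun v ts) \<tau>" using rule_facts(1)[OF R] by blast
    then have "ts = []" using sig_theory[OF \<iota>] by (auto simp: wt_Fun_iff)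
    then show False using rule_facts(4)[OF R, of \<iota>] \<iota> by (auto simp: wt_Fun_iff)
  next
    assume "(Fun v ts, r, \<phi>) \<in> calc_rules T"
    then show False using v(1) by (auto simp: calc_rules_def calc_syms_def)
  qed
qed

lemma val_constructor: "v \<in> vals T \<Longrightarrow> v \<in> C"
  using val_not_defined vals_sort[of v] sig_theory[of v] by (auto simp: constructors_def dom_def)

lemma calc_rule_exists:
  assumes f: "f \<in> calc_syms T" "theory_sig T f = Some (\<sigma>s, \<tau>)"
  shows "\<exists>xs y. (Fun f (map Var xs), Var y, c_eq T y (Fun f (map Var xs))) \<in> calc_rules T \<and>
    distinct (y # xs) \<and> map snd xs = \<sigma>s \<and> snd y = \<tau>"
proof -
  have "\<exists>zs :: 's vr list. distinct zs \<and> map snd zs = \<tau> # \<sigma>s" using fresh_vars[of "{}" "\<tau> # \<sigma>s"] by simp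
  then obtain zs :: "'s vr list" where zs: "distinct zs" "map snd zs = \<tau> # \<sigma>s" by (elim exE conjE)
  then obtain y xs where "zs = y # xs" "snd y = \<tau>" "map snd xs = \<sigma>s" by (cases zs) auto
  then show ?thesis using f zs unfolding calc_rules_def by blast
qed

lemma calc_defined: "f \<in> calc_syms T \<Longrightarrow> f \<in> defined_syms T R"
  using calc_rule_exists[of f] unfolding defined_syms_def calc_syms_def by fastforce

lemma defined_dom_F:
  assumes "f \<in> defined_syms T R - calc_syms T" shows "f \<in> dom F" "f \<notin> vals T"
proof -
  show nv: "f \<notin> vals T" using assms val_not_defined by blast
  obtain ts r \<phi> where "(Fun f ts, r, \<phi>) \<in> R"
    using assms unfolding defined_syms_def calc_rules_def by blast
  then obtain \<tau> where "wt \<Sigma> (Fun f ts) \<tau>" using rule_facts(1) by blast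
  then have "f \<in> dom \<Sigma>" by (auto simp: wt_Fun_iff)
  then show "f \<in> dom F" using assms nv sig_cases[of f] by (auto simp: calc_syms_def dom_def)
qed

text \<open>Calculation symbols are defined through \<open>calc_rules\<close>, so a theory symbol is
  a constructor only if it is a value.\<close>

lemma constructor_cases: "c \<in> C \<Longrightarrow> c \<in> vals T \<or> c \<in> C0"
  using calc_defined[of c] sig_cases[of c] by (auto simp: constructors_def C0_def calc_syms_def dom_def)

lemma C0_sort: "c \<in> C0 \<Longrightarrow> \<exists>\<sigma>s \<tau>. F c = Some (\<sigma>s, \<tau>) \<and> \<tau> \<notin> th"
  using adm sig_F[of c] unfolding admissible_def no_theory_sorted_constructors_def C0_def
  by (auto simp: dom_def)

lemma ground_terms_cases:
  assumes "t \<in> ground_terms \<sigma>"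
  shows "\<exists>c ts \<sigma>s. t = Fun c ts \<and> c \<in> C \<and> \<Sigma> c = Some (\<sigma>s, \<sigma>) \<and>
    length ts = length \<sigma>s \<and> (\<forall>i < length ts. ts ! i \<in> ground_terms (\<sigma>s ! i))"
proof (cases t)
  case (Var x)
  then show ?thesis using assms by (simp add: ground_terms_def)
next
  case (Fun c ts)
  then obtain \<sigma>s where \<sigma>s: "\<Sigma> c = Some (\<sigma>s, \<sigma>)" "length ts = length \<sigma>s" "\<forall>i < length ts. wt \<Sigma> (ts ! i) (\<sigma>s ! i)"
    using assms by (auto simp: ground_terms_def wt_Fun_iff)
  have "vars u = {}" "funs u \<subseteq> C" if "u \<in> set ts" for u
    using assms that unfolding Fun by (auto simp: ground_terms_def)
  then have "\<forall>i < length ts. ts ! i \<in> ground_terms (\<sigma>s ! i)" using \<sigma>s by (simp add: ground_terms_def)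
  moreover have "c \<in> C" using assms unfolding Fun by (simp add: ground_terms_def)
  ultimately show ?thesis using Fun \<sigma>s by blast
qed

text \<open>Through \<open>C0_sort\<close> this rests on the absence of theory-sorted constructors.
  It lets constraints be evaluated directly under a ground matcher.\<close>

lemma ground_terms_value_terms: "\<sigma> \<in> th \<Longrightarrow> ground_terms \<sigma> = value_terms \<sigma>"
proof (intro equalityI subsetI)
  fix t assume \<sigma>: "\<sigma> \<in> th" and t: "t \<in> ground_terms \<sigma>"
  obtain c ts \<sigma>s where c: "t = Fun c ts" "c \<in> C" "\<Sigma> c = Some (\<sigma>s, \<sigma>)" "length ts = length \<sigma>s"
    using ground_terms_cases[OF t] by blast
  have "c \<in> vals T" using constructor_cases[OF c(2)] C0_sort[of c] sig_F[of c] c(3) \<sigma> by auto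
  then obtain \<iota> where "theory_sig T c = Some ([], \<iota>)" using vals_sort by blast
  then show "t \<in> value_terms \<sigma>" using c \<open>c \<in> vals T\<close> sig_theory[of c] by (auto simp: value_terms_def)
next
  fix t assume "t \<in> value_terms \<sigma>"
  then show "t \<in> ground_terms \<sigma>" using val_constructor sig_theory by (auto simp: value_terms_def ground_terms_def wt_Fun_iff)
qed

lemma value_terms_ground_terms: "t \<in> value_terms \<sigma> \<Longrightarrow> t \<in> ground_terms \<sigma>"
  using ground_terms_value_terms[of \<sigma>] theory_sig_sorts(2) by (auto simp: value_terms_def)

lemma ground_terms_term_sort:
  assumes "t \<in> ground_terms \<sigma>" "\<sigma> \<notin> th"
  shows "\<exists>c ts \<sigma>s. t = Fun c ts \<and> c \<in> C0 \<and> F c = Some (\<sigma>s, \<sigma>) \<and>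
    length ts = length \<sigma>s \<and> (\<forall>i < length ts. ts ! i \<in> ground_terms (\<sigma>s ! i))"
proof -
  obtain c ts \<sigma>s where c: "t = Fun c ts" "c \<in> C" "\<Sigma> c = Some (\<sigma>s, \<sigma>)" "length ts = length \<sigma>s"
    "\<forall>i < length ts. ts ! i \<in> ground_terms (\<sigma>s ! i)"
    using ground_terms_cases[OF assms(1)] by blast
  have "theory_sig T c \<noteq> Some (\<sigma>s, \<sigma>)" using theory_sig_sorts(2)[of c \<sigma>s \<sigma>] assms(2) by blast
  then have F: "F c = Some (\<sigma>s, \<sigma>)" using sig_cases[OF c(3)] by blast
  have "c \<notin> vals T" using vals_sort[of c] sig_theory[of c] c(3) assms(2) theory_sig_sorts(2) by fastforce
  then have "c \<in> C0" using constructor_cases[OF c(2)] by blast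
  then show ?thesis using c F by blast
qed

lemma ground_terms_wt: "t \<in> ground_terms \<sigma> \<Longrightarrow> wt \<Sigma> t \<sigma>"
  by (simp add: ground_terms_def)

end

subsection \<open>Instances of constrained patterns\<close>

text \<open>Variables are pairs, and these rules would split every quantified variable into its
  index and its sort.\<close>

declare split_paired_All [simp del] split_paired_Ex [simp del]

lemma (in background) satisfiable_and:
  assumes "is_constraint T \<phi>" "is_constraint T \<psi>"
  shows "satisfiable T (c_and T \<phi> \<psi>) \<longleftrightarrow>
    (\<exists>\<gamma>. (\<forall>x \<in> vars \<phi> \<union> vars \<psi>. \<gamma> x \<in> value_terms (snd x)) \<and> holds \<gamma> \<phi> \<and> holds \<gamma> \<psi>)"
proof -
  have "vars (c_and T \<phi> \<psi>) = vars \<phi> \<union> vars \<psi>" by simp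
  then show ?thesis
    unfolding satisfiable_iff[OF constraint_and[OF assms]] using holds_and[OF assms] by metis
qed

lemma ceq_refl: "ceq T c c"
proof -
  have "is_renaming (\<lambda>x. x)" using bij_id by (simp add: is_renaming_def id_def)
  then show ?thesis unfolding ceq_def by (auto split: prod.splits intro!: exI[of _ "\<lambda>x. x"])
qed

context admissible_lctrs
begin

definition lin_pattern :: "('f, 's) trm \<Rightarrow> bool" where
  "lin_pattern s \<longleftrightarrow> (\<exists>f us \<sigma>s \<tau>. s = Fun f us \<and> F f = Some (\<sigma>s, \<tau>) \<and> length us = length \<sigma>s \<and>
     (\<forall>i < length us. wt \<Sigma> (us ! i) (\<sigma>s ! i)) \<and> (\<forall>u \<in> set us. funs u \<subseteq> C0) \<and> linear s)"

definition good_cterm :: "('f, 's) cterm \<Rightarrow> bool" where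
  "good_cterm = (\<lambda>(s, \<phi>). lin_pattern s \<and> is_constraint T \<phi> \<and> vars \<phi> \<subseteq> vars s)"

definition ground_on :: "'s vr set \<Rightarrow> ('f, 's) subst \<Rightarrow> bool" where
  "ground_on V \<gamma> \<longleftrightarrow> (\<forall>x \<in> V. \<gamma> x \<in> ground_terms (snd x))"

definition instances :: "('f, 's) cterm \<Rightarrow> ('f, 's) trm set" where
  "instances = (\<lambda>(s, \<phi>). {s \<cdot> \<gamma> | \<gamma>. ground_on (vars s) \<gamma> \<and> holds \<gamma> \<phi>})"

text \<open>All variables of linear patterns have these sorts, so it is here that inhabitants are
  needed. There are only finitely many of them.\<close>

definition arg_sorts :: "'s set" where
  "arg_sorts = {\<sigma>. \<exists>f \<sigma>s \<tau>. F f = Some (\<sigma>s, \<tau>) \<and> \<sigma> \<in> set \<sigma>s}"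

lemma C0_C: "C0 \<subseteq> C"
  by (auto simp: C0_def)

text \<open>No symbol of \<open>C0\<close> has a theory sort as its result sort.\<close>

lemma C0_theory_var: "wt \<Sigma> u \<sigma> \<Longrightarrow> funs u \<subseteq> C0 \<Longrightarrow> \<sigma> \<in> th \<Longrightarrow> \<exists>z. u = Var z \<and> snd z = \<sigma>"
  using C0_sort sig_F by (cases u) (fastforce simp: wt_Fun_iff)+

lemma lin_pattern_wt: "lin_pattern s \<Longrightarrow> \<exists>f us \<tau>. s = Fun f us \<and> wt \<Sigma> s \<tau>"
  using sig_F by (auto simp: lin_pattern_def wt_Fun_iff)

lemma lin_pattern_linear: "lin_pattern s \<Longrightarrow> linear s"
  by (auto simp: lin_pattern_def)

lemma lin_pattern_app:
  assumes "lin_pattern s" "\<And>x. x \<in> vars s \<Longrightarrow> wt \<Sigma> (\<rho> x) (snd x)" "\<And>x. x \<in> vars s \<Longrightarrow> funs (\<rho> x) \<subseteq> C0" "linear (s \<cdot> \<rho>)"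
  shows "lin_pattern (s \<cdot> \<rho>)"
proof -
  obtain f us \<sigma>s \<tau> where s: "s = Fun f us" "F f = Some (\<sigma>s, \<tau>)" "length us = length \<sigma>s"
     "\<And>i. i < length us \<Longrightarrow> wt \<Sigma> (us ! i) (\<sigma>s ! i)" "\<forall>u \<in> set us. funs u \<subseteq> C0"
    using assms(1) unfolding lin_pattern_def by blast
  have "wt \<Sigma> (us ! i \<cdot> \<rho>) (\<sigma>s ! i)" if "i < length us" for i
    using s(4)[OF that] vars_nth[OF that, of f] assms(2) s(1) by (intro wt_app) auto
  moreover have "funs (u \<cdot> \<rho>) \<subseteq> C0" if "u \<in> set us" for u
    using that s(1,5) assms(3) unfolding funs_app by fastforce
  ultimately show ?thesis
    unfolding lin_pattern_def using assms(4) s(1-3) by auto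
qed

lemma wt_arg_sorts:
  "wt \<Sigma> u \<sigma> \<Longrightarrow> \<sigma> \<in> arg_sorts \<Longrightarrow> funs u \<subseteq> C0 \<Longrightarrow> x \<in> vars u \<Longrightarrow> snd x \<in> arg_sorts"
proof (induction rule: wt.induct)
  case (wt_Fun f \<sigma>s \<tau> ts)
  then obtain i where i: "i < length ts" "x \<in> vars (ts ! i)" by (auto simp: in_set_conv_nth)
  have "f \<in> C0" "funs (ts ! i) \<subseteq> C0" using wt_Fun.prems(2) i(1) by (auto dest: nth_mem)
  moreover have "F f = Some (\<sigma>s, \<tau>)" using \<open>f \<in> C0\<close> wt_Fun.hyps(1) C0_sort sig_F by fastforce
  then have "\<sigma>s ! i \<in> arg_sorts" using i(1) wt_Fun.hyps(2) unfolding arg_sorts_def by fastforce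
  ultimately show ?case using wt_Fun.IH i by blast
qed simp

lemma lin_pattern_arg_sorts: "lin_pattern s \<Longrightarrow> x \<in> vars s \<Longrightarrow> snd x \<in> arg_sorts"
proof -
  assume s: "lin_pattern s" and x: "x \<in> vars s"
  obtain f us \<sigma>s \<tau> where s: "s = Fun f us" "F f = Some (\<sigma>s, \<tau>)" "length us = length \<sigma>s"
     "\<And>i. i < length us \<Longrightarrow> wt \<Sigma> (us ! i) (\<sigma>s ! i)" "\<forall>u \<in> set us. funs u \<subseteq> C0"
    using s unfolding lin_pattern_def by blast
  then obtain i where i: "i < length us" "x \<in> vars (us ! i)" using x by (auto simp: in_set_conv_nth)
  moreover have "\<sigma>s ! i \<in> arg_sorts" using i(1) s(2,3) unfolding arg_sorts_def by fastforce
  ultimately show ?thesis using wt_arg_sorts[OF s(4)] s(5) by auto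
qed

lemma ground_on_app:
  assumes "x \<in> V" "wt \<Sigma> (\<sigma> x) (snd x)" "funs (\<sigma> x) \<subseteq> C0" "ground_on (\<Union>x\<in>V. vars (\<sigma> x)) \<delta>"
  shows "\<sigma> x \<cdot> \<delta> \<in> ground_terms (snd x)"
proof -
  have "\<delta> z \<in> ground_terms (snd z)" if "z \<in> vars (\<sigma> x)" for z using assms(1,4) that by (auto simp: ground_on_def)
  then show ?thesis
    using assms(2,3) C0_C unfolding ground_terms_def by (auto simp: vars_app funs_app intro!: wt_app)
qed

lemma ground_on_factor:
  assumes "\<sigma> x \<cdot> \<delta> \<in> ground_terms \<tau>" "is_subst \<Sigma> \<delta>" "z \<in> vars (\<sigma> x)"
  shows "\<delta> z \<in> ground_terms (snd z)"
  using assms unfolding ground_terms_def is_subst_def by (auto simp: vars_app funs_app)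

lemma good_cterm_value_terms: "good_cterm (s, \<phi>) \<Longrightarrow> ground_on (vars s) \<gamma> \<Longrightarrow> x \<in> vars \<phi> \<Longrightarrow> \<gamma> x \<in> value_terms (snd x)"
  using constraint_var_sort[of \<phi> x] ground_terms_value_terms by (auto simp: good_cterm_def ground_on_def)

lemma semI: "ground_on (vars s) \<gamma> \<Longrightarrow> holds \<gamma> \<phi> \<Longrightarrow> s \<cdot> \<gamma> \<in> instances (s, \<phi>)"
  unfolding instances_def by auto

lemma semE: "g \<in> instances (s, \<phi>) \<Longrightarrow> (\<And>\<gamma>. g = s \<cdot> \<gamma> \<Longrightarrow> ground_on (vars s) \<gamma> \<Longrightarrow> holds \<gamma> \<phi> \<Longrightarrow> P) \<Longrightarrow> P"
  unfolding instances_def by auto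

lemma has_instance_ground: "ground_on (vars s) \<gamma> \<Longrightarrow> has_instance ground_terms s (s \<cdot> \<gamma>)"
  by (auto simp: ground_on_def intro: has_instance_inst)

end

text \<open>The setting of one difference: \<open>t\<close> is already renamed apart, and
  \<open>\<sigma>\<close> is any most general unifier with the domain that \<open>cunifier\<close>
  demands. Satisfiability is left out, since it only decides whether the overlap is treated.\<close>

locale unif = admissible_lctrs T F R
  for T :: "('s, 'f, 'a) background" and F :: "('f, 's) sig" and R :: "('f, 's) rule set" +
  fixes s t :: "('f, 's) trm" and \<phi> \<psi> :: "('f, 's) trm" and \<sigma> :: "('f, 's) subst"
  assumes good_cterm_s: "good_cterm (s, \<phi>)" and good_cterm_t: "good_cterm (t, \<psi>)" and disj: "vars s \<inter> vars t = {}"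
    and mgu: "is_mgu \<Sigma> s t \<sigma>" and sdom: "sdom \<sigma> \<subseteq> vars s \<union> vars t"
begin

lemma abstract_patterns: "lin_pattern s" "lin_pattern t"
  using good_cterm_s good_cterm_t by (auto simp: good_cterm_def)

lemma eq: "s \<cdot> \<sigma> = t \<cdot> \<sigma>"
  using mgu by (simp add: is_mgu_def)

lemma compatible: "clash_free s t"
  using eq by (rule clash_free_unifiable)

lemma same_sort: "\<exists>\<tau>. wt \<Sigma> s \<tau> \<and> wt \<Sigma> t \<tau>"
proof -
  obtain f us \<tau> g ts \<tau>' where f: "s = Fun f us" "wt \<Sigma> s \<tau>" and g: "t = Fun g ts" "wt \<Sigma> t \<tau>'"
    using abstract_patterns[THEN lin_pattern_wt] by blast
  then have "f = g" using eq by simp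
  then have "\<tau> = \<tau>'" using f g by (auto simp: wt_Fun_iff)
  then show ?thesis using f g by blast
qed

text \<open>Linearity, symbols and depth of the unified term are transferred from the constructed
  unifier to \<open>\<sigma>\<close> along \<open>d\<close>.\<close>

lemma explicit:
  "\<exists>d. inj_on d (\<Union>x. vars (bindings_subst s t x)) \<and> (\<forall>x. \<sigma> x = rename (bindings_subst s t x) d)"
proof -
  obtain \<tau> where "wt \<Sigma> s \<tau>" "wt \<Sigma> t \<tau>" using same_sort by blast
  then show ?thesis
    using mgu_variant[OF mgu bindings_subst_mgu(1)[OF compatible _ _ disj]] abstract_patterns[THEN lin_pattern_linear] by blast
qed

lemma wt_\<sigma>: "wt \<Sigma> (\<sigma> x) (snd x)"
  using mgu by (auto simp: is_mgu_def is_subst_def)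

lemma funs_\<sigma>: "funs (\<sigma> x) \<subseteq> C0"
proof -
  obtain \<tau> where \<tau>: "wt \<Sigma> s \<tau>" "wt \<Sigma> t \<tau>" using same_sort by blast
  obtain f ss where s: "s = Fun f ss" "\<forall>u \<in> set ss. funs u \<subseteq> C0" using abstract_patterns unfolding lin_pattern_def by blast
  obtain g ts where t: "t = Fun g ts" "\<forall>u \<in> set ts. funs u \<subseteq> C0" using abstract_patterns unfolding lin_pattern_def by blast
  have len: "length ss = length ts" using eq unfolding s t by (auto dest: map_eq_imp_length_eq)
  have "funs (bindings_subst s t x) \<subseteq> C0"
  proof (cases "bindings_subst s t x = Var x")
    case False
    then have "(x, bindings_subst s t x) \<in> set (bindings s t)"
      using bindings_subst_mgu(4)[OF compatible _ _ disj \<tau>] abstract_patterns[THEN lin_pattern_linear] by blast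
    \<comment> \<open>The root symbol lies outside of what the argument condition controls, but
      every binding comes from a pair of arguments, and these are terms over
      \<open>C0\<close>.\<close>
    then obtain i where i: "i < length ss" "(x, bindings_subst s t x) \<in> set (bindings (ss ! i) (ts ! i))"
      unfolding s t set_bindings_Fun[OF len] by blast
    then have "funs (ss ! i) \<subseteq> C0" "funs (ts ! i) \<subseteq> C0" using s t len by auto
    then show ?thesis using bindings_funs[OF i(2)] by blast
  qed simp
  moreover obtain d where "\<sigma> x = rename (bindings_subst s t x) d" using explicit by blast
  ultimately show ?thesis by (simp add: funs_app)
qed

lemma s\<sigma>: "linear (s \<cdot> \<sigma>)" "depth_le n s \<Longrightarrow> depth_le n t \<Longrightarrow> depth_le n (s \<cdot> \<sigma>)"
proof -
  obtain \<tau> where \<tau>: "wt \<Sigma> s \<tau>" "wt \<Sigma> t \<tau>" using same_sort by blast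
  obtain d where d: "inj_on d (\<Union>x. vars (bindings_subst s t x))" "\<And>x. \<sigma> x = rename (bindings_subst s t x) d"
    using explicit by blast
  have m: "s \<cdot> bindings_subst s t = overlay s t"
    using bindings_subst_mgu(3)[OF compatible _ _ disj \<tau>] abstract_patterns[THEN lin_pattern_linear] by blast
  have "s \<cdot> \<sigma> = s \<cdot> (\<lambda>x. rename (bindings_subst s t x) d)" using d(2) by (intro app_cong) auto
  also have "\<dots> = rename (overlay s t) d" by (simp add: app_app flip: m)
  finally have eq: "s \<cdot> \<sigma> = rename (overlay s t) d" .
  have "vars (overlay s t) \<subseteq> (\<Union>x. vars (bindings_subst s t x))" unfolding m[symmetric] vars_app by blast
  then have "inj_on d (vars (overlay s t))" using d(1) inj_on_subset by blast
  then show "linear (s \<cdot> \<sigma>)"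
    unfolding eq using overlay_linear[OF compatible _ _ disj] abstract_patterns[THEN lin_pattern_linear] by (intro linear_rename) auto
  show "depth_le n s \<Longrightarrow> depth_le n t \<Longrightarrow> depth_le n (s \<cdot> \<sigma>)"
    unfolding eq using overlay_depth_le[OF compatible] by simp
qed

lemma \<sigma>_theory_var: "snd x \<in> th \<Longrightarrow> \<exists>z. \<sigma> x = Var z \<and> snd z = snd x"
  using C0_theory_var[OF wt_\<sigma> funs_\<sigma>] .

lemma constraint_\<sigma>: "is_constraint T \<chi> \<Longrightarrow> is_constraint T (\<chi> \<cdot> \<sigma>)"
proof -
  assume \<chi>: "is_constraint T \<chi>"
  have "wt (theory_sig T) (\<sigma> x) (snd x)" if "x \<in> vars \<chi>" for x
    using \<sigma>_theory_var[OF constraint_var_sort[OF \<chi> that]] by (metis wt_Var_iff)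
  then show ?thesis using \<chi> unfolding is_constraint_def by (intro wt_app)
qed

lemma constraints: "is_constraint T \<phi>" "is_constraint T \<psi>" "vars \<phi> \<subseteq> vars s" "vars \<psi> \<subseteq> vars t"
  using good_cterm_s good_cterm_t by (auto simp: good_cterm_def)

lemma common_instance:
  assumes "ground_on (vars s) \<gamma>" "ground_on (vars t) \<gamma>'" "s \<cdot> \<gamma> = t \<cdot> \<gamma>'"
  shows "\<exists>\<delta>. is_subst \<Sigma> \<delta> \<and> (\<forall>x \<in> vars s. \<gamma> x = \<sigma> x \<cdot> \<delta>) \<and> (\<forall>x \<in> vars t. \<gamma>' x = \<sigma> x \<cdot> \<delta>) \<and>
    ground_on (vars (s \<cdot> \<sigma>)) \<delta>"
proof -
  \<comment> \<open>As \<open>s\<close> and \<open>t\<close> share no variables, their matchers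
    combine into one unifier.\<close>
  define \<tau> where "\<tau> x = (if x \<in> vars s then \<gamma> x else if x \<in> vars t then \<gamma>' x else Var x)" for x
  have "is_subst \<Sigma> \<tau>" using assms(1,2) unfolding is_subst_def \<tau>_def ground_on_def by (auto dest: ground_terms_wt)
  moreover have "s \<cdot> \<tau> = s \<cdot> \<gamma>" by (intro app_cong) (simp add: \<tau>_def)
  moreover have "t \<cdot> \<tau> = t \<cdot> \<gamma>'" using disj by (intro app_cong) (auto simp: \<tau>_def)
  ultimately obtain \<delta> where \<delta>: "is_subst \<Sigma> \<delta>" "\<And>x. \<tau> x = \<sigma> x \<cdot> \<delta>"
    using mgu assms(3) unfolding is_mgu_def by metis
  have 1: "\<gamma> x = \<sigma> x \<cdot> \<delta>" if "x \<in> vars s" for x using \<delta>(2)[of x] that by (simp add: \<tau>_def)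
  have 2: "\<gamma>' x = \<sigma> x \<cdot> \<delta>" if "x \<in> vars t" for x using \<delta>(2)[of x] that disj \<tau>_def[of x] by (metis disjoint_iff)
  have "ground_on (vars (s \<cdot> \<sigma>)) \<delta>"
    unfolding ground_on_def vars_app
    using 1 assms(1) ground_on_factor[OF _ \<delta>(1)] by (fastforce simp: ground_on_def)
  then show ?thesis using \<delta>(1) 1 2 by blast
qed

lemma cunifier_iff: "cunifier T \<Sigma> (s, \<phi>) (t, \<psi>) \<sigma> \<longleftrightarrow> satisfiable T (c_and T (\<phi> \<cdot> \<sigma>) (\<psi> \<cdot> \<sigma>))"
proof -
  have "is_val T (\<sigma> x) \<or> (\<exists>y. \<sigma> x = Var y)" if "x \<in> vars \<phi> \<union> vars \<psi>" for x
    using that \<sigma>_theory_var[of x] constraint_var_sort constraints(1,2) by blast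
  then show ?thesis using mgu sdom unfolding cunifier_def by auto
qed

lemma vars_t\<sigma>: "vars (\<psi> \<cdot> \<sigma>) \<subseteq> vars (s \<cdot> \<sigma>)" "vars (\<phi> \<cdot> \<sigma>) \<subseteq> vars (s \<cdot> \<sigma>)"
  unfolding eq using constraints(4) apply (auto simp: vars_app)[1]
  unfolding eq[symmetric] using constraints(3) by (auto simp: vars_app)

lemma ground_\<sigma>\<delta>:
  assumes "ground_on (vars (s \<cdot> \<sigma>)) \<delta>"
  shows "ground_on (vars s) (\<lambda>x. \<sigma> x \<cdot> \<delta>)" "ground_on (vars t) (\<lambda>x. \<sigma> x \<cdot> \<delta>)"
proof -
  have "ground_on (vars (t \<cdot> \<sigma>)) \<delta>" using assms by (simp add: eq)
  then show "ground_on (vars s) (\<lambda>x. \<sigma> x \<cdot> \<delta>)" "ground_on (vars t) (\<lambda>x. \<sigma> x \<cdot> \<delta>)"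
    using assms ground_on_app[where \<sigma> = \<sigma>, OF _ wt_\<sigma> funs_\<sigma>] unfolding vars_app
    by (simp_all add: ground_on_def)
qed

lemma overlap_satisfiable:
  assumes "instances (s, \<phi>) \<inter> instances (t, \<psi>) \<noteq> {}"
  shows "satisfiable T (c_and T (\<phi> \<cdot> \<sigma>) (\<psi> \<cdot> \<sigma>))"
proof -
  obtain \<gamma> \<gamma>' where \<gamma>: "s \<cdot> \<gamma> = t \<cdot> \<gamma>'" "ground_on (vars s) \<gamma>" "ground_on (vars t) \<gamma>'" "holds \<gamma> \<phi>" "holds \<gamma>' \<psi>"
    using assms by (auto elim!: semE)
  obtain \<delta> where \<delta>: "\<forall>x \<in> vars s. \<gamma> x = \<sigma> x \<cdot> \<delta>" "\<forall>x \<in> vars t. \<gamma>' x = \<sigma> x \<cdot> \<delta>"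
    "ground_on (vars (s \<cdot> \<sigma>)) \<delta>"
    using common_instance[OF \<gamma>(2,3,1)] by blast
  have value_terms: "\<delta> x \<in> value_terms (snd x)" if "x \<in> vars (\<phi> \<cdot> \<sigma>) \<union> vars (\<psi> \<cdot> \<sigma>)" for x
  proof -
    have "snd x \<in> th" using that constraint_var_sort constraint_\<sigma> constraints(1,2) by blast
    then show ?thesis using \<delta>(3) that vars_t\<sigma> ground_terms_value_terms unfolding ground_on_def by blast
  qed
  have "holds \<delta> (\<phi> \<cdot> \<sigma>)" "holds \<delta> (\<psi> \<cdot> \<sigma>)"
    using holds_app[of \<phi> \<gamma> \<sigma> \<delta>] holds_app[of \<psi> \<gamma>' \<sigma> \<delta>] \<gamma>(4,5) \<delta>(1,2) constraints(3,4) by blast+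
  then show ?thesis
    unfolding satisfiable_and[OF constraint_\<sigma>[OF constraints(1)] constraint_\<sigma>[OF constraints(2)]] using value_terms by blast
qed

lemma satisfiable_overlap:
  assumes sat: "satisfiable T (c_and T (\<phi> \<cdot> \<sigma>) (\<psi> \<cdot> \<sigma>))" and inh: "\<And>\<tau>. \<tau> \<in> arg_sorts \<Longrightarrow> ground_terms \<tau> \<noteq> {}"
  shows "instances (s, \<phi>) \<inter> instances (t, \<psi>) \<noteq> {}"
proof -
  obtain \<delta>0 where \<delta>0: "\<And>x. x \<in> vars (\<phi> \<cdot> \<sigma>) \<union> vars (\<psi> \<cdot> \<sigma>) \<Longrightarrow> \<delta>0 x \<in> value_terms (snd x)"
    "holds \<delta>0 (\<phi> \<cdot> \<sigma>)" "holds \<delta>0 (\<psi> \<cdot> \<sigma>)"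
    using sat unfolding satisfiable_and[OF constraint_\<sigma>[OF constraints(1)] constraint_\<sigma>[OF constraints(2)]] by blast
  \<comment> \<open>Satisfiability fixes only the constraint variables. The others receive any
    ground constructor term of their sort, which exists by \<open>inh\<close>.\<close>
  define \<delta> where "\<delta> x = (if x \<in> vars (\<phi> \<cdot> \<sigma>) \<union> vars (\<psi> \<cdot> \<sigma>) then \<delta>0 x else (SOME t. t \<in> ground_terms (snd x)))" for x
  have "lin_pattern (s \<cdot> \<sigma>)" using abstract_patterns(1) wt_\<sigma> funs_\<sigma> s\<sigma>(1) by (intro lin_pattern_app)
  then have g: "ground_on (vars (s \<cdot> \<sigma>)) \<delta>"
  proof (unfold ground_on_def, intro ballI)
    fix x assume x: "x \<in> vars (s \<cdot> \<sigma>)"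
    then have "ground_terms (snd x) \<noteq> {}" using inh[OF lin_pattern_arg_sorts[OF \<open>lin_pattern (s \<cdot> \<sigma>)\<close>]] by simp
    then have "(SOME t. t \<in> ground_terms (snd x)) \<in> ground_terms (snd x)" by (simp add: some_in_eq)
    then show "\<delta> x \<in> ground_terms (snd x)" using \<delta>0(1)[of x] value_terms_ground_terms by (simp add: \<delta>_def)
  qed
  have "holds \<delta> (\<phi> \<cdot> \<sigma>)" "holds \<delta> (\<psi> \<cdot> \<sigma>)"
    using holds_cong[of "\<phi> \<cdot> \<sigma>" \<delta>0 \<delta>] holds_cong[of "\<psi> \<cdot> \<sigma>" \<delta>0 \<delta>] \<delta>0(2,3) by (simp_all add: \<delta>_def)
  then have "holds (\<lambda>x. \<sigma> x \<cdot> \<delta>) \<phi>" "holds (\<lambda>x. \<sigma> x \<cdot> \<delta>) \<psi>"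
    using holds_app[of _ "\<lambda>x. \<sigma> x \<cdot> \<delta>" \<sigma> \<delta>] by blast+
  then have "s \<cdot> (\<lambda>x. \<sigma> x \<cdot> \<delta>) \<in> instances (s, \<phi>)" "t \<cdot> (\<lambda>x. \<sigma> x \<cdot> \<delta>) \<in> instances (t, \<psi>)"
    using ground_\<sigma>\<delta>[OF g] by (auto intro: semI)
  then show ?thesis using eq by (metis app_app disjoint_iff)
qed

text \<open>The set from which \<open>diff_set\<close> keeps the fresh variables of complements
  away.\<close>

definition X :: "'s vr set" where
  "X = vars s \<union> vars \<phi> \<union> vars t \<union> vars \<psi> \<union> (\<Union>x \<in> sdom \<sigma>. vars (\<sigma> x))"

lemma finite_X: "finite X"
  unfolding X_def using finite_subset[OF sdom] by simp

lemma vars_\<sigma>_X: "x \<in> vars s \<union> vars t \<Longrightarrow> vars (\<sigma> x) \<subseteq> X"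
  unfolding X_def by (cases "x \<in> sdom \<sigma>") (auto simp: sdom_def)

lemma diff_set_eq: "diff_set T \<Sigma> C (s, \<phi>) (t, \<psi>) \<sigma> =
    {(s \<cdot> \<rho>, \<phi> \<cdot> \<sigma>) | \<rho>. cosub \<Sigma> C X \<sigma> \<rho> \<and> s \<cdot> \<rho> \<noteq> s \<cdot> \<sigma>} \<union>
    {(s \<cdot> \<sigma>, \<chi>) | \<chi>. \<chi> = c_and T (\<phi> \<cdot> \<sigma>) (c_not T (\<psi> \<cdot> \<sigma>)) \<and> satisfiable T \<chi>}"
  by (simp add: diff_set_def X_def)

lemma cosub_cases: "cosub \<Sigma> C X \<sigma> \<rho> \<Longrightarrow> \<rho> x = \<sigma> x \<or> co \<Sigma> C X (\<sigma> x) (\<rho> x)"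
  by (cases "x \<in> sdom \<sigma>") (auto simp: cosub_def sdom_def set_eq_iff)

lemma cosub_var: "cosub \<Sigma> C X \<sigma> \<rho> \<Longrightarrow> \<sigma> x = Var z \<Longrightarrow> \<rho> x = \<sigma> x"
  using cosub_cases[of \<rho> x] co_Fun by fastforce

lemma cosub_lin_pattern:
  assumes \<rho>: "cosub \<Sigma> C X \<sigma> \<rho>"
  shows "lin_pattern (s \<cdot> \<rho>)" "\<And>x. wt \<Sigma> (\<rho> x) (snd x)" "\<And>x. funs (\<rho> x) \<subseteq> C0"
    "depth_le n (s \<cdot> \<sigma>) \<Longrightarrow> depth_le n (s \<cdot> \<rho>)"
proof -
  \<comment> \<open>The result sort of a symbol in \<open>C0\<close> is no theory sort, so no value
    shares it.\<close>
  have closed: "c' \<in> C0" if "c \<in> C0" "c' \<in> C" "\<Sigma> c = Some (\<sigma>s, \<tau>)" "\<Sigma> c' = Some (\<sigma>s', \<tau>)" for c c' \<sigma>s \<sigma>s' \<tau>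
  proof -
    have "\<tau> \<notin> th" using C0_sort[OF that(1)] sig_F[of c] that(3) by auto
    then have "c' \<notin> vals T"
      using vals_sort[of c'] sig_theory[of c'] that(4) theory_sig_sorts(2)[of c'] by fastforce
    then show ?thesis using constructor_cases that(2) by blast
  qed
  show w: "wt \<Sigma> (\<rho> x) (snd x)" for x
    using cosub_cases[OF \<rho>, of x] co_wt wt_\<sigma> by metis
  show f: "funs (\<rho> x) \<subseteq> C0" for x
    using cosub_cases[OF \<rho>, of x] co_funs[of C0 C \<Sigma> X "\<sigma> x" "\<rho> x"] closed funs_\<sigma>[of x] by metis
  have lx: "linear (\<rho> x)" if "x \<in> vars s" for x
    using cosub_cases[OF \<rho>, of x] co_linear[of \<Sigma> C X "\<sigma> x" "\<rho> x"] vars_\<sigma>_X[of x] that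
      linear_app_linear[OF s\<sigma>(1) that] by auto
  have vx: "vars (\<rho> x) \<subseteq> vars (\<sigma> x) \<union> - X" for x
    using cosub_cases[OF \<rho>, of x] co_vars[of \<Sigma> C X "\<sigma> x" "\<rho> x"] by auto
  \<comment> \<open>Common variables would lie in \<open>X\<close>, hence stem from
    \<open>\<sigma> x\<close> and \<open>\<sigma> y\<close>, which are disjoint because
    \<open>s \<cdot> \<sigma>\<close> is linear.\<close>
  have "vars (\<rho> x) \<inter> vars (\<rho> y) = {}" if xy: "x \<in> vars s" "y \<in> vars s" "x \<noteq> y" for x y
  proof -
    have "vars (\<rho> x) \<inter> vars (\<rho> y) \<subseteq> X"
    proof (cases "x \<in> sdom \<sigma> \<and> y \<in> sdom \<sigma>")
      case True
      then show ?thesis using \<rho> xy(3) unfolding cosub_def by blast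
    next
      case False
      then have "\<rho> x = Var x \<or> \<rho> y = Var y"
        using cosub_var[OF \<rho>, of x x] cosub_var[OF \<rho>, of y y] by (auto simp: sdom_def)
      then show ?thesis using xy by (auto simp: X_def)
    qed
    then show ?thesis using vx[of x] vx[of y] linear_app_disjoint[OF s\<sigma>(1) xy] by blast
  qed
  then have "linear (s \<cdot> \<rho>)" using lx abstract_patterns(1)[THEN lin_pattern_linear] by (intro linear_app)
  then show "lin_pattern (s \<cdot> \<rho>)" using abstract_patterns(1) w f by (intro lin_pattern_app)
  have "depth_le k (\<rho> x)" if "depth_le k (\<sigma> x)" for x k
    using cosub_cases[OF \<rho>, of x] co_depth_le[of \<Sigma> C X "\<sigma> x" "\<rho> x" k] that by auto
  then show "depth_le n (s \<cdot> \<sigma>) \<Longrightarrow> depth_le n (s \<cdot> \<rho>)" by (rule depth_le_app_mono)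
qed

text \<open>Constraint variables are unified with variables, and a variable has an empty complement.
  This is why a difference may pair \<open>s \<cdot> \<rho>\<close> with the constraint
  \<open>\<phi> \<cdot> \<sigma>\<close>.\<close>

lemma cosub_constraint_vars:
  assumes "cosub \<Sigma> C X \<sigma> \<rho>" "x \<in> vars \<phi>" shows "\<exists>z. \<sigma> x = Var z \<and> \<rho> x = Var z"
proof -
  obtain z where "\<sigma> x = Var z"
    using \<sigma>_theory_var[OF constraint_var_sort[OF constraints(1) assms(2)]] by blast
  then show ?thesis using cosub_var[OF assms(1)] by simp
qed

lemma diff_set_good_cterm:
  assumes "a \<in> diff_set T \<Sigma> C (s, \<phi>) (t, \<psi>) \<sigma>"
  shows "good_cterm a" "depth_le n s \<Longrightarrow> depth_le n t \<Longrightarrow> depth_le n (fst a)"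
    "satisfiable T (c_and T (\<phi> \<cdot> \<sigma>) (\<psi> \<cdot> \<sigma>)) \<Longrightarrow> satisfiable T (snd a)"
proof -
  consider \<rho> where "a = (s \<cdot> \<rho>, \<phi> \<cdot> \<sigma>)" "cosub \<Sigma> C X \<sigma> \<rho>"
    | "a = (s \<cdot> \<sigma>, c_and T (\<phi> \<cdot> \<sigma>) (c_not T (\<psi> \<cdot> \<sigma>)))" "satisfiable T (snd a)"
    using assms unfolding diff_set_eq by auto
  then have "good_cterm a \<and> (depth_le n s \<longrightarrow> depth_le n t \<longrightarrow> depth_le n (fst a)) \<and>
    (satisfiable T (c_and T (\<phi> \<cdot> \<sigma>) (\<psi> \<cdot> \<sigma>)) \<longrightarrow> satisfiable T (snd a))"
  proof cases
    case 1
    have "vars (\<phi> \<cdot> \<sigma>) \<subseteq> vars (s \<cdot> \<rho>)"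
      using cosub_constraint_vars[OF 1(2)] constraints(3) unfolding vars_app by fastforce
    then have "good_cterm a" using 1 cosub_lin_pattern(1) constraint_\<sigma> constraints(1) by (auto simp: good_cterm_def)
    moreover have "satisfiable T (\<phi> \<cdot> \<sigma>)" if "satisfiable T (c_and T (\<phi> \<cdot> \<sigma>) (\<psi> \<cdot> \<sigma>))"
    proof -
      show ?thesis
        using that unfolding satisfiable_and[OF constraint_\<sigma>[OF constraints(1)] constraint_\<sigma>[OF constraints(2)]]
          satisfiable_iff[OF constraint_\<sigma>[OF constraints(1)]] by blast
    qed
    ultimately show ?thesis using 1 cosub_lin_pattern(4)[OF 1(2)] s\<sigma>(2) by auto
  next
    case 2
    have "lin_pattern (s \<cdot> \<sigma>)" using abstract_patterns(1) wt_\<sigma> funs_\<sigma> s\<sigma>(1) by (intro lin_pattern_app)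
    then have "good_cterm a"
      using 2(1) vars_t\<sigma> constraint_and constraint_not constraint_\<sigma> constraints(1,2) by (auto simp: good_cterm_def)
    then show ?thesis using 2 s\<sigma>(2) by auto
  qed
  then show "good_cterm a" "depth_le n s \<Longrightarrow> depth_le n t \<Longrightarrow> depth_le n (fst a)"
    "satisfiable T (c_and T (\<phi> \<cdot> \<sigma>) (\<psi> \<cdot> \<sigma>)) \<Longrightarrow> satisfiable T (snd a)" by blast+
qed

text \<open>Constraints are left out because the termination measure counts instances of the terms
  alone.\<close>

lemma diff_set_instance:
  assumes a: "a \<in> diff_set T \<Sigma> C (s, \<phi>) (t, \<psi>) \<sigma>" and g: "has_instance ground_terms (fst a) g"
  shows "has_instance ground_terms s g"
proof -
  have "linear (fst a)" using diff_set_good_cterm(1)[OF a] by (auto simp: good_cterm_def lin_pattern_linear split: prod.splits)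
  then obtain \<delta> where \<delta>: "fst a \<cdot> \<delta> = g" "ground_on (vars (fst a)) \<delta>"
    using has_instance_linear[OF g] by (auto simp: ground_on_def)
  obtain \<rho> where \<rho>: "fst a = s \<cdot> \<rho>" "\<And>x. wt \<Sigma> (\<rho> x) (snd x)" "\<And>x. funs (\<rho> x) \<subseteq> C0"
    using a cosub_lin_pattern(2,3) wt_\<sigma> funs_\<sigma> unfolding diff_set_eq by auto
  have "ground_on (vars s) (\<lambda>x. \<rho> x \<cdot> \<delta>)"
    using ground_on_app[where \<sigma> = \<rho>, OF _ \<rho>(2,3)] \<delta>(2) unfolding \<rho>(1) vars_app
    by (simp add: ground_on_def)
  then show ?thesis using has_instance_ground \<delta>(1) \<rho>(1) app_app by metis
qed

lemma cosub_not_instance: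
  assumes \<rho>: "cosub \<Sigma> C X \<sigma> \<rho>" "s \<cdot> \<rho> \<noteq> s \<cdot> \<sigma>" and g: "has_instance ground_terms (s \<cdot> \<rho>) (s \<cdot> \<gamma>)"
  shows "\<not> has_instance ground_terms (s \<cdot> \<sigma>) (s \<cdot> \<gamma>)"
proof -
  obtain x where x: "x \<in> vars s" "\<rho> x \<noteq> \<sigma> x" using \<rho>(2) app_cong by metis
  then have "co \<Sigma> C X (\<sigma> x) (\<rho> x)" using cosub_cases[OF \<rho>(1)] by blast
  then show ?thesis using g x(1) co_has_instance_disjoint unfolding has_instance_app by blast
qed

lemma cosub_exists:
  assumes \<gamma>: "ground_on (vars s) \<gamma>" and n: "\<not> has_instance ground_terms (s \<cdot> \<sigma>) (s \<cdot> \<gamma>)"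
  shows "\<exists>\<rho>. cosub \<Sigma> C X \<sigma> \<rho> \<and> s \<cdot> \<rho> \<noteq> s \<cdot> \<sigma> \<and> has_instance ground_terms (s \<cdot> \<rho>) (s \<cdot> \<gamma>)"
proof -
  define B where "B = {x \<in> vars s. \<not> has_instance ground_terms (\<sigma> x) (\<gamma> x)}"
  have fin: "finite B" by (simp add: B_def)
  \<comment> \<open>Only variables at which matching fails are changed. They are handled one at a
    time, since each complement must take its fresh variables apart from those chosen
    before.\<close>
  have "\<exists>\<rho>. (\<forall>x \<in> V. co \<Sigma> C X (\<sigma> x) (\<rho> x) \<and> has_instance ground_terms (\<rho> x) (\<gamma> x)) \<and> (\<forall>x. x \<notin> V \<longrightarrow> \<rho> x = \<sigma> x) \<and>
      (\<forall>x \<in> V. \<forall>y \<in> V. x \<noteq> y \<longrightarrow> vars (\<rho> x) \<inter> vars (\<rho> y) \<subseteq> X)" if "finite V" "V \<subseteq> B" for V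
    using that
  proof (induction V rule: finite_induct)
    case (insert x V)
    then obtain \<rho> where \<rho>: "\<forall>x \<in> V. co \<Sigma> C X (\<sigma> x) (\<rho> x) \<and> has_instance ground_terms (\<rho> x) (\<gamma> x)"
      "\<forall>x. x \<notin> V \<longrightarrow> \<rho> x = \<sigma> x" "\<forall>x \<in> V. \<forall>y \<in> V. x \<noteq> y \<longrightarrow> vars (\<rho> x) \<inter> vars (\<rho> y) \<subseteq> X"
      by blast
    let ?X = "X \<union> (\<Union>y \<in> V. vars (\<rho> y))"
    have "finite ?X" using finite_X insert.hyps(1) by simp
    moreover have x: "x \<in> vars s" "\<not> has_instance ground_terms (\<sigma> x) (\<gamma> x)" using insert.prems by (auto simp: B_def)
    moreover have "\<gamma> x \<in> ground_terms (snd x)" using \<gamma> x(1) by (simp add: ground_on_def)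
    ultimately obtain u where u: "co \<Sigma> C ?X (\<sigma> x) u" "has_instance ground_terms u (\<gamma> x)"
      using co_cover[of ground_terms C \<Sigma> ?X "\<sigma> x" "snd x" "\<gamma> x"] ground_terms_cases wt_\<sigma> by metis
    have uv: "vars u \<inter> vars (\<rho> y) \<subseteq> X" if "y \<in> V" for y
      using co_vars[OF u(1)] vars_\<sigma>_X[of x] x(1) that by blast
    have "co \<Sigma> C X (\<sigma> x) u" using u(1) co_mono by blast
    then show ?case
      using \<rho> u(2) uv insert.hyps(2)
      by (intro exI[of _ "\<rho>(x := u)"]) (auto simp: Int_commute)
  qed auto
  from this[OF fin] obtain \<rho> where \<rho>: "\<And>x. x \<in> B \<Longrightarrow> co \<Sigma> C X (\<sigma> x) (\<rho> x) \<and> has_instance ground_terms (\<rho> x) (\<gamma> x)"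
    "\<And>x. x \<notin> B \<Longrightarrow> \<rho> x = \<sigma> x" "\<forall>x \<in> B. \<forall>y \<in> B. x \<noteq> y \<longrightarrow> vars (\<rho> x) \<inter> vars (\<rho> y) \<subseteq> X"
    by blast
  obtain x where x: "x \<in> B" using n unfolding has_instance_app B_def by blast
  then have "\<rho> x \<noteq> \<sigma> x" using \<rho>(1)[OF x] by (auto simp: B_def)
  then have ne: "s \<cdot> \<rho> \<noteq> s \<cdot> \<sigma>" using app_eqD x by (fastforce simp: B_def)
  have dom: "x \<in> sdom \<rho> \<longleftrightarrow> x \<in> sdom \<sigma>" for x
    using \<rho>(1)[of x] \<rho>(2)[of x] co_Fun[of \<Sigma> C X "\<sigma> x" "\<rho> x"] by (cases "x \<in> B") (auto simp: sdom_def)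
  have disj': "vars (\<rho> x) \<inter> vars (\<rho> y) \<subseteq> X" if "x \<in> sdom \<sigma>" "y \<in> sdom \<sigma>" "x \<noteq> y" for x y
    using \<rho>(2)[of x] \<rho>(2)[of y] \<rho>(3) vars_\<sigma>_X[of x] vars_\<sigma>_X[of y] that sdom
    by (cases "x \<in> B"; cases "y \<in> B") auto
  have "cosub \<Sigma> C X \<sigma> \<rho>"
    unfolding cosub_def using dom disj' \<rho>(1,2) ne by blast
  moreover have "has_instance ground_terms (s \<cdot> \<rho>) (s \<cdot> \<gamma>)"
    unfolding has_instance_app using \<rho>(1,2) by (metis (mono_tags, lifting) B_def mem_Collect_eq)
  ultimately show ?thesis using ne by blast
qed

text \<open>A ground instance of \<open>s\<close> that does not belong to \<open>t\<close> is either
  no instance of \<open>s \<cdot> \<sigma>\<close>, and then a complementary substitution catches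
  it, or it is one and violates \<open>\<psi>\<close>.\<close>

lemma instances_diff_set: "(\<Union>a \<in> diff_set T \<Sigma> C (s, \<phi>) (t, \<psi>) \<sigma>. instances a) = instances (s, \<phi>) - instances (t, \<psi>)"
proof (intro equalityI subsetI)
  fix g assume "g \<in> (\<Union>a \<in> diff_set T \<Sigma> C (s, \<phi>) (t, \<psi>) \<sigma>. instances a)"
  then consider \<rho> where "cosub \<Sigma> C X \<sigma> \<rho>" "s \<cdot> \<rho> \<noteq> s \<cdot> \<sigma>" "g \<in> instances (s \<cdot> \<rho>, \<phi> \<cdot> \<sigma>)"
    | "g \<in> instances (s \<cdot> \<sigma>, c_and T (\<phi> \<cdot> \<sigma>) (c_not T (\<psi> \<cdot> \<sigma>)))"
    unfolding diff_set_eq by blast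
  then show "g \<in> instances (s, \<phi>) - instances (t, \<psi>)"
  proof cases
    case 1
    then obtain \<delta> where \<delta>: "g = s \<cdot> \<rho> \<cdot> \<delta>" "ground_on (vars (s \<cdot> \<rho>)) \<delta>" "holds \<delta> (\<phi> \<cdot> \<sigma>)" by (elim semE)
    have gr: "ground_on (vars s) (\<lambda>x. \<rho> x \<cdot> \<delta>)"
      using ground_on_app[where \<sigma> = \<rho>, OF _ cosub_lin_pattern(2,3)[OF 1(1)]] \<delta>(2) unfolding vars_app
      by (simp add: ground_on_def)
    have "holds (\<lambda>x. \<rho> x \<cdot> \<delta>) \<phi>"
      using holds_app[of \<phi> "\<lambda>x. \<rho> x \<cdot> \<delta>" \<sigma> \<delta>] \<delta>(3) cosub_constraint_vars[OF 1(1)] by fastforce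
    then have "g \<in> instances (s, \<phi>)" unfolding \<delta>(1) app_app using gr by (intro semI)
    moreover have "g \<notin> instances (t, \<psi>)"
    proof
      assume "g \<in> instances (t, \<psi>)"
      then obtain \<gamma>' where \<gamma>': "g = t \<cdot> \<gamma>'" "ground_on (vars t) \<gamma>'" by (elim semE)
      then obtain \<delta>' where "\<forall>x \<in> vars s. \<rho> x \<cdot> \<delta> = \<sigma> x \<cdot> \<delta>'" "ground_on (vars (s \<cdot> \<sigma>)) \<delta>'"
        using common_instance[OF gr \<gamma>'(2)] \<delta>(1) by (auto simp: app_app)
      then have "has_instance ground_terms (s \<cdot> \<sigma>) (s \<cdot> (\<lambda>x. \<rho> x \<cdot> \<delta>))"
        using has_instance_ground[of "s \<cdot> \<sigma>" \<delta>'] by (simp add: app_app has_instance_app)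
      then show False
        using cosub_not_instance[OF 1(1,2), of "\<lambda>x. \<rho> x \<cdot> \<delta>"] has_instance_ground[OF \<delta>(2)] by (simp add: app_app)
    qed
    ultimately show ?thesis by blast
  next
    case 2
    then obtain \<delta> where \<delta>: "g = s \<cdot> \<sigma> \<cdot> \<delta>" "ground_on (vars (s \<cdot> \<sigma>)) \<delta>"
      "holds \<delta> (c_and T (\<phi> \<cdot> \<sigma>) (c_not T (\<psi> \<cdot> \<sigma>)))" by (elim semE)
    have value_terms: "\<delta> x \<in> value_terms (snd x)" if "x \<in> vars (\<phi> \<cdot> \<sigma>) \<union> vars (\<psi> \<cdot> \<sigma>)" for x
    proof -
      have "snd x \<in> th" using that constraint_var_sort constraint_\<sigma> constraints(1,2) by blast
      then show ?thesis using \<delta>(2) that vars_t\<sigma> ground_terms_value_terms unfolding ground_on_def by blast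
    qed
    have h: "holds \<delta> (\<phi> \<cdot> \<sigma>)" "\<not> holds \<delta> (\<psi> \<cdot> \<sigma>)"
      using holds_and[OF constraint_\<sigma> constraint_not[OF constraint_\<sigma>], of \<phi> \<psi> \<delta>]
        holds_not[OF constraint_\<sigma>, of \<psi> \<delta>] constraints(1,2) value_terms \<delta>(3) by auto
    have "holds (\<lambda>x. \<sigma> x \<cdot> \<delta>) \<phi>" "\<not> holds (\<lambda>x. \<sigma> x \<cdot> \<delta>) \<psi>"
      using h holds_app[of _ "\<lambda>x. \<sigma> x \<cdot> \<delta>" \<sigma> \<delta>] by blast+
    moreover have "g = t \<cdot> (\<lambda>x. \<sigma> x \<cdot> \<delta>)" using \<delta>(1) eq by (simp add: app_app)
    \<comment> \<open>All variables of \<open>\<psi>\<close> occur in \<open>t\<close>, so every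
      matcher of \<open>g\<close> gives \<open>\<psi>\<close> the same truth value. Otherwise the
      negated constraint would not describe the complement.\<close>
    moreover have "holds \<gamma>' \<psi> \<longleftrightarrow> holds (\<lambda>x. \<sigma> x \<cdot> \<delta>) \<psi>" if "t \<cdot> \<gamma>' = t \<cdot> (\<lambda>x. \<sigma> x \<cdot> \<delta>)" for \<gamma>'
      using constraints(4) app_eqD[OF that] by (intro holds_cong) auto
    ultimately have "g \<notin> instances (t, \<psi>)" by (metis semE)
    moreover have "g \<in> instances (s, \<phi>)"
      unfolding \<delta>(1) app_app using \<open>holds (\<lambda>x. \<sigma> x \<cdot> \<delta>) \<phi>\<close> ground_\<sigma>\<delta>(1)[OF \<delta>(2)] by (intro semI)
    ultimately show ?thesis by blast
  qed
next
  fix g assume g: "g \<in> instances (s, \<phi>) - instances (t, \<psi>)"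
  then obtain \<gamma> where \<gamma>: "g = s \<cdot> \<gamma>" "ground_on (vars s) \<gamma>" "holds \<gamma> \<phi>" by (blast elim: semE)
  show "g \<in> (\<Union>a \<in> diff_set T \<Sigma> C (s, \<phi>) (t, \<psi>) \<sigma>. instances a)"
  proof (cases "has_instance ground_terms (s \<cdot> \<sigma>) (s \<cdot> \<gamma>)")
    case True
    obtain \<delta> where \<delta>: "ground_on (vars (s \<cdot> \<sigma>)) \<delta>" "s \<cdot> \<sigma> \<cdot> \<delta> = s \<cdot> \<gamma>"
      using has_instance_linear[OF True s\<sigma>(1)] unfolding ground_on_def by blast
    have value_terms: "\<delta> x \<in> value_terms (snd x)" if "x \<in> vars (\<phi> \<cdot> \<sigma>) \<union> vars (\<psi> \<cdot> \<sigma>)" for x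
    proof -
      have "snd x \<in> th" using that constraint_var_sort constraint_\<sigma> constraints(1,2) by blast
      then show ?thesis using \<delta>(1) that vars_t\<sigma> ground_terms_value_terms unfolding ground_on_def by blast
    qed
    have "\<gamma> x = \<sigma> x \<cdot> \<delta>" if "x \<in> vars s" for x using \<delta>(2) app_eqD[OF _ that] unfolding app_app by metis
    then have "holds \<delta> (\<phi> \<cdot> \<sigma>)" using holds_app[of \<phi> \<gamma> \<sigma> \<delta>] \<gamma>(3) constraints(3) by blast
    moreover have "\<not> holds \<delta> (\<psi> \<cdot> \<sigma>)"
    proof
      assume "holds \<delta> (\<psi> \<cdot> \<sigma>)"
      then have "holds (\<lambda>x. \<sigma> x \<cdot> \<delta>) \<psi>" using holds_app[of \<psi> "\<lambda>x. \<sigma> x \<cdot> \<delta>" \<sigma> \<delta>] by blast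
      then have "t \<cdot> (\<lambda>x. \<sigma> x \<cdot> \<delta>) \<in> instances (t, \<psi>)" using ground_\<sigma>\<delta>(2)[OF \<delta>(1)] by (intro semI)
      moreover have "t \<cdot> (\<lambda>x. \<sigma> x \<cdot> \<delta>) = g" using \<gamma>(1) \<delta>(2) eq by (metis app_app)
      ultimately show False using g by blast
    qed
    ultimately have h: "holds \<delta> (c_and T (\<phi> \<cdot> \<sigma>) (c_not T (\<psi> \<cdot> \<sigma>)))"
      using holds_and[OF constraint_\<sigma> constraint_not[OF constraint_\<sigma>], of \<phi> \<psi> \<delta>]
        holds_not[OF constraint_\<sigma>, of \<psi> \<delta>] constraints(1,2) value_terms by auto
    then have "satisfiable T (c_and T (\<phi> \<cdot> \<sigma>) (c_not T (\<psi> \<cdot> \<sigma>)))"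
      using satisfiable_iff[OF constraint_and[OF constraint_\<sigma>[OF constraints(1)]
        constraint_not[OF constraint_\<sigma>[OF constraints(2)]]]] value_terms by fastforce
    then have "(s \<cdot> \<sigma>, c_and T (\<phi> \<cdot> \<sigma>) (c_not T (\<psi> \<cdot> \<sigma>))) \<in> diff_set T \<Sigma> C (s, \<phi>) (t, \<psi>) \<sigma>"
      unfolding diff_set_eq by blast
    moreover have "g \<in> instances (s \<cdot> \<sigma>, c_and T (\<phi> \<cdot> \<sigma>) (c_not T (\<psi> \<cdot> \<sigma>)))"
      unfolding \<gamma>(1) \<delta>(2)[symmetric] using \<delta>(1) h by (intro semI)
    ultimately show ?thesis by blast
  next
    case False
    then obtain \<rho> where \<rho>: "cosub \<Sigma> C X \<sigma> \<rho>" "s \<cdot> \<rho> \<noteq> s \<cdot> \<sigma>" "has_instance ground_terms (s \<cdot> \<rho>) (s \<cdot> \<gamma>)"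
      using cosub_exists[OF \<gamma>(2)] by blast
    obtain \<delta> where \<delta>: "ground_on (vars (s \<cdot> \<rho>)) \<delta>" "s \<cdot> \<rho> \<cdot> \<delta> = s \<cdot> \<gamma>"
      using has_instance_linear[OF \<rho>(3) lin_pattern_linear[OF cosub_lin_pattern(1)[OF \<rho>(1)]]] unfolding ground_on_def by blast
    have "\<gamma> x = \<rho> x \<cdot> \<delta>" if "x \<in> vars s" for x using \<delta>(2) app_eqD[OF _ that] unfolding app_app by metis
    then have "\<gamma> x = \<sigma> x \<cdot> \<delta>" if "x \<in> vars \<phi>" for x
      using cosub_constraint_vars[OF \<rho>(1) that] constraints(3) that by (metis subsetD)
    then have "holds \<delta> (\<phi> \<cdot> \<sigma>)" using holds_app[of \<phi> \<gamma> \<sigma> \<delta>] \<gamma>(3) by blast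
    then have "g \<in> instances (s \<cdot> \<rho>, \<phi> \<cdot> \<sigma>)" unfolding \<gamma>(1) \<delta>(2)[symmetric] using \<delta>(1) by (intro semI)
    moreover have "(s \<cdot> \<rho>, \<phi> \<cdot> \<sigma>) \<in> diff_set T \<Sigma> C (s, \<phi>) (t, \<psi>) \<sigma>"
      unfolding diff_set_eq using \<rho>(1,2) by blast
    ultimately show ?thesis by blast
  qed
qed

text \<open>The instance decides at each variable of \<open>s\<close> whether the substitution
  deviates from \<open>\<sigma>\<close> there, and with which shape. It also separates the members
  with term \<open>s \<cdot> \<rho>\<close> from the one with term
  \<open>s \<cdot> \<sigma>\<close>.\<close>

lemma diff_set_disjoint:
  assumes a: "a \<in> diff_set T \<Sigma> C (s, \<phi>) (t, \<psi>) \<sigma>" and b: "b \<in> diff_set T \<Sigma> C (s, \<phi>) (t, \<psi>) \<sigma>"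
    and g: "has_instance ground_terms (fst a) g" "has_instance ground_terms (fst b) g"
  shows "ceq T a b"
proof -
  have inst: "\<exists>\<gamma>. g = s \<cdot> \<gamma>"
  proof -
    have "linear (fst a)" using diff_set_good_cterm(1)[OF a] by (auto simp: good_cterm_def lin_pattern_linear split: prod.splits)
    then obtain \<delta> where "fst a \<cdot> \<delta> = g" using has_instance_linear[OF g(1)] by blast
    moreover obtain \<rho> where "fst a = s \<cdot> \<rho>" using a unfolding diff_set_eq by auto
    ultimately show ?thesis by (metis app_app)
  qed
  then obtain \<gamma> where \<gamma>: "g = s \<cdot> \<gamma>" by blast

  have mixed: False if "cosub \<Sigma> C X \<sigma> \<rho>" "s \<cdot> \<rho> \<noteq> s \<cdot> \<sigma>" "has_instance ground_terms (s \<cdot> \<rho>) g" "has_instance ground_terms (s \<cdot> \<sigma>) g" for \<rho>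
    using cosub_not_instance that unfolding \<gamma> by blast
  have both: "ceq T (s \<cdot> \<rho>, \<phi> \<cdot> \<sigma>) (s \<cdot> \<rho>', \<phi> \<cdot> \<sigma>)"
    if \<rho>: "cosub \<Sigma> C X \<sigma> \<rho>" "has_instance ground_terms (s \<cdot> \<rho>) g" and \<rho>': "cosub \<Sigma> C X \<sigma> \<rho>'" "has_instance ground_terms (s \<cdot> \<rho>') g" for \<rho> \<rho>'
  proof -
    have "map_tm (\<lambda>f. f) snd (\<rho> x) = map_tm (\<lambda>f. f) snd (\<rho>' x)" if x: "x \<in> vars s" for x
    proof -
      have m: "has_instance ground_terms (\<rho> x) (\<gamma> x)" "has_instance ground_terms (\<rho>' x) (\<gamma> x)" using \<rho>(2) \<rho>'(2) x unfolding \<gamma> has_instance_app by auto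
      then show ?thesis
        using cosub_cases[OF \<rho>(1), of x] cosub_cases[OF \<rho>'(1), of x] co_has_instance_disjoint co_has_instance_shape by metis
    qed
    then have "map_tm (\<lambda>f. f) snd (s \<cdot> \<rho>) = map_tm (\<lambda>f. f) snd (s \<cdot> \<rho>')"
      by (induction s) auto
    then obtain \<pi> where \<pi>: "is_renaming \<pi>" "rename (s \<cdot> \<rho>) \<pi> = s \<cdot> \<rho>'"
      using shape_renaming lin_pattern_linear cosub_lin_pattern(1) \<rho>(1) \<rho>'(1) by blast
    have "rename (\<rho> x) \<pi> = \<rho>' x" if "x \<in> vars s" for x
      using \<pi>(2) that app_eqD[of s "\<lambda>x. rename (\<rho> x) \<pi>" \<rho>' x] by (simp add: app_app)
    \<comment> \<open>Both substitutions agree with \<open>\<sigma>\<close> on constraint variables,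
      so the renaming fixes the constraint.\<close>
    then have "rename (\<sigma> x) \<pi> = \<sigma> x" if "x \<in> vars \<phi>" for x
      using cosub_constraint_vars[OF \<rho>(1) that] cosub_constraint_vars[OF \<rho>'(1) that] constraints(3) that
      by (metis subsetD)
    then have "rename (\<phi> \<cdot> \<sigma>) \<pi> = \<phi> \<cdot> \<sigma>" unfolding app_app by (intro app_cong)
    then show ?thesis unfolding ceq_def prod.case using \<pi> by (intro exI[of _ \<pi>]) simp
  qed
  show ?thesis
    using a b g unfolding diff_set_eq by (auto intro: both ceq_refl dest: mixed)
qed

end

subsection \<open>Termination of the complement procedure\<close>

context admissible_lctrs
begin

lemma renaming_image: "is_renaming \<pi> \<Longrightarrow> inj_on \<pi> V"
  by (auto simp: is_renaming_def bij_def inj_on_def)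

lemma vars_rename: "vars (rename t \<pi>) = \<pi> ` vars t"
  by (auto simp: vars_app)

lemma constraint_rename: "is_renaming \<pi> \<Longrightarrow> is_constraint T \<phi> \<Longrightarrow> is_constraint T (rename \<phi> \<pi>)"
  unfolding is_constraint_def by (rule wt_app) (auto simp: is_renaming_def)

lemma good_cterm_rename:
  assumes "is_renaming \<pi>" "good_cterm (s, \<phi>)"
  shows "good_cterm (rename s \<pi>, rename \<phi> \<pi>)" "ceq T (s, \<phi>) (rename s \<pi>, rename \<phi> \<pi>)"
proof -
  have "lin_pattern (rename s \<pi>)"
    using assms renaming_image[OF assms(1)] by (intro lin_pattern_app linear_rename)
      (auto simp: good_cterm_def is_renaming_def lin_pattern_linear)
  then show "good_cterm (rename s \<pi>, rename \<phi> \<pi>)"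
    using assms constraint_rename[OF assms(1), of \<phi>] by (auto simp: good_cterm_def vars_rename)
  show "ceq T (s, \<phi>) (rename s \<pi>, rename \<phi> \<pi>)"
    unfolding ceq_def prod.case using assms(1) by (intro exI[of _ \<pi>]) simp
qed

lemma ceq_rename_has_instance:
  assumes "ceq T a b" shows "has_instance ground_terms (fst a) g \<longleftrightarrow> has_instance ground_terms (fst b) g"
proof -
  have "has_instance ground_terms (rename s \<pi>) g \<longleftrightarrow> has_instance ground_terms s g" if "is_renaming \<pi>" for s \<pi> g
  proof (induction s arbitrary: g)
    case (Var x)
    then show ?case using that by (simp add: is_renaming_def)
  qed (auto simp: has_instance_Fun_iff)
  then show ?thesis using assms unfolding ceq_def by (auto split: prod.splits)
qed

text \<open>The variables of the constraint occur in the term, so the existential closure in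
  \<open>ceq\<close> binds none of them and the constraints are compared under every assignment of
  values.\<close>

lemma ceq_instances:
  assumes c: "ceq T a b" and a: "good_cterm a" and b: "good_cterm b" shows "instances a = instances b"
proof -
  obtain s \<phi> t \<psi> where ab: "a = (s, \<phi>)" "b = (t, \<psi>)" by fastforce
  have gs: "is_constraint T \<phi>" "vars \<phi> \<subseteq> vars s" and gt: "is_constraint T \<psi>" "vars \<psi> \<subseteq> vars t"
    using a b by (auto simp: ab good_cterm_def)
  obtain \<pi> where \<pi>: "is_renaming \<pi>" "rename s \<pi> = t" and
    eq: "\<And>\<gamma>. is_subst (theory_sig T) \<gamma> \<Longrightarrow> (\<forall>x. snd x \<in> th \<longrightarrow> is_val T (\<gamma> x)) \<Longrightarrow>
        (\<exists>\<gamma>'. is_subst (theory_sig T) \<gamma>' \<and> (\<forall>x \<in> vars t. \<gamma>' x = \<gamma> x) \<and> resp T \<gamma>' (rename \<phi> \<pi>)) \<longleftrightarrow>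
        (\<exists>\<gamma>'. is_subst (theory_sig T) \<gamma>' \<and> (\<forall>x \<in> vars t. \<gamma>' x = \<gamma> x) \<and> resp T \<gamma>' \<psi>)"
    using c unfolding ceq_def ab by auto
  have vt: "vars t = \<pi> ` vars s" using \<pi>(2) vars_rename by blast
  have key: "holds (\<lambda>x. \<gamma> (\<pi> x)) \<phi> \<longleftrightarrow> holds \<gamma> \<psi>" if g: "ground_on (vars t) \<gamma>" for \<gamma>
  proof -
    have "\<exists>t. \<iota> \<in> th \<longrightarrow> t \<in> value_terms \<iota>" for \<iota>
      using val_exists[of \<iota>] by (auto simp: value_terms_def)
    then obtain d where d: "\<And>\<iota>. \<iota> \<in> th \<Longrightarrow> d \<iota> \<in> value_terms \<iota>" by metis
    \<comment> \<open>\<open>ceq\<close> quantifies over substitutions of the theory signature that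
      give values at all theory sorts. Hence term-sorted variables are left alone, and theory-sorted
      variables outside \<open>t\<close> receive default values.\<close>
    define \<gamma>t where "\<gamma>t x = (if snd x \<in> th then if x \<in> vars t then \<gamma> x else d (snd x) else Var x)" for x
    have V: "\<gamma>t x \<in> value_terms (snd x)" if "snd x \<in> th" for x
      using that g d ground_terms_value_terms by (auto simp: \<gamma>t_def ground_on_def)
    have sub: "is_subst (theory_sig T) \<gamma>t"
    proof (unfold is_subst_def, intro allI)
      fix x show "wt (theory_sig T) (\<gamma>t x) (snd x)"
        using V[of x] value_terms_wt by (cases "snd x \<in> th") (auto simp: \<gamma>t_def)
    qed
    have vals: "\<forall>x. snd x \<in> th \<longrightarrow> is_val T (\<gamma>t x)" using V value_terms_is_val by blast
    have ex: "(\<exists>\<gamma>'. is_subst (theory_sig T) \<gamma>' \<and> (\<forall>x \<in> vars t. \<gamma>' x = \<gamma>t x) \<and> resp T \<gamma>' \<chi>) \<longleftrightarrow> holds \<gamma> \<chi>"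
      if \<chi>: "is_constraint T \<chi>" "vars \<chi> \<subseteq> vars t" for \<chi>
    proof -
      have sorts: "snd x \<in> th" if "x \<in> vars \<chi>" for x using constraint_var_sort[OF \<chi>(1) that] .
      have e: "\<gamma>t x = \<gamma> x" if "x \<in> vars \<chi>" for x using sorts[OF that] \<chi>(2) that by (auto simp: \<gamma>t_def)
      have h: "holds \<gamma>t \<chi> \<longleftrightarrow> holds \<gamma> \<chi>" using e by (intro holds_cong) simp
      show ?thesis
      proof
        assume "\<exists>\<gamma>'. is_subst (theory_sig T) \<gamma>' \<and> (\<forall>x \<in> vars t. \<gamma>' x = \<gamma>t x) \<and> resp T \<gamma>' \<chi>"
        then obtain \<gamma>' where \<gamma>': "\<forall>x \<in> vars t. \<gamma>' x = \<gamma>t x" "holds \<gamma>' \<chi>"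
          unfolding resp_def holds_def by blast
        then have "holds \<gamma>' \<chi> \<longleftrightarrow> holds \<gamma>t \<chi>" using \<chi>(2) by (intro holds_cong) auto
        then show "holds \<gamma> \<chi>" using h \<gamma>'(2) by blast
      next
        assume "holds \<gamma> \<chi>"
        then have "resp T \<gamma>t \<chi>" using h V sorts value_terms_is_val unfolding resp_def holds_def by blast
        then show "\<exists>\<gamma>'. is_subst (theory_sig T) \<gamma>' \<and> (\<forall>x \<in> vars t. \<gamma>' x = \<gamma>t x) \<and> resp T \<gamma>' \<chi>"
          using sub by blast
      qed
    qed
    have "vars (rename \<phi> \<pi>) \<subseteq> vars t" unfolding vars_rename vt using gs(2) by blast
    then have "holds \<gamma> (rename \<phi> \<pi>) \<longleftrightarrow> holds \<gamma> \<psi>"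
      using eq[OF sub vals] ex[OF gt] ex[OF constraint_rename[OF \<pi>(1) gs(1)]] by blast
    then show ?thesis using holds_app[of \<phi> "\<lambda>x. \<gamma> (\<pi> x)" "\<lambda>x. Var (\<pi> x)" \<gamma>] by simp
  qed
  have ts: "t \<cdot> \<gamma> = s \<cdot> (\<lambda>x. \<gamma> (\<pi> x))" for \<gamma> unfolding \<pi>(2)[symmetric] by (simp add: app_app)
  have gr: "ground_on (vars t) \<gamma> \<longleftrightarrow> ground_on (vars s) (\<lambda>x. \<gamma> (\<pi> x))" for \<gamma>
    using \<pi>(1) unfolding ground_on_def vt by (simp add: is_renaming_def)
  have inv: "\<exists>\<gamma>'. \<gamma> = (\<lambda>x. \<gamma>' (\<pi> x))" for \<gamma> :: "('f, 's) subst"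
    using \<pi>(1) by (intro exI[of _ "\<lambda>x. \<gamma> (inv \<pi> x)"]) (simp add: is_renaming_def bij_def)
  show ?thesis
  proof (intro equalityI subsetI)
    fix g assume "g \<in> instances a"
    then obtain \<gamma> where \<gamma>: "g = s \<cdot> \<gamma>" "ground_on (vars s) \<gamma>" "holds \<gamma> \<phi>" unfolding ab by (elim semE)
    obtain \<gamma>' where "\<gamma> = (\<lambda>x. \<gamma>' (\<pi> x))" using inv by blast
    then show "g \<in> instances b" unfolding ab using \<gamma> gr[of \<gamma>'] key[of \<gamma>'] ts[of \<gamma>'] semI[of t \<gamma>' \<psi>] by simp
  next
    fix g assume "g \<in> instances b"
    then obtain \<gamma> where \<gamma>: "g = t \<cdot> \<gamma>" "ground_on (vars t) \<gamma>" "holds \<gamma> \<psi>" unfolding ab by (elim semE)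
    then show "g \<in> instances a" unfolding ab using gr key ts semI[of s "\<lambda>x. \<gamma> (\<pi> x)" \<phi>] by simp
  qed
qed

lemma variant_facts:
  assumes v: "disjoint_variant c d d'" and c: "good_cterm c" and d: "good_cterm d"
  shows "good_cterm d'" "instances d' = instances d" "vars (fst c) \<inter> vars (fst d') = {}"
    "depth_le n (fst d') = depth_le n (fst d)" "has_instance ground_terms (fst d') g = has_instance ground_terms (fst d) g"
proof -
  obtain s \<phi> t \<psi> where cd: "c = (s, \<phi>)" "d = (t, \<psi>)" by fastforce
  obtain \<pi> where \<pi>: "is_renaming \<pi>" "d' = (rename t \<pi>, rename \<psi> \<pi>)" "vars s \<inter> vars (rename t \<pi>) = {}"
    using v unfolding disjoint_variant_def cd by (auto split: prod.splits)
  have ceq: "ceq T d d'" and g: "good_cterm d'" using good_cterm_rename[OF \<pi>(1)] d unfolding \<pi>(2) cd by auto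
  then show "good_cterm d'" "instances d' = instances d" "has_instance ground_terms (fst d') g = has_instance ground_terms (fst d) g"
    using ceq_instances[OF ceq d g] ceq_rename_has_instance[OF ceq] by auto
  show "vars (fst c) \<inter> vars (fst d') = {}" "depth_le n (fst d') = depth_le n (fst d)"
    using \<pi> by (auto simp: cd)
qed

lemma variant_exists: "\<exists>d'. disjoint_variant c d d'"
proof -
  obtain s \<phi> t \<psi> where cd: "c = (s, \<phi>)" "d = (t, \<psi>)" by fastforce
  obtain \<pi> where \<pi>: "is_renaming \<pi>" "\<pi> ` (vars t \<union> vars \<psi>) \<inter> (vars s \<union> vars \<phi>) = {}"
    using avoid_renaming[of "vars t \<union> vars \<psi>" "vars s \<union> vars \<phi>"] by auto
  then have "disjoint_variant c d (rename t \<pi>, rename \<psi> \<pi>)"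
    unfolding disjoint_variant_def cd by (auto simp: vars_rename image_Un intro!: exI[of _ \<pi>])
  then show ?thesis by blast
qed

lemma unif_of:
  assumes "disjoint_variant c d d'" "good_cterm c" "good_cterm d" "is_mgu \<Sigma> (fst c) (fst d') \<sigma>"
    "sdom \<sigma> \<subseteq> vars (fst c) \<union> vars (fst d')"
  shows "unif T F R (fst c) (fst d') (snd c) (snd d') \<sigma>"
  using variant_facts[OF assms(1-3)] assms(2,4,5) by unfold_locales auto

lemma unif_of_cunifier:
  assumes "disjoint_variant c d d'" "good_cterm c" "good_cterm d" "cunifier T \<Sigma> c d' \<sigma>"
  shows "unif T F R (fst c) (fst d') (snd c) (snd d') \<sigma>"
  using assms(4) by (intro unif_of[OF assms(1-3)]) (auto simp: cunifier_def split: prod.splits)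

section \<open>Overlaps and differences in terms of denotations\<close>

definition inhabited :: bool where
  "inhabited \<longleftrightarrow> (\<forall>\<tau> \<in> arg_sorts. ground_terms \<tau> \<noteq> {})"

text \<open>Turns an empty denotation of a final set into emptiness of the set itself.\<close>

lemma instances_nonempty:
  assumes i: inhabited and g: "good_cterm p" "satisfiable T (snd p)" shows "instances p \<noteq> {}"
proof -
  obtain s \<phi> where p: "p = (s, \<phi>)" by fastforce
  have c: "is_constraint T \<phi>" "vars \<phi> \<subseteq> vars s" "lin_pattern s" using g by (auto simp: p good_cterm_def)
  then obtain \<gamma>0 where \<gamma>0: "\<forall>x \<in> vars \<phi>. \<gamma>0 x \<in> value_terms (snd x)" "holds \<gamma>0 \<phi>"
    using g(2) satisfiable_iff[OF c(1)] by (auto simp: p)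
  define \<gamma> where "\<gamma> x = (if x \<in> vars \<phi> then \<gamma>0 x else (SOME t. t \<in> ground_terms (snd x)))" for x
  have "ground_on (vars s) \<gamma>"
  proof (unfold ground_on_def, intro ballI)
    fix x assume x: "x \<in> vars s"
    then have "ground_terms (snd x) \<noteq> {}" using i lin_pattern_arg_sorts[OF c(3)] by (simp add: inhabited_def)
    then have "(SOME t. t \<in> ground_terms (snd x)) \<in> ground_terms (snd x)" by (simp add: some_in_eq)
    then show "\<gamma> x \<in> ground_terms (snd x)" using \<gamma>0(1) value_terms_ground_terms by (simp add: \<gamma>_def)
  qed
  moreover have "holds \<gamma> \<phi>" using \<gamma>0(2) holds_cong[of \<phi> \<gamma>0 \<gamma>] by (simp add: \<gamma>_def)
  ultimately show ?thesis unfolding p using semI by blast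
qed

text \<open>Shows that the case distinction in \<open>cdiff\<close> depends neither on the variant
  nor on the unifier.\<close>

lemma overlap_iff:
  assumes i: inhabited and g: "good_cterm c" "good_cterm d"
  shows "(\<exists>d' \<sigma>. disjoint_variant c d d' \<and> cunifier T \<Sigma> c d' \<sigma>) \<longleftrightarrow> instances c \<inter> instances d \<noteq> {}"
proof
  assume "\<exists>d' \<sigma>. disjoint_variant c d d' \<and> cunifier T \<Sigma> c d' \<sigma>"
  then obtain d' \<sigma> where d': "disjoint_variant c d d'" "cunifier T \<Sigma> c d' \<sigma>" by blast
  interpret unif T F R "fst c" "fst d'" "snd c" "snd d'" \<sigma> using unif_of_cunifier[OF d'(1) g d'(2)] .
  show "instances c \<inter> instances d \<noteq> {}"
    using satisfiable_overlap d'(2) cunifier_iff i variant_facts(2)[OF d'(1) g] by (auto simp: inhabited_def)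
next
  assume o: "instances c \<inter> instances d \<noteq> {}"
  obtain d' where d': "disjoint_variant c d d'" using variant_exists by blast
  note v = variant_facts[OF d' g]
  have o': "instances (fst c, snd c) \<inter> instances (fst d', snd d') \<noteq> {}" using o v(2) by simp
  then obtain \<gamma> \<gamma>' where \<gamma>: "fst c \<cdot> \<gamma> = fst d' \<cdot> \<gamma>'" by (blast elim: semE)
  have p: "lin_pattern (fst c)" "lin_pattern (fst d')" using g(1) v(1) by (auto simp: good_cterm_def)
  obtain f us \<tau> h ts \<tau>' where f: "fst c = Fun f us" "wt \<Sigma> (fst c) \<tau>" and h: "fst d' = Fun h ts" "wt \<Sigma> (fst d') \<tau>'"
    using p[THEN lin_pattern_wt] by blast
  then have "f = h" using \<gamma> by simp
  then have "\<tau> = \<tau>'" using f h by (auto simp: wt_Fun_iff)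
  note m = bindings_subst_mgu[OF clash_free_unifiable[OF \<gamma>] lin_pattern_linear[OF p(1)] lin_pattern_linear[OF p(2)] v(3) f(2) h(2)[folded \<open>\<tau> = \<tau>'\<close>]]
  interpret unif T F R "fst c" "fst d'" "snd c" "snd d'" "bindings_subst (fst c) (fst d')"
    using unif_of[OF d' g m(1,2)] .
  show "\<exists>d' \<sigma>. disjoint_variant c d d' \<and> cunifier T \<Sigma> c d' \<sigma>"
    using d' cunifier_iff overlap_satisfiable[OF o'] by auto
qed

definition all_instances :: "('f, 's) cterm set \<Rightarrow> ('f, 's) trm set" where
  "all_instances A = (\<Union>a \<in> A. instances a)"

text \<open>Ensures that removing an equivalence class from a set removes exactly the denotation of
  that class.\<close>

definition separated :: "('f, 's) cterm set \<Rightarrow> bool" where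
  "separated A \<longleftrightarrow> (\<forall>a \<in> A. \<forall>b \<in> A. ceq T a b \<or> instances a \<inter> instances b = {})"

lemma instances_has_instance: "g \<in> instances a \<Longrightarrow> has_instance ground_terms (fst a) g"
  by (cases a) (auto elim!: semE intro: has_instance_ground)

lemma cdiff_facts:
  assumes i: inhabited and g: "good_cterm c" "good_cterm d" and A: "cdiff T \<Sigma> C c d A"
  shows "\<And>a. a \<in> A \<Longrightarrow> good_cterm a" "all_instances A = instances c - instances d" "separated A" "finite A"
    "\<And>a n. a \<in> A \<Longrightarrow> depth_le n (fst c) \<Longrightarrow> depth_le n (fst d) \<Longrightarrow> depth_le n (fst a)"
    "\<And>a. a \<in> A \<Longrightarrow> satisfiable T (snd c) \<Longrightarrow> satisfiable T (snd a)"
    "\<And>a g. a \<in> A \<Longrightarrow> has_instance ground_terms (fst a) g \<Longrightarrow> has_instance ground_terms (fst c) g"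
    "set_ceq T A {c} \<longleftrightarrow> instances c \<inter> instances d = {}"
proof -
  have "(\<forall>a \<in> A. good_cterm a) \<and> all_instances A = instances c - instances d \<and> separated A \<and> finite A \<and>
    (\<forall>a \<in> A. \<forall>n. depth_le n (fst c) \<longrightarrow> depth_le n (fst d) \<longrightarrow> depth_le n (fst a)) \<and>
    (\<forall>a \<in> A. satisfiable T (snd c) \<longrightarrow> satisfiable T (snd a)) \<and>
    (\<forall>a \<in> A. \<forall>g. has_instance ground_terms (fst a) g \<longrightarrow> has_instance ground_terms (fst c) g) \<and>
    (set_ceq T A {c} \<longleftrightarrow> instances c \<inter> instances d = {})"
  proof (cases "instances c \<inter> instances d = {}")
    case True
    then have "A = {c}" using A overlap_iff[OF i g] unfolding cdiff_def by blast
    then show ?thesis using True g(1) ceq_refl[of T c] by (auto simp: all_instances_def separated_def set_ceq_def)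
  next
    case False
    then obtain d' \<sigma> where d': "disjoint_variant c d d'" "cunifier T \<Sigma> c d' \<sigma>"
      and A: "represents T A (diff_set T \<Sigma> C c d' \<sigma>)"
      using A overlap_iff[OF i g] unfolding cdiff_def by blast
    interpret u: unif T F R "fst c" "fst d'" "snd c" "snd d'" \<sigma> using unif_of_cunifier[OF d'(1) g d'(2)] .
    note v = variant_facts[OF d'(1) g]
    let ?D = "diff_set T \<Sigma> C c d' \<sigma>"
    have A: "finite A" "A \<subseteq> ?D" "set_ceq T A ?D" using A by (auto simp: represents_def)
    have good_cterm: "good_cterm a" if "a \<in> ?D" for a using u.diff_set_good_cterm(1) that by simp
    have sat: "satisfiable T (snd a)" if "a \<in> A" for a
    proof -
      have "a \<in> diff_set T \<Sigma> C (fst c, snd c) (fst d', snd d') \<sigma>" using that A(2) by auto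
      then show ?thesis using u.diff_set_good_cterm(3) u.cunifier_iff d'(2) by simp
    qed
    have le: "depth_le n (fst a)" if "a \<in> A" "depth_le n (fst c)" "depth_le n (fst d)" for a n
      using u.diff_set_good_cterm(2)[of a n] A(2) that v(4) by auto
    have inst: "has_instance ground_terms (fst c) g" if "a \<in> A" "has_instance ground_terms (fst a) g" for a g
      using u.diff_set_instance[of a g] A(2) that by auto
    have "all_instances A = all_instances ?D"
    proof (intro equalityI subsetI)
      fix g assume "g \<in> all_instances A" then show "g \<in> all_instances ?D" using A(2) by (auto simp: all_instances_def)
    next
      fix g assume "g \<in> all_instances ?D"
      then obtain b where b: "b \<in> ?D" "g \<in> instances b" by (auto simp: all_instances_def)
      then obtain a where a: "a \<in> A" "ceq T a b" using A(3) unfolding set_ceq_def by blast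
      then show "g \<in> all_instances A" using ceq_instances[OF a(2)] good_cterm A(2) b unfolding all_instances_def by blast
    qed
    then have S: "all_instances A = instances c - instances d" using u.instances_diff_set v(2) unfolding all_instances_def by simp
    have sep: "separated A"
      unfolding separated_def
    proof (intro ballI)
      fix a b assume ab: "a \<in> A" "b \<in> A"
      then show "ceq T a b \<or> instances a \<inter> instances b = {}"
        using u.diff_set_disjoint[of a b] instances_has_instance[of _ a] instances_has_instance[of _ b] A(2) by auto
    qed
    have "\<not> set_ceq T A {c}"
    proof
      assume "set_ceq T A {c}"
      then obtain a where a: "a \<in> A" "ceq T a c" unfolding set_ceq_def by blast
      then have "instances a = instances c" using ceq_instances g(1) good_cterm A(2) by blast
      then show False using a(1) S False unfolding all_instances_def by blast
    qed
    then show ?thesis using good_cterm A(1,2) sat le inst S sep False by blast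
  qed
  then show "\<And>a. a \<in> A \<Longrightarrow> good_cterm a" "all_instances A = instances c - instances d" "separated A" "finite A"
    "\<And>a n. a \<in> A \<Longrightarrow> depth_le n (fst c) \<Longrightarrow> depth_le n (fst d) \<Longrightarrow> depth_le n (fst a)"
    "\<And>a. a \<in> A \<Longrightarrow> satisfiable T (snd c) \<Longrightarrow> satisfiable T (snd a)"
    "\<And>a g. a \<in> A \<Longrightarrow> has_instance ground_terms (fst a) g \<Longrightarrow> has_instance ground_terms (fst c) g"
    "set_ceq T A {c} \<longleftrightarrow> instances c \<inter> instances d = {}" by blast+
qed

text \<open>
  A finite set of ground terms that contains an instance of every pattern of depth at most \<open>n\<close>. Counting
  instances in it bounds the number of steps of the complement procedure.
\<close>

definition test_set :: "nat \<Rightarrow> ('f, 's) trm set \<Rightarrow> bool" where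
  "test_set n G \<longleftrightarrow> finite G \<and> (\<forall>u. lin_pattern u \<and> depth_le n u \<longrightarrow> (\<exists>g \<in> G. has_instance ground_terms u g))"

lemma finite_dom_F: "finite (dom F)"
  using adm by (simp add: admissible_def)

lemma finite_arg_sorts: "finite arg_sorts"
proof -
  have "arg_sorts \<subseteq> (\<Union>f \<in> dom F. set (fst (the (F f))))" by (force simp: arg_sorts_def)
  then show ?thesis by (rule finite_subset) (simp add: finite_dom_F)
qed

text \<open>Up to variable names there are finitely many patterns of bounded depth. Instantiating
  each variable by one fixed inhabitant of its sort erases the names.\<close>

lemma test_set_exists:
  assumes i: inhabited shows "\<exists>G. test_set n G"
proof -
  define g where "g \<tau> = (SOME t. t \<in> ground_terms \<tau>)" for \<tau>
  have g: "g \<tau> \<in> ground_terms \<tau>" if "\<tau> \<in> arg_sorts" for \<tau>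
    using i that unfolding g_def inhabited_def by (simp add: some_in_eq)
  define \<gamma> where "\<gamma> x = g (snd x)" for x :: "'s vr"
  define H where "H n = {u \<cdot> \<gamma> | u \<sigma>. depth_le n u \<and> wt \<Sigma> u \<sigma> \<and> funs u \<subseteq> dom F \<and> snd ` vars u \<subseteq> arg_sorts}" for n
  \<comment> \<open>The truncated subtraction is harmless: within the bound 0 there are only
    variables, which fall under the first set.\<close>
  have step: "H n \<subseteq> g ` arg_sorts \<union>
      (\<Union>f \<in> dom F. Fun f ` {ts. set ts \<subseteq> H (n - 1) \<and> length ts = length (fst (the (F f)))})" for n
  proof
    fix w assume "w \<in> H n"
    then obtain u \<sigma> where u: "w = u \<cdot> \<gamma>" "depth_le n u" "wt \<Sigma> u \<sigma>" "funs u \<subseteq> dom F" "snd ` vars u \<subseteq> arg_sorts"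
      by (auto simp: H_def)
    show "w \<in> g ` arg_sorts \<union>
      (\<Union>f \<in> dom F. Fun f ` {ts. set ts \<subseteq> H (n - 1) \<and> length ts = length (fst (the (F f)))})"
    proof (cases u)
      case (Var x)
      then show ?thesis using u by (auto simp: \<gamma>_def)
    next
      case (Fun f us)
      then have f: "f \<in> dom F" using u(4) by simp
      then obtain \<sigma>s \<tau> where F: "F f = Some (\<sigma>s, \<tau>)" by fastforce
      then have wt: "length us = length \<sigma>s" "\<forall>i < length us. wt \<Sigma> (us ! i) (\<sigma>s ! i)"
        using u(3) sig_F unfolding Fun by (auto simp: wt_Fun_iff)
      obtain m where m: "n = Suc m" "\<forall>u \<in> set us. depth_le m u" using u(2) unfolding Fun depth_le_Fun by blast
      have "u' \<cdot> \<gamma> \<in> H m" if u': "u' \<in> set us" for u'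
      proof -
        obtain j where "j < length us" "u' = us ! j" using u' by (auto simp: in_set_conv_nth)
        then have "wt \<Sigma> u' (\<sigma>s ! j)" using wt by simp
        moreover have "funs u' \<subseteq> dom F" "snd ` vars u' \<subseteq> arg_sorts" using u(4,5) u' unfolding Fun by auto
        ultimately show ?thesis using m(2) u' unfolding H_def by blast
      qed
      then show ?thesis
        using f F wt(1) unfolding u(1) Fun m(1)
        by (intro UnI2 UN_I[of f] image_eqI[of _ _ "map (\<lambda>t. t \<cdot> \<gamma>) us"]) auto
    qed
  qed
  have fin: "finite (g ` arg_sorts)" using finite_arg_sorts by simp
  have "finite (H n)" for n
  proof (induction n)
    case 0
    have "H 0 \<subseteq> g ` arg_sorts" by (auto simp: H_def \<gamma>_def depth_le_Fun elim: depth_le.elims)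
    then show ?case using fin finite_subset by blast
  next
    case (Suc n)
    have "finite {ts. set ts \<subseteq> H n \<and> length ts = k}" for k using finite_lists_length_eq[OF Suc] .
    then have "finite (\<Union>f \<in> dom F. Fun f ` {ts. set ts \<subseteq> H n \<and> length ts = length (fst (the (F f)))})"
      using finite_dom_F by auto
    then show ?case using step[of "Suc n"] fin by (auto intro: finite_subset)
  qed
  moreover have "\<exists>g \<in> H n. has_instance ground_terms u g" if u: "lin_pattern u" "depth_le n u" for u
  proof
    have ar: "snd ` vars u \<subseteq> arg_sorts" using lin_pattern_arg_sorts[OF u(1)] by blast
    obtain \<tau> where "wt \<Sigma> u \<tau>" using lin_pattern_wt[OF u(1)] by blast
    moreover have "funs u \<subseteq> dom F" using u(1) C0_sort unfolding lin_pattern_def C0_def by fastforce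
    ultimately show "u \<cdot> \<gamma> \<in> H n" using u(2) ar unfolding H_def by blast
    show "has_instance ground_terms u (u \<cdot> \<gamma>)" using g ar by (auto simp: \<gamma>_def intro!: has_instance_inst)
  qed
  ultimately show ?thesis unfolding test_set_def by blast
qed

definition test_instances :: "('f, 's) trm set \<Rightarrow> ('f, 's) cterm \<Rightarrow> ('f, 's) trm set" where
  "test_instances G a = {g \<in> G. has_instance ground_terms (fst a) g}"

text \<open>\<open>diff_set\<close> is infinite through the choice of fresh variables. Each member
  has a test term, and members that share one are equivalent. Choosing one member for each occurring
  set of test terms thus yields finitely many representatives, whose test sets are moreover
  disjoint.\<close>

lemma cdiff_exists:
  assumes i: inhabited and g: "good_cterm c" "good_cterm d" and G: "test_set n G" and le: "depth_le n (fst c)" "depth_le n (fst d)"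
  shows "\<exists>A. cdiff T \<Sigma> C c d A \<and> (\<forall>a \<in> A. \<forall>b \<in> A. a \<noteq> b \<longrightarrow> test_instances G a \<inter> test_instances G b = {})"
proof (cases "instances c \<inter> instances d = {}")
  case True
  then have "cdiff T \<Sigma> C c d {c}" using overlap_iff[OF i g] unfolding cdiff_def by blast
  then show ?thesis by blast
next
  case False
  then obtain d' \<sigma> where d': "disjoint_variant c d d'" "cunifier T \<Sigma> c d' \<sigma>"
    using overlap_iff[OF i g] by blast
  interpret u: unif T F R "fst c" "fst d'" "snd c" "snd d'" \<sigma> using unif_of_cunifier[OF d'(1) g d'(2)] .
  let ?D = "diff_set T \<Sigma> C c d' \<sigma>"
  have fG: "finite G" using G by (simp add: test_set_def)
  have shared: "ceq T a b" if "a \<in> ?D" "b \<in> ?D" "test_instances G a \<inter> test_instances G b \<noteq> {}" for a b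
    using u.diff_set_disjoint[of a b] that by (auto simp: test_instances_def)
  have same: "test_instances G a = test_instances G b" if "a \<in> ?D" "b \<in> ?D" "test_instances G a \<inter> test_instances G b \<noteq> {}" for a b
    using ceq_rename_has_instance[OF shared[OF that]] by (auto simp: test_instances_def)
  have ne: "test_instances G a \<noteq> {}" if "a \<in> ?D" for a
  proof -
    have "lin_pattern (fst a)" using u.diff_set_good_cterm(1)[of a] that by (auto simp: good_cterm_def)
    moreover have "depth_le n (fst a)"
      using u.diff_set_good_cterm(2)[of a n] that le variant_facts(4)[OF d'(1) g] by auto
    ultimately show ?thesis using G unfolding test_set_def test_instances_def by blast
  qed
  define pick where "pick I = (SOME a. a \<in> ?D \<and> test_instances G a = I)" for I
  have pick: "pick (test_instances G a) \<in> ?D \<and> test_instances G (pick (test_instances G a)) = test_instances G a" if "a \<in> ?D" for a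
    unfolding pick_def by (rule someI[of _ a]) (simp add: that)
  define A where "A = (\<lambda>a. pick (test_instances G a)) ` ?D"
  have "A = pick ` (test_instances G ` ?D)" by (auto simp: A_def)
  moreover have "finite (test_instances G ` ?D)" using fG by (rule_tac finite_subset[of _ "Pow G"]) (auto simp: test_instances_def)
  ultimately have "finite A" by simp
  moreover have "A \<subseteq> ?D" using pick by (auto simp: A_def)
  moreover have "set_ceq T A ?D"
    unfolding set_ceq_def
  proof (intro conjI ballI)
    fix a assume "a \<in> A" then show "\<exists>b \<in> ?D. ceq T a b" using \<open>A \<subseteq> ?D\<close> ceq_refl by blast
  next
    fix b assume b: "b \<in> ?D"
    then have "ceq T (pick (test_instances G b)) b" using pick[OF b] ne[OF b] by (intro shared) auto
    then show "\<exists>a \<in> A. ceq T a b" using b by (auto simp: A_def)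
  qed
  ultimately have "cdiff T \<Sigma> C c d A" unfolding cdiff_def represents_def using d' by blast
  moreover have "test_instances G a \<inter> test_instances G b = {}" if ab: "a \<in> A" "b \<in> A" "a \<noteq> b" for a b
  proof (rule ccontr)
    assume sh: "test_instances G a \<inter> test_instances G b \<noteq> {}"
    obtain a' b' where a': "a' \<in> ?D" "a = pick (test_instances G a')" and b': "b' \<in> ?D" "b = pick (test_instances G b')"
      using ab by (auto simp: A_def)
    have "test_instances G a = test_instances G b" using same sh ab \<open>A \<subseteq> ?D\<close> by blast
    then have "test_instances G a' = test_instances G b'" using pick[OF a'(1)] pick[OF b'(1)] a'(2) b'(2) by simp
    then show False using a'(2) b'(2) ab(3) by simp
  qed
  ultimately show ?thesis by blast
qed

definition invariant :: "('f, 's) cterm set \<Rightarrow> ('f, 's) cterm set \<Rightarrow> bool" where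
  "invariant P Q \<longleftrightarrow> finite P \<and> finite Q \<and> (\<forall>p \<in> P. good_cterm p \<and> satisfiable T (snd p)) \<and> (\<forall>q \<in> Q. good_cterm q) \<and> separated P"

lemma diff_step_invariant:
  assumes i: inhabited and I: "invariant P Q" and st: "diff_step T \<Sigma> C (P, Q) (P', Q')"
  shows "invariant P' Q'" "all_instances P' - all_instances Q' = all_instances P - all_instances Q"
    "\<forall>a \<in> P \<union> Q. depth_le n (fst a) \<Longrightarrow> \<forall>a \<in> P' \<union> Q'. depth_le n (fst a)"
proof -
  from st obtain c d A B where c: "c \<in> P" and d: "d \<in> Q" and A: "cdiff T \<Sigma> C c d A" and B: "cdiff T \<Sigma> C d c B"
    and P': "P' = {p \<in> P. \<not> ceq T p c} \<union> A" and Q': "Q' = {q \<in> Q. \<not> ceq T q d} \<union> B"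
    by cases auto
  have g: "good_cterm c" "good_cterm d" using I c d by (auto simp: invariant_def)
  note a = cdiff_facts[OF i g A]
  note b = cdiff_facts[OF i g(2,1) B]
  have sat: "satisfiable T (snd c)" using I c by (auto simp: invariant_def)
  have sep: "instances p \<inter> instances c = {}" if "p \<in> P" "\<not> ceq T p c" for p
    using I that c unfolding invariant_def separated_def by blast
  have sub: "instances x \<subseteq> instances c" if "x \<in> A" for x using a(2) that unfolding all_instances_def by blast
  have "separated P'"
    unfolding separated_def P'
  proof (intro ballI)
    fix x y assume x: "x \<in> {p \<in> P. \<not> ceq T p c} \<union> A" and y: "y \<in> {p \<in> P. \<not> ceq T p c} \<union> A"
    show "ceq T x y \<or> instances x \<inter> instances y = {}"
    proof (cases "x \<in> A"; cases "y \<in> A")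
      assume "x \<in> A" "y \<in> A" then show ?thesis using a(3) by (simp add: separated_def)
    next
      assume "x \<in> A" "y \<notin> A" then show ?thesis using sub[of x] sep[of y] y by blast
    next
      assume "x \<notin> A" "y \<in> A" then show ?thesis using sub[of y] sep[of x] x by blast
    next
      assume "x \<notin> A" "y \<notin> A" then show ?thesis using x y I by (auto simp: invariant_def separated_def)
    qed
  qed
  then show "invariant P' Q'"
    using I a(1,4,6) b(1,4) sat unfolding invariant_def P' Q' by auto
  have cP: "instances p = instances c" if "p \<in> P" "ceq T p c" for p
    using ceq_instances that I g(1) by (auto simp: invariant_def)
  have dQ: "instances q = instances d" if "q \<in> Q" "ceq T q d" for q
    using ceq_instances that I g(2) by (auto simp: invariant_def)
  have SP: "all_instances P' = all_instances P - instances c \<union> (instances c - instances d)"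
  proof -
    have "all_instances {p \<in> P. \<not> ceq T p c} = all_instances P - instances c"
    proof (intro equalityI subsetI)
      fix g assume "g \<in> all_instances {p \<in> P. \<not> ceq T p c}"
      then obtain p where p: "p \<in> P" "\<not> ceq T p c" "g \<in> instances p" unfolding all_instances_def by blast
      then show "g \<in> all_instances P - instances c" using sep[OF p(1,2)] unfolding all_instances_def by auto
    next
      fix g assume "g \<in> all_instances P - instances c"
      then obtain p where p: "p \<in> P" "g \<in> instances p" "g \<notin> instances c" unfolding all_instances_def by blast
      then have "\<not> ceq T p c" using cP[of p] by auto
      then show "g \<in> all_instances {p \<in> P. \<not> ceq T p c}" using p unfolding all_instances_def by auto
    qed
    moreover have "all_instances P' = all_instances {p \<in> P. \<not> ceq T p c} \<union> all_instances A" unfolding P' all_instances_def by blast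
    ultimately show ?thesis using a(2) by simp
  qed
  have "all_instances Q' = all_instances {q \<in> Q. \<not> ceq T q d} \<union> all_instances B" unfolding Q' all_instances_def by blast
  then have Q'': "all_instances Q' = all_instances {q \<in> Q. \<not> ceq T q d} \<union> (instances d - instances c)" using b(2) by simp
  \<comment> \<open>\<open>Q\<close> is not known to be separated, so other members may still cover
    what is cut off from \<open>d\<close>. Two inclusions suffice: whatever disappears from
    \<open>Q\<close> lies in both \<open>c\<close> and \<open>d\<close>, and this part has left
    \<open>P\<close> as well.\<close>
  have SQ1: "all_instances Q' \<subseteq> all_instances Q" unfolding Q'' using d unfolding all_instances_def by blast
  have SQ2: "all_instances Q - (instances c \<inter> instances d) \<subseteq> all_instances Q'"
  proof
    fix g assume "g \<in> all_instances Q - (instances c \<inter> instances d)"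
    then obtain q where "q \<in> Q" "g \<in> instances q" "g \<notin> instances c \<inter> instances d" unfolding all_instances_def by blast
    note q = this
    show "g \<in> all_instances Q'"
    proof (cases "ceq T q d")
      case True
      then show ?thesis using q dQ[of q] unfolding Q'' by simp
    next
      case False
      then show ?thesis using q unfolding Q'' by (auto simp: all_instances_def)
    qed
  qed
  show "all_instances P' - all_instances Q' = all_instances P - all_instances Q"
  proof -
    have "instances c \<subseteq> all_instances P" "instances d \<subseteq> all_instances Q" using c d unfolding all_instances_def by blast+
    then show ?thesis using SP SQ1 SQ2 by blast
  qed
  show "\<forall>a \<in> P \<union> Q. depth_le n (fst a) \<Longrightarrow> \<forall>a \<in> P' \<union> Q'. depth_le n (fst a)"
    using a(5) b(5) c d unfolding P' Q' by auto
qed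

lemma diff_steps_invariant:
  assumes i: inhabited and "invariant P Q" "(diff_step T \<Sigma> C)\<^sup>*\<^sup>* (P, Q) (P', Q')"
  shows "invariant P' Q' \<and> all_instances P' - all_instances Q' = all_instances P - all_instances Q"
proof -
  have "invariant (fst Y) (snd Y) \<and> all_instances (fst Y) - all_instances (snd Y) = all_instances P - all_instances Q"
    if "(diff_step T \<Sigma> C)\<^sup>*\<^sup>* (P, Q) Y" for Y
    using that
  proof (induction rule: rtranclp_induct)
    case (step Y Z)
    then show ?case
      using diff_step_invariant(1,2)[OF i, of "fst Y" "snd Y" "fst Z" "snd Z"] by auto
  qed (use assms(2) in simp)
  from this[OF assms(3)] show ?thesis by simp
qed

lemma depth_le_bound: "finite A \<Longrightarrow> \<exists>n. \<forall>a \<in> A. depth_le n (fst a)"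
proof (induction A rule: finite_induct)
  case (insert a A)
  then obtain n m where "\<forall>a \<in> A. depth_le n (fst a)" "depth_le m (fst a)" using depth_le_exists by metis
  then have "\<forall>b \<in> insert a A. depth_le (max n m) (fst b)" using depth_le_mono by (metis insert_iff max.cobounded1 max.cobounded2)
  then show ?case by blast
qed simp

text \<open>\<open>diff_final\<close> speaks about existing difference sets, so an overlap
  contradicts it only after a finite representation of the difference has been exhibited.\<close>

lemma diff_final_disjoint:
  assumes i: inhabited and I: "invariant P Q" and f: "diff_final T \<Sigma> C P Q"
  shows "all_instances P \<inter> all_instances Q = {}"
proof (rule ccontr)
  assume "all_instances P \<inter> all_instances Q \<noteq> {}"
  then obtain c d where cd: "c \<in> P" "d \<in> Q" "instances c \<inter> instances d \<noteq> {}" unfolding all_instances_def by blast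
  have g: "good_cterm c" "good_cterm d" using I cd by (auto simp: invariant_def)
  obtain n where "\<forall>a \<in> {c, d}. depth_le n (fst a)" using depth_le_bound[of "{c, d}"] by blast
  moreover obtain G where "test_set n G" using test_set_exists[OF i] by blast
  ultimately obtain A where A: "cdiff T \<Sigma> C c d A" using cdiff_exists[OF i g] by blast
  then have "\<not> set_ceq T A {c}" using cdiff_facts(8)[OF i g A] cd(3) by simp
  then show False using f A cd(1,2) unfolding diff_final_def by blast
qed

lemma sum_union_le: "finite A \<Longrightarrow> finite B \<Longrightarrow> sum f (A \<union> B) \<le> sum f A + (sum f B :: nat)"
  by (simp add: sum_Un_nat)

text \<open>One stopping run is exhibited. It takes representatives with disjoint test sets, so that
  splitting an element never raises the total weight.\<close>

lemma diff_terminates: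
  assumes i: inhabited and G: "test_set n G"
  shows "invariant P Q \<Longrightarrow> \<forall>a \<in> P \<union> Q. depth_le n (fst a) \<Longrightarrow>
    \<exists>P' Q'. (diff_step T \<Sigma> C)\<^sup>*\<^sup>* (P, Q) (P', Q') \<and> diff_final T \<Sigma> C P' Q'"
proof -
  \<comment> \<open>Terms may share test terms although their constraints exclude each other. The
    value 0 in this case makes a step count that merely strengthens a constraint.\<close>
  define w where "w p q = (if instances p \<inter> instances q = {} then 0 else card (test_instances G p \<inter> test_instances G q))" for p q
  have sym: "w p q = w q p" for p q by (simp add: w_def Int_commute)
  have fG: "finite (test_instances G a)" for a using G by (simp add: test_set_def test_instances_def)
  show "invariant P Q \<Longrightarrow> \<forall>a \<in> P \<union> Q. depth_le n (fst a) \<Longrightarrow> ?thesis"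
  proof (induction "\<Sum>p\<in>P. \<Sum>q\<in>Q. w p q" arbitrary: P Q rule: less_induct)
    case less
    note I = less.prems(1) and le = less.prems(2)
    show ?case
    proof (cases "diff_final T \<Sigma> C P Q")
      case False
      then obtain c d A0 where cd: "c \<in> P" "d \<in> Q" "cdiff T \<Sigma> C c d A0" "\<not> set_ceq T A0 {c}"
        unfolding diff_final_def by blast
      have g: "good_cterm c" "good_cterm d" using I cd by (auto simp: invariant_def)
      have o: "instances c \<inter> instances d \<noteq> {}" using cdiff_facts(8)[OF i g cd(3)] cd(4) by simp
      have lcd: "depth_le n (fst c)" "depth_le n (fst d)" using le cd by auto
      obtain A where A: "cdiff T \<Sigma> C c d A" "\<forall>a \<in> A. \<forall>b \<in> A. a \<noteq> b \<longrightarrow> test_instances G a \<inter> test_instances G b = {}"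
        using cdiff_exists[OF i g G lcd] by blast
      obtain B where B: "cdiff T \<Sigma> C d c B" "\<forall>a \<in> B. \<forall>b \<in> B. a \<noteq> b \<longrightarrow> test_instances G a \<inter> test_instances G b = {}"
        using cdiff_exists[OF i g(2,1) G lcd(2,1)] by blast
      note a = cdiff_facts[OF i g A(1)]
      note b = cdiff_facts[OF i g(2,1) B(1)]
      define P1 where "P1 = {p \<in> P. \<not> ceq T p c}"
      define Q1 where "Q1 = {q \<in> Q. \<not> ceq T q d}"
      have "\<not> set_ceq T A {c}" using a(8) o by simp
      then have st: "diff_step T \<Sigma> C (P, Q) (P1 \<union> A, Q1 \<union> B)"
        unfolding P1_def Q1_def using cd A(1) B(1) by (intro diff_step.intros)
      have fin: "finite P" "finite Q" using I by (auto simp: invariant_def)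
      have P1: "P1 \<subseteq> P - {c}" and Q1: "Q1 \<subseteq> Q - {d}" using ceq_refl by (auto simp: P1_def Q1_def)
      have fin1: "finite P1" "finite Q1" using fin by (auto simp: P1_def Q1_def)
      \<comment> \<open>The parts of \<open>c\<close> have disjoint test sets, all contained in that
        of \<open>c\<close>.\<close>
      have split: "(\<Sum>a\<in>A. w a q) \<le> w c q"
        if fA: "finite A" and dj: "\<forall>a \<in> A. \<forall>b \<in> A. a \<noteq> b \<longrightarrow> test_instances G a \<inter> test_instances G b = {}"
          and sub: "\<And>a. a \<in> A \<Longrightarrow> instances a \<subseteq> instances c" "\<And>a. a \<in> A \<Longrightarrow> test_instances G a \<subseteq> test_instances G c" for A c q
      proof (cases "instances c \<inter> instances q = {}")
        case True
        then have "\<forall>a \<in> A. w a q = 0" using sub(1) unfolding w_def by (auto split: if_splits)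
        then show ?thesis by simp
      next
        case ne: False
        have "(\<Sum>a\<in>A. w a q) \<le> (\<Sum>a\<in>A. card (test_instances G a \<inter> test_instances G q))" by (intro sum_mono) (simp add: w_def)
        also have "\<dots> = card (\<Union>a\<in>A. test_instances G a \<inter> test_instances G q)"
          using fA fG dj by (intro card_UN_disjoint[symmetric]) blast+
        also have "\<dots> \<le> card (test_instances G c \<inter> test_instances G q)" using sub(2) fG by (intro card_mono) blast+
        finally show ?thesis using ne by (simp add: w_def)
      qed
      have sA: "instances x \<subseteq> instances c - instances d" if "x \<in> A" for x using a(2) that unfolding all_instances_def by blast
      have sB: "instances x \<subseteq> instances d - instances c" if "x \<in> B" for x using b(2) that unfolding all_instances_def by blast
      have iA: "test_instances G x \<subseteq> test_instances G c" if "x \<in> A" for x using a(7)[OF that] by (auto simp: test_instances_def)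
      have iB: "test_instances G x \<subseteq> test_instances G d" if "x \<in> B" for x using b(7)[OF that] by (auto simp: test_instances_def)
      have wA: "(\<Sum>a\<in>A. w a q) \<le> w c q" for q using split[OF a(4) A(2)] sA iA by blast
      have wB: "(\<Sum>x\<in>B. w p x) \<le> w p d" for p
      proof -
        have "(\<Sum>x\<in>B. w p x) = (\<Sum>x\<in>B. w x p)" using sym by (intro sum.cong) auto
        also have "\<dots> \<le> w d p" using sB iB by (intro split[OF b(4) B(2)]) blast+
        finally show ?thesis using sym by simp
      qed
      have wAB: "w x y = 0" if "x \<in> A" "y \<in> B" for x y using sA[OF that(1)] sB[OF that(2)] by (auto simp: w_def)
      \<comment> \<open>The unified term respects the depth bound, so it has a test term, which is
        then an instance of both patterns.\<close>
      have pos: "w c d > 0"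
      proof -
        obtain d' \<sigma> where d': "disjoint_variant c d d'" "cunifier T \<Sigma> c d' \<sigma>" using overlap_iff[OF i g] o by blast
        interpret u: unif T F R "fst c" "fst d'" "snd c" "snd d'" \<sigma> using unif_of_cunifier[OF d'(1) g d'(2)] .
        note v = variant_facts[OF d'(1) g]
        have "lin_pattern (fst c \<cdot> \<sigma>)" using u.abstract_patterns(1) u.wt_\<sigma> u.funs_\<sigma> u.s\<sigma>(1) by (intro lin_pattern_app)
        moreover have "depth_le n (fst c \<cdot> \<sigma>)" using u.s\<sigma>(2) lcd v(4) by blast
        ultimately obtain e where e: "e \<in> G" "has_instance ground_terms (fst c \<cdot> \<sigma>) e" using G unfolding test_set_def by blast
        obtain \<delta> where \<delta>: "ground_on (vars (fst c \<cdot> \<sigma>)) \<delta>" "fst c \<cdot> \<sigma> \<cdot> \<delta> = e"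
          using has_instance_linear[OF e(2) u.s\<sigma>(1)] unfolding ground_on_def by blast
        have "has_instance ground_terms (fst c) e" "has_instance ground_terms (fst d') e"
          using u.ground_\<sigma>\<delta>[OF \<delta>(1)] has_instance_ground \<delta>(2) u.eq by (metis app_app)+
        then have "e \<in> test_instances G c \<inter> test_instances G d" using e(1) v(5) by (simp add: test_instances_def)
        then show ?thesis using o fG by (auto simp: w_def card_gt_0_iff)
      qed
      have "(\<Sum>p\<in>P1 \<union> A. \<Sum>q\<in>Q1 \<union> B. w p q) \<le>
          (\<Sum>p\<in>P1. \<Sum>q\<in>Q1 \<union> B. w p q) + (\<Sum>p\<in>A. \<Sum>q\<in>Q1 \<union> B. w p q)"
        using fin1 a(4) by (intro sum_union_le)
      also have "\<dots> \<le> (\<Sum>p\<in>P1. (\<Sum>q\<in>Q1. w p q) + w p d) + (\<Sum>p\<in>A. \<Sum>q\<in>Q1. w p q)"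
      proof (intro add_mono sum_mono)
        fix p show "(\<Sum>q\<in>Q1 \<union> B. w p q) \<le> (\<Sum>q\<in>Q1. w p q) + w p d"
          using sum_union_le[OF fin1(2) b(4), of "w p"] wB[of p] by linarith
      next
        fix p assume "p \<in> A"
        then have "(\<Sum>q\<in>B. w p q) = 0" using wAB by simp
        then show "(\<Sum>q\<in>Q1 \<union> B. w p q) \<le> (\<Sum>q\<in>Q1. w p q)"
          using sum_union_le[OF fin1(2) b(4), of "w p"] by linarith
      qed
      also have "(\<Sum>p\<in>A. \<Sum>q\<in>Q1. w p q) = (\<Sum>q\<in>Q1. \<Sum>p\<in>A. w p q)" by (rule sum.swap)
      also have "\<dots> \<le> (\<Sum>q\<in>Q1. w c q)" using wA by (intro sum_mono)
      also have "(\<Sum>p\<in>P1. (\<Sum>q\<in>Q1. w p q) + w p d) + (\<Sum>q\<in>Q1. w c q) \<le>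
          (\<Sum>p\<in>P - {c}. (\<Sum>q\<in>Q - {d}. w p q) + w p d) + (\<Sum>q\<in>Q - {d}. w c q)"
        using P1 Q1 fin by (intro add_mono order_trans[OF sum_mono sum_mono2] sum_mono2) auto
      \<comment> \<open>The weight of the pair \<open>c\<close>, \<open>d\<close> is lost without
        replacement: by \<open>wAB\<close> the parts in \<open>A\<close> and in \<open>B\<close>
        have weight 0 against each other.\<close>
      also have "\<dots> < (\<Sum>p\<in>P - {c}. (\<Sum>q\<in>Q - {d}. w p q) + w p d) + ((\<Sum>q\<in>Q - {d}. w c q) + w c d)"
        using pos by simp
      also have "\<dots> = (\<Sum>p\<in>P. \<Sum>q\<in>Q. w p q)"
      proof -
        have e: "sum (w p) Q = sum (w p) (Q - {d}) + w p d" for p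
          using sum.remove[OF fin(2) cd(2), of "w p"] by simp
        show ?thesis
          using sum.remove[OF fin(1) cd(1), of "\<lambda>p. \<Sum>q\<in>Q. w p q"] unfolding e by simp
      qed
      finally have "(\<Sum>p\<in>P1 \<union> A. \<Sum>q\<in>Q1 \<union> B. w p q) < (\<Sum>p\<in>P. \<Sum>q\<in>Q. w p q)" by simp
      from less.hyps[OF this diff_step_invariant(1)[OF i I st] diff_step_invariant(3)[OF i I st le]]
      show ?thesis using st by (meson converse_rtranclp_into_rtranclp)
    qed blast
  qed
qed

end

subsection \<open>Quasi-reducibility as an empty complement\<close>

lemma abs_vals_wt: "abs_vals T u u' E \<Longrightarrow> (\<And>f d. theory_sig T f = Some d \<Longrightarrow> \<Sigma> f = Some d) \<Longrightarrow> wt \<Sigma> u \<tau> \<Longrightarrow> wt \<Sigma> u' \<tau>"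
proof (induction arbitrary: \<tau> rule: abs_vals.induct)
  case (abs_Val v y)
  then show ?case by (auto simp: wt_Fun_iff)
next
  case (abs_Fun f us ts Es)
  then show ?case by (auto simp: wt_Fun_iff)
qed auto

lemma abs_vals_funs: "abs_vals T u u' E \<Longrightarrow> funs u' \<subseteq> funs u - vals T"
proof (induction rule: abs_vals.induct)
  case (abs_Fun f us ts Es)
  then have "funs (us ! i) \<subseteq> funs (ts ! i) - vals T" if "i < length us" for i using that by simp
  then have "funs t \<subseteq> (\<Union>t \<in> set ts. funs t) - vals T" if "t \<in> set us" for t
    using that abs_Fun(2) by (fastforce simp: in_set_conv_nth)
  then show ?case using abs_Fun(1) by fastforce
qed auto

lemma abs_vals_app: "abs_vals T u u' E \<Longrightarrow> (\<And>y v. (y, v) \<in> set E \<Longrightarrow> \<gamma> y = Fun v []) \<Longrightarrow> u' \<cdot> \<gamma> = u \<cdot> \<gamma>"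
proof (induction rule: abs_vals.induct)
  case (abs_Fun f us ts Es)
  have "us ! i \<cdot> \<gamma> = ts ! i \<cdot> \<gamma>" if i: "i < length ts" for i
  proof -
    have "(y, v) \<in> set (concat Es)" if "(y, v) \<in> set (Es ! i)" for y v
      using that i abs_Fun(3) by (auto intro!: bexI[of _ "Es ! i"])
    then show ?thesis using abs_Fun i by blast
  qed
  then show ?case using abs_Fun(2) by (auto intro!: nth_equalityI)
qed auto

lemma abs_vals_vars: "abs_vals T u u' E \<Longrightarrow> vars u' = vars u \<union> fst ` set E"
proof (induction rule: abs_vals.induct)
  case (abs_Fun f us ts Es)
  have "vars (Fun f us) = (\<Union>i < length ts. vars (us ! i))"
    using abs_Fun(2) by (auto simp: set_conv_nth)
  also have "\<dots> = (\<Union>i < length ts. vars (ts ! i) \<union> fst ` set (Es ! i))" using abs_Fun(4) by simp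
  also have "\<dots> = (\<Union>i < length ts. vars (ts ! i)) \<union> (\<Union>i < length ts. fst ` set (Es ! i))" by blast
  also have "(\<Union>i < length ts. vars (ts ! i)) = vars (Fun f ts)"
    by (auto simp: set_conv_nth)
  also have "(\<Union>i < length ts. fst ` set (Es ! i)) = (\<Union>e \<in> set Es. fst ` set e)"
    using abs_Fun(3) by (auto simp: set_conv_nth)
  also have "\<dots> = fst ` set (concat Es)" by auto
  finally show ?case .
qed auto

lemma abs_vals_values: "abs_vals T u u' E \<Longrightarrow> (y, v) \<in> set E \<Longrightarrow> v \<in> vals T \<and> theory_sig T v = Some ([], snd y)"
proof (induction rule: abs_vals.induct)
  case (abs_Fun f us ts Es)
  then obtain i where "i < length Es" "(y, v) \<in> set (Es ! i)" by (auto simp: in_set_conv_nth[of _ Es])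
  then show ?case using abs_Fun by auto
qed auto

lemma abs_vals_linear:
  "abs_vals T u u' E \<Longrightarrow> linear u \<Longrightarrow> distinct (map fst E) \<Longrightarrow> fst ` set E \<inter> vars u = {} \<Longrightarrow> linear u'"
proof (induction rule: abs_vals.induct)
  case (abs_Fun f us ts Es)
  have sub: "fst ` set (Es ! i) \<subseteq> fst ` set (concat Es)" if "i < length ts" for i
  proof -
    have "Es ! i \<in> set Es" using that abs_Fun(3) by simp
    then have "set (Es ! i) \<subseteq> set (concat Es)" by auto
    then show ?thesis by (rule image_mono)
  qed
  have d: "distinct (concat (map (map fst) Es))" using abs_Fun.prems(2) by (simp add: map_concat)
  then have d1: "distinct (map fst (Es ! i))" if "i < length ts" for i
    using that abs_Fun(3) unfolding distinct_concat_nth by simp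
  have d2: "fst ` set (Es ! i) \<inter> fst ` set (Es ! j) = {}" if "i < length ts" "j < length ts" "i \<noteq> j" for i j
    using that abs_Fun(3) d unfolding distinct_concat_nth by simp
  have tv: "vars (ts ! i) \<subseteq> vars (Fun f ts)" if "i < length ts" for i using that by (rule vars_nth)
  have lin: "linear (us ! i)" if "i < length ts" for i
  proof -
    have "fst ` set (Es ! i) \<inter> vars (ts ! i) = {}"
      using sub[OF that] tv[OF that] abs_Fun.prems(3) by (meson disjoint_iff subsetD)
    then show ?thesis using abs_Fun.IH abs_Fun.prems(1) d1[OF that] that by (auto simp: linear_Fun)
  qed
  have vu: "vars (us ! i) = vars (ts ! i) \<union> fst ` set (Es ! i)" if "i < length ts" for i
    using abs_vals_vars abs_Fun.IH that by metis
  have "vars (us ! i) \<inter> vars (us ! j) = {}" if ij: "i < length ts" "j < length ts" "i \<noteq> j" for i j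
  proof -
    have "vars (ts ! i) \<inter> vars (ts ! j) = {}" using abs_Fun.prems(1) ij by (simp add: linear_Fun)
    moreover have "fst ` set (Es ! i) \<inter> vars (ts ! j) = {}" "fst ` set (Es ! j) \<inter> vars (ts ! i) = {}"
    proof -
      have "fst ` set (concat Es) \<inter> vars (ts ! j) = {}" "fst ` set (concat Es) \<inter> vars (ts ! i) = {}"
        using tv[OF ij(1)] tv[OF ij(2)] abs_Fun.prems(3) by (meson disjoint_iff subsetD)+
      then show "fst ` set (Es ! i) \<inter> vars (ts ! j) = {}" "fst ` set (Es ! j) \<inter> vars (ts ! i) = {}"
        using sub[OF ij(1)] sub[OF ij(2)] by (meson disjoint_iff subsetD)+
    qed
    ultimately show ?thesis unfolding vu[OF ij(1)] vu[OF ij(2)] using d2[OF ij] by (simp add: Int_Un_distrib Int_Un_distrib2 Int_commute)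
  qed
  then show ?case using lin abs_Fun(2) by (simp add: linear_Fun)
qed auto

context admissible_lctrs
begin

lemma abs_vals_exists:
  "wt \<Sigma> u \<tau> \<Longrightarrow> finite X \<Longrightarrow> \<exists>u' E. abs_vals T u u' E \<and> distinct (map fst E) \<and> fst ` set E \<inter> X = {}"
proof (induction u arbitrary: \<tau> X)
  case (Var x)
  show ?case by (intro exI[of _ "Var x"] exI[of _ "[]"]) (auto intro: abs_Var)
next
  case (Fun f ts)
  show ?case
  proof (cases "f \<in> vals T")
    case True
    then obtain \<iota> where \<iota>: "theory_sig T f = Some ([], \<iota>)" using vals_sort by blast
    then have "ts = []" using Fun.prems(1) sig_theory by (auto simp: wt_Fun_iff)
    obtain ys :: "'s vr list" where "map snd ys = [\<iota>]" "set ys \<inter> X = {}"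
      using fresh_vars[OF Fun.prems(2), of "[\<iota>]"] by metis
    then obtain y where "snd y = \<iota>" "y \<notin> X" by auto
    then show ?thesis
      using abs_Val[OF True, of y] \<iota> \<open>ts = []\<close> by (intro exI[of _ "Var y"] exI[of _ "[(y, f)]"]) auto
  next
    case False
    have "\<exists>us Es. length us = length ts \<and> length Es = length ts \<and>
        (\<forall>i < length ts. abs_vals T (ts ! i) (us ! i) (Es ! i)) \<and>
        distinct (map fst (concat Es)) \<and> fst ` set (concat Es) \<inter> X = {}"
      if "finite X" "\<forall>t \<in> set ts. \<exists>\<tau>. wt \<Sigma> t \<tau>" for X
      using that Fun.IH
    proof (induction ts arbitrary: X)
      case (Cons t ts)
      obtain \<tau> where \<tau>: "wt \<Sigma> t \<tau>" using Cons.prems(2) by auto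
      obtain u E where u: "abs_vals T t u E" "distinct (map fst E)" "fst ` set E \<inter> X = {}"
        using Cons.prems(3)[OF _ \<tau> Cons.prems(1)] by auto
      have "finite (X \<union> fst ` set E)" using Cons.prems(1) by simp
      then obtain us Es where us: "length us = length ts" "length Es = length ts"
        "\<forall>i < length ts. abs_vals T (ts ! i) (us ! i) (Es ! i)"
        "distinct (map fst (concat Es))" "fst ` set (concat Es) \<inter> (X \<union> fst ` set E) = {}"
        using Cons.IH[OF \<open>finite (X \<union> fst ` set E)\<close>] Cons.prems(2,3) by auto
      have "distinct (map fst (concat (E # Es)))" "fst ` set (concat (E # Es)) \<inter> X = {}"
        using us(4,5) u(2,3) by auto
      moreover have "\<forall>i < length (t # ts). abs_vals T ((t # ts) ! i) ((u # us) ! i) ((E # Es) ! i)"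
        using us(3) u(1) by (auto simp: less_Suc_eq_0_disj)
      ultimately show ?case using us(1,2) by (intro exI[of _ "u # us"] exI[of _ "E # Es"]) simp
    qed simp
    moreover have "\<forall>t \<in> set ts. \<exists>\<tau>. wt \<Sigma> t \<tau>" using Fun.prems(1) by (auto simp: wt_Fun_iff in_set_conv_nth) blast
    ultimately obtain us Es where us: "length us = length ts" "length Es = length ts"
      "\<forall>i < length ts. abs_vals T (ts ! i) (us ! i) (Es ! i)"
      "distinct (map fst (concat Es))" "fst ` set (concat Es) \<inter> X = {}"
      using Fun.prems(2) by meson
    then show ?thesis using abs_Fun[OF False us(1-3)] by blast
  qed
qed

lemma eq_constraint:
  assumes v: "v \<in> vals T" "theory_sig T v = Some ([], snd y)"
  shows "is_constraint T (c_eq T y (Fun v []))"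
    "\<gamma> y \<in> value_terms (snd y) \<Longrightarrow> holds \<gamma> (c_eq T y (Fun v [])) \<longleftrightarrow> \<gamma> y = Fun v []"
proof -
  have th: "snd y \<in> th" using theory_sig_sorts(2)[OF v(2)] .
  show "is_constraint T (c_eq T y (Fun v []))"
    using bool_facts(11)[OF th] v(2) unfolding is_constraint_def by (auto simp: wt_Fun_iff less_Suc_eq)
  assume "\<gamma> y \<in> value_terms (snd y)"
  then obtain w where w: "\<gamma> y = Fun w []" "w \<in> vals T" "theory_sig T w = Some ([], snd y)"
    by (auto simp: value_terms_def)
  show "holds \<gamma> (c_eq T y (Fun v [])) \<longleftrightarrow> \<gamma> y = Fun v []"
    using bool_facts(12)[OF th val_universe[OF w(3)] val_universe[OF v(2)]] val_inj[OF w(2) v(1) w(3) v(2)] w(1)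
    by (auto simp: holds_def)
qed

lemma abs_constraint:
  assumes "is_constraint T \<phi>" "\<And>y v. (y, v) \<in> set E \<Longrightarrow> v \<in> vals T \<and> theory_sig T v = Some ([], snd y)"
  defines "\<phi>' \<equiv> foldl (\<lambda>\<chi> (y, v). c_and T \<chi> (c_eq T y (Fun v []))) \<phi> E"
  shows "is_constraint T \<phi>' \<and> vars \<phi>' = vars \<phi> \<union> fst ` set E \<and>
    (\<forall>\<gamma>. (\<forall>x \<in> vars \<phi> \<union> fst ` set E. \<gamma> x \<in> value_terms (snd x)) \<longrightarrow>
      holds \<gamma> \<phi>' \<longleftrightarrow> holds \<gamma> \<phi> \<and> (\<forall>(y, v) \<in> set E. \<gamma> y = Fun v []))"
  using assms(1,2) unfolding \<phi>'_def
proof (induction E arbitrary: \<phi>)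
  case (Cons e E)
  obtain y v where e: "e = (y, v)" by fastforce
  have v: "v \<in> vals T" "theory_sig T v = Some ([], snd y)" using Cons.prems(2)[of y v] e by auto
  let ?\<chi> = "c_and T \<phi> (c_eq T y (Fun v []))"
  have c: "is_constraint T ?\<chi>" using Cons.prems(1) eq_constraint(1)[OF v] by (rule constraint_and)
  have vs: "vars ?\<chi> = insert y (vars \<phi>)" by auto
  have h: "holds \<gamma> ?\<chi> \<longleftrightarrow> holds \<gamma> \<phi> \<and> \<gamma> y = Fun v []" if "\<forall>x \<in> insert y (vars \<phi>). \<gamma> x \<in> value_terms (snd x)" for \<gamma>
    using holds_and[OF Cons.prems(1) eq_constraint(1)[OF v], of \<gamma>] eq_constraint(2)[OF v, of \<gamma>] that by auto
  have pe: "v \<in> vals T \<and> theory_sig T v = Some ([], snd y)" if "(y, v) \<in> set E" for y v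
    using Cons.prems(2)[of y v] that by simp
  note IH = Cons.IH[OF c pe, unfolded vs]
  show ?case
    unfolding e foldl_Cons prod.case
  proof (intro conjI allI impI)
    fix \<gamma> :: "('f, 's) subst"
    assume "\<forall>x \<in> vars \<phi> \<union> fst ` set ((y, v) # E). \<gamma> x \<in> value_terms (snd x)"
    then have g: "\<forall>x \<in> insert y (vars \<phi>) \<union> fst ` set E. \<gamma> x \<in> value_terms (snd x)" by simp
    then show "holds \<gamma> (foldl (\<lambda>\<chi> (y, v). c_and T \<chi> (c_eq T y (Fun v []))) ?\<chi> E) \<longleftrightarrow>
        holds \<gamma> \<phi> \<and> (\<forall>(y, v) \<in> set ((y, v) # E). \<gamma> y = Fun v [])"
      using IH h[of \<gamma>] by simp
  qed (use IH in simp_all)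
qed simp

text \<open>Such a term is a variable or a value. Hence a left-hand side that is a pattern with a
  calculation symbol at the root would be a theory term; this is how \<open>pattern_rule\<close>
  excludes it.\<close>

lemma theory_term:
  assumes "wt \<Sigma> u \<sigma>" "\<sigma> \<in> th" "funs u \<subseteq> C" shows "wt (theory_sig T) u \<sigma>"
proof (cases u)
  case (Fun c us)
  then have c: "c \<in> C" using assms(3) by simp
  obtain \<sigma>s where s: "\<Sigma> c = Some (\<sigma>s, \<sigma>)" "length us = length \<sigma>s" using assms(1) Fun by (auto simp: wt_Fun_iff)
  have "c \<in> vals T" using constructor_cases[OF c] C0_sort[of c] sig_F[of c] s(1) assms(2) by auto
  then obtain \<iota> where "theory_sig T c = Some ([], \<iota>)" using vals_sort by blast
  then show ?thesis using s sig_theory[of c] unfolding Fun by (auto simp: wt_Fun_iff)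
qed (use assms in auto)

lemma pattern_rule:
  assumes R: "(l, r, \<phi>) \<in> R" and p: "is_pattern T F R l"
  obtains f us \<sigma>s \<tau> where "l = Fun f us" "F f = Some (\<sigma>s, \<tau>)" "f \<notin> vals T" "f \<in> defined_syms T R - calc_syms T"
    "length us = length \<sigma>s" "\<And>i. i < length us \<Longrightarrow> wt \<Sigma> (us ! i) (\<sigma>s ! i)" "\<And>u. u \<in> set us \<Longrightarrow> funs u \<subseteq> C"
    "wt \<Sigma> l \<tau>" "linear l"
proof -
  obtain f us where l: "l = Fun f us" "f \<in> defined_syms T R" "\<And>u. u \<in> set us \<Longrightarrow> funs u \<subseteq> C"
    using p unfolding is_pattern_def by blast
  obtain \<sigma>s \<tau> where s: "\<Sigma> f = Some (\<sigma>s, \<tau>)" "length us = length \<sigma>s" "\<And>i. i < length us \<Longrightarrow> wt \<Sigma> (us ! i) (\<sigma>s ! i)"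
    using p unfolding is_pattern_def l(1) by (auto simp: wt_Fun_iff)
  have "f \<notin> calc_syms T"
  proof
    assume "f \<in> calc_syms T"
    then obtain d where d: "theory_sig T f = Some d" by (auto simp: calc_syms_def)
    then have th: "theory_sig T f = Some (\<sigma>s, \<tau>)" using sig_theory[of f d] s(1) by simp
    have "wt (theory_sig T) (us ! i) (\<sigma>s ! i)" if i: "i < length us" for i
      using theory_sig_sorts(1)[OF th] i s(2) l(3)[OF nth_mem[OF i]] by (intro theory_term s(3)) auto
    then have "wt (theory_sig T) l \<tau>" using th s(2) unfolding l(1) by (auto simp: wt_Fun_iff)
    then show False using rule_facts(4)[OF R] by blast
  qed
  then have f: "f \<in> defined_syms T R - calc_syms T" using l(2) by blast
  then have "F f = Some (\<sigma>s, \<tau>)" using defined_dom_F(1)[OF f] sig_F s(1) by fastforce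
  then show thesis using that l s f defined_dom_F(2)[OF f] rule_facts(5)[OF R] by (auto simp: wt_Fun_iff)
qed

lemma ground_pattern_iff:
  "is_pattern T F R t \<and> vars t = {} \<longleftrightarrow> (\<exists>f ts \<sigma>s \<tau>. t = Fun f ts \<and> f \<in> defined_syms T R \<and> \<Sigma> f = Some (\<sigma>s, \<tau>) \<and>
    length ts = length \<sigma>s \<and> (\<forall>i < length ts. ts ! i \<in> ground_terms (\<sigma>s ! i)))"
  unfolding is_pattern_def ground_terms_def by (fastforce simp: wt_Fun_iff in_set_conv_nth)

text \<open>The arguments are values, and the variable on the right of the calculation rule is sent
  to the value of the result. So quasi-reducibility is decided at the other defined symbols.\<close>

lemma calc_redex:
  assumes f: "f \<in> calc_syms T" "\<Sigma> f = Some (\<sigma>s, \<tau>)" and ts: "length ts = length \<sigma>s" "\<And>i. i < length ts \<Longrightarrow> ts ! i \<in> ground_terms (\<sigma>s ! i)"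
  shows "is_redex T F R (Fun f ts)"
proof -
  have th: "theory_sig T f = Some (\<sigma>s, \<tau>)" using f sig_theory[of f] by (auto simp: calc_syms_def)
  obtain xs y where xs: "(Fun f (map Var xs), Var y, c_eq T y (Fun f (map Var xs))) \<in> calc_rules T"
    "distinct (y # xs)" "map snd xs = \<sigma>s" "snd y = \<tau>"
    using calc_rule_exists[OF f(1) th] by blast
  have tV: "ts ! i \<in> value_terms (\<sigma>s ! i)" if "i < length ts" for i
    using ts(2)[OF that] theory_sig_sorts(1)[OF th] that ts(1) ground_terms_value_terms by (metis nth_mem subsetD)
  have "list_all2 (\<lambda>a \<sigma>. a \<in> universe T \<sigma>) (map (den T) ts) \<sigma>s"
    using tV ts(1) val_universe by (fastforce simp: list_all2_conv_all_nth value_terms_def)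
  then have univ: "interp T f (map (den T) ts) \<in> universe T \<tau>" using theory_sig_sorts(3)[OF th] by blast
  have \<tau>: "\<tau> \<in> th" using theory_sig_sorts(2)[OF th] .
  obtain v where v: "v \<in> vals T" "theory_sig T v = Some ([], \<tau>)" "interp T v [] = interp T f (map (den T) ts)"
    using val_of[OF univ \<tau>] by blast
  define \<gamma> where "\<gamma> x = (case map_of (zip (y # xs) (Fun v [] # ts)) x of Some t \<Rightarrow> t | None \<Rightarrow> Var x)" for x
  have len: "length xs = length ts" using xs(3) ts(1) by (metis length_map)
  have \<gamma>y: "\<gamma> y = Fun v []" by (simp add: \<gamma>_def)
  have \<gamma>x: "\<gamma> (xs ! i) = ts ! i" if "i < length xs" for i
  proof -
    have "map_of (zip (y # xs) (Fun v [] # ts)) ((y # xs) ! Suc i) = Some ((Fun v [] # ts) ! Suc i)"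
      using that len xs(2) by (intro map_of_zip_nth) auto
    then show ?thesis by (simp add: \<gamma>_def)
  qed
  have \<gamma>o: "\<gamma> x = Var x" if "x \<notin> set (y # xs)" for x
  proof -
    have "map_of (zip (y # xs) (Fun v [] # ts)) x = None"
      using that len by (subst map_of_zip_is_None) auto
    then show ?thesis by (simp only: \<gamma>_def option.case)
  qed
  have value_terms: "\<gamma> x \<in> value_terms (snd x)" if "x \<in> set (y # xs)" for x
  proof (cases "x = y")
    case False
    then have "x \<in> set xs" using that by simp
    then obtain i where i: "i < length xs" "x = xs ! i" by (auto simp: in_set_conv_nth)
    then have "snd x = \<sigma>s ! i" using xs(3) by auto
    then show ?thesis using \<gamma>x tV i len by simp
  qed (use v \<gamma>y xs(4) in \<open>auto simp: value_terms_def\<close>)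
  have sub: "is_subst \<Sigma> \<gamma>"
    unfolding is_subst_def using value_terms \<gamma>o by (metis value_terms_wt wt_Var_iff wt_theory)
  have app: "Fun f (map Var xs) \<cdot> \<gamma> = Fun f ts" using \<gamma>x len by (auto intro: nth_equalityI)
  then have "den T (c_eq T y (Fun f (map Var xs)) \<cdot> \<gamma>) = interp T (eq_sym T \<tau>) [interp T v [], interp T f (map (den T) ts)]"
    using \<gamma>y xs(4) by (simp del: map_map)
  also have "\<dots> = truth T True" using bool_facts(12)[OF \<tau> univ univ] v(3) by simp
  finally have "respects_rule T F \<gamma> (Fun f (map Var xs), Var y, c_eq T y (Fun f (map Var xs)))"
  proof -
    have "is_val T (\<gamma> x)" if "x \<in> set (y # xs)" for x using value_terms_is_val[OF value_terms[OF that]] .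
    then show ?thesis if "den T (c_eq T y (Fun f (map Var xs)) \<cdot> \<gamma>) = truth T True"
      unfolding respects_rule_def using sub that by auto
  qed
  then show ?thesis unfolding is_redex_def using xs(1) app by (metis (mono_tags, lifting) UnI2 case_prodI)
qed

text \<open>Extra variables of a right-hand side have to be mapped to values, which exist exactly at theory sorts.\<close>

definition matches :: "('f, 's) rule \<Rightarrow> ('f, 's) trm \<Rightarrow> bool" where
  "matches = (\<lambda>(l, r, \<phi>) t. snd ` (vars r - vars l) \<subseteq> th \<and>
     (\<exists>\<gamma>. ground_on (vars l) \<gamma> \<and> holds \<gamma> \<phi> \<and> t = l \<cdot> \<gamma>))"

text \<open>A symbol of the left-hand side below the root survives in the redex, whose arguments are
  constructor terms. Hence only rules whose left-hand side is a pattern apply.\<close>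

lemma redex_iff:
  assumes cv: "constraint_vars_in_lhs T F R" and f: "F f = Some (\<sigma>s, \<tau>)"
    and ts: "length ts = length \<sigma>s" "\<And>i. i < length ts \<Longrightarrow> ts ! i \<in> ground_terms (\<sigma>s ! i)"
  shows "is_redex T F R (Fun f ts) \<longleftrightarrow> (\<exists>(l, r, \<phi>) \<in> R. is_pattern T F R l \<and> matches (l, r, \<phi>) (Fun f ts))"
proof
  assume "is_redex T F R (Fun f ts)"
  then obtain l r \<phi> \<gamma> where R: "(l, r, \<phi>) \<in> R \<union> calc_rules T" and \<gamma>: "is_subst \<Sigma> \<gamma>"
    "\<And>x. x \<in> vars \<phi> \<union> (vars r - vars l) \<Longrightarrow> is_val T (\<gamma> x)" "den T (\<phi> \<cdot> \<gamma>) = truth T True" "Fun f ts = l \<cdot> \<gamma>"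
    unfolding is_redex_def respects_rule_def by blast
  have R: "(l, r, \<phi>) \<in> R"
  proof (rule ccontr)
    assume "(l, r, \<phi>) \<notin> R"
    then have "f \<in> calc_syms T" using R \<gamma>(4) by (auto simp: calc_rules_def)
    then show False using dom_F_calc f by blast
  qed
  obtain us where l: "l = Fun f us" "ts = map (\<lambda>u. u \<cdot> \<gamma>) us" using \<gamma>(4) rule_facts(3)[OF R] by (cases l) auto
  have tsC: "funs t \<subseteq> C \<and> vars t = {}" if "t \<in> set ts" for t using ts(2) that by (auto simp: ground_terms_def in_set_conv_nth)
  have usC: "funs u \<subseteq> C" if "u \<in> set us" for u
    using tsC[of "u \<cdot> \<gamma>"] that l(2) by (auto simp: funs_app)
  have "f \<in> defined_syms T R" using R l(1) unfolding defined_syms_def by blast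
  then have p: "is_pattern T F R l" unfolding is_pattern_def using rule_facts(1)[OF R] l(1) usC by blast
  have gr: "ground_on (vars l) \<gamma>"
    unfolding ground_on_def
  proof
    fix x assume "x \<in> vars l"
    then obtain u where u: "u \<in> set us" "x \<in> vars u" using l(1) by auto
    then have "funs (\<gamma> x) \<subseteq> C" "vars (\<gamma> x) = {}"
      using tsC[of "u \<cdot> \<gamma>"] l(2) by (auto simp: funs_app vars_app)
    then show "\<gamma> x \<in> ground_terms (snd x)" using \<gamma>(1) by (simp add: ground_terms_def is_subst_def)
  qed
  have "snd x \<in> th" if x: "x \<in> vars r - vars l" for x
  proof -
    obtain v where v: "v \<in> vals T" "\<gamma> x = Fun v []" using \<gamma>(2)[of x] x unfolding is_val_def by blast
    then obtain \<iota> where \<iota>: "theory_sig T v = Some ([], \<iota>)" using vals_sort by blast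
    have "wt \<Sigma> (\<gamma> x) (snd x)" using \<gamma>(1) by (simp add: is_subst_def)
    then have "snd x = \<iota>" using sig_theory[OF \<iota>] v(2) by (auto simp: wt_Fun_iff)
    then show ?thesis using theory_sig_sorts(2)[OF \<iota>] by simp
  qed
  then have "matches (l, r, \<phi>) (Fun f ts)" using gr \<gamma>(3,4) by (auto simp: matches_def holds_def)
  then show "\<exists>(l, r, \<phi>) \<in> R. is_pattern T F R l \<and> matches (l, r, \<phi>) (Fun f ts)" using R p by blast
next
  assume "\<exists>(l, r, \<phi>) \<in> R. is_pattern T F R l \<and> matches (l, r, \<phi>) (Fun f ts)"
  then obtain l r \<phi> \<gamma>0 where R: "(l, r, \<phi>) \<in> R" and p: "is_pattern T F R l" and ex: "snd ` (vars r - vars l) \<subseteq> th"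
    and \<gamma>0: "ground_on (vars l) \<gamma>0" "holds \<gamma>0 \<phi>" "Fun f ts = l \<cdot> \<gamma>0"
    unfolding matches_def by auto
  have "\<exists>t. \<iota> \<in> th \<longrightarrow> t \<in> value_terms \<iota>" for \<iota>
    using val_exists[of \<iota>] by (auto simp: value_terms_def)
  then obtain d where d: "\<And>\<iota>. \<iota> \<in> th \<Longrightarrow> d \<iota> \<in> value_terms \<iota>" by metis
  \<comment> \<open>The matcher says nothing about extra variables of \<open>r\<close>; those of
    theory sort, and by \<open>ex\<close> there are no others, receive default values.\<close>
  define \<gamma> where "\<gamma> x = (if x \<in> vars l then \<gamma>0 x else if snd x \<in> th then d (snd x) else Var x)" for x
  have "wt \<Sigma> (\<gamma> x) (snd x)" for x
    using \<gamma>0(1) d[of "snd x"] by (auto simp: \<gamma>_def ground_on_def intro: ground_terms_wt wt_theory value_terms_wt)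
  then have sub: "is_subst \<Sigma> \<gamma>" by (simp add: is_subst_def)
  have \<phi>: "vars \<phi> \<subseteq> vars l" using cv R p unfolding constraint_vars_in_lhs_def by blast
  have "\<gamma>0 x = \<gamma> x" if "x \<in> vars \<phi>" for x using \<phi> that by (auto simp: \<gamma>_def)
  then have h: "holds \<gamma> \<phi>" using \<gamma>0(2) holds_cong[of \<phi> \<gamma>0 \<gamma>] by blast
  have "is_val T (\<gamma> x)" if x: "x \<in> vars \<phi> \<union> (vars r - vars l)" for x
  proof (cases "x \<in> vars \<phi>")
    case True
    then have "snd x \<in> th" using constraint_var_sort[OF rule_facts(2)[OF R]] by blast
    moreover have "\<gamma> x \<in> ground_terms (snd x)" using True \<phi> \<gamma>0(1) by (auto simp: \<gamma>_def ground_on_def)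
    ultimately show ?thesis using ground_terms_value_terms value_terms_is_val by blast
  next
    case False
    then have "snd x \<in> th" "x \<notin> vars l" using ex x by auto
    then show ?thesis using value_terms_is_val[OF d[of "snd x"]] by (simp add: \<gamma>_def)
  qed
  then have "respects_rule T F \<gamma> (l, r, \<phi>)" using sub h by (simp add: respects_rule_def holds_def)
  moreover have "Fun f ts = l \<cdot> \<gamma>" unfolding \<gamma>0(3) by (intro app_cong) (simp add: \<gamma>_def)
  ultimately show "is_redex T F R (Fun f ts)" using R unfolding is_redex_def by blast
qed

lemma quasi_reducible_iff:
  assumes cv: "constraint_vars_in_lhs T F R"
  shows "quasi_reducible T F R \<longleftrightarrow> (\<forall>f \<sigma>s \<tau> ts. f \<in> defined_syms T R - calc_syms T \<longrightarrow> F f = Some (\<sigma>s, \<tau>) \<longrightarrow>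
    length ts = length \<sigma>s \<longrightarrow> (\<forall>i < length ts. ts ! i \<in> ground_terms (\<sigma>s ! i)) \<longrightarrow>
    (\<exists>(l, r, \<phi>) \<in> R. is_pattern T F R l \<and> matches (l, r, \<phi>) (Fun f ts)))" (is "_ \<longleftrightarrow> ?rhs")
proof
  assume q: "quasi_reducible T F R"
  show ?rhs
  proof (intro allI impI)
    fix f \<sigma>s \<tau> ts
    assume f: "f \<in> defined_syms T R - calc_syms T" "F f = Some (\<sigma>s, \<tau>)"
      and ts: "length ts = length \<sigma>s" "\<forall>i < length ts. ts ! i \<in> ground_terms (\<sigma>s ! i)"
    have "is_pattern T F R (Fun f ts) \<and> vars (Fun f ts) = {}"
      unfolding ground_pattern_iff using f ts sig_F[OF f(2)] by blast
    then have "is_redex T F R (Fun f ts)" using q unfolding quasi_reducible_def by blast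
    then show "\<exists>(l, r, \<phi>) \<in> R. is_pattern T F R l \<and> matches (l, r, \<phi>) (Fun f ts)"
      using redex_iff[OF cv f(2) ts(1)] ts(2) by blast
  qed
next
  assume r: ?rhs
  show "quasi_reducible T F R"
    unfolding quasi_reducible_def
  proof (intro allI impI)
    fix t assume "is_pattern T F R t \<and> vars t = {}"
    then obtain f ts \<sigma>s \<tau> where t: "t = Fun f ts" "f \<in> defined_syms T R" "\<Sigma> f = Some (\<sigma>s, \<tau>)"
      "length ts = length \<sigma>s" "\<forall>i < length ts. ts ! i \<in> ground_terms (\<sigma>s ! i)"
      unfolding ground_pattern_iff by blast
    show "is_redex T F R t"
    proof (cases "f \<in> calc_syms T")
      case True
      then show ?thesis using calc_redex t by blast
    next
      case False
      then have f: "f \<in> defined_syms T R - calc_syms T" using t(2) by blast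
      then have "F f = Some (\<sigma>s, \<tau>)" using defined_dom_F(1)[OF f] sig_F[of f] t(3) by fastforce
      then show ?thesis using redex_iff[OF cv _ t(4)] t(1,5) r f t(4) by blast
    qed
  qed
qed

text \<open>The added equations send the fresh variables back to the values they replace, so
  abstraction keeps the instances while the arguments become terms over \<open>C0\<close>.\<close>

lemma variant_instances:
  assumes cv: "constraint_vars_in_lhs T F R" and R: "(l, r, \<phi>) \<in> R" and p: "is_pattern T F R l"
    and v: "value_free_variant T (l, \<phi>) q"
  shows "good_cterm q" "instances q = {l \<cdot> \<gamma> | \<gamma>. ground_on (vars l) \<gamma> \<and> holds \<gamma> \<phi>}"
proof -
  obtain l' \<phi>' where q: "q = (l', \<phi>')" by fastforce
  obtain E where E: "abs_vals T l l' E" "distinct (map fst E)" "fst ` set E \<inter> (vars l \<union> vars \<phi>) = {}"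
    and \<phi>': "\<phi>' = foldl (\<lambda>\<chi> (y, v). c_and T \<chi> (c_eq T y (Fun v []))) \<phi> E"
    using v unfolding value_free_variant_def q by auto
  obtain f us \<sigma>s \<tau> where l: "l = Fun f us" "F f = Some (\<sigma>s, \<tau>)" "f \<notin> vals T" "length us = length \<sigma>s"
    "\<And>i. i < length us \<Longrightarrow> wt \<Sigma> (us ! i) (\<sigma>s ! i)" "\<And>u. u \<in> set us \<Longrightarrow> funs u \<subseteq> C" "linear l"
    using pattern_rule[OF R p] by metis
  note ev = abs_vals_values[OF E(1)]
  have \<phi>: "vars \<phi> \<subseteq> vars l" using cv R p unfolding constraint_vars_in_lhs_def by blast
  note c = abs_constraint[of \<phi> E, OF rule_facts(2)[OF R] ev, folded \<phi>']
  from E(1) obtain us' Es where l': "l' = Fun f us'" "length us' = length us" "length Es = length us"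
    "\<And>i. i < length us \<Longrightarrow> abs_vals T (us ! i) (us' ! i) (Es ! i)"
    unfolding l(1) using l(3) by cases auto
  have w: "wt \<Sigma> (us' ! i) (\<sigma>s ! i)" if "i < length us" for i
    using abs_vals_wt[OF l'(4)[OF that] sig_theory l(5)[OF that]] by blast
  have fu: "funs (us' ! i) \<subseteq> C0" if i: "i < length us" for i
    using abs_vals_funs[OF l'(4)[OF i]] l(6)[of "us ! i"] i constructor_cases by fastforce
  have is_value: "vars l' = vars l \<union> fst ` set E" using abs_vals_vars[OF E(1)] .
  have "linear l'" using abs_vals_linear[OF E(1) l(7) E(2)] E(3) by blast
  moreover have "\<forall>u \<in> set us'. funs u \<subseteq> C0" using fu l'(2) by (metis in_set_conv_nth)
  ultimately have "lin_pattern l'" unfolding lin_pattern_def l'(1) using l(2,4) w l'(2) by auto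
  then show "good_cterm q" unfolding good_cterm_def q using c \<phi> is_value by auto
  have value_terms: "\<forall>x \<in> vars \<phi> \<union> fst ` set E. \<gamma> x \<in> value_terms (snd x)" if g: "ground_on (vars l') \<gamma>" for \<gamma>
    using good_cterm_value_terms[of l' \<phi>' \<gamma>] \<open>good_cterm q\<close> g c unfolding q by blast
  show "instances q = {l \<cdot> \<gamma> | \<gamma>. ground_on (vars l) \<gamma> \<and> holds \<gamma> \<phi>}"
  proof (intro equalityI subsetI)
    fix g assume "g \<in> instances q"
    then obtain \<gamma> where \<gamma>: "g = l' \<cdot> \<gamma>" "ground_on (vars l') \<gamma>" "holds \<gamma> \<phi>'" unfolding q by (elim semE)
    then have "holds \<gamma> \<phi>" "\<And>y v. (y, v) \<in> set E \<Longrightarrow> \<gamma> y = Fun v []" using c value_terms by blast+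
    moreover from this have "l' \<cdot> \<gamma> = l \<cdot> \<gamma>" using abs_vals_app[OF E(1)] by blast
    moreover have "ground_on (vars l) \<gamma>" using \<gamma>(2) is_value by (auto simp: ground_on_def)
    ultimately show "g \<in> {l \<cdot> \<gamma> | \<gamma>. ground_on (vars l) \<gamma> \<and> holds \<gamma> \<phi>}" using \<gamma>(1) by blast
  next
    fix g assume "g \<in> {l \<cdot> \<gamma> | \<gamma>. ground_on (vars l) \<gamma> \<and> holds \<gamma> \<phi>}"
    then obtain \<gamma>0 where \<gamma>0: "g = l \<cdot> \<gamma>0" "ground_on (vars l) \<gamma>0" "holds \<gamma>0 \<phi>" by blast
    \<comment> \<open>The keys of \<open>E\<close> are distinct and fresh, so this agrees with every
      pair of \<open>E\<close> and does not disturb \<open>l\<close> and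
      \<open>\<phi>\<close>.\<close>
    define \<gamma> where "\<gamma> x = (case map_of E x of Some v \<Rightarrow> Fun v [] | None \<Rightarrow> \<gamma>0 x)" for x
    have e: "\<gamma> y = Fun v []" if "(y, v) \<in> set E" for y v
      using that E(2) by (simp add: \<gamma>_def)
    have o: "\<gamma> x = \<gamma>0 x" if "x \<in> vars l \<union> vars \<phi>" for x
    proof -
      have "x \<notin> fst ` set E" using that E(3) by blast
      then show ?thesis by (simp add: \<gamma>_def map_of_eq_None_iff[THEN iffD2])
    qed
    have "ground_on (vars l') \<gamma>"
      unfolding ground_on_def
    proof
      fix x assume "x \<in> vars l'"
      then consider "x \<in> vars l" | v where "(x, v) \<in> set E" using is_value by auto
      then show "\<gamma> x \<in> ground_terms (snd x)"
      proof cases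
        case 2
        then show ?thesis using e[OF 2] ev[OF 2] by (intro value_terms_ground_terms) (auto simp: value_terms_def)
      qed (use o \<gamma>0(2) in \<open>simp add: ground_on_def\<close>)
    qed
    moreover have "holds \<gamma> \<phi>" using \<gamma>0(3) o holds_cong[of \<phi> \<gamma>0 \<gamma>] by simp
    ultimately have "l' \<cdot> \<gamma> \<in> instances q" unfolding q using c value_terms e by (intro semI) blast+
    moreover have "l' \<cdot> \<gamma> = l \<cdot> \<gamma>" using abs_vals_app[OF E(1)] e by blast
    moreover have "l \<cdot> \<gamma> = l \<cdot> \<gamma>0" using o by (intro app_cong) simp
    ultimately show "g \<in> instances q" using \<gamma>0(1) by simp
  qed
qed

lemma variant_free_exists:
  assumes R: "(l, r, \<phi>) \<in> R" shows "\<exists>q. value_free_variant T (l, \<phi>) q"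
proof -
  obtain \<tau> where "wt \<Sigma> l \<tau>" using rule_facts(1)[OF R] by blast
  then show ?thesis
    using abs_vals_exists[of l \<tau> "vars l \<union> vars \<phi>"] unfolding value_free_variant_def by auto
qed

text \<open>Every step preserves the difference of the two denotations. If the rules cover the start
  pattern, each outcome denotes nothing and is empty; if the empty set is an outcome, the rules
  cover the start pattern. Termination shows that there is an outcome at all.\<close>

theorem complement_correct:
  assumes cv: "constraint_vars_in_lhs T F R" and ev: "extra_vars_theory_sorted T F R"
    and inh: "argument_sorts_inhabited T F R" and Q: "represents T Q (pattern_cterms T F R)"
  shows "quasi_reducible T F R \<Longrightarrow> f \<in> defined_syms T R - calc_syms T \<Longrightarrow> co_results T F R f Q = {{}}"
    "(\<forall>f \<in> defined_syms T R - calc_syms T. {} \<in> co_results T F R f Q) \<Longrightarrow> quasi_reducible T F R"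
proof -
  have i: inhabited
    using inh unfolding inhabited_def argument_sorts_inhabited_def arg_sorts_def ground_terms_def by blast
  have finQ: "finite Q" and subQ: "Q \<subseteq> pattern_cterms T F R" and ceqQ: "set_ceq T Q (pattern_cterms T F R)"
    using Q by (auto simp: represents_def)
  have goodP: "good_cterm q" if "q \<in> pattern_cterms T F R" for q
    using that variant_instances(1)[OF cv, of _ _ _ q] unfolding pattern_cterms_def by blast
  have goodQ: "\<And>q. q \<in> Q \<Longrightarrow> good_cterm q" using goodP subQ by blast
  \<comment> \<open>\<open>Q\<close> represents all value-free variants, and \<open>ev\<close> takes
    care of the condition on extra variables in \<open>matches\<close>.\<close>
  have semQ: "g \<in> all_instances Q \<longleftrightarrow> (\<exists>(l, r, \<phi>) \<in> R. is_pattern T F R l \<and> matches (l, r, \<phi>) g)" for g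
  proof
    assume "g \<in> all_instances Q"
    then obtain q where q: "q \<in> Q" "g \<in> instances q" by (auto simp: all_instances_def)
    then obtain l r \<phi> where l: "(l, r, \<phi>) \<in> R" "is_pattern T F R l" "value_free_variant T (l, \<phi>) q"
      using subQ unfolding pattern_cterms_def by blast
    have "snd ` (vars r - vars l) \<subseteq> th" using ev l(1,2) unfolding extra_vars_theory_sorted_def by blast
    then have "matches (l, r, \<phi>) g" using q(2) variant_instances(2)[OF cv l] unfolding matches_def by auto
    then show "\<exists>(l, r, \<phi>) \<in> R. is_pattern T F R l \<and> matches (l, r, \<phi>) g" using l by blast
  next
    assume "\<exists>(l, r, \<phi>) \<in> R. is_pattern T F R l \<and> matches (l, r, \<phi>) g"
    then obtain l r \<phi> where l: "(l, r, \<phi>) \<in> R" "is_pattern T F R l" and m: "matches (l, r, \<phi>) g" by blast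
    obtain q where q: "value_free_variant T (l, \<phi>) q" using variant_free_exists[OF l(1)] by blast
    have g: "g \<in> instances q" using m unfolding variant_instances(2)[OF cv l q] matches_def by auto
    have qP: "q \<in> pattern_cterms T F R" unfolding pattern_cterms_def using l q by blast
    then obtain q' where q': "q' \<in> Q" "ceq T q' q" using ceqQ unfolding set_ceq_def by blast
    then show "g \<in> all_instances Q" using ceq_instances[OF q'(2) goodQ goodP] qP g unfolding all_instances_def by blast
  qed
  have start: "invariant {(Fun f (map Var xs), c_true T)} Q \<and>
      all_instances {(Fun f (map Var xs), c_true T)} = {Fun f ts | ts. length ts = length xs \<and> (\<forall>i < length ts. ts ! i \<in> ground_terms (snd (xs ! i)))}"
    if f: "f \<in> defined_syms T R - calc_syms T" and xs: "distinct xs" "\<Sigma> f = Some (map snd xs, \<tau>)" for f xs \<tau>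
  proof -
    let ?p = "Fun f (map Var xs)"
    have F: "F f = Some (map snd xs, \<tau>)" using defined_dom_F(1)[OF f] sig_F[of f] xs(2) by fastforce
    have lin: "linear ?p" using xs(1) by (simp add: linear_def comp_def)
    have p: "lin_pattern ?p" unfolding lin_pattern_def using F lin by auto
    then have g: "good_cterm (?p, c_true T)" using constraint_true by (simp add: good_cterm_def)
    have "satisfiable T (c_true T)" using satisfiable_iff[OF constraint_true] holds_true by auto
    then have I: "invariant {(?p, c_true T)} Q"
      unfolding invariant_def separated_def using g finQ goodQ ceq_refl[of T "(?p, c_true T)"] by auto
    have "instances (?p, c_true T) = {Fun f ts | ts. length ts = length xs \<and> (\<forall>i < length ts. ts ! i \<in> ground_terms (snd (xs ! i)))}"
    proof (intro equalityI subsetI)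
      fix g assume "g \<in> instances (?p, c_true T)"
      then obtain \<gamma> where \<gamma>: "g = ?p \<cdot> \<gamma>" "ground_on (vars ?p) \<gamma>" by (elim semE)
      then show "g \<in> {Fun f ts | ts. length ts = length xs \<and> (\<forall>i < length ts. ts ! i \<in> ground_terms (snd (xs ! i)))}"
        by (auto simp: ground_on_def)
    next
      fix g assume "g \<in> {Fun f ts | ts. length ts = length xs \<and> (\<forall>i < length ts. ts ! i \<in> ground_terms (snd (xs ! i)))}"
      then have "has_instance ground_terms ?p g" by (auto simp: has_instance_Fun_iff)
      then obtain \<gamma> where "ground_on (vars ?p) \<gamma>" "?p \<cdot> \<gamma> = g" using has_instance_linear[OF _ lin] unfolding ground_on_def by blast
      then show "g \<in> instances (?p, c_true T)" using semI[of ?p \<gamma> "c_true T"] holds_true by blast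
    qed
    then show ?thesis using I by (simp add: all_instances_def)
  qed
  show "co_results T F R f Q = {{}}" if q: "quasi_reducible T F R" and f: "f \<in> defined_syms T R - calc_syms T"
  proof -
    obtain \<sigma>s \<tau> where F: "F f = Some (\<sigma>s, \<tau>)" using defined_dom_F(1)[OF f] by fastforce
    have cover: "all_instances {(Fun f (map Var xs), c_true T)} \<subseteq> all_instances Q" if xs: "distinct xs" "\<Sigma> f = Some (map snd xs, \<tau>)" for xs \<tau>
    proof
      fix g assume "g \<in> all_instances {(Fun f (map Var xs), c_true T)}"
      then obtain ts where ts: "g = Fun f ts" "length ts = length (map snd xs)" "\<forall>i < length ts. ts ! i \<in> ground_terms (map snd xs ! i)"
        using start[OF f xs] by auto
      have "F f = Some (map snd xs, \<tau>)" using F sig_F[OF F] xs(2) by simp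
      then show "g \<in> all_instances Q" unfolding semQ ts(1) using q f ts unfolding quasi_reducible_iff[OF cv] by blast
    qed
    have all: "P' = {}" if xs: "distinct xs" "\<Sigma> f = Some (map snd xs, \<tau>)"
      and P': "P' \<in> diff_results T \<Sigma> C {(Fun f (map Var xs), c_true T)} Q" for xs \<tau> P'
    proof -
      obtain Q' where Q': "(diff_step T \<Sigma> C)\<^sup>*\<^sup>* ({(Fun f (map Var xs), c_true T)}, Q) (P', Q')" "diff_final T \<Sigma> C P' Q'"
        using P' unfolding diff_results_def by blast
      have I: "invariant {(Fun f (map Var xs), c_true T)} Q" using start[OF f xs] by blast
      note J = diff_steps_invariant[OF i I Q'(1)]
      \<comment> \<open>By disjointness the preserved difference is the denotation of
        \<open>P'\<close> itself.\<close>
      have "all_instances P' \<inter> all_instances Q' = {}" using diff_final_disjoint[OF i _ Q'(2)] J by blast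
      then have "all_instances P' = {}" using J cover[OF xs] by blast
      moreover have "instances p \<noteq> {}" if "p \<in> P'" for p
        using J that by (intro instances_nonempty[OF i]) (auto simp: invariant_def)
      ultimately show ?thesis unfolding all_instances_def by blast
    qed
    have ex: "\<exists>xs P'. distinct xs \<and> (\<exists>\<tau>. \<Sigma> f = Some (map snd xs, \<tau>)) \<and>
      P' \<in> diff_results T \<Sigma> C {(Fun f (map Var xs), c_true T)} Q"
    proof -
      obtain xs :: "'s vr list" where xs: "distinct xs" "map snd xs = \<sigma>s" using fresh_vars[OF finite.emptyI, of \<sigma>s] by metis
      then have s: "\<Sigma> f = Some (map snd xs, \<tau>)" using sig_F[OF F] by simp
      let ?P = "{(Fun f (map Var xs), c_true T)}"
      have I: "invariant ?P Q" using start[OF f xs(1) s] by blast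
      obtain n where "\<forall>a \<in> ?P \<union> Q. depth_le n (fst a)" using depth_le_bound[of "?P \<union> Q"] finQ by auto
      moreover obtain G where "test_set n G" using test_set_exists[OF i] by blast
      ultimately obtain P' Q' where "(diff_step T \<Sigma> C)\<^sup>*\<^sup>* (?P, Q) (P', Q')" "diff_final T \<Sigma> C P' Q'"
        using diff_terminates[OF i _ I] by blast
      then show ?thesis using xs(1) s unfolding diff_results_def by blast
    qed
    show ?thesis
    proof (intro equalityI subsetI)
      fix P' assume "P' \<in> co_results T F R f Q"
      then obtain xs \<tau> where "distinct xs" "\<Sigma> f = Some (map snd xs, \<tau>)"
        "P' \<in> diff_results T \<Sigma> C {(Fun f (map Var xs), c_true T)} Q" unfolding co_results_def by blast
      then show "P' \<in> {{}}" using all by simp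
    next
      fix P' :: "('f, 's) cterm set" assume "P' \<in> {{}}"
      then have P': "P' = {}" by simp
      obtain xs \<tau> P where x: "distinct xs" "\<Sigma> f = Some (map snd xs, \<tau>)"
        "P \<in> diff_results T \<Sigma> C {(Fun f (map Var xs), c_true T)} Q" using ex by (elim exE conjE)
      then have "P = {}" using all by blast
      then show "P' \<in> co_results T F R f Q"
        unfolding co_results_def P' using x by (intro UN_I[of xs]) auto
    qed
  qed
  show "quasi_reducible T F R" if e: "\<forall>f \<in> defined_syms T R - calc_syms T. {} \<in> co_results T F R f Q"
    unfolding quasi_reducible_iff[OF cv]
  proof (intro allI impI)
    fix f \<sigma>s \<tau> ts
    assume f: "f \<in> defined_syms T R - calc_syms T" "F f = Some (\<sigma>s, \<tau>)"
      and ts: "length ts = length \<sigma>s" "\<forall>i < length ts. ts ! i \<in> ground_terms (\<sigma>s ! i)"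
    obtain xs \<tau>' Q' where xs: "distinct xs" "\<Sigma> f = Some (map snd xs, \<tau>')"
      "(diff_step T \<Sigma> C)\<^sup>*\<^sup>* ({(Fun f (map Var xs), c_true T)}, Q) ({}, Q')"
      using e f(1) unfolding co_results_def diff_results_def by blast
    have "map snd xs = \<sigma>s" using xs(2) sig_F[OF f(2)] by simp
    then have "Fun f ts \<in> all_instances {(Fun f (map Var xs), c_true T)}"
      using start[OF f(1) xs(1,2)] ts by auto
    moreover have "all_instances {(Fun f (map Var xs), c_true T)} - all_instances Q = {}"
      using diff_steps_invariant[OF i _ xs(3)] start[OF f(1) xs(1,2)] by (auto simp: all_instances_def)
    ultimately show "\<exists>(l, r, \<phi>) \<in> R. is_pattern T F R l \<and> matches (l, r, \<phi>) (Fun f ts)"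
      using semQ by blast
  qed
qed

end

subsection \<open>Computable functions on encoded data\<close>

text \<open>\<open>recfn\<close> also fixes the function on lists of other lengths. Disregarding
  these makes functions exchangeable that agree at the intended arity.\<close>

definition recfn_on :: "nat \<Rightarrow> (nat list \<Rightarrow> nat) \<Rightarrow> bool" where
  "recfn_on k f \<longleftrightarrow> (\<exists>g. recfn k g \<and> (\<forall>xs. length xs = k \<longrightarrow> g xs = f xs))"

lemma recfn_on_recfn: "recfn k f \<Longrightarrow> recfn_on k f"
  by (auto simp: recfn_on_def)

lemma recfn_on_cong: "recfn_on k f \<Longrightarrow> (\<And>xs. length xs = k \<Longrightarrow> f xs = f' xs) \<Longrightarrow> recfn_on k f'"
  by (auto simp: recfn_on_def)

lemma recfn_on_proj: "i < k \<Longrightarrow> recfn_on k (\<lambda>xs. xs ! i)"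
  by (intro recfn_on_recfn rec_proj)

lemma recfn_on_comp:
  assumes f: "recfn_on m f" and gs: "length gs = m" "\<forall>g \<in> set gs. recfn_on k g"
  shows "recfn_on k (\<lambda>xs. f (map (\<lambda>g. g xs) gs))"
proof -
  obtain f' where f': "recfn m f'" "\<forall>xs. length xs = m \<longrightarrow> f' xs = f xs" using f by (auto simp: recfn_on_def)
  have "\<forall>g. \<exists>g'. g \<in> set gs \<longrightarrow> recfn k g' \<and> (\<forall>xs. length xs = k \<longrightarrow> g' xs = g xs)"
    using gs(2) unfolding recfn_on_def by blast
  then obtain c where c: "\<And>g. g \<in> set gs \<Longrightarrow> recfn k (c g) \<and> (\<forall>xs. length xs = k \<longrightarrow> c g xs = g xs)" by metis
  have "recfn k (\<lambda>xs. f' (map (\<lambda>g. g xs) (map c gs)))" using f'(1) gs(1) c by (intro rec_comp) auto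
  moreover have "f' (map (\<lambda>g. g xs) (map c gs)) = f (map (\<lambda>g. g xs) gs)" if "length xs = k" for xs
  proof -
    have e: "map (\<lambda>g. g xs) (map c gs) = map (\<lambda>g. g xs) gs" using c that by simp
    show ?thesis unfolding e using f'(2) gs(1) by simp
  qed
  ultimately show ?thesis unfolding recfn_on_def by blast
qed

lemma recfn_on_unary_recfn: "recfn_on 1 f \<Longrightarrow> recfn_on k g \<Longrightarrow> recfn_on k (\<lambda>xs. f [g xs])"
  using recfn_on_comp[of 1 f "[g]" k] by simp

lemma recfn_on_Suc: "recfn_on k g \<Longrightarrow> recfn_on k (\<lambda>xs. Suc (g xs))"
  using recfn_on_unary_recfn[OF recfn_on_recfn[OF rec_succ]] by simp

lemma recfn_on_const: "recfn_on k (\<lambda>xs. n)"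
  by (induction n) (auto intro: recfn_on_recfn rec_zero recfn_on_Suc)

lemma recfn_on_prim:
  assumes "recfn_on k f" "recfn_on (Suc (Suc k)) g"
  shows "recfn_on (Suc k) (\<lambda>xs. rec_nat (f (tl xs)) (\<lambda>n r. g (n # r # tl xs)) (hd xs))"
proof -
  obtain f' g' where f': "recfn k f'" "\<And>xs. length xs = k \<Longrightarrow> f' xs = f xs"
    and g': "recfn (Suc (Suc k)) g'" "\<And>xs. length xs = Suc (Suc k) \<Longrightarrow> g' xs = g xs"
    using assms by (auto simp: recfn_on_def)
  have "rec_nat (f' (tl xs)) (\<lambda>n r. g' (n # r # tl xs)) (hd xs) = rec_nat (f (tl xs)) (\<lambda>n r. g (n # r # tl xs)) (hd xs)"
    if "length xs = Suc k" for xs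
    using f'(2)[of "tl xs"] g'(2)[of "_ # _ # tl xs"] that by simp
  then show ?thesis using rec_prim[OF f'(1) g'(1)] unfolding recfn_on_def by blast
qed

lemma recfn_on_mu:
  assumes "recfn_on (Suc k) f" "\<And>xs. length xs = k \<Longrightarrow> \<exists>n. f (n # xs) = 0"
  shows "recfn_on k (\<lambda>xs. LEAST n. f (n # xs) = 0)"
proof -
  obtain f' where f': "recfn (Suc k) f'" "\<And>xs. length xs = Suc k \<Longrightarrow> f' xs = f xs"
    using assms(1) by (auto simp: recfn_on_def)
  then have "recfn k (\<lambda>xs. LEAST n. f' (n # xs) = 0)" using assms(2) by (intro rec_mu) auto
  then show ?thesis using f'(2) unfolding recfn_on_def by (intro exI conjI) auto
qed

lemma recfn_on_rec:
  assumes "recfn_on k b" "recfn_on (Suc (Suc k)) s" "recfn_on k c"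
  shows "recfn_on k (\<lambda>xs. rec_nat (b xs) (\<lambda>n r. s (n # r # xs)) (c xs))"
proof -
  \<comment> \<open>Primitive recursion runs over the first argument, so the computed counter
    \<open>c\<close> is put in front of all projections.\<close>
  have "recfn_on k (\<lambda>xs. (\<lambda>xs. rec_nat (b (tl xs)) (\<lambda>n r. s (n # r # tl xs)) (hd xs)) (map (\<lambda>g. g xs) (c # map (\<lambda>i xs. xs ! i) [0..<k])))"
    using assms(3) by (intro recfn_on_comp[OF recfn_on_prim[OF assms(1,2)]]) (auto intro: recfn_on_proj)
  then show ?thesis
  proof (rule recfn_on_cong)
    fix xs :: "nat list" assume "length xs = k"
    then have "map (\<lambda>i. xs ! i) [0..<k] = xs" by (metis map_nth)
    then show "rec_nat (b (tl (map (\<lambda>g. g xs) (c # map (\<lambda>i xs. xs ! i) [0..<k]))))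
        (\<lambda>n r. s (n # r # tl (map (\<lambda>g. g xs) (c # map (\<lambda>i xs. xs ! i) [0..<k]))))
        (hd (map (\<lambda>g. g xs) (c # map (\<lambda>i xs. xs ! i) [0..<k]))) =
      rec_nat (b xs) (\<lambda>n r. s (n # r # xs)) (c xs)" by (simp add: comp_def)
  qed
qed

lemma recfn_on_drop2: "recfn_on k h \<Longrightarrow> recfn_on (Suc (Suc k)) (\<lambda>xs. h (drop 2 xs))"
proof -
  assume "recfn_on k h"
  then have "recfn_on (Suc (Suc k)) (\<lambda>xs. h (map (\<lambda>g. g xs) (map (\<lambda>i xs. xs ! i) [2..<Suc (Suc k)])))"
    by (rule recfn_on_comp) (auto intro: recfn_on_proj)
  then show ?thesis
  proof (rule recfn_on_cong)
    fix xs :: "nat list" assume "length xs = Suc (Suc k)"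
    then have "map (\<lambda>i. xs ! i) [2..<Suc (Suc k)] = drop 2 xs"
      by (intro nth_equalityI) (auto simp: nth_drop simp del: upt_Suc)
    then show "h (map (\<lambda>g. g xs) (map (\<lambda>i xs. xs ! i) [2..<Suc (Suc k)])) = h (drop 2 xs)"
      by (simp add: comp_def del: upt_Suc)
  qed
qed

lemma recfn_on_add: "recfn_on k f \<Longrightarrow> recfn_on k g \<Longrightarrow> recfn_on k (\<lambda>xs. f xs + g xs)"
proof -
  assume f: "recfn_on k f" "recfn_on k g"
  have "rec_nat a (\<lambda>n r. Suc r) m = a + m" for a m by (induction m) auto
  then show ?thesis using recfn_on_rec[OF f(1) recfn_on_Suc[OF recfn_on_proj[of 1]] f(2)] by simp
qed

lemma recfn_on_sub: "recfn_on k f \<Longrightarrow> recfn_on k g \<Longrightarrow> recfn_on k (\<lambda>xs. f xs - g xs)"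
proof -
  assume f: "recfn_on k f" "recfn_on k g"
  have "rec_nat 0 (\<lambda>n r. n) m = m - 1" for m by (cases m) auto
  then have pred: "recfn_on k (\<lambda>xs. h xs - 1)" if "recfn_on k h" for k h
    using recfn_on_rec[OF recfn_on_const[of k 0] recfn_on_proj[of 0] that] by simp
  have "rec_nat a (\<lambda>n r. r - 1) m = a - m" for a m by (induction m) auto
  then show ?thesis using recfn_on_rec[OF f(1) pred[OF recfn_on_proj[of 1]] f(2)] by simp
qed

lemma recfn_on_if: "recfn_on k f \<Longrightarrow> recfn_on k g \<Longrightarrow> recfn_on k h \<Longrightarrow> recfn_on k (\<lambda>xs. if f xs = 0 then g xs else h xs)"
proof -
  assume f: "recfn_on k f" "recfn_on k g" "recfn_on k h"
  have "rec_nat a (\<lambda>n r. b) m = (if m = 0 then a else b)" for a b :: nat and m by (cases m) auto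
  then show ?thesis using recfn_on_rec[OF f(2) recfn_on_drop2[OF f(3)] f(1)] by simp
qed

lemma recfn_on_triangle: "recfn_on k f \<Longrightarrow> recfn_on k (\<lambda>xs. triangle (f xs))"
proof -
  assume f: "recfn_on k f"
  have "rec_nat 0 (\<lambda>n r. r + Suc n) m = triangle m" for m by (induction m) auto
  then show ?thesis
    using recfn_on_rec[OF recfn_on_const[of k 0] recfn_on_add[OF recfn_on_proj[of 1] recfn_on_Suc[OF recfn_on_proj[of 0]]] f] by simp
qed

section \<open>Unary recursive functions, with pairing in place of several arguments\<close>

definition unary_recfn :: "(nat \<Rightarrow> nat) \<Rightarrow> bool" where
  "unary_recfn f \<longleftrightarrow> recfn_on 1 (\<lambda>xs. f (xs ! 0))"

named_theorems unary_recfn_intros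

lemma unary_recfn_recfn_on: "unary_recfn f \<Longrightarrow> recfn_on k g \<Longrightarrow> recfn_on k (\<lambda>xs. f (g xs))"
  unfolding unary_recfn_def using recfn_on_unary_recfn[of "\<lambda>xs. f (xs ! 0)" k g] by simp

lemma unary_recfn_id [unary_recfn_intros]: "unary_recfn (\<lambda>x. x)"
  unfolding unary_recfn_def by (rule recfn_on_proj) simp

lemma unary_recfn_const [unary_recfn_intros]: "unary_recfn (\<lambda>x. c)"
  unfolding unary_recfn_def by (rule recfn_on_const)

lemma unary_recfn_comp: "unary_recfn f \<Longrightarrow> unary_recfn g \<Longrightarrow> unary_recfn (\<lambda>x. f (g x))"
  using unary_recfn_recfn_on unfolding unary_recfn_def[of g] unary_recfn_def[of "\<lambda>x. f (g x)"] .

lemma unary_recfn_Suc [unary_recfn_intros]: "unary_recfn f \<Longrightarrow> unary_recfn (\<lambda>x. Suc (f x))"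
  unfolding unary_recfn_def by (rule recfn_on_Suc)

lemma unary_recfn_add [unary_recfn_intros]: "unary_recfn f \<Longrightarrow> unary_recfn g \<Longrightarrow> unary_recfn (\<lambda>x. f x + g x)"
  unfolding unary_recfn_def by (rule recfn_on_add)

lemma unary_recfn_sub [unary_recfn_intros]: "unary_recfn f \<Longrightarrow> unary_recfn g \<Longrightarrow> unary_recfn (\<lambda>x. f x - g x)"
  unfolding unary_recfn_def by (rule recfn_on_sub)

lemma unary_recfn_if [unary_recfn_intros]: "unary_recfn f \<Longrightarrow> unary_recfn g \<Longrightarrow> unary_recfn h \<Longrightarrow> unary_recfn (\<lambda>x. if f x = 0 then g x else h x)"
  unfolding unary_recfn_def by (rule recfn_on_if)

lemma recfn_on_prod_encode: "recfn_on k f \<Longrightarrow> recfn_on k g \<Longrightarrow> recfn_on k (\<lambda>xs. prod_encode (f xs, g xs))"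
  unfolding prod_encode_def prod.case by (intro recfn_on_add recfn_on_triangle)

lemma unary_recfn_pair [unary_recfn_intros]: "unary_recfn f \<Longrightarrow> unary_recfn g \<Longrightarrow> unary_recfn (\<lambda>x. prod_encode (f x, g x))"
  unfolding unary_recfn_def by (rule recfn_on_prod_encode)

lemma triangle_mono: "m \<le> n \<Longrightarrow> triangle m \<le> triangle n"
  by (induction n) (auto simp: le_Suc_eq)

lemma pair_sum: "prod_decode n = (a, b) \<Longrightarrow> n = triangle (a + b) + a"
  using prod_decode_inverse[of n] by (simp add: prod_encode_def)

text \<open>The sum of the components of a pair code \<open>n\<close> is the greatest \<open>w\<close> with \<open>triangle w \<le> n\<close>.\<close>

lemma unary_recfn_decode:
  "unary_recfn (\<lambda>n. fst (prod_decode n))" "unary_recfn (\<lambda>n. snd (prod_decode n))"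
proof -
  define w where "w n = (LEAST w. Suc n - triangle (Suc w) = 0)" for n
  have w: "w n = fst (prod_decode n) + snd (prod_decode n)" for n
  proof -
    obtain a b where ab: "prod_decode n = (a, b)" by fastforce
    have n: "n = triangle (a + b) + a" by (rule pair_sum[OF ab])
    have "w n = a + b"
      unfolding w_def
    proof (rule Least_equality)
      fix y assume "Suc n - triangle (Suc y) = 0"
      then show "a + b \<le> y" using triangle_mono[of "Suc y" "a + b"] n by (cases "a + b \<le> y") auto
    qed (simp add: n)
    then show ?thesis by (simp add: ab)
  qed
  have "n \<le> triangle n" for n by (induction n) auto
  then have "Suc n - triangle (Suc n) = 0" for n using trans_le_add2[of n "triangle n" "Suc n"] by simp
  then have "\<exists>m. Suc n - triangle (Suc m) = 0" for n by blast
  moreover have "recfn_on 2 (\<lambda>xs. Suc (xs ! 1) - triangle (Suc (xs ! 0)))"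
    by (intro recfn_on_sub recfn_on_Suc recfn_on_triangle recfn_on_proj) auto
  ultimately have "recfn_on 1 (\<lambda>xs. LEAST w. Suc ((w # xs) ! 1) - triangle (Suc ((w # xs) ! 0)) = 0)"
    by (intro recfn_on_mu[where f = "\<lambda>xs. Suc (xs ! 1) - triangle (Suc (xs ! 0))"]) (auto simp: numeral_2_eq_2)
  then have cw: "unary_recfn w" unfolding unary_recfn_def w_def by simp
  have "unary_recfn triangle" unfolding unary_recfn_def by (intro recfn_on_triangle recfn_on_proj) simp
  then have "unary_recfn (\<lambda>n. n - triangle (w n))" by (intro unary_recfn_sub unary_recfn_id unary_recfn_comp[OF _ cw])
  moreover have "n - triangle (w n) = fst (prod_decode n)" for n
  proof -
    obtain a b where ab: "prod_decode n = (a, b)" by fastforce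
    have "n = triangle (a + b) + a" by (rule pair_sum[OF ab])
    then show ?thesis unfolding w ab fst_conv snd_conv by linarith
  qed
  ultimately show f: "unary_recfn (\<lambda>n. fst (prod_decode n))" by simp
  have "unary_recfn (\<lambda>n. w n - fst (prod_decode n))" by (intro unary_recfn_sub cw f)
  then show "unary_recfn (\<lambda>n. snd (prod_decode n))" by (simp add: w)
qed

lemmas unary_recfn_fst [unary_recfn_intros] = unary_recfn_comp[OF unary_recfn_decode(1)]
lemmas unary_recfn_snd [unary_recfn_intros] = unary_recfn_comp[OF unary_recfn_decode(2)]

lemma unary_recfn_rec:
  assumes "unary_recfn b" "unary_recfn s" "unary_recfn c"
  shows "unary_recfn (\<lambda>x. rec_nat (b x) (\<lambda>n r. s (prod_encode (n, prod_encode (r, x)))) (c x))"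
proof -
  have "recfn_on (Suc (Suc 1)) (\<lambda>xs. s (prod_encode (xs ! 0, prod_encode (xs ! 1, xs ! 2))))"
    by (intro unary_recfn_recfn_on[OF assms(2)] recfn_on_prod_encode recfn_on_proj) auto
  then show ?thesis
    using recfn_on_rec[of 1 "\<lambda>xs. b (xs ! 0)" "\<lambda>xs. s (prod_encode (xs ! 0, prod_encode (xs ! 1, xs ! 2)))" "\<lambda>xs. c (xs ! 0)"]
      assms(1,3) unfolding unary_recfn_def by (simp add: numeral_2_eq_2)
qed

text \<open>The tag of a sum code is its parity, so these two functions take term codes
  apart.\<close>

lemma unary_recfn_half: "unary_recfn (\<lambda>n. n div 2)" "unary_recfn (\<lambda>n. n mod 2)"
proof -
  \<comment> \<open>Counts up from 0 with the pair of quotient and remainder as the state.\<close>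
  let ?s = "\<lambda>p. let r = fst (prod_decode (snd (prod_decode p))) in
    if snd (prod_decode r) = 0 then prod_encode (fst (prod_decode r), 1) else prod_encode (Suc (fst (prod_decode r)), 0)"
  have "unary_recfn (\<lambda>x. rec_nat (prod_encode (0, 0)) (\<lambda>n r. ?s (prod_encode (n, prod_encode (r, x)))) x)"
    unfolding Let_def by (intro unary_recfn_rec unary_recfn_intros)
  moreover have "rec_nat (prod_encode (0, 0)) (\<lambda>n r. ?s (prod_encode (n, prod_encode (r, x)))) m =
      prod_encode (m div 2, m mod 2)" for x m
    by (induction m) (auto simp: Let_def mod_Suc div_Suc)
  ultimately have c: "unary_recfn (\<lambda>x. prod_encode (x div 2, x mod 2))" by simp
  show "unary_recfn (\<lambda>n. n div 2)" "unary_recfn (\<lambda>n. n mod 2)"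
    using unary_recfn_fst[OF c] unary_recfn_snd[OF c] by simp_all
qed

section \<open>Computable functions on encoded types\<close>

definition computable :: "('a \<Rightarrow> nat) \<Rightarrow> ('b \<Rightarrow> nat) \<Rightarrow> ('a \<Rightarrow> 'b) \<Rightarrow> bool" where
  "computable ea eb f \<longleftrightarrow> (\<exists>g. unary_recfn g \<and> (\<forall>x. g (ea x) = eb (f x)))"

definition enat :: "nat \<Rightarrow> nat" where "enat n = n"
definition ebool :: "bool \<Rightarrow> nat" where "ebool b = (if b then 1 else 0)"
definition eprod :: "('a \<Rightarrow> nat) \<Rightarrow> ('b \<Rightarrow> nat) \<Rightarrow> 'a \<times> 'b \<Rightarrow> nat" where
  "eprod ea eb p = prod_encode (ea (fst p), eb (snd p))"
definition elist :: "('a \<Rightarrow> nat) \<Rightarrow> 'a list \<Rightarrow> nat" where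
  "elist ea xs = list_encode (map ea xs)"

lemma inj_enat: "inj enat" by (simp add: enat_def inj_def)
lemma inj_eprod: "inj ea \<Longrightarrow> inj eb \<Longrightarrow> inj (eprod ea eb)"
  by (auto simp: eprod_def inj_def prod_eq_iff)
lemma elist_simps: "elist ea [] = 0" "elist ea (x # xs) = Suc (prod_encode (ea x, elist ea xs))"
  by (simp_all add: elist_def)

text \<open>Each rule treats one outermost operation. Bound variables are passed as further
  components of the argument, so \<open>ex\<close> codes the surrounding context.\<close>

named_theorems cintros

lemma c_id [cintros]: "computable ea ea (\<lambda>x. x)"
  unfolding computable_def by (intro exI[of _ "\<lambda>x. x"] conjI unary_recfn_id) simp

lemma c_const [cintros]: "computable ea eb (\<lambda>x. c)"
  unfolding computable_def by (intro exI[of _ "\<lambda>x. eb c"] conjI unary_recfn_const) simp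

lemma c_lift: "unary_recfn h \<Longrightarrow> (\<And>x. h (eb (f x)) = ec (k (f x))) \<Longrightarrow> computable ea eb f \<Longrightarrow> computable ea ec (\<lambda>x. k (f x))"
  unfolding computable_def by (metis unary_recfn_comp)

lemma c_comp: "computable eb ec f \<Longrightarrow> computable ea eb g \<Longrightarrow> computable ea ec (\<lambda>x. f (g x))"
  unfolding computable_def by (metis unary_recfn_comp)

lemma c_pair [cintros]: "computable ea eb f \<Longrightarrow> computable ea ec g \<Longrightarrow> computable ea (eprod eb ec) (\<lambda>x. (f x, g x))"
proof -
  assume "computable ea eb f" "computable ea ec g"
  then obtain h k where "unary_recfn h" "\<forall>x. h (ea x) = eb (f x)" "unary_recfn k" "\<forall>x. k (ea x) = ec (g x)"
    unfolding computable_def by blast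
  then show ?thesis
    unfolding computable_def eprod_def by (intro exI[of _ "\<lambda>x. prod_encode (h x, k x)"]) (auto intro: unary_recfn_pair)
qed

lemma c_op2:
  assumes "unary_recfn h" "\<And>a b. h (prod_encode (eb a, ec b)) = ed (k a b)" "computable ea eb f" "computable ea ec g"
  shows "computable ea ed (\<lambda>x. k (f x) (g x))"
proof -
  have "computable (eprod eb ec) ed (\<lambda>p. k (fst p) (snd p))"
    unfolding computable_def using assms(1,2) by (intro exI[of _ h]) (simp add: eprod_def)
  from c_comp[OF this c_pair[OF assms(3,4)]] show ?thesis by simp
qed

lemma c_fst [cintros]: "computable ea (eprod eb ec) f \<Longrightarrow> computable ea eb (\<lambda>x. fst (f x))"
  by (rule c_lift[where k = fst, OF unary_recfn_decode(1)]) (simp_all add: eprod_def)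

lemma c_snd [cintros]: "computable ea (eprod eb ec) f \<Longrightarrow> computable ea ec (\<lambda>x. snd (f x))"
  by (rule c_lift[where k = snd, OF unary_recfn_decode(2)]) (simp_all add: eprod_def)

text \<open>The first branch has to be computable only where the condition holds. This is for
  equality symbols, which can be computed only at theory sorts.\<close>

lemma c_if_total:
  assumes "computable ea ebool b" "\<exists>h. unary_recfn h \<and> (\<forall>x. b x \<longrightarrow> h (ea x) = eb (f x))" "computable ea eb g"
  shows "computable ea eb (\<lambda>x. if b x then f x else g x)"
proof -
  obtain kb h k where "unary_recfn kb" "\<forall>x. kb (ea x) = ebool (b x)" "unary_recfn h" "\<forall>x. b x \<longrightarrow> h (ea x) = eb (f x)"
    "unary_recfn k" "\<forall>x. k (ea x) = eb (g x)"
    using assms unfolding computable_def by blast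
  then show ?thesis
    unfolding computable_def
    by (intro exI[of _ "\<lambda>x. if kb x = 0 then k x else h x"]) (auto intro: unary_recfn_if simp: ebool_def)
qed

lemma c_if [cintros]:
  "computable ea ebool b \<Longrightarrow> computable ea eb f \<Longrightarrow> computable ea eb g \<Longrightarrow> computable ea eb (\<lambda>x. if b x then f x else g x)"
  by (rule c_if_total) (auto simp: computable_def)

lemma c_not [cintros]: "computable ea ebool b \<Longrightarrow> computable ea ebool (\<lambda>x. \<not> b x)"
proof -
  assume "computable ea ebool b"
  moreover have "(\<lambda>x. \<not> b x) = (\<lambda>x. if b x then False else True)" by auto
  ultimately show ?thesis by (simp only: c_if c_const)
qed

lemma c_conj [cintros]: "computable ea ebool b \<Longrightarrow> computable ea ebool c \<Longrightarrow> computable ea ebool (\<lambda>x. b x \<and> c x)"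
  using c_if[of ea b ebool c "\<lambda>x. False"] c_const[of ea ebool False] by (auto simp: computable_def ebool_def cong: if_cong)

lemma c_disj [cintros]: "computable ea ebool b \<Longrightarrow> computable ea ebool c \<Longrightarrow> computable ea ebool (\<lambda>x. b x \<or> c x)"
proof -
  assume "computable ea ebool b" "computable ea ebool c"
  then have "computable ea ebool (\<lambda>x. \<not> (\<not> b x \<and> \<not> c x))" by (intro cintros)
  then show ?thesis by simp
qed

lemma c_eq: "inj eb \<Longrightarrow> computable ea eb f \<Longrightarrow> computable ea eb g \<Longrightarrow> computable ea ebool (\<lambda>x. f x = g x)"
proof (rule c_op2[where k = "(=)" and h = "\<lambda>n. if (fst (prod_decode n) - snd (prod_decode n)) + (snd (prod_decode n) - fst (prod_decode n)) = 0 then 1 else 0"])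
  assume "inj eb"
  show "(if fst (prod_decode (prod_encode (eb a, eb b))) - snd (prod_decode (prod_encode (eb a, eb b))) +
        (snd (prod_decode (prod_encode (eb a, eb b))) - fst (prod_decode (prod_encode (eb a, eb b)))) = 0 then 1 else 0) =
      ebool (a = b)" for a b
    using injD[OF \<open>inj eb\<close>, of a b] by (auto simp: ebool_def)
next
  show "unary_recfn (\<lambda>n. if fst (prod_decode n) - snd (prod_decode n) + (snd (prod_decode n) - fst (prod_decode n)) = 0 then 1 else 0)"
    by (intro unary_recfn_intros)
qed

lemma c_Suc [cintros]: "computable ea enat f \<Longrightarrow> computable ea enat (\<lambda>x. Suc (f x))"
  by (rule c_lift[where k = Suc, OF unary_recfn_Suc[OF unary_recfn_id]]) (simp_all add: enat_def)

lemma c_add [cintros]: "computable ea enat f \<Longrightarrow> computable ea enat g \<Longrightarrow> computable ea enat (\<lambda>x. f x + g x)"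
  by (rule c_op2[where k = "(+)" and h = "\<lambda>n. fst (prod_decode n) + snd (prod_decode n)"])
    (auto simp: enat_def intro!: unary_recfn_intros)

lemma c_rec_nat:
  assumes "computable ex eb b" "computable (eprod ex (eprod enat eb)) eb (\<lambda>p. s (fst p) (fst (snd p)) (snd (snd p)))"
    "computable ex enat c"
  shows "computable ex eb (\<lambda>x. rec_nat (b x) (s x) (c x))"
proof -
  obtain gb gs gc where b: "unary_recfn gb" "\<And>x. gb (ex x) = eb (b x)"
    and s: "unary_recfn gs" "\<And>x n r. gs (prod_encode (ex x, prod_encode (n, eb r))) = eb (s x n r)"
    and c: "unary_recfn gc" "\<And>x. gc (ex x) = c x"
    using assms unfolding computable_def eprod_def enat_def by (metis fst_conv snd_conv)
  \<comment> \<open>\<open>unary_recfn_rec\<close> supplies counter, accumulator and parameter in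
    this order, while \<open>gs\<close> expects the parameter first.\<close>
  let ?s = "\<lambda>p. gs (prod_encode (snd (prod_decode (snd (prod_decode p))),
    prod_encode (fst (prod_decode p), fst (prod_decode (snd (prod_decode p))))))"
  let ?g = "\<lambda>x. rec_nat (gb x) (\<lambda>n r. ?s (prod_encode (n, prod_encode (r, x)))) (gc x)"
  have "unary_recfn ?g" by (intro unary_recfn_rec b(1) c(1) unary_recfn_comp[OF s(1)] unary_recfn_intros)
  moreover have "rec_nat (gb (ex x)) (\<lambda>n r. ?s (prod_encode (n, prod_encode (r, ex x)))) m = eb (rec_nat (b x) (s x) m)" for x m
    by (induction m) (simp_all add: b s)
  then have "?g (ex x) = eb (rec_nat (b x) (s x) (c x))" for x by (simp only: c)
  ultimately show ?thesis unfolding computable_def by blast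
qed

lemma c_Cons [cintros]: "computable ea eb f \<Longrightarrow> computable ea (elist eb) g \<Longrightarrow> computable ea (elist eb) (\<lambda>x. f x # g x)"
  by (rule c_op2[where k = "(#)", OF unary_recfn_Suc[OF unary_recfn_id]]) (auto simp: elist_simps)

lemma c_null [cintros]: "computable ea (elist eb) f \<Longrightarrow> computable ea ebool (\<lambda>x. f x = [])"
proof (rule c_lift[where k = "\<lambda>xs. xs = []" and h = "\<lambda>n. if n = 0 then 1 else 0"])
  show "(if elist eb (f x) = 0 then 1 else 0) = ebool (f x = [])" for x
    by (cases "f x") (auto simp: elist_simps ebool_def)
qed (intro unary_recfn_intros)

lemma c_tl [cintros]: "computable ea (elist eb) f \<Longrightarrow> computable ea (elist eb) (\<lambda>x. tl (f x))"
proof (rule c_lift[where k = tl and h = "\<lambda>n. if n = 0 then 0 else snd (prod_decode (n - 1))"])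
  show "(if elist eb (f x) = 0 then 0 else snd (prod_decode (elist eb (f x) - 1))) = elist eb (tl (f x))" for x
    by (cases "f x") (auto simp: elist_simps)
qed (intro unary_recfn_intros)

lemma c_hd [cintros]: "computable ea (elist eb) f \<Longrightarrow> computable ea eb (\<lambda>x. hd (f x))"
proof (rule c_lift[where k = hd and h = "\<lambda>n. if n = 0 then eb (hd []) else fst (prod_decode (n - 1))"])
  show "(if elist eb (f x) = 0 then eb (hd []) else fst (prod_decode (elist eb (f x) - 1))) = eb (hd (f x))" for x
    by (cases "f x") (auto simp: elist_simps)
qed (intro unary_recfn_intros)

lemma length_le_elist: "length xs \<le> elist ea xs"
proof (induction xs)
  case (Cons x xs)
  then show ?case using le_prod_encode_2[of "elist ea xs" "ea x"] by (simp add: elist_simps)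
qed simp

text \<open>Makes the code of a datum available as a number. Such numbers serve as bounds for
  iterations and for the depth.\<close>

lemma c_code: "computable ea eb f \<Longrightarrow> computable ea enat (\<lambda>x. eb (f x))"
  unfolding computable_def enat_def .

text \<open>The state consists of the remaining list and the accumulator. The number of iterations
  is the code of the list, which is at least its length; once the list is used up, the state no
  longer changes.\<close>

lemma c_foldl:
  assumes h: "computable (eprod ex (eprod eacc eel)) eacc (\<lambda>p. h (fst p) (fst (snd p)) (snd (snd p)))"
    and z: "computable ex eacc z" and l: "computable ex (elist eel) l"
  shows "computable ex eacc (\<lambda>x. foldl (h x) (z x) (l x))"
proof -
  let ?s = "\<lambda>x n r. if fst r = [] then r else (tl (fst r), h x (snd r) (hd (fst r)))"
  have h': "computable e eacc (\<lambda>p. h (a p) (b p) (c p))"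
    if "computable e ex a" "computable e eacc b" "computable e eel c" for e a b c
    using c_comp[OF h c_pair[OF that(1) c_pair[OF that(2,3)]]] by simp
  have "computable (eprod ex (eprod enat (eprod (elist eel) eacc))) (eprod (elist eel) eacc)
    (\<lambda>p. ?s (fst p) (fst (snd p)) (snd (snd p)))"
    by (rule c_null h' cintros)+
  then have "computable ex (eprod (elist eel) eacc) (\<lambda>x. rec_nat (l x, z x) (?s x) (elist eel (l x)))"
    by - (rule c_rec_nat c_pair c_code l z | assumption)+
  then have "computable ex eacc (\<lambda>x. snd (rec_nat (l x, z x) (?s x) (elist eel (l x))))" by (rule c_snd)
  moreover have "rec_nat (xs, a) (?s x) m = (drop m xs, foldl (h x) a (take m xs))" for xs a x m
  proof (induction m)
    case (Suc m)
    show ?case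
    proof (cases "m < length xs")
      case True
      then have "take (Suc m) xs = take m xs @ [hd (drop m xs)]" "tl (drop m xs) = drop (Suc m) xs" "drop m xs \<noteq> []"
        by (simp_all add: take_Suc_conv_app_nth hd_drop_conv_nth drop_Suc tl_drop)
      then show ?thesis using Suc.IH by simp
    qed (use Suc.IH in simp)
  qed simp
  ultimately show ?thesis using length_le_elist[of "l _" eel] by simp
qed

lemma c_rev [cintros]: "computable ex (elist ea) l \<Longrightarrow> computable ex (elist ea) (\<lambda>x. rev (l x))"
proof -
  assume "computable ex (elist ea) l"
  then have "computable ex (elist ea) (\<lambda>x. foldl (\<lambda>acc y. y # acc) [] (l x))"
    by - (rule c_foldl cintros | assumption)+
  moreover have "foldl (\<lambda>acc y. y # acc) a xs = rev xs @ a" for a and xs :: "'b list" by (induction xs arbitrary: a) auto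
  ultimately show ?thesis by simp
qed

lemma c_foldr [cintros]:
  assumes "computable (eprod ex (eprod eel eacc)) eacc (\<lambda>p. h (fst p) (fst (snd p)) (snd (snd p)))"
    and "computable ex (elist eel) l" and "computable ex eacc z"
  shows "computable ex eacc (\<lambda>x. foldr (h x) (l x) (z x))"
proof -
  have "computable (eprod ex (eprod eacc eel)) eacc (\<lambda>p. h (fst p) (snd (snd p)) (fst (snd p)))"
    using c_comp[OF assms(1), of "eprod ex (eprod eacc eel)" "\<lambda>p. (fst p, snd (snd p), fst (snd p))"]
    unfolding fst_conv snd_conv by (rule meta_mp) (rule cintros)+
  then show ?thesis
    unfolding foldr_conv_foldl using assms(2,3) by (intro c_foldl c_rev)
qed

lemma c_map [cintros]:
  assumes "computable (eprod ex ea) eb (\<lambda>p. f (fst p) (snd p))" "computable ex (elist ea) l"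
  shows "computable ex (elist eb) (\<lambda>x. map (f x) (l x))"
proof -
  have "computable (eprod ex (eprod ea (elist eb))) eb (\<lambda>p. f (fst p) (fst (snd p)))"
    using c_comp[OF assms(1), of "eprod ex (eprod ea (elist eb))" "\<lambda>p. (fst p, fst (snd p))"]
    unfolding fst_conv snd_conv by (rule meta_mp) (rule cintros)+
  then have "computable ex (elist eb) (\<lambda>x. foldr (\<lambda>y ys. f x y # ys) (l x) [])"
    using assms(2) by - (rule cintros | assumption)+
  moreover have "foldr (\<lambda>y ys. g y # ys) xs [] = map g xs" for g :: "'b \<Rightarrow> 'c" and xs by (induction xs) auto
  ultimately show ?thesis by simp
qed

lemma c_append [cintros]: "computable ex (elist ea) l \<Longrightarrow> computable ex (elist ea) m \<Longrightarrow> computable ex (elist ea) (\<lambda>x. l x @ m x)"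
proof -
  assume a: "computable ex (elist ea) l" "computable ex (elist ea) m"
  have "computable ex (elist ea) (\<lambda>x. foldr (\<lambda>y ys. y # ys) (l x) (m x))"
    by (rule a cintros)+
  moreover have "foldr (\<lambda>y ys. y # ys) xs zs = xs @ zs" for xs zs :: "'b list" by (induction xs) auto
  ultimately show ?thesis by simp
qed

lemma c_concat [cintros]: "computable ex (elist (elist ea)) l \<Longrightarrow> computable ex (elist ea) (\<lambda>x. concat (l x))"
  unfolding concat_conv_foldr by (rule cintros | assumption)+

lemma c_filter [cintros]:
  assumes "computable (eprod ex ea) ebool (\<lambda>p. P (fst p) (snd p))" "computable ex (elist ea) l"
  shows "computable ex (elist ea) (\<lambda>x. filter (P x) (l x))"
proof -
  have "computable (eprod ex (eprod ea (elist ea))) ebool (\<lambda>p. P (fst p) (fst (snd p)))"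
    using c_comp[OF assms(1), of "eprod ex (eprod ea (elist ea))" "\<lambda>p. (fst p, fst (snd p))"]
    unfolding fst_conv snd_conv by (rule meta_mp) (rule cintros)+
  then have "computable ex (elist ea) (\<lambda>x. foldr (\<lambda>y ys. if P x y then y # ys else ys) (l x) [])"
    using assms(2) by - (rule cintros | assumption)+
  moreover have "foldr (\<lambda>y ys. if Q y then y # ys else ys) xs [] = filter Q xs" for Q :: "'b \<Rightarrow> bool" and xs by (induction xs) auto
  ultimately show ?thesis by simp
qed

lemma c_ball [cintros]:
  assumes "computable (eprod ex ea) ebool (\<lambda>p. P (fst p) (snd p))" "computable ex (elist ea) l"
  shows "computable ex ebool (\<lambda>x. \<forall>y \<in> set (l x). P x y)"
proof -
  have "computable ex ebool (\<lambda>x. filter (\<lambda>y. \<not> P x y) (l x) = [])"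
    using assms by (intro c_null c_filter c_not)
  then show ?thesis by (simp add: filter_empty_conv)
qed

lemma c_bex [cintros]:
  assumes "computable (eprod ex ea) ebool (\<lambda>p. P (fst p) (snd p))" "computable ex (elist ea) l"
  shows "computable ex ebool (\<lambda>x. \<exists>y \<in> set (l x). P x y)"
proof -
  have "computable ex ebool (\<lambda>x. \<not> (\<forall>y \<in> set (l x). \<not> P x y))"
    using assms by (intro c_not c_ball)
  then show ?thesis by simp
qed

lemma c_member:
  assumes "inj ea" "computable ex ea f" "computable ex (elist ea) l"
  shows "computable ex ebool (\<lambda>x. f x \<in> set (l x))"
proof -
  have "computable (eprod ex ea) ea (\<lambda>p. f (fst p))" by (rule c_comp[OF assms(2)]) (rule cintros)+
  then have "computable ex ebool (\<lambda>x. \<exists>y \<in> set (l x). f x = y)"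
    using assms(3) by - (rule c_eq[OF assms(1)] cintros | assumption)+
  then show ?thesis by simp
qed

text \<open>As in \<open>map_of\<close>, the first entry for \<open>k\<close> wins. A default takes
  the place of the option type, so that options need not be coded.\<close>

definition lookup :: "'k \<Rightarrow> ('k \<times> 'v) list \<Rightarrow> 'v \<Rightarrow> 'v" where
  "lookup k ps d = foldr (\<lambda>p r. if fst p = k then snd p else r) ps d"

lemma c_lookup:
  assumes "inj ek" "computable ex ek k" "computable ex (elist (eprod ek ev)) ps" "computable ex ev d"
  shows "computable ex ev (\<lambda>x. lookup (k x) (ps x) (d x))"
proof -
  have "computable (eprod ex (eprod (eprod ek ev) ev)) ek (\<lambda>p. k (fst p))" by (rule c_comp[OF assms(2)]) (rule cintros)+
  then show ?thesis
    unfolding lookup_def using assms(3,4) by - (rule c_eq[OF assms(1)] cintros | assumption)+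
qed

lemma elist_member: "y \<in> set ys \<Longrightarrow> ea y < elist ea ys"
proof (induction ys)
  case (Cons z ys)
  then show ?case
    using le_prod_encode_1[of "ea z" "elist ea ys"] le_prod_encode_2[of "elist ea ys" "ea z"]
    by (auto simp: elist_simps less_Suc_eq_le)
qed simp

text \<open>
  Recursion along decreasing codes. The values for all smaller numbers are tabulated, no matter whether
  the numbers are codes.
\<close>

lemma c_code_rec:
  fixes f :: "'a \<Rightarrow> 'b"
  assumes f: "\<And>x. f x = H x (map f (ch x))" and less: "\<And>x y. y \<in> set (ch x) \<Longrightarrow> ea y < ea x"
    and ch: "computable ea (elist ea) ch"
    and H: "computable (eprod ea (elist eb)) eb (\<lambda>p. H (fst p) (snd p))"
  shows "computable ea eb f"
proof -
  obtain gc gh where gc: "unary_recfn gc" "\<And>x. gc (ea x) = elist ea (ch x)"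
    and gh: "unary_recfn gh" "\<And>x ys. gh (prod_encode (ea x, elist eb ys)) = eb (H x ys)"
    using ch H unfolding computable_def eprod_def by (metis fst_conv snd_conv)
  have nat: "computable e enat (\<lambda>x. g (k x))" if "unary_recfn g" "computable e enat k" for e g and k :: "'e \<Rightarrow> nat"
    by (rule c_lift[where k = g, OF that(1) _ that(2)]) (simp add: enat_def)
  have dec: "computable e (elist enat) (\<lambda>x. list_decode (k x))" if "computable e enat k" for e and k :: "'e \<Rightarrow> nat"
    by (rule c_lift[where k = list_decode, OF unary_recfn_id _ that]) (simp add: enat_def[abs_def] elist_def)
  have enc: "computable e enat (\<lambda>x. list_encode (k x))" if "computable e (elist enat) k" for e and k :: "'e \<Rightarrow> nat list"
    using c_code[OF that] by (simp add: elist_def enat_def[abs_def])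
  have encp: "computable e enat (\<lambda>x. prod_encode (j x, k x))" if "computable e enat j" "computable e enat k" for e and j k :: "'e \<Rightarrow> nat"
    using c_code[OF c_pair[OF that]] by (simp add: eprod_def enat_def)
  \<comment> \<open>If \<open>n\<close> codes \<open>x\<close>, then \<open>gc n\<close> lists the
    codes of the children of \<open>x\<close>, whose values are already in the table
    \<open>tb\<close>.\<close>
  define val where "val n tb = gh (prod_encode (n, list_encode (map (\<lambda>m. lookup m tb 0) (list_decode (gc n)))))" for n tb
  define tab where "tab n = rec_nat [] (\<lambda>n tb. (n, val n tb) # tb) n" for n
  have "computable enat (elist (eprod enat enat)) tab"
    unfolding tab_def val_def
    by (rule c_rec_nat nat[OF gh(1)] nat[OF gc(1)] encp enc dec c_lookup[OF inj_enat] cintros)+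
  then have t: "computable enat (elist (eprod enat enat)) (\<lambda>n. tab (Suc n))"
    by (rule c_comp) (rule cintros)+
  have "computable enat enat (\<lambda>n. lookup n (tab (Suc n)) 0)"
    by (rule c_lookup[OF inj_enat] t cintros)+
  then have "unary_recfn (\<lambda>n. lookup n (tab (Suc n)) 0)" unfolding computable_def enat_def by (auto simp: fun_eq_iff[symmetric])
  moreover have "lookup (ea x) (tab n) 0 = eb (f x)" if "ea x < n" for x n
    using that
  proof (induction n arbitrary: x)
    case (Suc n)
    have tab: "tab (Suc n) = (n, val n (tab n)) # tab n" by (simp add: tab_def)
    show ?case
    proof (cases "ea x = n")
      case True
      have m: "map (\<lambda>m. lookup m (tab n) 0) (map ea (ch x)) = map eb (map f (ch x))"
        using Suc.IH less[of _ x] True by simp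
      have "list_decode (gc n) = map ea (ch x)" using gc(2)[of x] True by (simp add: elist_def)
      then have "val n (tab n) = gh (prod_encode (n, list_encode (map eb (map f (ch x)))))"
        unfolding val_def by (simp only: m)
      then have "val n (tab n) = eb (H x (map f (ch x)))"
        using gh(2)[of x "map f (ch x)"] True by (simp only: elist_def)
      then show ?thesis unfolding tab f[of x] using True by (simp add: lookup_def)
    next
      case False
      then show ?thesis using Suc unfolding tab by (simp add: lookup_def)
    qed
  qed simp
  ultimately show ?thesis unfolding computable_def by (intro exI[of _ "\<lambda>n. lookup n (tab (Suc n)) 0"]) simp
qed

lemma decidable_of_computable:
  assumes "computable code ebool f" "\<And>i. i \<in> A \<Longrightarrow> f i = P i"
  shows "decidable_on A code P"
proof -
  obtain g where "unary_recfn g" "\<And>x. g (code x) = ebool (f x)" using assms(1) unfolding computable_def by blast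
  moreover then obtain g' where "recfn 1 g'" "\<And>n. g' [n] = g n" unfolding unary_recfn_def recfn_on_def by force
  ultimately show ?thesis unfolding decidable_on_def using assms(2) by (intro exI[of _ g']) (auto simp: ebool_def)
qed

lemma unary_recfn_of_recfn: "recfn 1 g \<Longrightarrow> unary_recfn (\<lambda>n. g [n])"
proof -
  assume "recfn 1 g"
  then have "recfn_on 1 g" by (rule recfn_on_recfn)
  then show ?thesis unfolding unary_recfn_def by (rule recfn_on_cong) (auto simp: length_Suc_conv)
qed

text \<open>A given decider may return any number outside its domain. Comparing the answer with 1
  yields a total test that is correct on the domain.\<close>

lemma computable_of_recfn: "recfn 1 g \<Longrightarrow> computable ea ebool (\<lambda>x. g [ea x] = 1)"
proof -
  assume "recfn 1 g"
  then have "unary_recfn (\<lambda>n. if (g [n] - 1) + (1 - g [n]) = 0 then 1 else 0)"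
    by (intro unary_recfn_of_recfn unary_recfn_intros)
  then show ?thesis
    unfolding computable_def
    by (intro exI[of _ "\<lambda>n. if (g [n] - 1) + (1 - g [n]) = 0 then 1 else 0"]) (auto simp: ebool_def)
qed

subsection \<open>The decision procedure\<close>

fun is_Var :: "('f, 'v) tm \<Rightarrow> bool" where
  "is_Var (Var x) = True" | "is_Var (Fun f ts) = False"
fun var_of :: "('f, 'v) tm \<Rightarrow> 'v" where
  "var_of (Var x) = x" | "var_of (Fun f ts) = undefined"
fun root_sym :: "('f, 'v) tm \<Rightarrow> 'f" where
  "root_sym (Var x) = undefined" | "root_sym (Fun f ts) = f"
fun args_of :: "('f, 'v) tm \<Rightarrow> ('f, 'v) tm list" where
  "args_of (Var x) = []" | "args_of (Fun f ts) = ts"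

fun flist :: "('f, 'v) tm \<Rightarrow> 'f list" where
  "flist (Var x) = []" | "flist (Fun f ts) = f # concat (map flist ts)"

lemma set_flist: "set (flist t) = funs t"
  by (induction t) auto

text \<open>Declarations and rules are triples coded as lists and not as nested pairs. Separate
  constants keep their selectors apart from \<open>fst\<close> and \<open>snd\<close> in the rules
  \<open>cintros\<close>.\<close>

definition dsym :: "'f \<times> 's list \<times> 's \<Rightarrow> 'f" where "dsym d = fst d"
definition dargs :: "'f \<times> 's list \<times> 's \<Rightarrow> 's list" where "dargs d = fst (snd d)"
definition dres :: "'f \<times> 's list \<times> 's \<Rightarrow> 's" where "dres d = snd (snd d)"
definition rlhs :: "('f, 's) rule \<Rightarrow> ('f, 's) trm" where "rlhs r = fst r"
definition rrhs :: "('f, 's) rule \<Rightarrow> ('f, 's) trm" where "rrhs r = fst (snd r)"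
definition rcon :: "('f, 's) rule \<Rightarrow> ('f, 's) trm" where "rcon r = snd (snd r)"

text \<open>
  Matching of \<open>l\<close> against a term \<open>p\<close> whose variables stand for values: the test whether a match is
  possible, and the pairs of subterms that remain to be matched.
\<close>

function (sequential) may_match :: "('f, 'v) tm \<Rightarrow> ('f, 'v) tm \<Rightarrow> bool" where
  "may_match (Var x) p = True"
| "may_match (Fun g us) (Var z) = (us = [])"
| "may_match (Fun g us) (Fun h vs) = (g = h \<and> length us = length vs \<and> (\<forall>q \<in> set (zip us vs). may_match (fst q) (snd q)))"
  by pat_completeness auto
termination
  by (relation "measure (\<lambda>(s, t). size s)")
    (auto dest!: set_zip_leftD simp: less_Suc_eq_le size_list_estimation')

function (sequential) residual :: "('f, 'v) tm \<Rightarrow> ('f, 'v) tm \<Rightarrow> (('f, 'v) tm \<times> ('f, 'v) tm) list" where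
  "residual (Var x) p = [(Var x, p)]"
| "residual (Fun g us) (Var z) = [(Fun g us, Var z)]"
| "residual (Fun g us) (Fun h vs) =
    (if length us = length vs then concat (map (\<lambda>q. residual (fst q) (snd q)) (zip us vs)) else [])"
  by pat_completeness auto
termination
  by (relation "measure (\<lambda>(s, t). size s)")
    (auto dest!: set_zip_leftD simp: less_Suc_eq_le size_list_estimation')

text \<open>For \<open>b\<close> equal to 0 and 1 the new indices are even and odd, which keeps the
  variables of two terms apart. Doubling is written as a sum because addition is among the rules
  \<open>cintros\<close>.\<close>

definition shift_vars :: "nat \<Rightarrow> ('f, 's) trm \<Rightarrow> ('f, 's) trm" where
  "shift_vars b t = t \<cdot> (\<lambda>x. Var (fst x + fst x + b, snd x))"

text \<open>The head receives even indices and the remaining arguments odd ones. Hence values chosen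
  independently for the arguments can be combined into one substitution.\<close>

definition arg_lists :: "(('f, 's) trm \<times> 's) list \<Rightarrow> 's list \<Rightarrow> ('f, 's) trm list list" where
  "arg_lists G \<sigma>s = foldr (\<lambda>\<sigma> acc. concat (map (\<lambda>u. map (\<lambda>us. shift_vars 0 (fst u) # us) (map (map (shift_vars 1)) acc))
     (filter (\<lambda>u. snd u = \<sigma>) G))) \<sigma>s [[]]"

text \<open>A later declaration of the same symbol is shadowed, in accordance with
  \<open>map_of\<close>.\<close>

definition effective_decls :: "('f \<times> 's list \<times> 's) list \<Rightarrow> ('f \<times> 's list \<times> 's) list" where
  "effective_decls ds = foldr (\<lambda>d acc. d # filter (\<lambda>e. dsym e \<noteq> dsym d) acc) ds []"

definition roots :: "('f, 's) rule list \<Rightarrow> 'f list" where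
  "roots rs = map (\<lambda>r. root_sym (rlhs r)) rs"

definition binding :: "(('f, 's) trm \<times> ('f, 's) trm) list \<Rightarrow> 's vr \<Rightarrow> ('f, 's) trm" where
  "binding ps x = lookup x (map (\<lambda>q. (var_of (fst q), snd q)) (filter (\<lambda>q. is_Var (fst q)) ps)) (Var x)"

text \<open>The tests are parameters, because the given deciders are reliable only on theory symbols
  and on constraints; correctness there is assumed in the locale \<open>decision\<close>.\<close>

locale procedure =
  fixes T :: "('s, 'f, 'a) background" and is_value :: "'f \<Rightarrow> bool" and sat :: "('f, 's) trm \<Rightarrow> bool"
begin

text \<open>Only the given lists and the test for values are consulted. Calculation symbols are
  excluded because they are neither declared in \<open>ds\<close> nor values.\<close>

definition is_pattern_lhs :: "('f \<times> 's list \<times> 's) list \<Rightarrow> ('f, 's) rule list \<Rightarrow> ('f, 's) trm \<Rightarrow> bool" where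
  "is_pattern_lhs ds rs l \<longleftrightarrow> (\<forall>g \<in> set (concat (map flist (args_of l))). g \<notin> set (roots rs) \<and> (g \<in> set (map dsym ds) \<or> is_value g))"

definition usable :: "('f \<times> 's list \<times> 's) list \<Rightarrow> ('f, 's) rule list \<Rightarrow> ('f, 's) rule \<Rightarrow> bool" where
  "usable ds rs r \<longleftrightarrow> is_pattern_lhs ds rs (rlhs r) \<and>
     (\<forall>x \<in> set (var_list (rrhs r)). x \<in> set (var_list (rlhs r)) \<or> snd x \<in> theory_sorts T)"

definition constructor_decls :: "('f \<times> 's list \<times> 's) list \<Rightarrow> ('f, 's) rule list \<Rightarrow> ('f \<times> 's list \<times> 's) list" where
  "constructor_decls ds rs = filter (\<lambda>d. dsym d \<notin> set (roots rs) \<and> dres d \<notin> theory_sorts T) (effective_decls ds)"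

definition root_decls :: "('f \<times> 's list \<times> 's) list \<Rightarrow> ('f, 's) rule list \<Rightarrow> ('f \<times> 's list \<times> 's) list" where
  "root_decls ds rs = filter (\<lambda>d. dsym d \<in> set (roots rs)) (effective_decls ds)"

text \<open>Every variable starts with index 0; different indices arise from the shifts in
  \<open>arg_lists\<close>.\<close>

definition base_terms :: "('f \<times> 's list \<times> 's) list \<Rightarrow> (('f, 's) trm \<times> 's) list" where
  "base_terms ds = map (\<lambda>\<sigma>. (Var (0, \<sigma>), \<sigma>)) (filter (\<lambda>\<sigma>. \<sigma> \<in> theory_sorts T) (concat (map dargs (effective_decls ds))))"

definition constructor_terms :: "('f \<times> 's list \<times> 's) list \<Rightarrow> ('f, 's) rule list \<Rightarrow> nat \<Rightarrow> (('f, 's) trm \<times> 's) list" where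
  "constructor_terms ds rs n = rec_nat (base_terms ds) (\<lambda>_ G. base_terms ds @ concat (map (\<lambda>d.
     map (\<lambda>ts. (Fun (dsym d) ts, dres d)) (arg_lists G (dargs d))) (constructor_decls ds rs))) n"

definition abstract_patterns :: "('f \<times> 's list \<times> 's) list \<Rightarrow> ('f, 's) rule list \<Rightarrow> nat \<Rightarrow> ('f, 's) trm list" where
  "abstract_patterns ds rs n = concat (map (\<lambda>d. map (\<lambda>ts. Fun (dsym d) ts) (arg_lists (constructor_terms ds rs n) (dargs d))) (root_decls ds rs))"

text \<open>Equality symbols can be computed at theory sorts only, and the other branch makes the
  function total. By \<open>residual_typed\<close>, a variable that meets a value in a residual pair
  has a theory sort.\<close>

definition value_eq :: "'s vr \<Rightarrow> 'f \<Rightarrow> ('f, 's) trm" where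
  "value_eq z v = (if snd z \<in> theory_sorts T then c_eq T z (Fun v []) else c_true T)"

text \<open>A residual pair with a variable on the left instantiates the constraint of the rule.
  Every other pair consists of a value and a variable and becomes an equation.\<close>

definition match_cond :: "('f, 's) rule \<Rightarrow> ('f, 's) trm \<Rightarrow> ('f, 's) trm" where
  "match_cond r p = foldr (\<lambda>q \<chi>. if is_Var (fst q) then \<chi> else c_and T (value_eq (var_of (snd q)) (root_sym (fst q))) \<chi>)
     (residual (rlhs r) p) (rcon r \<cdot> binding (residual (rlhs r) p))"

definition no_match :: "('f \<times> 's list \<times> 's) list \<Rightarrow> ('f, 's) rule list \<Rightarrow> ('f, 's) trm \<Rightarrow> ('f, 's) trm" where
  "no_match ds rs p = foldr (\<lambda>r \<chi>. if usable ds rs r \<and> may_match (rlhs r) p then c_and T (c_not T (match_cond r p)) \<chi> else \<chi>)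
     rs (c_true T)"

definition decide :: "('f \<times> 's list \<times> 's) list \<Rightarrow> ('f, 's) rule list \<Rightarrow> nat \<Rightarrow> bool" where
  "decide ds rs n \<longleftrightarrow> (\<forall>p \<in> set (abstract_patterns ds rs n). \<not> sat (no_match ds rs p))"

end

section \<open>Computability of the decision procedure\<close>

lemma prod_encode_less: "a \<le> c \<Longrightarrow> b < d \<Longrightarrow> prod_encode (a, b) < prod_encode (c, d)"
proof -
  assume l: "a \<le> c" "b < d"
  have "triangle (a + b) < triangle (Suc (a + b))" by simp
  also have "\<dots> \<le> triangle (c + d)" using l by (intro triangle_mono) simp
  finally show ?thesis using l by (simp add: prod_encode_def)
qed

locale procedure_codes = procedure T is_value sat
  for T :: "('s, 'f, 'a) background" and is_value :: "'f \<Rightarrow> bool" and sat :: "('f, 's) trm \<Rightarrow> bool" +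
  fixes cs :: "'s \<Rightarrow> nat" and cf :: "'f \<Rightarrow> nat"
  assumes inj_cs: "inj cs" and inj_cf: "inj cf"
    and c_th0: "computable cs ebool (\<lambda>\<sigma>. \<sigma> \<in> theory_sorts T)"
    and c_vl0: "computable cf ebool is_value"
    and c_eq_sym0: "\<exists>h. unary_recfn h \<and> (\<forall>\<sigma> \<in> theory_sorts T. h (cs \<sigma>) = cf (eq_sym T \<sigma>))"
    and c_sat0: "computable (code_tm cs cf) ebool sat"
begin

abbreviation "ev \<equiv> eprod enat cs"
abbreviation "et \<equiv> code_tm cs cf"
abbreviation "ed \<equiv> code_decl cs cf"
abbreviation "er \<equiv> code_rule cs cf"

lemma inj_ev: "inj ev" using inj_enat inj_cs by (rule inj_eprod)

lemmas c_th [cintros] = c_comp[OF c_th0]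
lemmas c_is_value [cintros] = c_comp[OF c_vl0]
lemmas c_sat [cintros] = c_comp[OF c_sat0]
lemmas c_eqs [cintros] = c_eq[OF inj_cs] c_eq[OF inj_cf] c_eq[OF inj_enat]
lemmas c_members [cintros] = c_member[OF inj_cf] c_member[OF inj_ev]

lemma et_simps: "et (Var x) = ev x + ev x" "et (Fun f ts) = Suc (eprod cf (elist et) (f, ts) + eprod cf (elist et) (f, ts))"
  by (simp_all add: sum_encode_def eprod_def enat_def elist_def)

lemma c_Var [cintros]: "computable ex ev f \<Longrightarrow> computable ex et (\<lambda>x. Var (f x))"
  by (rule c_lift[where k = Var, OF unary_recfn_add[OF unary_recfn_id unary_recfn_id]]) (simp_all add: et_simps del: code_tm.simps)

lemma c_Fun [cintros]: "computable ex cf f \<Longrightarrow> computable ex (elist et) ts \<Longrightarrow> computable ex et (\<lambda>x. Fun (f x) (ts x))"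
  by (rule c_op2[where k = Fun, OF unary_recfn_Suc[OF unary_recfn_add[OF unary_recfn_id unary_recfn_id]]])
    (simp_all add: et_simps eprod_def del: code_tm.simps)

lemma parity: "(n + n) mod 2 = (0::nat)" "Suc (n + n) mod 2 = 1" "(n + n) div 2 = n" "Suc (n + n) div 2 = n"
  by presburger+

lemma c_is_Var [cintros]: "computable ex et f \<Longrightarrow> computable ex ebool (\<lambda>x. is_Var (f x))"
proof (rule c_lift[where k = is_Var and h = "\<lambda>n. if n mod 2 = 0 then 1 else 0"])
  show "(if et (f x) mod 2 = 0 then 1 else 0) = ebool (is_Var (f x))" for x
    by (cases "f x") (simp_all add: et_simps parity ebool_def del: code_tm.simps)
qed (intro unary_recfn_intros unary_recfn_half)

lemma c_var_of [cintros]: "computable ex et f \<Longrightarrow> computable ex ev (\<lambda>x. var_of (f x))"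
proof (rule c_lift[where k = var_of and h = "\<lambda>n. if n mod 2 = 0 then n div 2 else ev undefined"])
  show "(if et (f x) mod 2 = 0 then et (f x) div 2 else ev undefined) = ev (var_of (f x))" for x
    by (cases "f x") (simp_all add: et_simps parity del: code_tm.simps)
qed (intro unary_recfn_intros unary_recfn_half)

lemma c_root_sym [cintros]: "computable ex et f \<Longrightarrow> computable ex cf (\<lambda>x. root_sym (f x))"
proof (rule c_lift[where k = root_sym and h = "\<lambda>n. if n mod 2 = 0 then cf undefined else fst (prod_decode (n div 2))"])
  show "(if et (f x) mod 2 = 0 then cf undefined else fst (prod_decode (et (f x) div 2))) = cf (root_sym (f x))" for x
    by (cases "f x") (simp_all add: et_simps parity eprod_def del: code_tm.simps)
qed (intro unary_recfn_intros unary_recfn_half)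

lemma c_args_of [cintros]: "computable ex et f \<Longrightarrow> computable ex (elist et) (\<lambda>x. args_of (f x))"
proof (rule c_lift[where k = args_of and h = "\<lambda>n. if n mod 2 = 0 then 0 else snd (prod_decode (n div 2))"])
  show "(if et (f x) mod 2 = 0 then 0 else snd (prod_decode (et (f x) div 2))) = elist et (args_of (f x))" for x
    by (cases "f x") (simp_all add: et_simps parity eprod_def elist_simps del: code_tm.simps)
qed (intro unary_recfn_intros unary_recfn_half)

lemma args_of_less: "t' \<in> set (args_of t) \<Longrightarrow> et t' < et t"
proof (cases t)
  case (Fun f ts)
  assume "t' \<in> set (args_of t)"
  then have "et t' < elist et ts" using Fun elist_member by simp
  also have "\<dots> \<le> eprod cf (elist et) (f, ts)" unfolding eprod_def by (simp add: le_prod_encode_2)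
  finally show ?thesis unfolding Fun et_simps by simp
qed simp

text \<open>The parameter \<open>x\<close> is paired with each subterm. This respects the order of
  recursion, because pair codes grow with the second component.\<close>

lemma c_tm_rec:
  assumes f: "\<And>x t. f x t = H x t (map (f x) (args_of t))"
    and H: "computable (eprod ex (eprod et (elist eb))) eb (\<lambda>p. H (fst p) (fst (snd p)) (snd (snd p)))"
  shows "computable (eprod ex et) eb (\<lambda>p. f (fst p) (snd p))"
proof (rule c_code_rec[where H = "\<lambda>p ys. H (fst p) (snd p) ys" and ch = "\<lambda>p. map (Pair (fst p)) (args_of (snd p))"])
  show "f (fst p) (snd p) = H (fst p) (snd p) (map (\<lambda>p. f (fst p) (snd p)) (map (Pair (fst p)) (args_of (snd p))))" for p
    using f[of "fst p" "snd p"] by (simp add: comp_def)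
  show "q \<in> set (map (Pair (fst p)) (args_of (snd p))) \<Longrightarrow> eprod ex et q < eprod ex et p" for p q
    using args_of_less by (auto simp: eprod_def intro!: prod_encode_less)
  show "computable (eprod ex et) (elist (eprod ex et)) (\<lambda>p. map (Pair (fst p)) (args_of (snd p)))"
    by (rule cintros)+
  show "computable (eprod (eprod ex et) (elist eb)) eb (\<lambda>p. H (fst (fst p)) (snd (fst p)) (snd p))"
    using c_comp[OF H, of "eprod (eprod ex et) (elist eb)" "\<lambda>p. (fst (fst p), snd (fst p), snd p)"]
    unfolding fst_conv snd_conv by (rule meta_mp) (rule cintros)+
qed

lemma c_tm_rec1:
  assumes f: "\<And>t. f t = H t (map f (args_of t))"
    and H: "computable (eprod et (elist eb)) eb (\<lambda>p. H (fst p) (snd p))" and t: "computable ex et t"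
  shows "computable ex eb (\<lambda>x. f (t x))"
proof (rule c_comp[OF _ t], rule c_code_rec[where f = f and H = H and ch = args_of])
  show "f t = H t (map f (args_of t))" for t by (rule f)
  show "t' \<in> set (args_of t) \<Longrightarrow> et t' < et t" for t' t by (rule args_of_less)
  show "computable et (elist et) args_of" by (rule c_args_of[OF c_id])
qed (rule H)

lemma c_flist [cintros]: "computable ex et t \<Longrightarrow> computable ex (elist cf) (\<lambda>x. flist (t x))"
proof (rule c_tm_rec1[where H = "\<lambda>t ys. if is_Var t then [] else root_sym t # concat ys"])
  show "flist t = (if is_Var t then [] else root_sym t # concat (map flist (args_of t)))" for t :: "('f, 's) trm" by (cases t) auto
qed (rule cintros | assumption)+

lemma c_var_list [cintros]: "computable ex et t \<Longrightarrow> computable ex (elist ev) (\<lambda>x. var_list (t x))"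
proof (rule c_tm_rec1[where H = "\<lambda>t ys. if is_Var t then [var_of t] else concat ys"])
  show "var_list t = (if is_Var t then [var_of t] else concat (map var_list (args_of t)))" for t :: "('f, 's) trm" by (cases t) auto
qed (rule cintros | assumption)+

lemma c_app [cintros]:
  assumes s: "computable (eprod ex ev) et (\<lambda>p. s (fst p) (snd p))" and t: "computable ex et t"
  shows "computable ex et (\<lambda>x. t x \<cdot> s x)"
proof -
  have s': "computable (eprod ex (eprod et (elist et))) et (\<lambda>p. s (fst p) (var_of (fst (snd p))))"
    using c_comp[OF s, of "eprod ex (eprod et (elist et))" "\<lambda>p. (fst p, var_of (fst (snd p)))"]
    unfolding fst_conv snd_conv by (rule meta_mp) (rule cintros)+
  have "computable (eprod ex et) et (\<lambda>p. (\<lambda>x t. t \<cdot> s x) (fst p) (snd p))"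
  proof (rule c_tm_rec[where H = "\<lambda>x t ys. if is_Var t then s x (var_of t) else Fun (root_sym t) ys"])
    show "t \<cdot> s x = (if is_Var t then s x (var_of t) else Fun (root_sym t) (map (\<lambda>t. t \<cdot> s x) (args_of t)))" for x and t :: "('f, 's) trm"
      by (cases t) auto
  qed (rule s' cintros)+
  from c_comp[OF this c_pair[OF c_id t]] show ?thesis by simp
qed

lemma c_length [cintros]:
  fixes l :: "'x \<Rightarrow> 'y list"
  shows "computable ex (elist ea) l \<Longrightarrow> computable ex enat (\<lambda>x. length (l x))"
proof -
  assume "computable ex (elist ea) l"
  then have "computable ex enat (\<lambda>x. foldr (\<lambda>y n. Suc n) (l x) 0)" by - (rule cintros | assumption)+
  moreover have "foldr (\<lambda>y n. Suc n) xs 0 = length xs" for xs :: "'y list" by (induction xs) auto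
  ultimately show ?thesis by simp
qed

text \<open>A zip obtained from \<open>foldl\<close>, whose computability is known. A second list
  that is too short would make it use \<open>hd []\<close>, hence the test of lengths in
  \<open>children\<close>.\<close>

definition zip_lists :: "'x list \<Rightarrow> 'y list \<Rightarrow> ('x \<times> 'y) list" where
  "zip_lists xs ys = rev (snd (foldl (\<lambda>s x. (tl (fst s), (x, hd (fst s)) # snd s)) (ys, []) xs))"

lemma zip_lists_zip: "length xs = length ys \<Longrightarrow> zip_lists xs ys = zip xs ys"
proof -
  have "length xs = length ys \<Longrightarrow>
    snd (foldl (\<lambda>s x. (tl (fst s), (x, hd (fst s)) # snd s)) (ys, acc) xs) = rev (zip xs ys) @ acc" for acc
  proof (induction xs arbitrary: ys acc)
    case (Cons x xs)
    then show ?case by (cases ys) auto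
  qed simp
  then show "length xs = length ys \<Longrightarrow> zip_lists xs ys = zip xs ys" by (simp add: zip_lists_def)
qed

definition children :: "('f, 's) trm \<times> ('f, 's) trm \<Rightarrow> (('f, 's) trm \<times> ('f, 's) trm) list" where
  "children p = (if length (args_of (fst p)) = length (args_of (snd p)) then zip_lists (args_of (fst p)) (args_of (snd p)) else [])"

lemma children_less: "q \<in> set (children p) \<Longrightarrow> eprod et et q < eprod et et p"
proof -
  assume q: "q \<in> set (children p)"
  then have "q \<in> set (zip (args_of (fst p)) (args_of (snd p)))" by (auto simp: children_def zip_lists_zip split: if_splits)
  then have "fst q \<in> set (args_of (fst p))" "snd q \<in> set (args_of (snd p))"
    by (metis prod.collapse set_zip_leftD, metis prod.collapse set_zip_rightD)
  then show ?thesis using args_of_less unfolding eprod_def by (intro prod_encode_less) (auto intro: less_imp_le)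
qed

lemma c_children: "computable (eprod et et) (elist (eprod et et)) children"
  unfolding children_def zip_lists_def by (rule c_foldl cintros)+

lemmas c_pair_rec = c_code_rec[OF _ children_less c_children]

lemma c_may_match [cintros]: "computable ex et l \<Longrightarrow> computable ex et p \<Longrightarrow> computable ex ebool (\<lambda>x. may_match (l x) (p x))"
proof -
  assume a: "computable ex et l" "computable ex et p"
  have "computable (eprod et et) ebool (\<lambda>q. may_match (fst q) (snd q))"
  proof (rule c_pair_rec[where H = "\<lambda>q ys. is_Var (fst q) \<or> (if is_Var (snd q) then args_of (fst q) = [] else
      (root_sym (fst q) = root_sym (snd q) \<and> length (args_of (fst q)) = length (args_of (snd q)) \<and> (\<forall>y \<in> set ys. y)))"])
    show "may_match (fst q) (snd q) = (is_Var (fst q) \<or> (if is_Var (snd q) then args_of (fst q) = [] else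
      (root_sym (fst q) = root_sym (snd q) \<and> length (args_of (fst q)) = length (args_of (snd q)) \<and>
       (\<forall>y \<in> set (map (\<lambda>q. may_match (fst q) (snd q)) (children q)). y))))" for q
      by (cases "(fst q, snd q)" rule: may_match.cases) (auto simp: children_def zip_lists_zip)
  qed (assumption | rule cintros)+
  from c_comp[OF this c_pair[OF a]] show ?thesis by simp
qed

lemma c_residual [cintros]: "computable ex et l \<Longrightarrow> computable ex et p \<Longrightarrow> computable ex (elist (eprod et et)) (\<lambda>x. residual (l x) (p x))"
proof -
  assume a: "computable ex et l" "computable ex et p"
  have "computable (eprod et et) (elist (eprod et et)) (\<lambda>q. residual (fst q) (snd q))"
  proof (rule c_pair_rec[where H = "\<lambda>q ys. if is_Var (fst q) \<or> is_Var (snd q) then [(fst q, snd q)] else concat ys"])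
    show "residual (fst q) (snd q) = (if is_Var (fst q) \<or> is_Var (snd q) then [(fst q, snd q)] else
       concat (map (\<lambda>q. residual (fst q) (snd q)) (children q)))" for q
      by (cases "(fst q, snd q)" rule: residual.cases) (auto simp: children_def zip_lists_zip)
  qed (assumption | rule cintros)+
  from c_comp[OF this c_pair[OF a]] show ?thesis by simp
qed

lemma c_dsym [cintros]: "computable ex ed d \<Longrightarrow> computable ex cf (\<lambda>x. dsym (d x))"
proof (rule c_lift[where k = dsym and h = "\<lambda>n. fst (prod_decode (n - 1))"])
  show "fst (prod_decode (ed (d x) - 1)) = cf (dsym (d x))" for x
    by (cases "d x") (simp add: dsym_def)
qed (intro unary_recfn_intros)

lemma c_dargs [cintros]: "computable ex ed d \<Longrightarrow> computable ex (elist cs) (\<lambda>x. dargs (d x))"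
proof (rule c_lift[where k = dargs and h = "\<lambda>n. fst (prod_decode (snd (prod_decode (n - 1)) - 1))"])
  show "fst (prod_decode (snd (prod_decode (ed (d x) - 1)) - 1)) = elist cs (dargs (d x))" for x
    by (cases "d x") (simp add: dargs_def elist_def)
qed (intro unary_recfn_intros)

lemma c_dres [cintros]: "computable ex ed d \<Longrightarrow> computable ex cs (\<lambda>x. dres (d x))"
proof (rule c_lift[where k = dres and
    h = "\<lambda>n. fst (prod_decode (snd (prod_decode (snd (prod_decode (n - 1)) - 1)) - 1))"])
  show "fst (prod_decode (snd (prod_decode (snd (prod_decode (ed (d x) - 1)) - 1)) - 1)) = cs (dres (d x))" for x
    by (cases "d x") (simp add: dres_def)
qed (intro unary_recfn_intros)

lemma c_rlhs [cintros]: "computable ex er d \<Longrightarrow> computable ex et (\<lambda>x. rlhs (d x))"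
proof (rule c_lift[where k = rlhs and h = "\<lambda>n. fst (prod_decode (n - 1))"])
  show "fst (prod_decode (er (d x) - 1)) = et (rlhs (d x))" for x
    by (cases "d x") (simp add: rlhs_def)
qed (intro unary_recfn_intros)

lemma c_rrhs [cintros]: "computable ex er d \<Longrightarrow> computable ex et (\<lambda>x. rrhs (d x))"
proof (rule c_lift[where k = rrhs and h = "\<lambda>n. fst (prod_decode (snd (prod_decode (n - 1)) - 1))"])
  show "fst (prod_decode (snd (prod_decode (er (d x) - 1)) - 1)) = et (rrhs (d x))" for x
    by (cases "d x") (simp add: rrhs_def)
qed (intro unary_recfn_intros)

lemma c_rcon [cintros]: "computable ex er d \<Longrightarrow> computable ex et (\<lambda>x. rcon (d x))"
proof (rule c_lift[where k = rcon and
    h = "\<lambda>n. fst (prod_decode (snd (prod_decode (snd (prod_decode (n - 1)) - 1)) - 1))"])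
  show "fst (prod_decode (snd (prod_decode (snd (prod_decode (er (d x) - 1)) - 1)) - 1)) = et (rcon (d x))" for x
    by (cases "d x") (simp add: rcon_def)
qed (intro unary_recfn_intros)

lemma c_ren0: "computable (eprod enat et) et (\<lambda>p. shift_vars (fst p) (snd p))"
  unfolding shift_vars_def by (rule cintros)+
lemmas c_shift_vars [cintros] = c_comp[OF c_ren0 c_pair, unfolded fst_conv snd_conv]

lemma c_argl0: "computable (eprod (elist (eprod et cs)) (elist cs)) (elist (elist et)) (\<lambda>p. arg_lists (fst p) (snd p))"
  unfolding arg_lists_def by (rule cintros)+
lemmas c_arg_lists [cintros] = c_comp[OF c_argl0 c_pair, unfolded fst_conv snd_conv]

lemma c_eff0: "computable (elist ed) (elist ed) (\<lambda>ds. effective_decls ds)"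
  unfolding effective_decls_def by (rule cintros)+
lemmas c_effective_decls [cintros] = c_comp[OF c_eff0]

lemma c_roots0: "computable (elist er) (elist cf) (\<lambda>rs. roots rs)"
  unfolding roots_def by (rule cintros)+
lemmas c_roots [cintros] = c_comp[OF c_roots0]

lemma c_bnd0: "computable (eprod (elist (eprod et et)) ev) et (\<lambda>p. binding (fst p) (snd p))"
  unfolding binding_def by (rule c_lookup[OF inj_ev] cintros)+
lemmas c_binding [cintros] = c_comp[OF c_bnd0 c_pair, unfolded fst_conv snd_conv]

lemma c_isp0: "computable (eprod (elist ed) (eprod (elist er) et)) ebool (\<lambda>p. is_pattern_lhs (fst p) (fst (snd p)) (snd (snd p)))"
  unfolding is_pattern_lhs_def by (rule cintros)+
lemmas c_is_pattern_lhs [cintros] = c_comp[OF c_isp0 c_pair[OF _ c_pair], unfolded fst_conv snd_conv]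

lemma c_rok0: "computable (eprod (elist ed) (eprod (elist er) er)) ebool (\<lambda>p. usable (fst p) (fst (snd p)) (snd (snd p)))"
  unfolding usable_def by (rule cintros)+
lemmas c_usable [cintros] = c_comp[OF c_rok0 c_pair[OF _ c_pair], unfolded fst_conv snd_conv]

lemma c_cdecls0: "computable (eprod (elist ed) (elist er)) (elist ed) (\<lambda>p. constructor_decls (fst p) (snd p))"
  unfolding constructor_decls_def by (rule cintros)+
lemmas c_constructor_decls [cintros] = c_comp[OF c_cdecls0 c_pair, unfolded fst_conv snd_conv]

lemma c_rdecls0: "computable (eprod (elist ed) (elist er)) (elist ed) (\<lambda>p. root_decls (fst p) (snd p))"
  unfolding root_decls_def by (rule cintros)+
lemmas c_root_decls [cintros] = c_comp[OF c_rdecls0 c_pair, unfolded fst_conv snd_conv]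

lemma c_base0: "computable (elist ed) (elist (eprod et cs)) (\<lambda>ds. base_terms ds)"
  unfolding base_terms_def by (rule cintros)+
lemmas c_base_terms [cintros] = c_comp[OF c_base0]

lemma c_gens0: "computable (eprod (elist ed) (eprod (elist er) enat)) (elist (eprod et cs))
    (\<lambda>p. constructor_terms (fst p) (fst (snd p)) (snd (snd p)))"
  unfolding constructor_terms_def by (rule c_rec_nat cintros)+
lemmas c_constructor_terms [cintros] = c_comp[OF c_gens0 c_pair[OF _ c_pair], unfolded fst_conv snd_conv]

lemma c_pats0: "computable (eprod (elist ed) (eprod (elist er) enat)) (elist et)
    (\<lambda>p. abstract_patterns (fst p) (fst (snd p)) (snd (snd p)))"
  unfolding abstract_patterns_def by (rule cintros)+
lemmas c_abstract_patterns [cintros] = c_comp[OF c_pats0 c_pair[OF _ c_pair], unfolded fst_conv snd_conv]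

lemma c_eqc0: "computable (eprod ev cf) et (\<lambda>p. value_eq (fst p) (snd p))"
  unfolding value_eq_def
proof (rule c_if_total)
  show "computable (eprod ev cf) ebool (\<lambda>p. snd (fst p) \<in> theory_sorts T)" by (rule cintros)+
  show "computable (eprod ev cf) et (\<lambda>p. c_true T)" by (rule cintros)
  obtain h where h: "unary_recfn h" "\<forall>\<sigma> \<in> theory_sorts T. h (cs \<sigma>) = cf (eq_sym T \<sigma>)" using c_eq_sym0 by blast
  have "computable (eprod ev cf) enat (\<lambda>p. cs (snd (fst p)))" by (rule c_code cintros)+
  then obtain k where k: "unary_recfn k" "\<And>p. k (eprod ev cf p) = cs (snd (fst p))" unfolding computable_def enat_def by blast
  have "computable (eprod ev cf) (elist et) (\<lambda>p. [Var (fst p), Fun (snd p) []])" by (rule cintros)+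
  then obtain m where m: "unary_recfn m" "\<And>p. m (eprod ev cf p) = elist et [Var (fst p), Fun (snd p) []]"
    unfolding computable_def by blast
  \<comment> \<open>The code of the equation is assembled by hand, as the code of its symbol is
    known only at theory sorts.\<close>
  let ?h = "\<lambda>n. Suc (prod_encode (h (k n), m n) + prod_encode (h (k n), m n))"
  have "unary_recfn ?h" by (intro unary_recfn_Suc unary_recfn_add unary_recfn_pair m(1) unary_recfn_comp[OF h(1) k(1)])
  moreover have "?h (eprod ev cf p) = et (c_eq T (fst p) (Fun (snd p) []))" if "snd (fst p) \<in> theory_sorts T" for p
  proof -
    have e: "h (k (eprod ev cf p)) = cf (eq_sym T (snd (fst p)))" using h(2) that k(2) by simp
    show ?thesis unfolding e m(2) et_simps(2) eprod_def[of cf "elist et"] fst_conv snd_conv ..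
  qed
  ultimately show "\<exists>h. unary_recfn h \<and> (\<forall>p. snd (fst p) \<in> theory_sorts T \<longrightarrow>
      h (eprod ev cf p) = et (c_eq T (fst p) (Fun (snd p) [])))" by blast
qed
lemmas c_value_eq [cintros] = c_comp[OF c_eqc0 c_pair, unfolded fst_conv snd_conv]

lemma c_cond0: "computable (eprod er et) et (\<lambda>p. match_cond (fst p) (snd p))"
  unfolding match_cond_def by (rule cintros)+
lemmas c_match_cond [cintros] = c_comp[OF c_cond0 c_pair, unfolded fst_conv snd_conv]

lemma c_refute0: "computable (eprod (elist ed) (eprod (elist er) et)) et
    (\<lambda>p. no_match (fst p) (fst (snd p)) (snd (snd p)))"
  unfolding no_match_def by (rule cintros)+
lemmas c_no_match [cintros] = c_comp[OF c_refute0 c_pair[OF _ c_pair], unfolded fst_conv snd_conv]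

lemma c_decide: "computable (eprod (elist ed) (eprod (elist er) enat)) ebool
    (\<lambda>p. decide (fst p) (fst (snd p)) (snd (snd p)))"
  unfolding decide_def by (rule cintros)+

text \<open>The code of the input bounds both the depth of left-hand sides and the number of
  declared symbols. Twice the code plus one is therefore at least the depth that remains after
  truncation.\<close>

lemma c_decide_code:
  "computable (code_lctrs cs cf) ebool (\<lambda>i. decide (fst i) (snd i) (Suc (code_lctrs cs cf i + code_lctrs cs cf i)))"
proof -
  have code: "code_lctrs cs cf = eprod (elist ed) (elist er)"
    by (rule ext) (auto simp: eprod_def elist_def)
  have "computable (eprod (elist ed) (elist er)) (eprod (elist ed) (eprod (elist er) enat))
    (\<lambda>i. (fst i, snd i, Suc (eprod (elist ed) (elist er) i + eprod (elist ed) (elist er) i)))"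
    by (rule c_code[OF c_id] cintros)+
  from c_comp[OF c_decide this] show ?thesis unfolding code by simp
qed

end

subsection \<open>Correctness of the decision procedure\<close>

lemma effective_decls_iff: "d \<in> set (effective_decls ds) \<longleftrightarrow> map_of ds (dsym d) = Some (dargs d, dres d)"
proof -
  have "d \<in> set (effective_decls ds) \<longleftrightarrow> map_of ds (fst d) = Some (snd d)"
  proof (induction ds)
    case (Cons e ds)
    have "effective_decls (e # ds) = e # filter (\<lambda>e'. dsym e' \<noteq> dsym e) (effective_decls ds)" by (simp add: effective_decls_def)
    then show ?case using Cons.IH by (cases e; cases d) (auto simp: dsym_def)
  qed (simp add: effective_decls_def)
  then show ?thesis by (simp add: dsym_def dargs_def dres_def)
qed

lemma arg_lists_Cons: "set (arg_lists G (\<sigma> # \<sigma>s)) =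
    {shift_vars 0 u # map (shift_vars 1) us | u us. (u, \<sigma>) \<in> set G \<and> us \<in> set (arg_lists G \<sigma>s)}"
  by (force simp: arg_lists_def)

text \<open>Below a variable of \<open>p\<close> the instance is a constant, so at this position
  \<open>l\<close> has a variable or a constant.\<close>

lemma may_match_of_instance:
  "l \<cdot> \<delta> = p \<cdot> \<gamma> \<Longrightarrow> (\<And>z. z \<in> vars p \<Longrightarrow> \<exists>v. \<gamma> z = Fun v []) \<Longrightarrow> may_match l p"
proof (induction l p rule: may_match.induct)
  case (2 g us z)
  then show ?case by fastforce
next
  case (3 g us h vs)
  have e: "g = h" "map (\<lambda>t. t \<cdot> \<delta>) us = map (\<lambda>t. t \<cdot> \<gamma>) vs" using 3(2) by auto
  then have len: "length us = length vs" by (metis length_map)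
  have "may_match (fst q) (snd q)" if q: "q \<in> set (zip us vs)" for q
  proof (rule 3(1)[OF q])
    obtain i where i: "i < length us" "q = (us ! i, vs ! i)" using q len by (auto simp: set_zip)
    then show "fst q \<cdot> \<delta> = snd q \<cdot> \<gamma>" using e(2) len by (metis fst_conv nth_map snd_conv)
    show "\<exists>v. \<gamma> z = Fun v []" if "z \<in> vars (snd q)" for z
    proof -
      have "vs ! i \<in> set vs" using i(1) len by simp
      then have "z \<in> vars (Fun h vs)" using that unfolding i(2) by auto
      then show ?thesis by (rule 3(3))
    qed
  qed
  then show ?case using e(1) len by simp
qed simp

lemma residual_instance:
  "may_match l p \<Longrightarrow> l \<cdot> \<delta> = p \<cdot> \<gamma> \<longleftrightarrow> (\<forall>q \<in> set (residual l p). fst q \<cdot> \<delta> = snd q \<cdot> \<gamma>)"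
proof (induction l p rule: may_match.induct)
  case (3 g us h vs)
  then have len: "length us = length vs" and m: "g = h" "\<And>q. q \<in> set (zip us vs) \<Longrightarrow> may_match (fst q) (snd q)" by auto
  have "Fun g us \<cdot> \<delta> = Fun h vs \<cdot> \<gamma> \<longleftrightarrow> (\<forall>q \<in> set (zip us vs). fst q \<cdot> \<delta> = snd q \<cdot> \<gamma>)"
    using len m(1) by (auto simp: list_eq_iff_nth_eq set_zip)
  also have "\<dots> \<longleftrightarrow> (\<forall>q \<in> set (zip us vs). \<forall>q' \<in> set (residual (fst q) (snd q)). fst q' \<cdot> \<delta> = snd q' \<cdot> \<gamma>)"
    using 3(1) m(2) by simp
  also have "\<dots> \<longleftrightarrow> (\<forall>q \<in> set (residual (Fun g us) (Fun h vs)). fst q \<cdot> \<delta> = snd q \<cdot> \<gamma>)"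
    using len by auto
  finally show ?case .
qed auto

text \<open>Each variable occurrence of \<open>l\<close> ends up in exactly one residual pair, so
  linearity of \<open>l\<close> makes the binding of a variable unique.\<close>

lemma residual_keys:
  "may_match l p \<Longrightarrow> map (\<lambda>q. var_of (fst q)) (filter (\<lambda>q. is_Var (fst q)) (residual l p)) = var_list l"
proof (induction l p rule: may_match.induct)
  case (3 g us h vs)
  then have len: "length us = length vs" and m: "\<And>q. q \<in> set (zip us vs) \<Longrightarrow> may_match (fst q) (snd q)" by auto
  have "map (\<lambda>q. var_of (fst q)) (filter (\<lambda>q. is_Var (fst q)) (residual (Fun g us) (Fun h vs))) =
      concat (map (\<lambda>q. map (\<lambda>q. var_of (fst q)) (filter (\<lambda>q. is_Var (fst q)) (residual (fst q) (snd q)))) (zip us vs))"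
    using len by (simp add: filter_concat map_concat comp_def)
  also have "\<dots> = concat (map (\<lambda>q. var_list (fst q)) (zip us vs))"
    using 3(1) m by (intro arg_cong[of _ _ concat] map_cong) auto
  also have "map (\<lambda>q. var_list (fst q)) (zip us vs) = map var_list us"
    using len by (simp add: list_eq_iff_nth_eq)
  finally show ?case by simp
qed auto

lemma lookup_in: "distinct (map fst ps) \<Longrightarrow> (k, v) \<in> set ps \<Longrightarrow> lookup k ps d = v"
  by (induction ps) (force simp: lookup_def)+

lemma binding_residual:
  assumes "may_match l p" "linear l" "(Var x, b) \<in> set (residual l p)"
  shows "binding (residual l p) x = b"
proof -
  have "map fst (map (\<lambda>q. (var_of (fst q), snd q)) (filter (\<lambda>q. is_Var (fst q)) (residual l p))) = var_list l"
    using residual_keys[OF assms(1)] by (simp add: comp_def)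
  moreover have "(x, b) \<in> set (map (\<lambda>q. (var_of (fst q), snd q)) (filter (\<lambda>q. is_Var (fst q)) (residual l p)))"
    using assms(3) by force
  ultimately show ?thesis unfolding binding_def using assms(2) by (intro lookup_in) (simp_all add: linear_def)
qed

lemma residual_binds: "may_match l p \<Longrightarrow> x \<in> vars l \<Longrightarrow> \<exists>b. (Var x, b) \<in> set (residual l p)"
proof -
  assume m: "may_match l p" and x: "x \<in> vars l"
  have "x \<in> set (map (\<lambda>q. var_of (fst q)) (filter (\<lambda>q. is_Var (fst q)) (residual l p)))"
    unfolding residual_keys[OF m] set_var_list using x .
  then obtain q where q: "q \<in> set (residual l p)" "is_Var (fst q)" "x = var_of (fst q)" by auto
  then have "fst q = Var x" by (cases "fst q") auto
  then show ?thesis using q(1) by (metis prod.collapse)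
qed

text \<open>The property \<open>P\<close> is carried along for \<open>trunc_match\<close> and
  \<open>decide_sound\<close>, where it records sorts and the agreement of two matchers at theory
  sorts.\<close>

lemma merge_instance:
  assumes lin: "linear (Fun f us)" and len: "length us = length ts"
    and ex: "\<And>i. i < length us \<Longrightarrow> \<exists>\<gamma>. us ! i \<cdot> \<gamma> = ts ! i \<and> (\<forall>x \<in> vars (us ! i). P x (\<gamma> x))"
  shows "\<exists>\<gamma>. Fun f us \<cdot> \<gamma> = Fun f ts \<and> (\<forall>x \<in> vars (Fun f us). P x (\<gamma> x))"
proof -
  have "\<forall>i. \<exists>\<gamma>. i < length us \<longrightarrow> us ! i \<cdot> \<gamma> = ts ! i \<and> (\<forall>x \<in> vars (us ! i). P x (\<gamma> x))" using ex by blast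
  then obtain \<Gamma> where \<Gamma>: "\<And>i. i < length us \<Longrightarrow> us ! i \<cdot> \<Gamma> i = ts ! i \<and> (\<forall>x \<in> vars (us ! i). P x (\<Gamma> i x))" by metis
  obtain \<gamma> where \<gamma>: "\<forall>i < length us. \<forall>x \<in> vars (us ! i). \<gamma> x = \<Gamma> i x"
    using merge_disjoint[of "length us" "\<lambda>i. vars (us ! i)" \<Gamma>] lin by (auto simp: linear_Fun)
  have "us ! i \<cdot> \<gamma> = ts ! i" if "i < length us" for i
    using \<Gamma>[OF that] \<gamma> that app_cong[of "us ! i" \<gamma> "\<Gamma> i"] by simp
  then have "Fun f us \<cdot> \<gamma> = Fun f ts" using len by (simp add: list_eq_iff_nth_eq)
  moreover have "P x (\<gamma> x)" if x: "x \<in> vars (Fun f us)" for x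
  proof -
    obtain i where i: "i < length us" "x \<in> vars (us ! i)" using x by (auto simp: in_set_conv_nth)
    then show ?thesis using \<Gamma>[of i] \<gamma> by auto
  qed
  ultimately show ?thesis by blast
qed

context admissible_lctrs
begin

text \<open>Values are required at all theory-sorted variables, not just those of one term, so that
  such substitutions can be combined after a shift of indices.\<close>

definition value_subst :: "('f, 's) subst \<Rightarrow> bool" where
  "value_subst \<gamma> \<longleftrightarrow> (\<forall>x. snd x \<in> th \<longrightarrow> \<gamma> x \<in> value_terms (snd x))"

text \<open>A ground constructor term with its values replaced by variables; every value
  substitution turns it into a ground constructor term again.\<close>

definition skeleton :: "('f, 's) trm \<Rightarrow> 's \<Rightarrow> bool" where
  "skeleton u \<sigma> \<longleftrightarrow> wt \<Sigma> u \<sigma> \<and> funs u \<subseteq> C0 \<and> (\<forall>x \<in> vars u. snd x \<in> th)"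

lemma skeleton_ground_terms: "skeleton u \<sigma> \<Longrightarrow> value_subst \<gamma> \<Longrightarrow> u \<cdot> \<gamma> \<in> ground_terms \<sigma>"
proof -
  assume u: "skeleton u \<sigma>" and \<gamma>: "value_subst \<gamma>"
  then have g: "\<gamma> x \<in> ground_terms (snd x)" if "x \<in> vars u" for x
    using that value_terms_ground_terms by (auto simp: skeleton_def value_subst_def)
  have "wt \<Sigma> (u \<cdot> \<gamma>) \<sigma>" using u g ground_terms_wt by (intro wt_app) (auto simp: skeleton_def)
  moreover have "vars (u \<cdot> \<gamma>) = {}" "funs (u \<cdot> \<gamma>) \<subseteq> C"
    using u g C0_C by (fastforce simp: skeleton_def ground_terms_def vars_app funs_app)+
  ultimately show ?thesis by (simp add: ground_terms_def)
qed

lemma default_values: "\<exists>d. \<forall>\<iota> \<in> th. d \<iota> \<in> value_terms \<iota>"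
proof -
  have "\<exists>t. \<iota> \<in> th \<longrightarrow> t \<in> value_terms \<iota>" for \<iota>
    using val_exists[of \<iota>] by (auto simp: value_terms_def)
  then show ?thesis by metis
qed

lemma value_subst_extend:
  assumes "\<And>x. x \<in> V \<Longrightarrow> \<gamma>0 x \<in> value_terms (snd x)"
  shows "\<exists>\<gamma>. value_subst \<gamma> \<and> (\<forall>x \<in> V. \<gamma> x = \<gamma>0 x)"
proof -
  obtain d where "\<forall>\<iota> \<in> th. d \<iota> \<in> value_terms \<iota>" using default_values by blast
  then show ?thesis
    using assms by (intro exI[of _ "\<lambda>x. if x \<in> V then \<gamma>0 x else d (snd x)"]) (simp add: value_subst_def)
qed

lemma value_subst_value_terms: "value_subst \<gamma> \<Longrightarrow> is_constraint T \<chi> \<Longrightarrow> x \<in> vars \<chi> \<Longrightarrow> \<gamma> x \<in> value_terms (snd x)"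
  using constraint_var_sort unfolding value_subst_def by blast

lemma shift_vars_skeleton: "skeleton u \<sigma> \<Longrightarrow> skeleton (shift_vars b u) \<sigma>"
  unfolding skeleton_def shift_vars_def by (auto simp: vars_app funs_app intro!: wt_app)

lemma arg_lists_skeleton:
  assumes "\<And>u \<sigma>. (u, \<sigma>) \<in> set G \<Longrightarrow> skeleton u \<sigma>" "us \<in> set (arg_lists G \<sigma>s)"
  shows "length us = length \<sigma>s \<and> (\<forall>i < length us. skeleton (us ! i) (\<sigma>s ! i))"
  using assms(2)
proof (induction \<sigma>s arbitrary: us)
  case Nil
  then show ?case by (simp add: arg_lists_def)
next
  case (Cons \<sigma> \<sigma>s)
  then obtain u us' where u: "us = shift_vars 0 u # map (shift_vars 1) us'" "(u, \<sigma>) \<in> set G" "us' \<in> set (arg_lists G \<sigma>s)"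
    unfolding arg_lists_Cons by blast
  have "skeleton (us ! i) ((\<sigma> # \<sigma>s) ! i)" if "i < length us" for i
    using that Cons.IH[OF u(3)] shift_vars_skeleton assms(1)[OF u(2)] unfolding u(1) by (cases i) auto
  then show ?case using Cons.IH[OF u(3)] u(1) by simp
qed

lemma arg_lists_complete:
  assumes "length ts = length \<sigma>s"
    "\<And>i. i < length ts \<Longrightarrow> \<exists>u \<gamma>. (u, \<sigma>s ! i) \<in> set G \<and> value_subst \<gamma> \<and> u \<cdot> \<gamma> = ts ! i"
  shows "\<exists>us \<gamma>. us \<in> set (arg_lists G \<sigma>s) \<and> value_subst \<gamma> \<and> map (\<lambda>u. u \<cdot> \<gamma>) us = ts"
  using assms
proof (induction \<sigma>s arbitrary: ts)
  case Nil
  obtain \<gamma> where "value_subst \<gamma>" using value_subst_extend[of "{}"] by auto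
  then show ?case using Nil by (auto simp: arg_lists_def)
next
  case (Cons \<sigma> \<sigma>s)
  then obtain t ts' where ts: "ts = t # ts'" by (cases ts) auto
  obtain u \<gamma>0 where u: "(u, \<sigma>) \<in> set G" "value_subst \<gamma>0" "u \<cdot> \<gamma>0 = t" using Cons.prems(2)[of 0] ts by auto
  have "\<exists>u \<gamma>. (u, \<sigma>s ! i) \<in> set G \<and> value_subst \<gamma> \<and> u \<cdot> \<gamma> = ts' ! i" if "i < length ts'" for i
    using Cons.prems(2)[of "Suc i"] that ts by auto
  then obtain us \<gamma>1 where us: "us \<in> set (arg_lists G \<sigma>s)" "value_subst \<gamma>1" "map (\<lambda>u. u \<cdot> \<gamma>1) us = ts'"
    using Cons.IH[of ts'] Cons.prems(1) ts by auto
  \<comment> \<open>Undoes the shifts: even indices belong to the head, odd ones to the remaining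
    arguments.\<close>
  define \<gamma> where "\<gamma> x = (if even (fst x) then \<gamma>0 (fst x div 2, snd x) else \<gamma>1 (fst x div 2, snd x))" for x
  have "value_subst \<gamma>"
    unfolding value_subst_def
  proof (intro allI impI)
    fix x :: "'s vr" assume "snd x \<in> th"
    then show "\<gamma> x \<in> value_terms (snd x)"
      using u(2) us(2) unfolding value_subst_def \<gamma>_def by (metis snd_conv)
  qed
  moreover have "shift_vars 0 v \<cdot> \<gamma> = v \<cdot> \<gamma>0" for v
    unfolding shift_vars_def app_app by (intro app_cong) (simp add: \<gamma>_def)
  moreover have "shift_vars 1 v \<cdot> \<gamma> = v \<cdot> \<gamma>1" for v
    unfolding shift_vars_def app_app by (intro app_cong) (simp add: \<gamma>_def)
  ultimately have "value_subst \<gamma> \<and> map (\<lambda>u. u \<cdot> \<gamma>) (shift_vars 0 u # map (shift_vars 1) us) = ts"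
    using u(3) us(3) ts by (simp add: comp_def)
  moreover have "shift_vars 0 u # map (shift_vars 1) us \<in> set (arg_lists G (\<sigma> # \<sigma>s))" unfolding arg_lists_Cons using u(1) us(1) by blast
  ultimately show ?case by blast
qed

lemma wt_funs: "wt \<Sigma> t \<tau> \<Longrightarrow> funs t \<subseteq> dom \<Sigma>"
proof (induction rule: wt.induct)
  case (wt_Fun f \<sigma>s \<tau> ts)
  then show ?case by (auto simp: in_set_conv_nth dom_def) (blast dest: subsetD)
qed simp

lemma value_term: "wt \<Sigma> (Fun v []) \<sigma> \<Longrightarrow> \<sigma> \<in> th \<Longrightarrow> v \<in> C \<Longrightarrow> v \<in> vals T \<and> theory_sig T v = Some ([], \<sigma>)"
  using ground_terms_value_terms[of \<sigma>] by (auto simp: ground_terms_def value_terms_def)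

lemma residual_typed:
  "may_match l p \<Longrightarrow> wt \<Sigma> l \<sigma> \<Longrightarrow> funs l \<subseteq> C \<Longrightarrow> skeleton p \<sigma> \<Longrightarrow> q \<in> set (residual l p) \<Longrightarrow>
   (\<exists>x b. q = (Var x, b) \<and> skeleton b (snd x)) \<or>
   (\<exists>v z. q = (Fun v [], Var z) \<and> v \<in> vals T \<and> theory_sig T v = Some ([], snd z))"
proof (induction l p arbitrary: \<sigma> rule: may_match.induct)
  case (2 g us z)
  then show ?case using value_term[of g \<sigma>] by (auto simp: skeleton_def)
next
  case (3 g us h vs)
  then have len: "length us = length vs" by auto
  then obtain q' where q': "q' \<in> set (zip us vs)" "q \<in> set (residual (fst q') (snd q'))" using 3(6) by auto
  then obtain i where i: "i < length us" "q' = (us ! i, vs ! i)" using len by (auto simp: set_zip)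
  obtain \<sigma>s where s: "\<Sigma> g = Some (\<sigma>s, \<sigma>)" "wt \<Sigma> (us ! i) (\<sigma>s ! i)" using 3(3) i by (auto simp: wt_Fun_iff)
  have "wt \<Sigma> (vs ! i) (\<sigma>s ! i)" using 3(2,5) s(1) i len by (auto simp: skeleton_def wt_Fun_iff)
  moreover have "funs (vs ! i) \<subseteq> C0" "\<forall>x \<in> vars (vs ! i). snd x \<in> th" "funs (us ! i) \<subseteq> C"
  proof -
    have "us ! i \<in> set us" "vs ! i \<in> set vs" using i(1) len by simp_all
    then show "funs (vs ! i) \<subseteq> C0" "\<forall>x \<in> vars (vs ! i). snd x \<in> th" "funs (us ! i) \<subseteq> C"
      using 3(4,5) by (auto simp: skeleton_def)
  qed
  ultimately show ?case using 3(1)[OF q'(1)] 3(2) q' i s(2) by (auto simp: skeleton_def)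
qed auto

section \<open>Ground terms of least depth and truncation\<close>

fun result_sort :: "('f, 's) trm \<Rightarrow> 's" where
  "result_sort (Var x) = snd x"
| "result_sort (Fun f ts) = snd (the (\<Sigma> f))"

lemma result_sort_wt: "wt \<Sigma> t \<sigma> \<Longrightarrow> result_sort t = \<sigma>"
  by (cases t) (auto simp: wt_Fun_iff)

text \<open>Meaningful for sorts that have a ground constructor term.\<close>

definition min_depth :: "'s \<Rightarrow> nat" where
  "min_depth \<sigma> = (LEAST n. \<exists>t \<in> ground_terms \<sigma>. depth_le n t)"

lemma min_depth_term: "t \<in> ground_terms \<sigma> \<Longrightarrow> \<exists>t \<in> ground_terms \<sigma>. depth_le (min_depth \<sigma>) t"
  unfolding min_depth_def by (rule LeastI_ex) (meson depth_le_exists)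

lemma min_depth_le: "t \<in> ground_terms \<sigma> \<Longrightarrow> depth_le n t \<Longrightarrow> min_depth \<sigma> \<le> n"
  unfolding min_depth_def by (rule Least_le) blast

definition reachable :: "'s set" where
  "reachable = {\<sigma>. \<sigma> \<notin> th \<and> ground_terms \<sigma> \<noteq> {}}"

lemma min_depth_theory: "\<sigma> \<in> th \<Longrightarrow> min_depth \<sigma> \<le> 1"
proof -
  assume \<sigma>: "\<sigma> \<in> th"
  obtain v where "v \<in> vals T" "theory_sig T v = Some ([], \<sigma>)" using val_exists[OF \<sigma>] by blast
  then have "Fun v [] \<in> ground_terms \<sigma>" by (intro value_terms_ground_terms) (auto simp: value_terms_def)
  then show ?thesis by (rule min_depth_le) simp
qed

text \<open>In a term of least depth, some argument sort has a least depth smaller by exactly one;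
  otherwise arguments of least depth would give a shallower term. The bound \<open>2 \<le> n\<close>
  ensures that this is no theory sort.\<close>

lemma min_depth_step:
  assumes \<sigma>: "\<sigma> \<in> reachable" and m: "min_depth \<sigma> = Suc n" "2 \<le> n"
  shows "\<exists>\<sigma>' \<in> reachable. min_depth \<sigma>' = n"
proof -
  obtain t where t: "t \<in> ground_terms \<sigma>" "depth_le (Suc n) t" using \<sigma> min_depth_term m(1) by (force simp: reachable_def)
  obtain c ts \<sigma>s where c: "t = Fun c ts" "c \<in> C0" "F c = Some (\<sigma>s, \<sigma>)" "length ts = length \<sigma>s"
    "\<forall>i < length ts. ts ! i \<in> ground_terms (\<sigma>s ! i)"
    using ground_terms_term_sort[OF t(1)] \<sigma> unfolding reachable_def by blast
  note c5 = c(5)[rule_format]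
  have le: "min_depth (\<sigma>s ! i) \<le> n" if "i < length ts" for i
    using t(2) that c(1) by (intro min_depth_le[OF c5[OF that]]) simp
  have "\<exists>i < length ts. min_depth (\<sigma>s ! i) = n"
  proof (rule ccontr)
    assume "\<not> (\<exists>i < length ts. min_depth (\<sigma>s ! i) = n)"
    then have lt: "min_depth (\<sigma>s ! i) \<le> n - 1" if "i < length ts" for i using le[OF that] that by fastforce
    have "\<forall>i. \<exists>t. i < length ts \<longrightarrow> t \<in> ground_terms (\<sigma>s ! i) \<and> depth_le (min_depth (\<sigma>s ! i)) t"
      using min_depth_term c5 by blast
    then obtain s where s: "\<And>i. i < length ts \<Longrightarrow> s i \<in> ground_terms (\<sigma>s ! i) \<and> depth_le (min_depth (\<sigma>s ! i)) (s i)" by metis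
    let ?t = "Fun c (map s [0..<length ts])"
    have "?t \<in> ground_terms \<sigma>"
      using s c(2,3,4) sig_F C0_C by (force simp: ground_terms_def wt_Fun_iff)
    moreover have "depth_le (Suc (n - 1)) ?t" using s lt depth_le_mono by fastforce
    ultimately have "min_depth \<sigma> \<le> Suc (n - 1)" by (rule min_depth_le)
    then show False using m by simp
  qed
  then obtain i where i: "i < length ts" "min_depth (\<sigma>s ! i) = n" by blast
  have "\<sigma>s ! i \<notin> th" using min_depth_theory[of "\<sigma>s ! i"] i(2) m(2) by auto
  then show ?thesis using i c5[OF i(1)] by (auto simp: reachable_def)
qed

text \<open>All numbers from 2 up to the least depth of \<open>\<sigma>\<close> are least depths of
  reachable sorts, and each reachable sort is the result sort of a declared symbol.\<close>

lemma min_depth_bound: "ground_terms \<sigma> \<noteq> {} \<Longrightarrow> min_depth \<sigma> \<le> Suc (card (dom F))"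
proof (cases "\<sigma> \<in> th")
  case True
  then show ?thesis using min_depth_theory[OF True] by simp
next
  case False
  assume "ground_terms \<sigma> \<noteq> {}"
  then have \<sigma>: "\<sigma> \<in> reachable" using False by (simp add: reachable_def)
  \<comment> \<open>\<open>min_depth_step\<close> descends only as far as 2. The value 1 is not
    counted, which accounts for the \<open>Suc\<close> in the bound.\<close>
  have "{2..min_depth \<sigma>} \<subseteq> min_depth ` reachable"
  proof
    fix j assume "j \<in> {2..min_depth \<sigma>}"
    then have j: "2 \<le> j" "j \<le> min_depth \<sigma>" by auto
    from j(2) show "j \<in> min_depth ` reachable"
    proof (induction rule: inc_induct)
      case base
      then show ?case using \<sigma> by blast
    next
      case (step n)
      then obtain \<sigma>' where "\<sigma>' \<in> reachable" "min_depth \<sigma>' = Suc n" by auto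
      then show ?case using min_depth_step[of \<sigma>' n] step j(1) by (metis image_eqI le_trans)
    qed
  qed
  moreover have sub: "reachable \<subseteq> (\<lambda>f. snd (the (F f))) ` dom F"
  proof
    fix \<tau> assume \<tau>: "\<tau> \<in> reachable"
    then obtain t where t: "t \<in> ground_terms \<tau>" by (auto simp: reachable_def)
    obtain c \<sigma>s where "F c = Some (\<sigma>s, \<tau>)" using ground_terms_term_sort[OF t] \<tau> by (auto simp: reachable_def)
    then show "\<tau> \<in> (\<lambda>f. snd (the (F f))) ` dom F" by force
  qed
  ultimately have "{2..min_depth \<sigma>} \<subseteq> min_depth ` (\<lambda>f. snd (the (F f))) ` dom F"
    by (rule order_trans[OF _ image_mono])
  then have "card {2..min_depth \<sigma>} \<le> card (min_depth ` (\<lambda>f. snd (the (F f))) ` dom F)"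
    using finite_dom_F by (intro card_mono) auto
  also have "\<dots> \<le> card (dom F)"
    using finite_dom_F by (meson card_image_le finite_imageI le_trans)
  finally show ?thesis by simp
qed

text \<open>Term-sorted subterms at level \<open>k\<close> are replaced by terms of least depth.
  Values are kept, since constraints depend on them.\<close>

fun trunc :: "nat \<Rightarrow> ('f, 's) trm \<Rightarrow> ('f, 's) trm" where
  "trunc (Suc k) (Fun f ts) = Fun f (map (trunc k) ts)"
| "trunc k t = (if result_sort t \<in> th then t else (SOME u. u \<in> ground_terms (result_sort t) \<and> depth_le (min_depth (result_sort t)) u))"

lemma trunc_theory: "t \<in> ground_terms \<sigma> \<Longrightarrow> \<sigma> \<in> th \<Longrightarrow> trunc k t = t"
proof -
  assume t: "t \<in> ground_terms \<sigma>" and \<sigma>: "\<sigma> \<in> th"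
  then obtain v where "t = Fun v []" using ground_terms_value_terms by (auto simp: value_terms_def)
  then show ?thesis using result_sort_wt[OF ground_terms_wt[OF t]] \<sigma> by (cases k) auto
qed

lemma trunc_ground_terms: "t \<in> ground_terms \<sigma> \<Longrightarrow> trunc k t \<in> ground_terms \<sigma> \<and> depth_le (k + Suc (card (dom F))) (trunc k t)"
proof (induction k arbitrary: t \<sigma>)
  case 0
  have s: "result_sort t = \<sigma>" using result_sort_wt[OF ground_terms_wt[OF 0]] .
  obtain f ts where t: "t = Fun f ts" using ground_terms_cases[OF 0] by blast
  show ?case
  proof (cases "\<sigma> \<in> th")
    case True
    then obtain v where "t = Fun v []" using 0 ground_terms_value_terms by (auto simp: value_terms_def)
    then show ?thesis using 0 trunc_theory[OF 0 True] by simp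
  next
    case False
    have "trunc 0 t = (SOME u. u \<in> ground_terms \<sigma> \<and> depth_le (min_depth \<sigma>) u)" using t s False by auto
    moreover obtain u where "u \<in> ground_terms \<sigma> \<and> depth_le (min_depth \<sigma>) u" using min_depth_term[OF 0] by blast
    then have "(SOME u. u \<in> ground_terms \<sigma> \<and> depth_le (min_depth \<sigma>) u) \<in> ground_terms \<sigma> \<and>
        depth_le (min_depth \<sigma>) (SOME u. u \<in> ground_terms \<sigma> \<and> depth_le (min_depth \<sigma>) u)"
      by (rule someI)
    ultimately have "trunc 0 t \<in> ground_terms \<sigma> \<and> depth_le (min_depth \<sigma>) (trunc 0 t)" by simp
    moreover have "min_depth \<sigma> \<le> Suc (card (dom F))" using 0 by (intro min_depth_bound) blast
    ultimately show ?thesis using depth_le_mono by auto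
  qed
next
  case (Suc k)
  obtain c ts \<sigma>s where c: "t = Fun c ts" "c \<in> C" "\<Sigma> c = Some (\<sigma>s, \<sigma>)" "length ts = length \<sigma>s"
    "\<forall>i < length ts. ts ! i \<in> ground_terms (\<sigma>s ! i)"
    using ground_terms_cases[OF Suc.prems] by blast
  have IH: "trunc k (ts ! i) \<in> ground_terms (\<sigma>s ! i) \<and> depth_le (k + Suc (card (dom F))) (trunc k (ts ! i))" if "i < length ts" for i
    using Suc.IH c(5) that by blast
  have "\<forall>u \<in> set ts. vars (trunc k u) = {} \<and> funs (trunc k u) \<subseteq> C \<and> depth_le (k + Suc (card (dom F))) (trunc k u)"
  proof
    fix u assume "u \<in> set ts"
    then obtain i where "i < length ts" "u = ts ! i" by (auto simp: in_set_conv_nth)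
    then show "vars (trunc k u) = {} \<and> funs (trunc k u) \<subseteq> C \<and> depth_le (k + Suc (card (dom F))) (trunc k u)"
      using IH[of i] by (simp add: ground_terms_def)
  qed
  moreover have "wt \<Sigma> (trunc (Suc k) t) \<sigma>" using IH c by (simp add: wt_Fun_iff ground_terms_def)
  ultimately show ?case using c(1,2) by (auto simp: ground_terms_def)
qed

text \<open>A term of depth at most \<open>k\<close> cannot tell \<open>t\<close> from its
  truncation: all changes lie below its variables, and at theory-sorted variables nothing
  changes.\<close>

lemma trunc_match:
  "linear l \<Longrightarrow> depth_le k l \<Longrightarrow> wt \<Sigma> l \<sigma> \<Longrightarrow> t \<in> ground_terms \<sigma> \<Longrightarrow> l \<cdot> \<gamma>' = trunc k t \<Longrightarrow>
   \<exists>\<gamma>. l \<cdot> \<gamma> = t \<and> (\<forall>x \<in> vars l. \<gamma> x \<in> ground_terms (snd x) \<and> (snd x \<in> th \<longrightarrow> \<gamma> x = \<gamma>' x))"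
proof (induction l arbitrary: k \<sigma> t)
  case (Var x)
  then show ?case using trunc_theory[of t \<sigma> k] by (intro exI[of _ "\<lambda>_. t"]) auto
next
  case (Fun f us)
  obtain m where m: "k = Suc m" "\<forall>u \<in> set us. depth_le m u" using Fun.prems(2) unfolding depth_le_Fun by blast
  obtain c ts \<sigma>s where c: "t = Fun c ts" "\<Sigma> c = Some (\<sigma>s, \<sigma>)" "length ts = length \<sigma>s"
    "\<forall>i < length ts. ts ! i \<in> ground_terms (\<sigma>s ! i)"
    using ground_terms_cases[OF Fun.prems(4)] by blast
  have e: "f = c" "map (\<lambda>u. u \<cdot> \<gamma>') us = map (trunc m) ts" using Fun.prems(5) unfolding m(1) c(1) by auto
  then have len: "length us = length ts" by (metis length_map)
  have "\<exists>\<gamma>. us ! i \<cdot> \<gamma> = ts ! i \<and> (\<forall>x \<in> vars (us ! i). \<gamma> x \<in> ground_terms (snd x) \<and> (snd x \<in> th \<longrightarrow> \<gamma> x = \<gamma>' x))"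
    if i: "i < length us" for i
  proof (rule Fun.IH)
    show "us ! i \<in> set us" using i by simp
    show "linear (us ! i)" using Fun.prems(1) i by (simp add: linear_Fun)
    show "depth_le m (us ! i)" using m(2) i by simp
    show "wt \<Sigma> (us ! i) (\<sigma>s ! i)" using Fun.prems(3) i c(2) e(1) by (auto simp: wt_Fun_iff)
    show "ts ! i \<in> ground_terms (\<sigma>s ! i)" using c(4) i len by simp
    show "us ! i \<cdot> \<gamma>' = trunc m (ts ! i)" using e(2) i len by (metis nth_map)
  qed
  from merge_instance[OF Fun.prems(1) len this] show ?case unfolding c(1) e(1) .
qed

end

locale decision = procedure T is_value sat + admissible_lctrs T "map_of ds" "set rs"
  for T :: "('s, 'f, 'a) background" and is_value :: "'f \<Rightarrow> bool" and sat :: "('f, 's) trm \<Rightarrow> bool"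
    and ds :: "('f \<times> 's list \<times> 's) list" and rs :: "('f, 's) rule list" +
  assumes is_value: "\<And>f. f \<in> dom (theory_sig T) \<Longrightarrow> is_value f \<longleftrightarrow> f \<in> vals T"
    and sat: "\<And>\<phi>. is_constraint T \<phi> \<Longrightarrow> sat \<phi> \<longleftrightarrow> satisfiable T \<phi>"
    and cv: "constraint_vars_in_lhs T (map_of ds) (set rs)"
begin

abbreviation "F \<equiv> map_of ds"
abbreviation "R \<equiv> set rs"

lemma root_iff: "f \<in> set (roots rs) \<longleftrightarrow> (\<exists>us r \<phi>. (Fun f us, r, \<phi>) \<in> R)"
proof
  assume "f \<in> set (roots rs)"
  then obtain l r \<phi> where r: "(l, r, \<phi>) \<in> R" "f = root_sym l" by (auto simp: roots_def rlhs_def)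
  then show "\<exists>us r \<phi>. (Fun f us, r, \<phi>) \<in> R" using rule_facts(3)[OF r(1)] by (cases l) (blast, fastforce)
qed (force simp: roots_def rlhs_def)

lemma root_defined: "f \<notin> calc_syms T \<Longrightarrow> f \<in> set (roots rs) \<longleftrightarrow> f \<in> defined_syms T R"
  unfolding root_iff defined_syms_def calc_rules_def by blast

lemma is_pattern_lhs_iff:
  assumes R: "(l, r, \<phi>) \<in> R" shows "is_pattern_lhs ds rs l \<longleftrightarrow> is_pattern T F R l"
proof -
  obtain f us where l: "l = Fun f us" using rule_facts(3)[OF R] by (cases l) auto
  obtain \<tau> where \<tau>: "wt \<Sigma> l \<tau>" using rule_facts(1)[OF R] by blast
  have f: "f \<in> defined_syms T R" using R l unfolding defined_syms_def by blast
  \<comment> \<open>A symbol of the signature is declared, a value or a calculation symbol. For the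
    last kind, being defined comes from \<open>calc_rules\<close> and not from
    \<open>rs\<close>.\<close>
  have K: "g \<in> C \<longleftrightarrow> g \<notin> set (roots rs) \<and> (g \<in> dom F \<or> is_value g)" if g: "g \<in> dom \<Sigma>" for g
  proof (cases "g \<in> dom F")
    case True
    then show ?thesis using root_defined[OF dom_F_calc[OF True]] g by (auto simp: constructors_def)
  next
    case False
    obtain d where "\<Sigma> g = Some d" using g by blast
    then have g': "g \<in> dom (theory_sig T)" using sig_cases[of g d] False by auto
    show ?thesis
    proof (cases "g \<in> vals T")
      case True
      then show ?thesis using val_constructor[OF True] is_value[OF g'] val_not_defined[OF True] root_defined[of g]
        by (auto simp: calc_syms_def)
    next
      case nv: False
      then have "g \<in> calc_syms T" using g' by (simp add: calc_syms_def)
      then show ?thesis using calc_defined is_value[OF g'] nv False by (auto simp: constructors_def)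
    qed
  qed
  have D: "g \<in> dom \<Sigma>" if "u \<in> set us" "g \<in> funs u" for u g
  proof -
    have "g \<in> funs l" using that unfolding l by auto
    then show ?thesis using wt_funs[OF \<tau>] by blast
  qed
  have "is_pattern_lhs ds rs l \<longleftrightarrow> (\<forall>u \<in> set us. \<forall>g \<in> funs u. g \<notin> set (roots rs) \<and> (g \<in> dom F \<or> is_value g))"
  proof -
    have "g \<in> set (map dsym ds) \<longleftrightarrow> g \<in> dom F" for g
      by (simp only: dsym_def[abs_def] dom_map_of_conv_image_fst set_map)
    then show ?thesis unfolding is_pattern_lhs_def l by (simp add: set_flist)
  qed
  also have "\<dots> \<longleftrightarrow> (\<forall>u \<in> set us. \<forall>g \<in> funs u. g \<in> C)" using K[OF D] by simp
  also have "\<dots> \<longleftrightarrow> (\<forall>u \<in> set us. funs u \<subseteq> C)" by (simp only: subset_eq)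
  finally have "(\<forall>u \<in> set us. funs u \<subseteq> C) \<longleftrightarrow> is_pattern_lhs ds rs l" by (rule sym)
  then show ?thesis unfolding is_pattern_def l using \<tau> f l by auto
qed

lemma usable_iff:
  "(l, r, \<phi>) \<in> R \<Longrightarrow> usable ds rs (l, r, \<phi>) \<longleftrightarrow> is_pattern T F R l \<and> snd ` (vars r - vars l) \<subseteq> th"
  unfolding usable_def using is_pattern_lhs_iff by (auto simp: rlhs_def rrhs_def set_var_list)

text \<open>The condition on the result sort removes exactly the values declared in
  \<open>ds\<close>, since no other constructor has a theory sort.\<close>

lemma constructor_decls_iff: "d \<in> set (constructor_decls ds rs) \<longleftrightarrow> F (dsym d) = Some (dargs d, dres d) \<and> dsym d \<in> C0"
proof -
  have "dsym d \<notin> set (roots rs) \<and> dres d \<notin> th \<longleftrightarrow> dsym d \<in> C0" if F: "F (dsym d) = Some (dargs d, dres d)"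
  proof -
    have dom: "dsym d \<in> dom F" "dsym d \<in> dom \<Sigma>" using F sig_F[OF F] by auto
    have "dsym d \<notin> vals T" if "dres d \<notin> th"
      using vals_sort[of "dsym d"] sig_theory[of "dsym d"] sig_F[OF F] theory_sig_sorts(2) that by fastforce
    moreover have "dsym d \<in> C \<longleftrightarrow> dsym d \<notin> set (roots rs)"
      using root_defined[OF dom_F_calc[OF dom(1)]] dom(2) by (simp add: constructors_def)
    ultimately show ?thesis using C0_sort[of "dsym d"] F dom(1) by (auto simp: C0_def)
  qed
  then show ?thesis unfolding constructor_decls_def by (auto simp: effective_decls_iff)
qed

lemma root_decls_iff: "d \<in> set (root_decls ds rs) \<longleftrightarrow>
    F (dsym d) = Some (dargs d, dres d) \<and> dsym d \<in> defined_syms T R - calc_syms T"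
proof -
  have "dsym d \<in> set (roots rs) \<longleftrightarrow> dsym d \<in> defined_syms T R - calc_syms T" if F: "F (dsym d) = Some (dargs d, dres d)"
  proof -
    have "dsym d \<notin> calc_syms T" using F by (intro dom_F_calc) blast
    then show ?thesis using root_defined by blast
  qed
  then show ?thesis unfolding root_decls_def by (auto simp: effective_decls_iff)
qed

lemma constructor_terms_simps:
  "constructor_terms ds rs 0 = base_terms ds"
  "constructor_terms ds rs (Suc n) = base_terms ds @ concat (map (\<lambda>d.
     map (\<lambda>ts. (Fun (dsym d) ts, dres d)) (arg_lists (constructor_terms ds rs n) (dargs d))) (constructor_decls ds rs))"
  by (simp_all add: constructor_terms_def)

lemma constructor_terms_skeleton: "(u, \<sigma>) \<in> set (constructor_terms ds rs n) \<Longrightarrow> skeleton u \<sigma>"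
proof (induction n arbitrary: u \<sigma>)
  case 0
  then show ?case by (auto simp: constructor_terms_simps base_terms_def skeleton_def)
next
  case (Suc n)
  then consider "(u, \<sigma>) \<in> set (base_terms ds)" | d ts where "d \<in> set (constructor_decls ds rs)" "u = Fun (dsym d) ts" "\<sigma> = dres d"
    "ts \<in> set (arg_lists (constructor_terms ds rs n) (dargs d))"
    unfolding constructor_terms_simps by auto
  then show ?case
  proof cases
    case 1
    then show ?thesis by (auto simp: base_terms_def skeleton_def)
  next
    case 2
    have ts: "length ts = length (dargs d)" "\<And>i. i < length ts \<Longrightarrow> skeleton (ts ! i) (dargs d ! i)"
      using arg_lists_skeleton[OF Suc.IH 2(4)] by auto
    have d: "F (dsym d) = Some (dargs d, dres d)" "dsym d \<in> C0" using 2(1) unfolding constructor_decls_iff by auto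
    have "\<forall>t \<in> set ts. funs t \<subseteq> C0 \<and> (\<forall>x \<in> vars t. snd x \<in> th)"
      using ts(2) unfolding skeleton_def by (metis in_set_conv_nth)
    moreover have "wt \<Sigma> u \<sigma>" using ts d(1) sig_F unfolding 2 by (auto simp: wt_Fun_iff skeleton_def)
    ultimately show ?thesis using d(2) unfolding 2 by (auto simp: skeleton_def)
  qed
qed

text \<open>The condition on \<open>\<sigma>\<close> reflects that base terms are listed for the
  argument sorts of declarations only.\<close>

lemma constructor_terms_complete:
  "t \<in> ground_terms \<sigma> \<Longrightarrow> depth_le n t \<Longrightarrow> \<sigma> \<in> arg_sorts \<Longrightarrow>
   \<exists>u \<gamma>. (u, \<sigma>) \<in> set (constructor_terms ds rs n) \<and> value_subst \<gamma> \<and> u \<cdot> \<gamma> = t"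
proof (induction n arbitrary: t \<sigma>)
  case 0
  then show ?case using ground_terms_cases[OF 0(1)] by auto
next
  case (Suc n)
  show ?case
  proof (cases "\<sigma> \<in> th")
    case True
    obtain f \<sigma>s \<tau> where "F f = Some (\<sigma>s, \<tau>)" "\<sigma> \<in> set \<sigma>s" using Suc.prems(3) by (auto simp: arg_sorts_def)
    then have "(f, \<sigma>s, \<tau>) \<in> set (effective_decls ds)" by (simp add: effective_decls_iff dsym_def dargs_def dres_def)
    then have "(Var (0, \<sigma>), \<sigma>) \<in> set (constructor_terms ds rs (Suc n))"
      using \<open>\<sigma> \<in> set \<sigma>s\<close> True unfolding constructor_terms_simps base_terms_def by (force simp: dargs_def)
    moreover obtain \<gamma> where "value_subst \<gamma>" "\<gamma> (0, \<sigma>) = t"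
      using value_subst_extend[of "{(0, \<sigma>)}" "\<lambda>_. t"] Suc.prems(1) ground_terms_value_terms[OF True] by auto
    ultimately show ?thesis by (intro exI[of _ "Var (0, \<sigma>)"] exI[of _ \<gamma>]) simp
  next
    case False
    obtain c ts \<sigma>s where c: "t = Fun c ts" "c \<in> C0" "F c = Some (\<sigma>s, \<sigma>)" "length ts = length \<sigma>s"
      "\<forall>i < length ts. ts ! i \<in> ground_terms (\<sigma>s ! i)"
      using ground_terms_term_sort[OF Suc.prems(1) False] by blast
    have "\<exists>u \<gamma>. (u, \<sigma>s ! i) \<in> set (constructor_terms ds rs n) \<and> value_subst \<gamma> \<and> u \<cdot> \<gamma> = ts ! i" if "i < length ts" for i
    proof (rule Suc.IH)
      show "ts ! i \<in> ground_terms (\<sigma>s ! i)" "depth_le n (ts ! i)" using c that Suc.prems(2) by auto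
      show "\<sigma>s ! i \<in> arg_sorts" using c(3,4) that unfolding arg_sorts_def by fastforce
    qed
    then obtain us \<gamma> where us: "us \<in> set (arg_lists (constructor_terms ds rs n) \<sigma>s)" "value_subst \<gamma>" "map (\<lambda>u. u \<cdot> \<gamma>) us = ts"
      using arg_lists_complete[OF c(4)] by blast
    have "(c, \<sigma>s, \<sigma>) \<in> set (constructor_decls ds rs)" unfolding constructor_decls_iff using c(2,3) by (simp add: dsym_def dargs_def dres_def)
    then have "(Fun c us, \<sigma>) \<in> set (constructor_terms ds rs (Suc n))"
      using us(1) unfolding constructor_terms_simps by (force simp: dsym_def dargs_def dres_def)
    then show ?thesis using us(2,3) c(1) by (intro exI[of _ "Fun c us"] exI[of _ \<gamma>]) simp
  qed
qed

lemma value_eq_facts: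
  assumes "v \<in> vals T" "theory_sig T v = Some ([], snd z)"
  shows "is_constraint T (value_eq z v)" "value_subst \<gamma> \<Longrightarrow> holds \<gamma> (value_eq z v) \<longleftrightarrow> \<gamma> z = Fun v []"
proof -
  have "value_eq z v = c_eq T z (Fun v [])" using theory_sig_sorts(2)[OF assms(2)] by (simp add: value_eq_def)
  then show "is_constraint T (value_eq z v)" "value_subst \<gamma> \<Longrightarrow> holds \<gamma> (value_eq z v) \<longleftrightarrow> \<gamma> z = Fun v []"
    using eq_constraint[OF assms] theory_sig_sorts(2)[OF assms(2)] by (auto simp: value_subst_def)
qed

lemma holds_and_value:
  "is_constraint T \<phi> \<Longrightarrow> is_constraint T \<psi> \<Longrightarrow> value_subst \<gamma> \<Longrightarrow> holds \<gamma> (c_and T \<phi> \<psi>) \<longleftrightarrow> holds \<gamma> \<phi> \<and> holds \<gamma> \<psi>"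
  using value_subst_value_terms by (intro holds_and) auto

text \<open>Both \<open>match_cond\<close> and \<open>no_match\<close> are folds of this
  form.\<close>

lemma foldr_constraint:
  assumes "is_constraint T \<chi>0" "\<And>q. q \<in> set qs \<Longrightarrow> P q \<Longrightarrow> is_constraint T (c q)"
  shows "is_constraint T (foldr (\<lambda>q \<chi>. if P q then c_and T (c q) \<chi> else \<chi>) qs \<chi>0) \<and>
    (value_subst \<gamma> \<longrightarrow> holds \<gamma> (foldr (\<lambda>q \<chi>. if P q then c_and T (c q) \<chi> else \<chi>) qs \<chi>0) \<longleftrightarrow>
      holds \<gamma> \<chi>0 \<and> (\<forall>q \<in> set qs. P q \<longrightarrow> holds \<gamma> (c q)))"
  using assms(2)
proof (induction qs)
  case Nil
  then show ?case using assms(1) by simp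
next
  case (Cons q qs)
  then have IH: "is_constraint T (foldr (\<lambda>q \<chi>. if P q then c_and T (c q) \<chi> else \<chi>) qs \<chi>0)"
    "value_subst \<gamma> \<Longrightarrow> holds \<gamma> (foldr (\<lambda>q \<chi>. if P q then c_and T (c q) \<chi> else \<chi>) qs \<chi>0) \<longleftrightarrow>
      holds \<gamma> \<chi>0 \<and> (\<forall>q \<in> set qs. P q \<longrightarrow> holds \<gamma> (c q))" by auto
  show ?case
  proof (cases "P q")
    case True
    then have c: "is_constraint T (c q)" using Cons.prems by simp
    show ?thesis
      using True constraint_and[OF c IH(1)] holds_and_value[OF c IH(1)] IH(2) by auto
  next
    case False
    then show ?thesis using IH by auto
  qed
qed

lemma match_iff:
  assumes R: "(l, r, \<phi>) \<in> R" and p: "is_pattern T F R l" and f: "F f = Some (\<sigma>s, \<tau>)"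
    and us: "length us = length \<sigma>s" "\<forall>i < length us. skeleton (us ! i) (\<sigma>s ! i)"
  shows "may_match l (Fun f us) \<Longrightarrow> is_constraint T (match_cond (l, r, \<phi>) (Fun f us))"
    "value_subst \<gamma> \<Longrightarrow> (\<exists>\<delta>. ground_on (vars l) \<delta> \<and> holds \<delta> \<phi> \<and> Fun f us \<cdot> \<gamma> = l \<cdot> \<delta>) \<longleftrightarrow>
      may_match l (Fun f us) \<and> holds \<gamma> (match_cond (l, r, \<phi>) (Fun f us))"
proof -
  let ?p = "Fun f us"
  obtain g ls \<sigma>s' \<tau>' where l: "l = Fun g ls" "F g = Some (\<sigma>s', \<tau>')" "length ls = length \<sigma>s'"
    "\<And>i. i < length ls \<Longrightarrow> wt \<Sigma> (ls ! i) (\<sigma>s' ! i)" "\<And>u. u \<in> set ls \<Longrightarrow> funs u \<subseteq> C" "linear l"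
    using pattern_rule[OF R p] by metis
  have \<phi>: "is_constraint T \<phi>" "vars \<phi> \<subseteq> vars l"
    using rule_facts(2)[OF R] cv R p unfolding constraint_vars_in_lhs_def by auto
  have vs: "snd z \<in> th" if z: "z \<in> vars ?p" for z
  proof -
    obtain i where "i < length us" "z \<in> vars (us ! i)" using z by (auto simp: in_set_conv_nth)
    then show ?thesis using us(2) by (auto simp: skeleton_def)
  qed
  have typed: "(\<exists>x b. q = (Var x, b) \<and> skeleton b (snd x)) \<or>
     (\<exists>v z. q = (Fun v [], Var z) \<and> v \<in> vals T \<and> theory_sig T v = Some ([], snd z))"
    if m: "may_match l ?p" and q: "q \<in> set (residual l ?p)" for q
  proof -
    have fg: "g = f" "length ls = length us" and m': "\<And>q. q \<in> set (zip ls us) \<Longrightarrow> may_match (fst q) (snd q)"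
      using m unfolding l(1) by auto
    obtain q' where q': "q' \<in> set (zip ls us)" "q \<in> set (residual (fst q') (snd q'))"
      using q fg(2) unfolding l(1) by auto
    then obtain i where i: "i < length ls" "q' = (ls ! i, us ! i)" using fg(2) by (auto simp: set_zip)
    have "\<sigma>s' = \<sigma>s" using l(2) f fg(1) by simp
    then show ?thesis
      using residual_typed[of "ls ! i" "us ! i" "\<sigma>s ! i" q] m'[OF q'(1)] q'(2) i l(4)[OF i(1)] l(5)[of "ls ! i"] us(2) fg(2)
      by auto
  qed
  have binding_typed: "skeleton (binding (residual l ?p) x) (snd x) \<and> (Var x, binding (residual l ?p) x) \<in> set (residual l ?p)"
    if m: "may_match l ?p" and x: "x \<in> vars l" for x
  proof -
    obtain b where b: "(Var x, b) \<in> set (residual l ?p)" using residual_binds[OF m x] by blast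
    then show ?thesis using binding_residual[OF m l(6) b] typed[OF m b] by auto
  qed
  have cb: "is_constraint T (\<phi> \<cdot> binding (residual l ?p))" if m: "may_match l ?p"
    unfolding is_constraint_def
  proof (rule wt_app)
    show "wt (theory_sig T) \<phi> (bool_sort T)" using \<phi>(1) by (simp add: is_constraint_def)
    fix x assume x: "x \<in> vars \<phi>"
    then have "skeleton (binding (residual l ?p) x) (snd x)" using binding_typed[OF m] \<phi>(2) by blast
    then obtain z where "binding (residual l ?p) x = Var z" "snd z = snd x"
      using C0_theory_var constraint_var_sort[OF \<phi>(1) x] unfolding skeleton_def by blast
    then show "wt (theory_sig T) (binding (residual l ?p) x) (snd x)" by simp
  qed
  have match_cond: "match_cond (l, r, \<phi>) ?p = foldr (\<lambda>q \<chi>. if \<not> is_Var (fst q) then c_and T (value_eq (var_of (snd q)) (root_sym (fst q))) \<chi> else \<chi>)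
     (residual l ?p) (\<phi> \<cdot> binding (residual l ?p))"
    unfolding match_cond_def rlhs_def rcon_def fst_conv snd_conv
    by (rule arg_cong[where f = "\<lambda>h. foldr h (residual l ?p) (\<phi> \<cdot> binding (residual l ?p))"]) (auto simp: fun_eq_iff)
  have ceq: "is_constraint T (value_eq (var_of (snd q)) (root_sym (fst q)))" if "may_match l ?p" "q \<in> set (residual l ?p)" "\<not> is_Var (fst q)" for q
    using typed[OF that(1,2)] that(3) value_eq_facts(1) by auto
  note fc = foldr_constraint[where ?\<chi>0.0 = "\<phi> \<cdot> binding (residual l ?p)" and qs = "residual l ?p" and P = "\<lambda>q. \<not> is_Var (fst q)"
    and c = "\<lambda>q. value_eq (var_of (snd q)) (root_sym (fst q))" and \<gamma> = \<gamma>, folded match_cond]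
  show "may_match l ?p \<Longrightarrow> is_constraint T (match_cond (l, r, \<phi>) ?p)" using fc cb ceq by blast
  have hc: "holds \<gamma> (match_cond (l, r, \<phi>) ?p) \<longleftrightarrow> holds \<gamma> (\<phi> \<cdot> binding (residual l ?p)) \<and>
      (\<forall>v z. (Fun v [], Var z) \<in> set (residual l ?p) \<longrightarrow> \<gamma> z = Fun v [])" if m: "may_match l ?p" and \<gamma>: "value_subst \<gamma>"
  proof -
    have "(\<forall>q \<in> set (residual l ?p). \<not> is_Var (fst q) \<longrightarrow> holds \<gamma> (value_eq (var_of (snd q)) (root_sym (fst q)))) \<longleftrightarrow>
      (\<forall>v z. (Fun v [], Var z) \<in> set (residual l ?p) \<longrightarrow> \<gamma> z = Fun v [])"
    proof (intro iffI ballI allI impI)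
      fix v z assume a: "\<forall>q \<in> set (residual l ?p). \<not> is_Var (fst q) \<longrightarrow> holds \<gamma> (value_eq (var_of (snd q)) (root_sym (fst q)))"
        and q: "(Fun v [], Var z) \<in> set (residual l ?p)"
      then have "holds \<gamma> (value_eq z v)" by force
      then show "\<gamma> z = Fun v []" using typed[OF m q] value_eq_facts(2)[OF _ _ \<gamma>] by auto
    next
      fix q assume a: "\<forall>v z. (Fun v [], Var z) \<in> set (residual l ?p) \<longrightarrow> \<gamma> z = Fun v []"
        and q: "q \<in> set (residual l ?p)" "\<not> is_Var (fst q)"
      then obtain v z where vz: "q = (Fun v [], Var z)" "v \<in> vals T" "theory_sig T v = Some ([], snd z)"
        using typed[OF m q(1)] by auto
      then show "holds \<gamma> (value_eq (var_of (snd q)) (root_sym (fst q)))" using a q(1) value_eq_facts(2)[OF vz(2,3) \<gamma>] by auto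
    qed
    then show ?thesis using fc cb[OF m] ceq[OF m] \<gamma> by blast
  qed
  show "(\<exists>\<delta>. ground_on (vars l) \<delta> \<and> holds \<delta> \<phi> \<and> ?p \<cdot> \<gamma> = l \<cdot> \<delta>) \<longleftrightarrow>
      may_match l ?p \<and> holds \<gamma> (match_cond (l, r, \<phi>) ?p)" if \<gamma>: "value_subst \<gamma>"
  proof
    assume "\<exists>\<delta>. ground_on (vars l) \<delta> \<and> holds \<delta> \<phi> \<and> ?p \<cdot> \<gamma> = l \<cdot> \<delta>"
    then obtain \<delta> where \<delta>: "holds \<delta> \<phi>" "l \<cdot> \<delta> = ?p \<cdot> \<gamma>" by metis
    have m: "may_match l ?p"
    proof (rule may_match_of_instance[OF \<delta>(2)])
      fix z assume "z \<in> vars ?p"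
      then have "snd z \<in> th" using vs by blast
      then show "\<exists>v. \<gamma> z = Fun v []" using \<gamma> unfolding value_subst_def value_terms_def by auto
    qed
    have eqs: "\<And>q. q \<in> set (residual l ?p) \<Longrightarrow> fst q \<cdot> \<delta> = snd q \<cdot> \<gamma>" using residual_instance[OF m] \<delta>(2) by blast
    have "\<delta> x = binding (residual l ?p) x \<cdot> \<gamma>" if "x \<in> vars \<phi>" for x
      using eqs[of "(Var x, binding (residual l ?p) x)"] binding_typed[OF m, of x] that \<phi>(2) by auto
    then have "holds \<gamma> (\<phi> \<cdot> binding (residual l ?p))" using holds_app[of \<phi> \<delta> _ \<gamma>] \<delta>(1) by blast
    moreover have "\<gamma> z = Fun v []" if "(Fun v [], Var z) \<in> set (residual l ?p)" for v z
      using eqs[OF that] by simp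
    ultimately show "may_match l ?p \<and> holds \<gamma> (match_cond (l, r, \<phi>) ?p)" using hc[OF m \<gamma>] m by blast
  next
    assume "may_match l ?p \<and> holds \<gamma> (match_cond (l, r, \<phi>) ?p)"
    then have m: "may_match l ?p" and h: "holds \<gamma> (\<phi> \<cdot> binding (residual l ?p))"
      and e: "\<And>v z. (Fun v [], Var z) \<in> set (residual l ?p) \<Longrightarrow> \<gamma> z = Fun v []" using hc[OF _ \<gamma>] by auto
    \<comment> \<open>The matcher is forced: a variable of \<open>l\<close> is bound to a subterm of
      the abstract pattern, and \<open>\<gamma>\<close> supplies the values.\<close>
    define \<delta> where "\<delta> x = binding (residual l ?p) x \<cdot> \<gamma>" for x
    have "fst q \<cdot> \<delta> = snd q \<cdot> \<gamma>" if q: "q \<in> set (residual l ?p)" for q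
      using typed[OF m q] e q binding_residual[OF m l(6)] by (auto simp: \<delta>_def)
    then have "?p \<cdot> \<gamma> = l \<cdot> \<delta>" using residual_instance[OF m, of \<delta> \<gamma>] by simp
    moreover have "ground_on (vars l) \<delta>"
      unfolding ground_on_def \<delta>_def using binding_typed[OF m] skeleton_ground_terms \<gamma> by blast
    moreover have "holds \<delta> \<phi>" using h holds_app[of \<phi> \<delta> "binding (residual l ?p)" \<gamma>] by (simp add: \<delta>_def)
    ultimately show "\<exists>\<delta>. ground_on (vars l) \<delta> \<and> holds \<delta> \<phi> \<and> ?p \<cdot> \<gamma> = l \<cdot> \<delta>" by blast
  qed
qed

lemma no_match_facts:
  assumes f: "F f = Some (\<sigma>s, \<tau>)"
    and us: "length us = length \<sigma>s" "\<forall>i < length us. skeleton (us ! i) (\<sigma>s ! i)"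
  shows "is_constraint T (no_match ds rs (Fun f us))"
    "value_subst \<gamma> \<Longrightarrow> holds \<gamma> (no_match ds rs (Fun f us)) \<longleftrightarrow>
      \<not> (\<exists>(l, r, \<phi>) \<in> R. is_pattern T F R l \<and> matches (l, r, \<phi>) (Fun f us \<cdot> \<gamma>))"
proof -
  let ?p = "Fun f us"
  have c: "is_constraint T (c_not T (match_cond q ?p))" if "q \<in> R" "usable ds rs q \<and> may_match (rlhs q) ?p" for q
  proof -
    obtain l r \<phi> where q: "q = (l, r, \<phi>)" by (cases q)
    then have "is_pattern T F R l" "may_match l ?p" using that usable_iff[of l r \<phi>] by (auto simp: rlhs_def)
    then show ?thesis using match_iff(1)[OF _ _ f us] that(1) q constraint_not by blast
  qed
  note fc = foldr_constraint[OF constraint_true, where qs = rs and P = "\<lambda>q. usable ds rs q \<and> may_match (rlhs q) ?p"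
    and c = "\<lambda>q. c_not T (match_cond q ?p)" and \<gamma> = \<gamma>, folded no_match_def]
  show "is_constraint T (no_match ds rs ?p)" using fc c by blast
  assume \<gamma>: "value_subst \<gamma>"
  have "(usable ds rs q \<and> may_match (rlhs q) ?p \<longrightarrow> holds \<gamma> (c_not T (match_cond q ?p))) \<longleftrightarrow>
      \<not> (is_pattern T F R (fst q) \<and> matches q (?p \<cdot> \<gamma>))" if q: "q \<in> R" for q
  proof -
    obtain l r \<phi> where qe: "q = (l, r, \<phi>)" by (cases q)
    show ?thesis
    proof (cases "is_pattern T F R l \<and> snd ` (vars r - vars l) \<subseteq> th")
      case True
      then have ok: "usable ds rs q" using usable_iff q qe by blast
      have "matches q (?p \<cdot> \<gamma>) \<longleftrightarrow> may_match l ?p \<and> holds \<gamma> (match_cond q ?p)"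
        using match_iff(2)[OF q[unfolded qe] _ f us \<gamma>] True unfolding matches_def qe by simp
      moreover have "may_match l ?p \<Longrightarrow> holds \<gamma> (c_not T (match_cond q ?p)) \<longleftrightarrow> \<not> holds \<gamma> (match_cond q ?p)"
        using match_iff(1)[OF q[unfolded qe] _ f us] True value_subst_value_terms[OF \<gamma>] unfolding qe by (intro holds_not) auto
      ultimately show ?thesis using ok True qe by (auto simp: rlhs_def)
    next
      case False
      then have "\<not> usable ds rs q" using usable_iff q qe by blast
      then show ?thesis using False qe by (auto simp: matches_def)
    qed
  qed
  then have "(\<forall>q \<in> R. usable ds rs q \<and> may_match (rlhs q) ?p \<longrightarrow> holds \<gamma> (c_not T (match_cond q ?p))) \<longleftrightarrow>
    \<not> (\<exists>(l, r, \<phi>) \<in> R. is_pattern T F R l \<and> matches (l, r, \<phi>) (?p \<cdot> \<gamma>))" by fastforce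
  then show "holds \<gamma> (no_match ds rs ?p) \<longleftrightarrow>
      \<not> (\<exists>(l, r, \<phi>) \<in> R. is_pattern T F R l \<and> matches (l, r, \<phi>) (?p \<cdot> \<gamma>))"
    using fc c \<gamma> holds_true by blast
qed

lemma decide_complete:
  assumes q: "quasi_reducible T F R" shows "decide ds rs n"
  unfolding decide_def
proof
  fix p assume "p \<in> set (abstract_patterns ds rs n)"
  then obtain d us where d: "d \<in> set (root_decls ds rs)" and us: "us \<in> set (arg_lists (constructor_terms ds rs n) (dargs d))"
    and p: "p = Fun (dsym d) us" unfolding abstract_patterns_def by auto
  have f: "F (dsym d) = Some (dargs d, dres d)" "dsym d \<in> defined_syms T R - calc_syms T"
    using d unfolding root_decls_iff by auto
  have sk: "length us = length (dargs d)" "\<forall>i < length us. skeleton (us ! i) (dargs d ! i)"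
    using arg_lists_skeleton[OF constructor_terms_skeleton us] by auto
  note recfn_on = no_match_facts[OF f(1) sk]
  show "\<not> sat (no_match ds rs p)"
  proof
    assume "sat (no_match ds rs p)"
    then have "satisfiable T (no_match ds rs p)" using sat[OF recfn_on(1)] p by simp
    then obtain \<gamma>0 where \<gamma>0: "\<forall>x \<in> vars (no_match ds rs p). \<gamma>0 x \<in> value_terms (snd x)" "holds \<gamma>0 (no_match ds rs p)"
      using satisfiable_iff[OF recfn_on(1)] p by auto
    \<comment> \<open>\<open>\<gamma>0\<close> is controlled only on the variables of the condition,
      while \<open>p\<close> may have others that must become values as well.\<close>
    obtain \<gamma> where \<gamma>: "value_subst \<gamma>" "\<forall>x \<in> vars (no_match ds rs p). \<gamma> x = \<gamma>0 x"
      using value_subst_extend[of "vars (no_match ds rs p)" \<gamma>0] \<gamma>0(1) by blast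
    then have "holds \<gamma> (no_match ds rs p)" using \<gamma>0(2) holds_cong[of "no_match ds rs p" \<gamma> \<gamma>0] by simp
    then have no: "\<not> (\<exists>(l, r, \<phi>) \<in> R. is_pattern T F R l \<and> matches (l, r, \<phi>) (Fun (dsym d) us \<cdot> \<gamma>))"
      using recfn_on(2)[OF \<gamma>(1)] p by blast
    let ?ts = "map (\<lambda>u. u \<cdot> \<gamma>) us"
    have "?ts ! i \<in> ground_terms (dargs d ! i)" if "i < length ?ts" for i
      using that skeleton_ground_terms[OF _ \<gamma>(1)] sk(2) by simp
    moreover have "length ?ts = length (dargs d)" using sk(1) by simp
    ultimately have "\<exists>(l, r, \<phi>) \<in> R. is_pattern T F R l \<and> matches (l, r, \<phi>) (Fun (dsym d) ?ts)"
      using q[unfolded quasi_reducible_iff[OF cv], rule_format, OF f(2,1)] by blast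
    then show False using no by simp
  qed
qed

text \<open>The truncated pattern is an instance of a listed one, so some rule matches it. The
  left-hand side is no deeper than \<open>D\<close> and cannot see the truncation, and the values on
  which the constraint depends are preserved.\<close>

lemma decide_sound:
  assumes D: "\<And>l r \<phi>. (l, r, \<phi>) \<in> R \<Longrightarrow> depth_le D l" and n: "D + Suc (card (dom F)) \<le> n" and dec: "decide ds rs n"
  shows "quasi_reducible T F R"
  unfolding quasi_reducible_iff[OF cv]
proof (intro allI impI)
  fix f \<sigma>s \<tau> ts
  assume f: "f \<in> defined_syms T R - calc_syms T" "F f = Some (\<sigma>s, \<tau>)"
    and ts: "length ts = length \<sigma>s" "\<forall>i < length ts. ts ! i \<in> ground_terms (\<sigma>s ! i)"
  let ?ts = "map (trunc D) ts"
  have "\<exists>u \<gamma>. (u, \<sigma>s ! i) \<in> set (constructor_terms ds rs n) \<and> value_subst \<gamma> \<and> u \<cdot> \<gamma> = ?ts ! i" if i: "i < length ?ts" for i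
  proof (rule constructor_terms_complete)
    have t: "trunc D (ts ! i) \<in> ground_terms (\<sigma>s ! i) \<and> depth_le (D + Suc (card (dom F))) (trunc D (ts ! i))"
      using trunc_ground_terms[of "ts ! i" "\<sigma>s ! i" D] ts(2) i by simp
    then show "?ts ! i \<in> ground_terms (\<sigma>s ! i)" "depth_le n (?ts ! i)" using i n depth_le_mono by auto
    show "\<sigma>s ! i \<in> arg_sorts" using f(2) ts(1) i unfolding arg_sorts_def by fastforce
  qed
  then obtain us \<gamma> where us: "us \<in> set (arg_lists (constructor_terms ds rs n) \<sigma>s)" "value_subst \<gamma>" "map (\<lambda>u. u \<cdot> \<gamma>) us = ?ts"
    using arg_lists_complete[of ?ts \<sigma>s "constructor_terms ds rs n"] ts(1) by auto
  have sk: "length us = length \<sigma>s" "\<forall>i < length us. skeleton (us ! i) (\<sigma>s ! i)"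
    using arg_lists_skeleton[OF constructor_terms_skeleton us(1)] by auto
  note recfn_on = no_match_facts[OF f(2) sk]
  have "(f, \<sigma>s, \<tau>) \<in> set (root_decls ds rs)" unfolding root_decls_iff using f by (simp add: dsym_def dargs_def dres_def)
  then have "Fun f us \<in> set (abstract_patterns ds rs n)" unfolding abstract_patterns_def using us(1) by (force simp: dsym_def dargs_def)
  then have "\<not> satisfiable T (no_match ds rs (Fun f us))" using dec sat[OF recfn_on(1)] unfolding decide_def by blast
  moreover have "\<forall>x \<in> vars (no_match ds rs (Fun f us)). \<gamma> x \<in> value_terms (snd x)" using value_subst_value_terms[OF us(2) recfn_on(1)] by blast
  ultimately have "\<not> holds \<gamma> (no_match ds rs (Fun f us))" using satisfiable_iff[OF recfn_on(1)] by blast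
  then obtain l r \<phi> where R: "(l, r, \<phi>) \<in> R" "is_pattern T F R l" and m: "matches (l, r, \<phi>) (Fun f ?ts)"
    using recfn_on(2)[OF us(2)] us(3) by auto
  obtain \<gamma>' where ex: "snd ` (vars r - vars l) \<subseteq> th" and \<gamma>': "holds \<gamma>' \<phi>" "Fun f ?ts = l \<cdot> \<gamma>'"
    using m unfolding matches_def by auto
  obtain g ls \<sigma>s' \<tau>' where l: "l = Fun g ls" "F g = Some (\<sigma>s', \<tau>')" "length ls = length \<sigma>s'"
    "\<And>i. i < length ls \<Longrightarrow> wt \<Sigma> (ls ! i) (\<sigma>s' ! i)" "linear l"
    using pattern_rule[OF R] by metis
  have e: "g = f" "map (\<lambda>u. u \<cdot> \<gamma>') ls = ?ts" using \<gamma>'(2) unfolding l(1) by auto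
  then have len: "length ls = length ts" by (metis length_map)
  have s: "\<sigma>s' = \<sigma>s" using l(2) e(1) f(2) by simp
  have "\<exists>\<gamma>. ls ! i \<cdot> \<gamma> = ts ! i \<and> (\<forall>x \<in> vars (ls ! i). \<gamma> x \<in> ground_terms (snd x) \<and> (snd x \<in> th \<longrightarrow> \<gamma> x = \<gamma>' x))"
    if i: "i < length ls" for i
  proof (rule trunc_match)
    show "linear (ls ! i)" using l(1,5) i by (simp add: linear_Fun)
    \<comment> \<open>The root uses up one level, but truncation is applied to the arguments with
      the full \<open>D\<close>; the weaker bound fits this.\<close>
    obtain m where m: "D = Suc m" "depth_le m (ls ! i)" using D[OF R(1)] i unfolding l(1) depth_le_Fun by auto
    show "depth_le D (ls ! i)" using depth_le_mono[OF m(2), of D] m(1) by simp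
    show "wt \<Sigma> (ls ! i) (\<sigma>s ! i)" using l(4)[OF i] s by simp
    show "ts ! i \<in> ground_terms (\<sigma>s ! i)" using ts(2) i len by simp
    show "ls ! i \<cdot> \<gamma>' = trunc D (ts ! i)" using e(2) i len by (metis nth_map)
  qed
  from merge_instance[OF l(5)[unfolded l(1)] len this]
  obtain \<delta> where \<delta>: "l \<cdot> \<delta> = Fun g ts" "\<forall>x \<in> vars l. \<delta> x \<in> ground_terms (snd x) \<and> (snd x \<in> th \<longrightarrow> \<delta> x = \<gamma>' x)"
    unfolding l(1) by blast
  have "\<delta> x = \<gamma>' x" if x: "x \<in> vars \<phi>" for x
  proof -
    have "x \<in> vars l" using cv R x unfolding constraint_vars_in_lhs_def by blast
    then show ?thesis using \<delta>(2) constraint_var_sort[OF rule_facts(2)[OF R(1)] x] by blast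
  qed
  then have "holds \<delta> \<phi>" using \<gamma>'(1) holds_cong[of \<phi> \<delta> \<gamma>'] by blast
  moreover have "ground_on (vars l) \<delta>" using \<delta>(2) by (simp add: ground_on_def)
  ultimately have "matches (l, r, \<phi>) (Fun f ts)" unfolding matches_def prod.case using ex \<delta>(1) e(1) by metis
  then show "\<exists>(l, r, \<phi>) \<in> R. is_pattern T F R l \<and> matches (l, r, \<phi>) (Fun f ts)" using R by blast
qed

end

section \<open>Bounds read off the code of the input\<close>

context procedure_codes
begin

text \<open>Codes decrease strictly from a term to its arguments, so a code bounds the depth without
  any computation of depths.\<close>

lemma depth_le_code: "depth_le (et t) t"
proof (induction t)
  case (Fun f ts)
  have "depth_le (eprod cf (elist et) (f, ts) + eprod cf (elist et) (f, ts)) t" if t: "t \<in> set ts" for t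
  proof (rule depth_le_mono[OF Fun.IH[OF t]])
    show "et t \<le> eprod cf (elist et) (f, ts) + eprod cf (elist et) (f, ts)"
      using args_of_less[of t "Fun f ts"] t unfolding et_simps by simp
  qed
  then show ?case unfolding et_simps by simp
qed simp

lemma lhs_code: "(l, r, \<phi>) \<in> set rs \<Longrightarrow> et l \<le> code_lctrs cs cf (ds, rs)"
proof -
  assume R: "(l, r, \<phi>) \<in> set rs"
  have "et l < er (l, r, \<phi>)" using le_prod_encode_1[of "et l"] by (simp add: less_Suc_eq_le)
  also have "\<dots> < elist er rs" using elist_member[OF R] .
  also have "\<dots> \<le> code_lctrs cs cf (ds, rs)" by (simp add: elist_def le_prod_encode_2)
  finally show ?thesis by simp
qed

lemma decls_code: "card (dom (map_of ds)) \<le> code_lctrs cs cf (ds, rs)"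
proof -
  have "card (dom (map_of ds)) \<le> length ds"
    unfolding dom_map_of_conv_image_fst by (metis card_image_le card_length finite_set le_trans)
  also have "\<dots> \<le> elist ed ds" by (rule length_le_elist)
  also have "\<dots> \<le> code_lctrs cs cf (ds, rs)" by (simp add: elist_def le_prod_encode_1)
  finally show ?thesis .
qed

end

theorem theorem4:
  fixes T :: "('s, 'f, 'a) background"
  assumes "is_background T"
  shows
    "(\<forall>F R Q. admissible T F R \<and> constraint_vars_in_lhs T F R \<and>
        extra_vars_theory_sorted T F R \<and> argument_sorts_inhabited T F R \<and>
        represents T Q (pattern_cterms T F R) \<longrightarrow>
        (quasi_reducible T F R \<longleftrightarrow>
          (\<forall>f \<in> defined_syms T R - calc_syms T. co_results T F R f Q = {{}})) \<and>
        (quasi_reducible T F R \<longleftrightarrow>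
          (\<forall>f \<in> defined_syms T R - calc_syms T. {} \<in> co_results T F R f Q))) \<and>
     (\<forall>cs cf. effective_syntax T cs cf \<and> satisfiability_decidable T cs cf \<longrightarrow>
        decidable_on
          {(ds, rs). admissible T (map_of ds) (set rs) \<and> constraint_vars_in_lhs T (map_of ds) (set rs)}
          (code_lctrs cs cf)
          (\<lambda>(ds, rs). quasi_reducible T (map_of ds) (set rs)))"
proof (intro conjI allI impI, goal_cases)
  case (1 F R Q)
  interpret admissible_lctrs T F R using assms 1 by unfold_locales auto
  note c = complement_correct[of Q] 1
  \<comment> \<open>A set of outcomes equal to \<open>{{}}\<close> contains \<open>{}\<close>, which
    links the two parts of \<open>complement_correct\<close>.\<close>
  show ?case using c by (metis insertI1)
next
  case (2 F R Q)
  interpret admissible_lctrs T F R using assms 2 by unfold_locales auto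
  note c = complement_correct[of Q] 2
  show ?case using c by (metis insertI1)
next
  case (3 cs cf)
  obtain gth where gth: "recfn 1 gth" "\<And>\<iota>. gth [cs \<iota>] = (if \<iota> \<in> theory_sorts T then 1 else 0)"
    using 3 unfolding effective_syntax_def decidable_on_def by auto
  obtain gvl where gvl: "recfn 1 gvl" "\<And>f. f \<in> dom (theory_sig T) \<Longrightarrow> gvl [cf f] = (if f \<in> vals T then 1 else 0)"
    using 3 unfolding effective_syntax_def decidable_on_def by auto
  obtain e where e: "recfn 1 e" "\<forall>\<iota> \<in> theory_sorts T. e [cs \<iota>] = cf (eq_sym T \<iota>)"
    using 3 unfolding effective_syntax_def by auto
  obtain gs where gs: "recfn 1 gs" "\<And>\<phi>. is_constraint T \<phi> \<Longrightarrow> gs [code_tm cs cf \<phi>] = (if satisfiable T \<phi> then 1 else 0)"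
    using 3 unfolding satisfiability_decidable_def decidable_on_def by auto
  define is_value where "is_value f \<longleftrightarrow> gvl [cf f] = 1" for f
  define sat where "sat \<phi> \<longleftrightarrow> gs [code_tm cs cf \<phi>] = 1" for \<phi>
  interpret procedure_codes T is_value sat cs cf
  proof
    show "inj cs" "inj cf" using 3 unfolding effective_syntax_def by auto
    show "computable cs ebool (\<lambda>\<sigma>. \<sigma> \<in> theory_sorts T)"
    proof -
      have "(\<lambda>\<sigma>. gth [cs \<sigma>] = 1) = (\<lambda>\<sigma>. \<sigma> \<in> theory_sorts T)" by (simp add: gth(2) fun_eq_iff)
      then show ?thesis using computable_of_recfn[OF gth(1), of cs] by simp
    qed
    show "computable cf ebool is_value" using computable_of_recfn[OF gvl(1), of cf] unfolding is_value_def .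
    show "\<exists>h. unary_recfn h \<and> (\<forall>\<sigma> \<in> theory_sorts T. h (cs \<sigma>) = cf (eq_sym T \<sigma>))" using unary_recfn_of_recfn[OF e(1)] e(2) by blast
    show "computable (code_tm cs cf) ebool sat" using computable_of_recfn[OF gs(1), of "code_tm cs cf"] unfolding sat_def .
  qed
  show ?case
  proof (rule decidable_of_computable[OF c_decide_code])
    fix i :: "('f, 's) lctrs_input"
    assume i: "i \<in> {(ds, rs). admissible T (map_of ds) (set rs) \<and> constraint_vars_in_lhs T (map_of ds) (set rs)}"
    obtain ds rs where ir: "i = (ds, rs)" by fastforce
    interpret decision T is_value sat ds rs
      using assms i ir gvl(2) gs(2) by unfold_locales (auto simp: is_value_def sat_def)
    have D: "depth_le (code_lctrs cs cf i) l" if "(l, r, \<phi>) \<in> set rs" for l r \<phi>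
      using depth_le_mono[OF depth_le_code lhs_code[OF that]] ir by simp
    have n: "code_lctrs cs cf i + Suc (card (dom (map_of ds))) \<le> Suc (code_lctrs cs cf i + code_lctrs cs cf i)"
      using decls_code[of ds rs] ir by simp
    have "decide ds rs (Suc (code_lctrs cs cf i + code_lctrs cs cf i)) \<longleftrightarrow> quasi_reducible T (map_of ds) (set rs)"
    proof
      assume "decide ds rs (Suc (code_lctrs cs cf i + code_lctrs cs cf i))"
      then show "quasi_reducible T (map_of ds) (set rs)" by (rule decide_sound[OF _ n, rotated]) (rule D)
    qed (rule decide_complete)
    then show "decide (fst i) (snd i) (Suc (code_lctrs cs cf i + code_lctrs cs cf i)) =
        (case i of (ds, rs) \<Rightarrow> quasi_reducible T (map_of ds) (set rs))" using ir by simp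
  qed
qed

end
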